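(* Let $q$ be a prime power, $\mathbb{F}_q$ the field with $q$ elements, and let $H\subset\mathbb{A}^n=\overline{\mathbb{F}}_q^{\,n}$ be an absolutely irreducible $\mathbb{F}_q$-hypersurface of degree $\delta$. If $q>15\delta^{13/3}$, then $$\bigl|\#(H\cap\mathbb{F}_q^n)-q^{n-1}\bigr|\le\bigl(\omega(q,\delta)+5\delta^2\bigr)q^{n-2},$$ where $\omega(q,\delta):=(\delta-1)(\delta-2)q^{1/2}+\delta+1$.
   Context: An $\mathbb{F}_q$-hypersurface of $\mathbb{A}^n$ is the zero set in $\overline{\mathbb{F}}_q^{\,n}$ ($\overline{\mathbb{F}}_q$ an algebraic closure of $\mathbb{F}_q$) of a nonconstant polynomial with coefficients in $\mathbb{F}_q$; it is absolutely irreducible if it is irreducible over $\overline{\mathbb{F}}_q$. *)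

theory Defs
  imports
    "HOL-Analysis.Analysis"
    "HOL-Library.Poly_Mapping"
    "HOL-Algebra.Algebraic_Closure_Type"
begin

text \<open>Polynomials in variables indexed by \<open>'n\<close>: finitely supported maps from exponent vectors to
  coefficients, with the convolution product of \<^theory>\<open>HOL-Library.Poly_Mapping\<close>.\<close>

type_synonym ('n, 'k) mpoly = "('n \<Rightarrow>\<^sub>0 nat) \<Rightarrow>\<^sub>0 'k"

definition mpoly_eval :: "('n::finite, 'k::comm_semiring_1) mpoly \<Rightarrow> 'k ^ 'n \<Rightarrow> 'k" where
  "mpoly_eval f x =
     (\<Sum>m\<in>Poly_Mapping.keys f. Poly_Mapping.lookup f m * (\<Prod>i\<in>UNIV. (x $ i) ^ Poly_Mapping.lookup m i))"

text \<open>The zero polynomial gets degree 0, so positive degree means nonconstant.\<close>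

definition mpoly_degree :: "('n::finite, 'k::zero) mpoly \<Rightarrow> nat" where
  "mpoly_degree f =
     Max (insert 0 ((\<lambda>m. \<Sum>i\<in>UNIV. Poly_Mapping.lookup m i) ` Poly_Mapping.keys f))"

definition zero_set :: "('n::finite, 'k::comm_semiring_1) mpoly set \<Rightarrow> ('k ^ 'n) set" where
  "zero_set F = {x. \<forall>f\<in>F. mpoly_eval f x = 0}"

definition algebraic_set :: "('k::comm_semiring_1 ^ 'n::finite) set \<Rightarrow> bool" where
  "algebraic_set V \<longleftrightarrow> (\<exists>F. V = zero_set F)"

definition irreducible_variety :: "('k::comm_semiring_1 ^ 'n::finite) set \<Rightarrow> bool" where
  "irreducible_variety V \<longleftrightarrow> algebraic_set V \<and> V \<noteq> {} \<and>
     (\<forall>A B. algebraic_set A \<longrightarrow> algebraic_set B \<longrightarrow> V = A \<union> B \<longrightarrow> V = A \<or> V = B)"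

text \<open>Here \<open>'a\<close> is the base field; the coefficients are embedded into the algebraic closure.\<close>

definition base_hypersurface :: "('a::field alg_closure ^ 'n::finite) set \<Rightarrow> bool" where
  "base_hypersurface H \<longleftrightarrow>
     (\<exists>f :: ('n, 'a) mpoly. mpoly_degree f > 0 \<and> H = zero_set {Poly_Mapping.map to_ac f})"

text \<open>Irreducibility is taken in the Zariski topology of affine space over the algebraic closure,
  that is, with respect to all algebraic subsets and not only those defined over the base field.\<close>

definition absolutely_irreducible :: "('a::field alg_closure ^ 'n::finite) set \<Rightarrow> bool" where
  "absolutely_irreducible H \<longleftrightarrow> irreducible_variety H"

text \<open>The degree of a hypersurface as a point set is that of a defining polynomial of least degree
  over the algebraic closure, i.e. of its reduced equation; an arbitrary defining polynomial may have
  repeated factors.\<close>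

definition hypersurface_degree :: "('k::comm_semiring_1 ^ 'n::finite) set \<Rightarrow> nat" where
  "hypersurface_degree H =
     (LEAST d. \<exists>f. mpoly_degree f > 0 \<and> H = zero_set {f} \<and> mpoly_degree f = d)"

definition rational_points :: "('a::field alg_closure ^ 'n::finite) set" where
  "rational_points = {x. \<forall>i. x $ i \<in> range to_ac}"

definition \<omega> :: "real \<Rightarrow> real \<Rightarrow> real" where
  "\<omega> q \<delta> = (\<delta> - 1) * (\<delta> - 2) * sqrt q + \<delta> + 1"

end

theory Submission
  imports Defs "Jordan_Normal_Form.Determinant"
begin

text \<open>
  The number of rational points of a hypersurface is compared with the number of rational points of its
  sections by random planes over the finite field. The points of a random plane are pairwise
  independent, so the variance of the number of zeros on a plane is at most its mean \<open>\<mu>\<close>, and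
  \<open>\<mu> q\<^sup>n\<^sup>-\<^sup>2\<close> is the number to be estimated. On every plane the number of zeros is within
  \<open>(\<delta> - 1)(\<delta> - 2)\<surd>q + 2\<delta>\<^sup>2 - \<delta>\<close> of a multiple \<open>jq\<close>, where \<open>j\<close> counts the Frobenius stable irreducible
  components; planes with \<open>j \<noteq> 1\<close> deviate from the mean by about \<open>q\<close>, so by the variance bound they
  contribute only \<open>O(1)\<close> to the mean. That \<open>j = 1\<close> is typical follows from an effective Bertini theorem
  in the style of Kaltofen: reducibility of a plane section is witnessed by a linear system for a factor
  vanishing on a power series root.

  The bound for an irreducible plane curve \<open>C\<close> is Weil's, proved by counting dimensions of spaces of
  functions on \<open>C \<times> C\<close> of given bidegree that vanish to prescribed orders along the diagonal and the
  graph of Frobenius: functions with many zeros on both fibres are zero, which bounds the dimension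
  from above, and filtering by the order of vanishing bounds it from below by the number of
  intersections of the two graphs.
\<close>

hide_const (open) Polynomials.degree Polynomials.lead_coeff Divisibility.prime Divisibility.irreducible Coset.order Module.smult

section \<open>Linear independence of functions on a set\<close>

text \<open>Divided by \<open>u 1 ^ ap * u q ^ be\<close>, the functions of the Weil part become
  sections with bounded bidegree and poles of order at most \<open>ap\<close> along the diagonal (or
  along the residual curve y1 \<noteq> y2 in x1 = x2) and \<open>be\<close> along the graph of
  Frobenius. Comparing both dimension counts for \<open>ap\<close> close to sqrt q times
  \<open>be\<close> yields the inequality of Castelnuovo and Severi; its lower order terms vanish in
  the limit. This bounds numbers of points only from above. The lower bound comes from the residual
  curve: it meets Frobenius in the points with x in F_q and y outside, and together both kinds
  number about d q. The obstacle for the plane sections is a small field of positive characteristic.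
  A rational direction is needed in which the equation has full degree and nonzero derivative, then
  a base point with separable fibre, then a second direction. Each condition is certified by a
  polynomial of explicit degree, \<delta> + 1, 2\<delta>^2 and \<delta>^4, in sum at most
  5\<delta>^4; q > 15\<delta>^4 keeps the bad planes to at most a third.\<close>

lemma homogeneous_system:
 fixes M :: "'i => 'j => 'k::field"
 assumes "finite J" "finite I" "card J < card I"
 shows "EX x. (\<exists>i\<in>I. x i ~= 0) & (\<forall>j\<in>J. (\<Sum>i\<in>I. x i * M i j) = 0)"
 using assms
proof (induction J arbitrary: I M rule: finite_induct)
 case empty
 then have "I ~= {}" by auto
 then obtain i where "i \<in> I" by blast
 then show ?case by (intro exI[of _ "%_. 1"]) auto
next
 case (insert j J)
 show ?case
 proof (cases "\<forall>i\<in>I. M i j = 0")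
  case True
  from insert have "card J < card I" by simp
  from insert.IH[OF insert.prems(1) this, of M] obtain x where
   "\<exists>i\<in>I. x i ~= 0" "\<forall>j\<in>J. (\<Sum>i\<in>I. x i * M i j) = 0" by blast
  then show ?thesis using True by (intro exI[of _ x]) auto
 next
  case False
  then obtain i0 where i0: "i0 \<in> I" "M i0 j ~= 0" by blast
  let ?I = "I - {i0}"
  let ?M = "%i j'. M i j' - M i j / M i0 j * M i0 j'"
  have "card J < card ?I" using insert i0 by simp
  from insert.IH[OF _ this, of ?M] insert.prems obtain x where
   x: "\<exists>i\<in>?I. x i ~= 0" "\<forall>j'\<in>J. (\<Sum>i\<in>?I. x i * ?M i j') = 0" by auto
  define c where "c = - (\<Sum>i\<in>?I. x i * M i j) / M i0 j"
  let ?y = "%i. if i = i0 then c else x i"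
  have sp: "(\<Sum>i\<in>I. ?y i * M i j') = c * M i0 j' + (\<Sum>i\<in>?I. x i * M i j')" for j'
   using insert.prems(1) i0(1) by (subst sum.remove[of _ i0]) (auto intro!: sum.cong)
  have 1: "(\<Sum>i\<in>I. ?y i * M i j) = 0" using sp[of j] i0(2) by (simp add: c_def)
  have 2: "(\<Sum>i\<in>I. ?y i * M i j') = 0" if "j' \<in> J" for j'
  proof -
   have "0 = (\<Sum>i\<in>?I. x i * ?M i j')" using x(2) that by simp
   also have "\<dots> = (\<Sum>i\<in>?I. x i * M i j' - x i * M i j * (M i0 j' / M i0 j))"
    by (intro sum.cong refl) (simp add: algebra_simps)
   also have "\<dots> = (\<Sum>i\<in>?I. x i * M i j') - (\<Sum>i\<in>?I. x i * M i j) * (M i0 j' / M i0 j)"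
    by (simp only: sum_subtractf sum_distrib_right[symmetric])
   finally show ?thesis using sp[of j'] by (simp add: c_def)
  qed
  show ?thesis using x(1) 1 2 by (intro exI[of _ ?y]) auto
 qed
qed

definition indep :: "'p set => 'i set => ('i => 'p => 'k::field) => bool" where
 "indep \<Omega> I be \<longleftrightarrow> (ALL c. (\<forall>z\<in>\<Omega>. (\<Sum>i\<in>I. c i * be i z) = 0) --> (\<forall>i\<in>I. c i = 0))"

definition spanned :: "'p set => 'i set => ('i => 'p => 'k::field) => ('p => 'k) => bool" where
 "spanned \<Omega> I be f \<longleftrightarrow> (EX c. \<forall>z\<in>\<Omega>. f z = (\<Sum>i\<in>I. c i * be i z))"

text \<open>Stands for a dimension of at least \<open>n\<close>. The class \<open>V\<close> need not
  be a subspace, so a finite set of functions may serve as \<open>V\<close>; the opposite bounds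
  come from \<open>spanned\<close> through \<open>rich_le_spanned\<close>.\<close>

definition rich :: "'p set => (('p => 'k::field) => bool) => nat => bool" where
 "rich \<Omega> V n \<longleftrightarrow> (\<exists>be. (\<forall>i<n. V (be i)) & indep \<Omega> {..<n} be)"

lemma indepD: "indep \<Omega> I be ==> (!!z. z \<in> \<Omega> ==> (\<Sum>i\<in>I. c i * be i z) = 0) ==> i \<in> I ==> c i = 0"
 unfolding indep_def by (elim allE[of _ c]) simp

lemma indepI: "(!!c i. (!!z. z \<in> \<Omega> ==> (\<Sum>i\<in>I. c i * be i z) = 0) ==> i \<in> I ==> c i = 0) ==> indep \<Omega> I be"
 unfolding indep_def by (intro allI impI ballI) simp

lemma indep_le_spanned:
 assumes "finite I" "finite J" "indep \<Omega> I be" "!!i. i \<in> I ==> spanned \<Omega> J \<gamma> (be i)"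
 shows "card I \<le> card J"
proof (rule ccontr)
 assume "~ ?thesis"
 then have lt: "card J < card I" by simp
 from assms(4) have "\<forall>i\<in>I. EX c. \<forall>z\<in>\<Omega>. be i z = (\<Sum>j\<in>J. c j * \<gamma> j z)" unfolding spanned_def by blast
 from bchoice[OF this] obtain M where M: "!!i z. i \<in> I ==> z \<in> \<Omega> ==> be i z = (\<Sum>j\<in>J. M i j * \<gamma> j z)" by blast
 from homogeneous_system[OF assms(2,1) lt, of M] obtain x where
  x: "\<exists>i\<in>I. x i ~= 0" "\<forall>j\<in>J. (\<Sum>i\<in>I. x i * M i j) = 0" by blast
 have "(\<Sum>i\<in>I. x i * be i z) = 0" if z: "z \<in> \<Omega>" for z
 proof -
  have "(\<Sum>i\<in>I. x i * be i z) = (\<Sum>i\<in>I. \<Sum>j\<in>J. x i * M i j * \<gamma> j z)"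
   by (intro sum.cong refl) (simp add: M z sum_distrib_left mult.assoc)
  also have "\<dots> = (\<Sum>j\<in>J. (\<Sum>i\<in>I. x i * M i j) * \<gamma> j z)"
   by (subst sum.swap) (simp add: sum_distrib_right)
  also have "\<dots> = 0" using x(2) by simp
  finally show ?thesis .
 qed
 then have "\<forall>i\<in>I. x i = 0" using assms(3) unfolding indep_def by blast
 then show False using x(1) by blast
qed

lemma rich_le_spanned:
 assumes "rich \<Omega> V n" "finite J" "!!f. V f ==> spanned \<Omega> J \<gamma> f"
 shows "n \<le> card J"
proof -
 from assms(1) obtain be where "\<forall>i<n. V (be i)" "indep \<Omega> {..<n} be" unfolding rich_def by blast
 then show ?thesis using indep_le_spanned[of "{..<n}" J \<Omega> be \<gamma>] assms by auto
qed

lemma richI: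
 fixes be :: "'i => 'p => 'k::field"
 assumes "finite I" "indep \<Omega> I be" "!!i. i \<in> I ==> V (be i)"
 shows "rich \<Omega> V (card I)"
proof -
 obtain h where h: "bij_betw h {..<card I} I"
  using ex_bij_betw_nat_finite[OF assms(1)] by (auto simp: atLeast0LessThan)
 have "indep \<Omega> {..<card I} (%i. be (h i))"
 proof (rule indepI)
  fix c :: "nat => 'k" and i
  assume c: "!!z. z \<in> \<Omega> ==> (\<Sum>i<card I. c i * be (h i) z) = 0" and i: "i \<in> {..<card I}"
  let ?g = "the_inv_into {..<card I} h"
  have inj: "inj_on h {..<card I}" using h by (simp add: bij_betw_def)
  have "(\<Sum>j\<in>I. c (?g j) * be j z) = 0" if "z \<in> \<Omega>" for z
  proof -
   have "(\<Sum>j\<in>I. c (?g j) * be j z) = (\<Sum>i<card I. c (?g (h i)) * be (h i) z)"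
    by (rule sum.reindex_bij_betw[OF h, symmetric])
   also have "\<dots> = (\<Sum>i<card I. c i * be (h i) z)"
    by (intro sum.cong refl) (simp add: the_inv_into_f_f[OF inj])
   finally show ?thesis using c[OF that] by simp
  qed
  from indepD[OF assms(2), of "%j. c (?g j)", OF this, of "h i"] i h
  show "c i = 0" by (auto simp: the_inv_into_f_f[OF inj] bij_betw_def)
 qed
 moreover have "\<forall>i<card I. V (be (h i))" using h assms(3) by (auto simp: bij_betw_def)
 ultimately show ?thesis unfolding rich_def by (intro exI[of _ "%i. be (h i)"] conjI)
qed

lemma rich_mono: "rich \<Omega> V n ==> (!!f. V f ==> W f) ==> rich \<Omega> W n"
 unfolding rich_def by blast

text \<open>Filtering by the order of vanishing along \<open>\<pi>\<close>: new functions of order \<open>k\<close> are independent of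
 those of order \<open>k + 1\<close> as soon as their leading coefficients are independent on a part \<open>\<iota> ` Z\<close>
 of the zero set of \<open>\<pi>\<close>.\<close>

lemma rich_lift:
 fixes V V0 Reg :: "('p => 'k::field) => bool"
 assumes r0: "rich \<Omega> V0 n" and V0: "!!f. V0 f ==> V f & (EX r. Reg r & (\<forall>z\<in>\<Omega>. f z = A z * \<pi> z ^ Suc k * r z))"
  and rf: "rich Z Rf m"
  and Rf: "!!f. Rf f ==> EX h. Reg h & V (%z. A z * \<pi> z ^ k * h z) & (\<forall>y\<in>Z. h (\<iota> y) = f y)"
  and \<iota>: "!!y. y \<in> Z ==> \<iota> y \<in> \<Omega> & \<pi> (\<iota> y) = 0"
  and Reg: "Reg \<pi>" "!!c. Reg (%_. c)" "!!f g. Reg f ==> Reg g ==> Reg (%z. f z + g z)"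
   "!!f g. Reg f ==> Reg g ==> Reg (%z. f z * g z)"
  and dense: "!!r. Reg r ==> (!!z. z \<in> \<Omega> ==> A z * \<pi> z ^ k * r z = 0) ==> (!!z. z \<in> \<Omega> ==> r z = 0)"
 shows "rich \<Omega> V (n + m)"
proof -
 from r0 obtain be where b: "!!i. i < n ==> V0 (be i)" "indep \<Omega> {..<n} be" unfolding rich_def by blast
 have "\<forall>i\<in>{..<n}. EX r. Reg r & (\<forall>z\<in>\<Omega>. be i z = A z * \<pi> z ^ Suc k * r z)" using b V0 by blast
 from bchoice[OF this] obtain r where r: "!!i. i < n ==> Reg (r i)" "!!i z. i < n ==> z \<in> \<Omega> ==> be i z = A z * \<pi> z ^ Suc k * r i z"
  by blast
 from rf obtain f where f: "!!i. i < m ==> Rf (f i)" "indep Z {..<m} f" unfolding rich_def by blast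
 have "\<forall>i\<in>{..<m}. EX h. Reg h & V (%z. A z * \<pi> z ^ k * h z) & (\<forall>y\<in>Z. h (\<iota> y) = f i y)" using f Rf by blast
 from bchoice[OF this] obtain h where h: "!!i. i < m ==> Reg (h i)" "!!i. i < m ==> V (%z. A z * \<pi> z ^ k * h i z)"
  "!!i y. i < m ==> y \<in> Z ==> h i (\<iota> y) = f i y" by blast
 have Regsum: "finite S ==> (!!i. i \<in> S ==> Reg (\<phi> i)) ==> Reg (%z. \<Sum>i\<in>S. c i * \<phi> i z)" for S :: "nat set" and \<phi> c
  by (induction S rule: finite_induct) (auto intro!: Reg(3) Reg(4) Reg(2))
 define \<gamma> where "\<gamma> i = (if i < n then be i else (%z. A z * \<pi> z ^ k * h (i - n) z))" for i
 have "indep \<Omega> {..<n+m} \<gamma>"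
 proof (rule indepI)
  fix c :: "nat => 'k" and i
  assume c: "!!z. z \<in> \<Omega> ==> (\<Sum>i<n+m. c i * \<gamma> i z) = 0" and i: "i \<in> {..<n+m}"
  have sp: "(\<Sum>i<n+m. c i * \<gamma> i z) = (\<Sum>i<n. c i * be i z) + (\<Sum>i<m. c (n+i) * (A z * \<pi> z ^ k * h i z))" for z
  proof -
   have "{..<n+m} = {..<n} \<union> {n..<n+m}" by auto
   then have "(\<Sum>i<n+m. c i * \<gamma> i z) = (\<Sum>i<n. c i * \<gamma> i z) + (\<Sum>i=n..<n+m. c i * \<gamma> i z)"
    by (simp add: sum.union_disjoint ivl_disj_int)
   also have "(\<Sum>i=n..<n+m. c i * \<gamma> i z) = (\<Sum>i<m. c (n+i) * \<gamma> (n+i) z)"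
    using sum.shift_bounds_nat_ivl[of "%i. c i * \<gamma> i z" 0 n m] by (simp add: atLeast0LessThan add.commute)
   finally show ?thesis by (simp add: \<gamma>_def)
  qed
  \<comment> \<open>The common factor \<open>A * \<pi> ^ k\<close> is taken out of the relation and
    cancelled by \<open>dense\<close>. On the image of \<open>\<iota>\<close> the terms from
    \<open>be\<close> vanish with \<open>\<pi>\<close>, which leaves a relation among the
    \<open>f i\<close> alone.\<close>
  let ?r = "%z. \<pi> z * (\<Sum>i<n. c i * r i z) + (\<Sum>i<m. c (n+i) * h i z)"
  have Rr: "Reg ?r" by (intro Reg(3) Reg(4) Reg(1) Regsum) (auto intro: r h)
  have eq: "A z * \<pi> z ^ k * ?r z = (\<Sum>i<n+m. c i * \<gamma> i z)" if z: "z \<in> \<Omega>" for z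
  proof -
   have "(\<Sum>i<n. c i * be i z) = A z * \<pi> z ^ k * (\<pi> z * (\<Sum>i<n. c i * r i z))"
    unfolding sum_distrib_left by (intro sum.cong refl) (simp add: r(2) z algebra_simps)
   moreover have "(\<Sum>i<m. c (n+i) * (A z * \<pi> z ^ k * h i z)) = A z * \<pi> z ^ k * (\<Sum>i<m. c (n+i) * h i z)"
    unfolding sum_distrib_left by (intro sum.cong refl) (simp add: algebra_simps)
   ultimately show ?thesis unfolding sp by (simp add: distrib_left)
  qed
  have "A z * \<pi> z ^ k * ?r z = 0" if "z \<in> \<Omega>" for z
   unfolding eq[OF that] by (rule c[OF that])
  then have z0: "?r z = 0" if "z \<in> \<Omega>" for z
   by (rule dense[OF Rr _ that])
  have ch: "c (n+j) = 0" if j: "j < m" for j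
  proof (rule indepD[OF f(2), of "%j. c (n+j)"])
   fix y assume y: "y \<in> Z"
   have "(\<Sum>i<m. c (n+i) * f i y) = ?r (\<iota> y)" using \<iota>[OF y] h(3)[OF _ y] by simp
   then show "(\<Sum>i<m. c (n+i) * f i y) = 0" using z0[of "\<iota> y"] \<iota>[OF y] by simp
  qed (use j in simp)
  have "c j = 0" if j: "j < n" for j
  proof (rule indepD[OF b(2), of c])
   fix z assume "z \<in> \<Omega>"
   from c[OF this] show "(\<Sum>i<n. c i * be i z) = 0" unfolding sp by (simp add: ch)
  qed (use j in simp)
  then show "c i = 0" using ch[of "i - n"] i by (cases "i < n") auto
 qed
 moreover have "\<forall>i<n+m. V (\<gamma> i)" using b V0 h by (auto simp: \<gamma>_def)
 ultimately show ?thesis unfolding rich_def by blast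
qed

section \<open>Polynomial functions\<close>

text \<open>Polynomials of degree at most \<open>s\<close> in the coordinates \<open>Xs\<close>,
  taken as functions: substitution and restriction to lines are then immediate, and over infinite
  fields a function determines its polynomial.\<close>

inductive PF :: "('v => 'k::comm_ring_1) set => nat => ('v => 'k) => bool" for Xs where
 PF_const: "PF Xs s (%_. c)"
| PF_coord: "x \<in> Xs ==> PF Xs s f ==> PF Xs (Suc s) (%z. x z * f z)"
| PF_add: "PF Xs s f ==> PF Xs s g ==> PF Xs s (%z. f z + g z)"

lemma PF_mono: "PF Xs s f ==> s \<le> t ==> PF Xs t f"
proof (induction arbitrary: t rule: PF.induct)
 case (PF_const s c)
 show ?case by (rule PF.PF_const)
next
 case (PF_coord x s f)
 then obtain t' where t: "t = Suc t'" "s \<le> t'" by (cases t) auto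
 show ?case unfolding t(1) by (rule PF.PF_coord[OF PF_coord(1) PF_coord(3)[OF t(2)]])
next
 case (PF_add s f g)
 show ?case by (rule PF.PF_add[OF PF_add(3)[OF PF_add(5)] PF_add(4)[OF PF_add(5)]])
qed

lemma PF_scale: "PF Xs s f ==> PF Xs s (%z. c * f z)"
proof (induction rule: PF.induct)
 case (PF_const s c)
 show ?case by (rule PF.PF_const)
next
 case (PF_coord x s f)
 have "(%z. c * (x z * f z)) = (%z. x z * (c * f z))" by (simp add: mult.left_commute)
 then show ?case using PF.PF_coord[OF PF_coord(1,3)] by simp
next
 case (PF_add s f g)
 show ?case unfolding distrib_left by (rule PF.PF_add[OF PF_add(3,4)])
qed

lemma PF_mult: "PF Xs s f ==> PF Xs t g ==> PF Xs (s + t) (%z. f z * g z)"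
proof (induction arbitrary: g rule: PF.induct)
 case (PF_const s c)
 show ?case by (rule PF_mono[OF PF_scale[OF PF_const]]) simp
next
 case (PF_coord x s f)
 show ?case unfolding mult.assoc add_Suc by (rule PF.PF_coord[OF PF_coord(1) PF_coord(3)[OF PF_coord(4)]])
next
 case (PF_add s f g')
 show ?case unfolding distrib_right by (rule PF.PF_add[OF PF_add(3)[OF PF_add(5)] PF_add(4)[OF PF_add(5)]])
qed

lemma PF_var: "x \<in> Xs ==> PF Xs 1 x"
 using PF_coord[of x Xs 0 "%_. 1", OF _ PF_const] by simp

lemma PF_minus: "PF Xs s f ==> PF Xs s (%z. - f z)"
 using PF_scale[of Xs s f "-1"] by simp

lemma PF_diff: "PF Xs s f ==> PF Xs s g ==> PF Xs s (%z. f z - g z)"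
 using PF_add[OF _ PF_minus, of Xs s f g] by simp

lemma PF_sum: "(!!i. i \<in> I ==> PF Xs s (f i)) ==> PF Xs s (%z. \<Sum>i\<in>I. f i z)"
proof (induction I rule: infinite_finite_induct)
 case (insert i I)
 have "PF Xs s (%z. f i z + (\<Sum>i\<in>I. f i z))" by (rule PF_add) (use insert in auto)
 then show ?case using insert by simp
qed (simp_all add: PF_const)

lemma PF_power: "PF Xs s f ==> PF Xs (n * s) (%z. f z ^ n)"
proof (induction n)
 case 0
 then show ?case using PF_const[of Xs 0 1] by simp
next
 case (Suc n)
 then show ?case using PF_mult[of Xs s f "n * s" "%z. f z ^ n"] by simp
qed

lemma PF_prod: "(!!i. i \<in> I ==> PF Xs (s i) (f i)) ==> PF Xs (\<Sum>i\<in>I. s i) (%z. \<Prod>i\<in>I. f i z)"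
proof (induction I rule: infinite_finite_induct)
 case (insert i I)
 then show ?case using PF_mult[of Xs "s i" "f i" "\<Sum>i\<in>I. s i" "%z. \<Prod>i\<in>I. f i z"] by simp
qed (simp_all add: PF_const)

lemma PF_comp:
 assumes "PF Xs s f" "!!x. x \<in> Xs ==> PF Y m (%w. x (h w))"
 shows "PF Y (m * s) (%w. f (h w))"
 using assms(1)
proof (induction rule: PF.induct)
 case (PF_coord x s f)
 then show ?case using PF_mult[OF assms(2) PF_coord(3)] by simp
next
 case (PF_const s c)
 show ?case by (rule PF.PF_const)
next
 case (PF_add s f g)
 show ?case by (rule PF.PF_add[OF PF_add(3,4)])
qed

lemma PF_comp_affine:
 assumes "PF Xs s f" "!!x. x \<in> Xs ==> PF Y 1 (%w. x (h w))"
 shows "PF Y s (%w. f (h w))"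
 using PF_comp[OF assms] by simp

lemma PF_poly:
 assumes "PF Xs s f" "!!x. x \<in> Xs ==> EX p. degree p \<le> 1 & (ALL t. x (l t) = poly p t)"
 shows "EX p. degree p \<le> s & (ALL t. f (l t) = poly p t)"
 using assms(1)
proof (induction rule: PF.induct)
 case (PF_const s c)
 then show ?case by (intro exI[of _ "[:c:]"]) auto
next
 case (PF_coord x s f)
 then obtain p p' where "degree p \<le> s" "ALL t. f (l t) = poly p t" "degree p' \<le> 1" "ALL t. x (l t) = poly p' t"
  using assms(2) by blast
 moreover have "degree (p' * p) \<le> Suc s" using calculation degree_mult_le[of p' p] by linarith
 ultimately show ?case by (intro exI[of _ "p' * p"]) auto
next
 case (PF_add s f g)
 then obtain p p' where "degree p \<le> s" "ALL t. f (l t) = poly p t" "degree p' \<le> s" "ALL t. g (l t) = poly p' t" by blast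
 then show ?case by (intro exI[of _ "p + p'"]) (auto intro: degree_add_le)
qed

hide_const (open) UnivPoly.up_ring.monom UnivPoly.up_ring.coeff

section \<open>Plane curves\<close>

definition polyfun :: "('v => 'k::comm_ring_1) set => ('v => 'k) => bool" where
 "polyfun Xs f \<longleftrightarrow> (EX s. PF Xs s f)"

lemma polyfunI: "PF Xs s f ==> polyfun Xs f" unfolding polyfun_def by blast

lemma polyfun_add: "polyfun Xs f ==> polyfun Xs g ==> polyfun Xs (%z. f z + g z)"
 unfolding polyfun_def
proof (elim exE)
 fix s t assume "PF Xs s f" "PF Xs t g"
 then show "EX s. PF Xs s (%z. f z + g z)"
  by (intro exI[of _ "max s t"] PF_add) (auto elim: PF_mono)
qed

lemma polyfun_mult: "polyfun Xs f ==> polyfun Xs g ==> polyfun Xs (%z. f z * g z)"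
 unfolding polyfun_def by (elim exE) (rule exI, erule (1) PF_mult)

lemma polyfun_const: "polyfun Xs (%_. c)" by (rule polyfunI[OF PF_const])

lemma polyfun_minus: "polyfun Xs f ==> polyfun Xs (%z. - f z)"
 unfolding polyfun_def by (elim exE) (rule exI, erule PF_minus)

lemma polyfun_diff: "polyfun Xs f ==> polyfun Xs g ==> polyfun Xs (%z. f z - g z)"
 using polyfun_add[OF _ polyfun_minus, of Xs f g] by simp

lemma polyfun_power: "polyfun Xs f ==> polyfun Xs (%z. f z ^ n)"
 unfolding polyfun_def by (elim exE) (rule exI, erule PF_power)

lemma polyfun_sum: "(!!i. i \<in> I ==> polyfun Xs (f i)) ==> polyfun Xs (%z. \<Sum>i\<in>I. f i z)"
proof (induction I rule: infinite_finite_induct)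
 case (insert i I)
 have "polyfun Xs (%z. f i z + (\<Sum>i\<in>I. f i z))" by (rule polyfun_add) (use insert in auto)
 then show ?case using insert by simp
qed (simp_all add: polyfun_const)

lemma polyfun_prod: "(!!i. i \<in> I ==> polyfun Xs (f i)) ==> polyfun Xs (%z. \<Prod>i\<in>I. f i z)"
proof (induction I rule: infinite_finite_induct)
 case (insert i I)
 have "polyfun Xs (%z. f i z * (\<Prod>i\<in>I. f i z))" by (rule polyfun_mult) (use insert in auto)
 then show ?case using insert by simp
qed (simp_all add: polyfun_const)

abbreviation Pl :: "nat => ('k::comm_ring_1 \<times> 'k => 'k) => bool" where "Pl \<equiv> PF {fst, snd}"
abbreviation Pol :: "('k::comm_ring_1 \<times> 'k => 'k) => bool" where "Pol \<equiv> polyfun {fst, snd}"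

lemma Pl_fst: "Pl 1 (%P. fst P)" and Pl_snd: "Pl 1 (%P. snd P)"
 using PF_var[of fst "{fst,snd}"] PF_var[of snd "{fst,snd}"] by simp_all

lemma Pol_fst: "Pol (%P. fst P)" and Pol_snd: "Pol (%P. snd P)"
 using Pl_fst Pl_snd polyfunI by blast+

lemmas polyfun_intros = polyfun_add polyfun_diff polyfun_mult polyfun_minus polyfun_const polyfun_power
 polyfun_sum polyfun_prod Pol_fst Pol_snd

lemma Pl_monom: "Pl (e + j) (%P. fst P ^ e * snd P ^ j)"
 using PF_mult[OF PF_power[OF Pl_fst, of e] PF_power[OF Pl_snd, of j]] by simp

definition curve_fun :: "(nat => nat => 'k::comm_ring_1) => nat => 'k => 'k => 'k" where
 "curve_fun a d x y = (\<Sum>k\<le>d. \<Sum>j\<le>d-k. a j k * x ^ j * y ^ k)"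

text \<open>Being monic in y of the same total degree \<open>d\<close> ensures that reduction modulo
  \<open>F\<close> does not raise total degrees and that every vertical line meets the curve in
  \<open>d\<close> points with multiplicity over a closed field.\<close>

locale monic_curve =
 fixes a :: "nat => nat => 'k::field" and d :: nat
 assumes d_pos: "d \<ge> 1" and monic: "a 0 d = 1" and inf_field: "infinite (UNIV :: 'k set)"
begin

abbreviation "F \<equiv> curve_fun a d"
definition "C = {P. F (fst P) (snd P) = 0}"
text \<open>A pair (j, e) stands for the monomial x^e y^j, so these are the monomials of degree at
  most \<open>s\<close> reduced modulo \<open>F\<close>, and \<open>card (M s)\<close> is the
  Hilbert function of the curve; \<open>card_M_add\<close> is its growth with slope
  \<open>d\<close>.\<close>

definition M :: "nat => (nat \<times> nat) set" where "M s = Sigma {..<d} (%j. {e. e + j \<le> s})"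
definition mon :: "nat \<times> nat => 'k \<times> 'k => 'k" where "mon i P = fst P ^ snd i * snd P ^ fst i"

lemma C_iff: "(x, y) \<in> C \<longleftrightarrow> F x y = 0" "P \<in> C \<longleftrightarrow> F (fst P) (snd P) = 0" by (simp_all add: C_def)

lemma finite_le_set [simp]: "finite {e::nat. e + j \<le> s}"
 by (rule finite_subset[of _ "{..s}"]) auto

lemma finite_M [simp]: "finite (M s)" unfolding M_def by (intro finite_SigmaI) simp_all

lemma mon_Pl: "Pl (fst i + snd i) (mon i)"
 unfolding mon_def using Pl_monom[of "snd i" "fst i"] by (simp add: add.commute)

lemma mon_Pl': "i \<in> M s ==> Pl s (mon i)"
 by (rule PF_mono[OF mon_Pl]) (auto simp: M_def)

lemma card_M_Suc: "d \<le> s + 2 ==> card (M (Suc s)) = card (M s) + d"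
proof -
 assume ds: "d \<le> s + 2"
 have "M (Suc s) = M s \<union> (%j. (j, Suc s - j)) ` {..<d}" using ds by (auto simp: M_def image_def)
 moreover have "M s \<inter> (%j. (j, Suc s - j)) ` {..<d} = {}" using ds by (auto simp: M_def)
 moreover have "card ((%j. (j, Suc s - j)) ` {..<d}) = d" by (subst card_image) (auto simp: inj_on_def)
 ultimately show ?thesis by (simp add: card_Un_disjoint)
qed

lemma card_M_add: "d \<le> s + 1 ==> card (M (s + t)) = card (M s) + d * t"
 by (induction t) (auto simp: card_M_Suc)

lemma card_M_ge: "d * (s + 1 - d) \<le> card (M s)"
proof -
 have "{..<d} \<times> {..<s + 1 - d} \<subseteq> M s" by (auto simp: M_def)
 from card_mono[OF finite_M this] show ?thesis by simp
qed

lemma F_split: "F x y = y ^ d + (\<Sum>k<d. \<Sum>j\<le>d-k. a j k * x ^ j * y ^ k)"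
proof -
 have "{..d} = insert d {..<d}" by auto
 then show ?thesis unfolding curve_fun_def by (simp add: monic)
qed

text \<open>Normal form after division by \<open>F\<close>. The cofactor \<open>G\<close> is kept
  because the identity is later used off the curve as well.\<close>

definition NF :: "nat => ('k \<times> 'k => 'k) => bool" where
 "NF s f \<longleftrightarrow> (EX c G. Pol G & (ALL P. f P = (\<Sum>i\<in>M s. c i * mon i P) + F (fst P) (snd P) * G P))"

lemma NF_add: assumes "NF s f" "NF s g" shows "NF s (%P. f P + g P)"
proof -
 from assms obtain c G c' G' where "Pol G" "ALL P. f P = (\<Sum>i\<in>M s. c i * mon i P) + F (fst P) (snd P) * G P"
  "Pol G'" "ALL P. g P = (\<Sum>i\<in>M s. c' i * mon i P) + F (fst P) (snd P) * G' P" unfolding NF_def by blast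
 then show ?thesis unfolding NF_def
  by (intro exI[of _ "%i. c i + c' i"] exI[of _ "%P. G P + G' P"]) (auto simp: algebra_simps sum.distrib intro: polyfun_add)
qed

lemma NF_scale: assumes "NF s f" shows "NF s (%P. c * f P)"
proof -
 from assms obtain c' G where "Pol G" "ALL P. f P = (\<Sum>i\<in>M s. c' i * mon i P) + F (fst P) (snd P) * G P"
  unfolding NF_def by blast
 then show ?thesis unfolding NF_def
  by (intro exI[of _ "%i. c * c' i"] exI[of _ "%P. c * G P"]) (auto simp: algebra_simps sum_distrib_left intro!: polyfun_mult polyfun_const)
qed

lemma NF_F: "Pol G ==> NF s (%P. F (fst P) (snd P) * G P)"
 unfolding NF_def by (intro exI[of _ "%_. 0"] exI[of _ G]) simp

lemma NF_zero: "NF s (%_. 0)" using NF_F[OF polyfun_const[of _ 0]] by simp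

lemma NF_sum: "(!!i. i \<in> I ==> NF s (f i)) ==> NF s (%P. \<Sum>i\<in>I. f i P)"
proof (induction I rule: infinite_finite_induct)
 case (insert i I)
 have "NF s (%z. f i z + (\<Sum>i\<in>I. f i z))" by (rule NF_add) (use insert in auto)
 then show ?case using insert by simp
qed (simp_all add: NF_zero)

lemma NF_mon: assumes "i \<in> M s" shows "NF s (mon i)"
proof -
 have "mon i P = (\<Sum>j\<in>M s. (if j = i then 1 else 0) * mon j P)" for P
  using assms by (subst sum.remove[of _ i]) (auto intro!: sum.neutral)
 then show ?thesis unfolding NF_def
  by (intro exI[of _ "%j. if j = i then 1 else 0"] exI[of _ "%_. 0"]) (simp add: polyfun_const)
qed

lemma NF_mult_step:
 assumes f: "NF s f" and m: "!!i. i \<in> M s ==> NF t (%P. x P * mon i P)" and x: "Pol x"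
 shows "NF t (%P. x P * f P)"
proof -
 from f obtain c G where G: "Pol G" and e: "!!P. f P = (\<Sum>i\<in>M s. c i * mon i P) + F (fst P) (snd P) * G P"
  unfolding NF_def by blast
 have "NF t (%P. (\<Sum>i\<in>M s. c i * (x P * mon i P)) + F (fst P) (snd P) * (x P * G P))"
  by (intro NF_add NF_sum NF_scale NF_F polyfun_mult m x G)
 moreover have "(%P. x P * f P) = (%P. (\<Sum>i\<in>M s. c i * (x P * mon i P)) + F (fst P) (snd P) * (x P * G P))"
  by (rule ext) (simp add: e algebra_simps sum_distrib_left)
 ultimately show ?thesis by simp
qed

lemma NF_fst: "NF s f ==> NF (Suc s) (%P. fst P * f P)"
proof (rule NF_mult_step)
 fix i assume "i \<in> M s"
 then have "(fst i, Suc (snd i)) \<in> M (Suc s)" by (auto simp: M_def)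
 from NF_mon[OF this] show "NF (Suc s) (%P. fst P * mon i P)" by (simp add: mon_def[abs_def] mult_ac)
qed (auto intro: Pol_fst)

lemma NF_snd: "NF s f ==> NF (Suc s) (%P. snd P * f P)"
proof (rule NF_mult_step)
 fix i assume i: "i \<in> M s"
 show "NF (Suc s) (%P. snd P * mon i P)"
 proof (cases "Suc (fst i) < d")
  case True
  then have "(Suc (fst i), snd i) \<in> M (Suc s)" using i by (auto simp: M_def)
  from NF_mon[OF this] show ?thesis by (simp add: mon_def[abs_def] mult_ac)
 next
  case False
  then have fi: "Suc (fst i) = d" using i by (auto simp: M_def)
  \<comment> \<open>Only y^d leaves the basis; the monic equation replaces it by terms of total
    degree at most \<open>d\<close>.\<close>
  have eq: "snd P * mon i P = F (fst P) (snd P) * fst P ^ snd i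
    + (\<Sum>k<d. \<Sum>j\<le>d-k. (- a j k) * mon (k, snd i + j) P)" for P
  proof -
   have "snd P * mon i P = fst P ^ snd i * snd P ^ d" by (simp add: mon_def flip: fi)
   also have "snd P ^ d = F (fst P) (snd P) - (\<Sum>k<d. \<Sum>j\<le>d-k. a j k * fst P ^ j * snd P ^ k)"
    by (simp add: F_split)
   also have "fst P ^ snd i * \<dots> = F (fst P) (snd P) * fst P ^ snd i
     + (\<Sum>k<d. \<Sum>j\<le>d-k. (- a j k) * mon (k, snd i + j) P)"
    by (simp add: mon_def algebra_simps sum_distrib_left power_add sum_negf)
   finally show ?thesis .
  qed
  show ?thesis unfolding eq
  proof (intro NF_add NF_F NF_sum NF_scale NF_mon)
   fix k j assume "k \<in> {..<d}" "j \<in> {..d-k}"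
   then show "(k, snd i + j) \<in> M (Suc s)" using i fi by (auto simp: M_def)
  qed (intro polyfun_intros)
 qed
qed (auto intro: Pol_snd)

lemma Pl_NF: "Pl s f ==> NF s f"
proof (induction rule: PF.induct)
 case (PF_const s c)
 have "(0, 0) \<in> M s" using d_pos by (auto simp: M_def)
 from NF_scale[OF NF_mon[OF this], of c] show ?case by (simp add: mon_def)
next
 case (PF_coord x s f)
 then show ?case using NF_fst NF_snd by auto
next
 case (PF_add s f g)
 then show ?case by (simp add: NF_add)
qed

lemma Pl_spanned: "Pl s f ==> spanned C (M s) mon f"
 using Pl_NF[of s f] unfolding NF_def spanned_def by (auto simp: C_iff(2))

definition Fp :: "'k => 'k poly" where "Fp x = (\<Sum>k\<le>d. monom (\<Sum>j\<le>d-k. a j k * x ^ j) k)"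

lemma poly_Fp: "poly (Fp x) y = F x y"
 by (simp add: Fp_def curve_fun_def poly_sum poly_monom sum_distrib_right)

lemma coeff_Fp: "coeff (Fp x) n = (if n \<le> d then \<Sum>j\<le>d-n. a j n * x ^ j else 0)"
 by (simp add: Fp_def coeff_sum)

lemma degree_Fp: "degree (Fp x) = d"
proof (rule antisym)
 show "degree (Fp x) \<le> d" by (rule degree_le) (simp add: coeff_Fp)
 show "d \<le> degree (Fp x)" by (rule le_degree) (simp add: coeff_Fp monic)
qed

lemma Fp_nz: "Fp x ~= 0" using degree_Fp[of x] d_pos by auto

lemma finite_roots: "finite {y. F x y = 0}"
 using poly_roots_finite[OF Fp_nz, of x] by (simp add: poly_Fp)

text \<open>Divided differences of \<open>F\<close> in y and in x. They trade a factor y - y0 for a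
  factor x - x0 on the curve; on equal arguments \<open>fy2\<close> becomes the partial derivative
  \<open>Fy\<close>.\<close>

definition fy2 :: "'k => 'k => 'k => 'k" where
 "fy2 x z y = (\<Sum>k\<le>d. \<Sum>j\<le>d-k. a j k * x ^ j * (\<Sum>r<k. z ^ r * y ^ (k - Suc r)))"
definition fx2 :: "'k => 'k => 'k => 'k" where
 "fx2 x z y = (\<Sum>k\<le>d. \<Sum>j\<le>d-k. a j k * (\<Sum>r<j. x ^ r * z ^ (j - Suc r)) * y ^ k)"
definition Fy :: "'k => 'k => 'k" where "Fy x y = fy2 x y y"

lemma fy2: "(z - y) * fy2 x z y = F x z - F x y"
proof -
 have "(z - y) * fy2 x z y = (\<Sum>k\<le>d. \<Sum>j\<le>d-k. a j k * x ^ j * (z ^ k - y ^ k))"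
  unfolding fy2_def sum_distrib_left
  by (intro sum.cong refl) (simp add: power_diff_sumr2 algebra_simps sum_distrib_left)
 then show ?thesis by (simp add: curve_fun_def algebra_simps sum_subtractf)
qed

lemma fx2: "(x - z) * fx2 x z y = F x y - F z y"
proof -
 have "(x - z) * fx2 x z y = (\<Sum>k\<le>d. \<Sum>j\<le>d-k. a j k * (x ^ j - z ^ j) * y ^ k)"
  unfolding fx2_def sum_distrib_left
  by (intro sum.cong refl) (simp add: power_diff_sumr2 algebra_simps sum_distrib_left)
 then show ?thesis by (simp add: curve_fun_def algebra_simps sum_subtractf)
qed

lemma polyfun_fy2: "polyfun Xs f ==> polyfun Xs g ==> polyfun Xs h ==> polyfun Xs (%w. fy2 (f w) (g w) (h w))"
 unfolding fy2_def by (intro polyfun_intros)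
lemma polyfun_fx2: "polyfun Xs f ==> polyfun Xs g ==> polyfun Xs h ==> polyfun Xs (%w. fx2 (f w) (g w) (h w))"
 unfolding fx2_def by (intro polyfun_intros)

definition good :: "'k => bool" where "good x \<longleftrightarrow> card {y. F x y = 0} = d"

text \<open>If the derivative vanished at y, all \<open>d\<close> points of the fibre would be roots
  of w \<mapsto> \<open>fy2 x w y\<close>, a monic polynomial of degree d - 1.\<close>

lemma good_Fy:
 assumes "good x" "F x y = 0" shows "Fy x y ~= 0"
proof
 assume z: "Fy x y = 0"
 define p where "p = (\<Sum>k\<le>d. \<Sum>j\<le>d-k. \<Sum>r<k. monom (a j k * x ^ j * y ^ (k - Suc r)) r)"
 have pp: "poly p w = fy2 x w y" for w
  unfolding p_def fy2_def by (simp add: poly_sum poly_monom sum_distrib_left mult_ac)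
 have cp: "coeff p n = (\<Sum>k\<le>d. \<Sum>j\<le>d-k. \<Sum>r<k. (if r = n then a j k * x ^ j * y ^ (k - Suc r) else 0))" for n
  by (simp add: p_def coeff_sum)
 have deg: "degree p \<le> d - 1" by (rule degree_le) (auto simp: cp intro!: sum.neutral)
 have "coeff p (d - 1) = (\<Sum>k\<le>d. (if k = d then \<Sum>j\<le>d-k. a j k * x ^ j else 0))"
  unfolding cp
 proof (intro sum.cong refl)
  fix k assume "k \<in> {..d}"
  then have k: "k \<le> d" by simp
  have "(\<Sum>r<k. (if r = d-1 then a j k * x ^ j * y ^ (k - Suc r) else 0)) = (if k = d then a j k * x ^ j else 0)" for j
   using k d_pos by auto
  then show "(\<Sum>j\<le>d-k. \<Sum>r<k. (if r = d-1 then a j k * x ^ j * y ^ (k - Suc r) else 0)) = (if k = d then \<Sum>j\<le>d-k. a j k * x ^ j else 0)"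
   by simp
 qed
 then have "coeff p (d - 1) = 1" by (simp add: monic)
 then have nz: "p ~= 0" by auto
 have "{w. F x w = 0} \<subseteq> {w. poly p w = 0}"
 proof
  fix w assume "w \<in> {w. F x w = 0}"
  then have "(w - y) * fy2 x w y = 0" using fy2[of w y x] assms(2) by simp
  then show "w \<in> {w. poly p w = 0}" using z by (cases "w = y") (auto simp: pp Fy_def)
 qed
 from card_mono[OF poly_roots_finite[OF nz] this] have "d \<le> degree p"
  using card_poly_roots_bound[OF nz] assms(1) by (simp add: good_def)
 then show False using deg d_pos by linarith
qed

end

locale sep_curve = monic_curve +
 assumes cofin: "finite {x. card {y. curve_fun a d x y = 0} ~= d}"
begin

lemma ex_good: assumes "finite S" shows "EX x y. good x & x \<notin> S & F x y = 0"
proof -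
 have "finite ({x. ~ good x} \<union> S)" using cofin assms by (simp add: good_def)
 then obtain x where x: "good x" "x \<notin> S" using inf_field ex_new_if_finite by blast
 have "{y. F x y = 0} ~= {}"
 proof
  assume "{y. F x y = 0} = {}"
  then have "card {y. F x y = 0} = 0" by (simp only: card.empty)
  then show False using x(1) d_pos by (simp add: good_def)
 qed
 then show ?thesis using x by blast
qed

lemma indep_mon: assumes "finite S" shows "indep {P\<in>C. fst P \<notin> S & good (fst P)} (M s) mon"
proof (rule indepI)
 fix c :: "nat \<times> nat => 'a" and i
 assume c: "!!P. P \<in> {P\<in>C. fst P \<notin> S & good (fst P)} ==> (\<Sum>i\<in>M s. c i * mon i P) = 0" and i: "i \<in> M s"
 define r where "r j = (\<Sum>e\<in>{e. e + j \<le> s}. monom (c (j, e)) e)" for j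
 have r0: "poly (r j) x = 0" if x: "good x" "x \<notin> S" and j: "j < d" for j x
 proof -
  define q where "q = (\<Sum>j<d. monom (poly (r j) x) j)"
  have cq: "coeff q n = (if n < d then poly (r n) x else 0)" for n by (simp add: q_def coeff_sum)
  have dq: "degree q < d" using d_pos by (intro degree_lessI) (auto simp: cq)
  have "poly q y = 0" if y: "F x y = 0" for y
  proof -
   have "poly q y = (\<Sum>j<d. \<Sum>e\<in>{e. e + j \<le> s}. c (j, e) * mon (j, e) (x, y))"
    by (simp add: q_def r_def poly_sum poly_monom mon_def sum_distrib_right mult.assoc)
   also have "\<dots> = (\<Sum>i\<in>M s. c i * mon i (x, y))" unfolding M_def by (subst sum.Sigma) auto
   also have "\<dots> = 0" by (rule c) (use x y in \<open>auto simp: C_iff\<close>)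
   finally show ?thesis .
  qed
  then have sub: "{y. F x y = 0} \<subseteq> {y. poly q y = 0}" by blast
  have "q = 0"
  proof (rule ccontr)
   assume "q ~= 0"
   from card_mono[OF poly_roots_finite[OF this] sub] card_poly_roots_bound[OF this] dq x(1)
   show False by (simp add: good_def)
  qed
  then show ?thesis using cq[of j] j by simp
 qed
 obtain j e where i': "i = (j, e)" "j < d" "e + j \<le> s" using i by (auto simp: M_def)
 have "r j = 0"
 proof (rule ccontr)
  assume nz: "r j ~= 0"
  have "UNIV - ({x. ~ good x} \<union> S) \<subseteq> {x. poly (r j) x = 0}" using r0 i' by auto
  moreover have "finite ({x. ~ good x} \<union> S)" using cofin assms by (simp add: good_def)
  ultimately show False using poly_roots_finite[OF nz] inf_field
   by (meson Diff_infinite_finite finite_subset)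
 qed
 moreover have "coeff (r j) e = c (j, e)" using i' by (simp add: r_def coeff_sum)
 ultimately show "c i = 0" by (simp add: i')
qed

lemma indep_mon': "indep C (M s) mon"
 using indep_mon[of "{}" s] unfolding indep_def by auto

end

text \<open>\<open>dom\<close> expresses that the coordinate ring of the curve is a domain; this is
  the form in which irreducibility enters the dimension counts.\<close>

locale irr_curve = sep_curve +
 assumes dom: "!!s t \<phi> ps. Pl s \<phi> ==> Pl t ps ==> (!!x y. curve_fun a d x y = 0 ==> \<phi> (x,y) * ps (x,y) = 0) ==>
   (ALL x y. curve_fun a d x y = 0 --> \<phi> (x,y) = 0) | (ALL x y. curve_fun a d x y = 0 --> ps (x,y) = 0)"
begin

lemma domC:
 assumes "Pol \<phi>" "Pol ps" "!!P. P \<in> C ==> \<phi> P * ps P = 0"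
 shows "(\<forall>P\<in>C. \<phi> P = 0) | (\<forall>P\<in>C. ps P = 0)"
proof -
 from assms(1,2) obtain s t where "Pl s \<phi>" "Pl t ps" unfolding polyfun_def by blast
 from dom[OF this] assms(3) show ?thesis by (auto simp: C_def)
qed

text \<open>The product of x - s over \<open>S\<close> is not identically zero on the curve, since
  some good fibre avoids \<open>S\<close>; so the domain property cancels it.\<close>

lemma dense:
 assumes "Pol \<phi>" "finite S" "!!P. P \<in> C ==> fst P \<notin> S ==> \<phi> P = 0" "P \<in> C"
 shows "\<phi> P = 0"
proof -
 let ?p = "%P. \<Prod>x\<in>S. (fst P - x)"
 have p: "Pol ?p" by (intro polyfun_intros)
 have z: "?p P = 0 \<longleftrightarrow> fst P \<in> S" for P using assms(2) by auto
 have "\<phi> P * ?p P = 0" if "P \<in> C" for P using assms(3)[OF that] z[of P] by auto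
 from domC[OF assms(1) p this] consider "\<forall>P\<in>C. \<phi> P = 0" | "\<forall>P\<in>C. ?p P = 0" by blast
 then show ?thesis
 proof cases
  case 2
  obtain x y where "x \<notin> S" "F x y = 0" using ex_good[OF assms(2)] by blast
  then show ?thesis using bspec[OF 2, of "(x,y)"] z[of "(x,y)"] by (simp add: C_iff(1))
 qed (use assms(4) in blast)
qed

text \<open>The local ring at a point with \<open>Fy \<noteq> 0\<close> is a discrete valuation ring with uniformiser \<open>x - x\<^sub>0\<close>;
 \<open>ordge P k \<phi>\<close> says that \<open>\<phi>\<close> has valuation at least \<open>k\<close> there.\<close>

definition ordge :: "'a \<times> 'a => nat => ('a \<times> 'a => 'a) => bool" where
 "ordge P0 k \<phi> \<longleftrightarrow> (\<exists>ps \<eta>. Pol ps & Pol \<eta> & ps P0 ~= 0 & (\<forall>P\<in>C. ps P * \<phi> P = (fst P - fst P0) ^ k * \<eta> P))"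

lemma ordgeI: "Pol ps ==> Pol \<eta> ==> ps P0 ~= 0 ==> (!!P. P \<in> C ==> ps P * \<phi> P = (fst P - fst P0) ^ k * \<eta> P) ==> ordge P0 k \<phi>"
 unfolding ordge_def by blast

lemma ordge_0: "Pol \<phi> ==> ordge P0 0 \<phi>"
 by (rule ordgeI[of "%_. 1" \<phi>]) (auto intro: polyfun_const)

lemma ordge_mult: assumes "ordge P0 k \<phi>" "ordge P0 l \<phi>'" shows "ordge P0 (k + l) (%P. \<phi> P * \<phi>' P)"
proof -
 from assms obtain ps \<eta> ps' \<eta>' where h: "Pol ps" "Pol \<eta>" "ps P0 ~= 0" "\<forall>P\<in>C. ps P * \<phi> P = (fst P - fst P0) ^ k * \<eta> P"
  "Pol ps'" "Pol \<eta>'" "ps' P0 ~= 0" "\<forall>P\<in>C. ps' P * \<phi>' P = (fst P - fst P0) ^ l * \<eta>' P" unfolding ordge_def by blast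
 show ?thesis
 proof (rule ordgeI[of "%P. ps P * ps' P" "%P. \<eta> P * \<eta>' P"])
  fix P assume "P \<in> C"
  have "ps P * ps' P * (\<phi> P * \<phi>' P) = (ps P * \<phi> P) * (ps' P * \<phi>' P)" by (simp add: mult_ac)
  also have "\<dots> = (fst P - fst P0) ^ (k + l) * (\<eta> P * \<eta>' P)" using h \<open>P \<in> C\<close> by (simp add: power_add mult_ac)
  finally show "ps P * ps' P * (\<phi> P * \<phi>' P) = (fst P - fst P0) ^ (k + l) * (\<eta> P * \<eta>' P)" .
 qed (use h in \<open>auto intro!: polyfun_mult\<close>)
qed

lemma ordge_mono: assumes "ordge P0 k \<phi>" "l \<le> k" shows "ordge P0 l \<phi>"
proof -
 from assms(1) obtain ps \<eta> where h: "Pol ps" "Pol \<eta>" "ps P0 ~= 0" "\<forall>P\<in>C. ps P * \<phi> P = (fst P - fst P0) ^ k * \<eta> P"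
  unfolding ordge_def by blast
 have "(fst P - fst P0) ^ k = (fst P - fst P0) ^ l * (fst P - fst P0) ^ (k - l)" for P :: "'a \<times> 'a"
  using assms(2) by (simp flip: power_add)
 then show ?thesis using h
  by (intro ordgeI[of ps "%P. (fst P - fst P0) ^ (k - l) * \<eta> P"]) (auto intro!: polyfun_intros simp: mult.assoc)
qed

lemma ordge_power: assumes "ordge P0 1 \<phi>" shows "ordge P0 k (%P. \<phi> P ^ k)"
proof (induction k)
 case 0
 show ?case using ordge_0[OF polyfun_const] by simp
next
 case (Suc k)
 from ordge_mult[OF assms Suc] show ?case by simp
qed

lemma ordge_poly_mult: "Pol f ==> ordge P0 k \<phi> ==> ordge P0 k (%P. f P * \<phi> P)"
 using ordge_mult[OF ordge_0[of f P0]] by simp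

text \<open>On the curve (y - y0) \<open>fy2\<close> = -(x - x0) \<open>fx2\<close>, and at the
  point itself the factor \<open>fy2\<close> takes the value \<open>Fy\<close> \<noteq> 0.\<close>

lemma ordge_snd:
 assumes "P0 \<in> C" "Fy (fst P0) (snd P0) ~= 0" shows "ordge P0 1 (%P. snd P - snd P0)"
proof (rule ordgeI[of "%P. fy2 (fst P) (snd P) (snd P0)" "%P. - fx2 (fst P) (fst P0) (snd P0)"])
 fix P assume "P \<in> C"
 then show "fy2 (fst P) (snd P) (snd P0) * (snd P - snd P0) = (fst P - fst P0) ^ 1 * - fx2 (fst P) (fst P0) (snd P0)"
  using fy2[of "snd P" "snd P0" "fst P"] fx2[of "fst P" "fst P0" "snd P0"] assms(1) by (simp add: C_iff(2) mult.commute)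
qed (use assms in \<open>auto simp: Fy_def intro!: polyfun_intros polyfun_fy2 polyfun_fx2\<close>)

lemma ordge_fst: "ordge P0 1 (%P. fst P - fst P0)"
 by (rule ordgeI[of "%_. 1" "%_. 1"]) (auto intro: polyfun_const)

lemma ordge_add: assumes "ordge P0 k \<phi>" "ordge P0 k \<phi>'" shows "ordge P0 k (%P. \<phi> P + \<phi>' P)"
proof -
 from assms obtain ps \<eta> ps' \<eta>' where h: "Pol ps" "Pol \<eta>" "ps P0 ~= 0" "\<forall>P\<in>C. ps P * \<phi> P = (fst P - fst P0) ^ k * \<eta> P"
  "Pol ps'" "Pol \<eta>'" "ps' P0 ~= 0" "\<forall>P\<in>C. ps' P * \<phi>' P = (fst P - fst P0) ^ k * \<eta>' P" unfolding ordge_def by blast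
 show ?thesis
 proof (rule ordgeI[of "%P. ps P * ps' P" "%P. ps' P * \<eta> P + ps P * \<eta>' P"])
  fix P assume "P \<in> C"
  have "ps P * ps' P * (\<phi> P + \<phi>' P) = ps' P * (ps P * \<phi> P) + ps P * (ps' P * \<phi>' P)" by (simp add: algebra_simps)
  also have "\<dots> = (fst P - fst P0) ^ k * (ps' P * \<eta> P + ps P * \<eta>' P)" using h \<open>P \<in> C\<close> by (simp add: algebra_simps)
  finally show "ps P * ps' P * (\<phi> P + \<phi>' P) = (fst P - fst P0) ^ k * (ps' P * \<eta> P + ps P * \<eta>' P)" .
 qed (use h in \<open>auto intro!: polyfun_intros\<close>)
qed

lemma taylor1: "Pol f ==> EX A B. Pol A & Pol B & (ALL P. f P = f P0 + (fst P - fst P0) * A P + (snd P - snd P0) * B P)"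
proof -
 assume "Pol f"
 then obtain s where "Pl s f" unfolding polyfun_def by blast
 then show ?thesis
 proof (induction rule: PF.induct)
  case (PF_const s c)
  show ?case by (intro exI[of _ "%_. 0"]) (simp add: polyfun_const)
 next
  case (PF_coord x s f)
  then obtain A B where h: "Pol A" "Pol B" "!!P. f P = f P0 + (fst P - fst P0) * A P + (snd P - snd P0) * B P" by blast
  from PF_coord(1) consider "x = fst" | "x = snd" by blast
  then show ?case
  proof cases
   case 1
   show ?thesis
   proof (rule exI[of _ "%P. f P0 + fst P * A P"], rule exI[of _ "%P. fst P * B P"], intro conjI allI)
    show "x P * f P = x P0 * f P0 + (fst P - fst P0) * (f P0 + fst P * A P) + (snd P - snd P0) * (fst P * B P)" for P
     by (subst h(3)) (simp add: 1 algebra_simps)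
   qed (intro polyfun_intros h)+
  next
   case 2
   show ?thesis
   proof (rule exI[of _ "%P. snd P * A P"], rule exI[of _ "%P. f P0 + snd P * B P"], intro conjI allI)
    show "x P * f P = x P0 * f P0 + (fst P - fst P0) * (snd P * A P) + (snd P - snd P0) * (f P0 + snd P * B P)" for P
     by (subst h(3)) (simp add: 2 algebra_simps)
   qed (intro polyfun_intros h)+
  qed
 next
  case (PF_add s f g)
  then obtain A B A' B' where h: "Pol A" "Pol B" "!!P. f P = f P0 + (fst P - fst P0) * A P + (snd P - snd P0) * B P"
   "Pol A'" "Pol B'" "!!P. g P = g P0 + (fst P - fst P0) * A' P + (snd P - snd P0) * B' P" by blast
  show ?case
  proof (rule exI[of _ "%P. A P + A' P"], rule exI[of _ "%P. B P + B' P"], intro conjI allI)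
   show "f P + g P = f P0 + g P0 + (fst P - fst P0) * (A P + A' P) + (snd P - snd P0) * (B P + B' P)" for P
    by (subst h(3), subst h(6)) (simp add: algebra_simps)
  qed (intro polyfun_intros h)+
 qed
qed

lemma ordge_1:
 assumes "Pol f" "f P0 = 0" "P0 \<in> C" "Fy (fst P0) (snd P0) ~= 0" shows "ordge P0 1 f"
proof -
 from taylor1[OF assms(1)] obtain A B where h: "Pol A" "Pol B" "!!P. f P = f P0 + (fst P - fst P0) * A P + (snd P - snd P0) * B P" by blast
 have "f = (%P. A P * (fst P - fst P0) + B P * (snd P - snd P0))" using h(3) assms(2) by (auto simp: mult.commute)
 then show ?thesis
  using ordge_add[OF ordge_poly_mult[OF h(1) ordge_fst] ordge_poly_mult[OF h(2) ordge_snd[OF assms(3,4)]]] by simp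
qed

text \<open>Consider functions of degree s + \<mu> with vanishing orders at least \<open>ka\<close>.
  For ka = k they contain the multiples of \<phi>, of dimension \<open>card (M s)\<close>; lowering
  one order by one gains a dimension. At ka = 0 the total cannot exceed
  \<open>card (M (s + \<mu>))\<close>, which is larger by only d \<mu>.\<close>

lemma bezout:
 assumes \<phi>: "Pl \<mu> \<phi>" and nz: "\<exists>P\<in>C. \<phi> P ~= 0" and S: "finite S" "!!P. P \<in> S ==> P \<in> C & Fy (fst P) (snd P) ~= 0"
  and k: "!!P. P \<in> S ==> ordge P (k P) \<phi>"
 shows "(\<Sum>P\<in>S. k P) \<le> d * \<mu>"
proof -
 \<comment> \<open>Large enough for the functions \<omega> below to have degree at most
   \<open>s\<close> and for \<open>card_M_add\<close> to apply.\<close>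
 define s where "s = d + (\<Sum>P\<in>S. k P)"
 let ?V = "%ka f. Pl (s + \<mu>) f & (\<forall>P\<in>S. ordge P (ka P) f)"
 have "rich C (?V ka) (card (M s) + n)" if "!!P. P \<in> S ==> ka P \<le> k P" "(\<Sum>P\<in>S. k P) = (\<Sum>P\<in>S. ka P) + n" for n ka
  using that
 proof (induction n arbitrary: ka)
  case 0
  have eq: "ka P = k P" if "P \<in> S" for P
  proof (rule ccontr)
   assume "ka P ~= k P"
   with 0 that have "(\<Sum>P\<in>S. ka P) < (\<Sum>P\<in>S. k P)" by (intro sum_strict_mono_ex1 S) (auto intro!: bexI[of _ P] simp: order_less_le)
   then show False using 0 by simp
  qed
  have "rich C (?V ka) (card (M s))"
  proof (rule richI[of _ _ "%i P. \<phi> P * mon i P"])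
   show "indep C (M s) (%i P. \<phi> P * mon i P)"
   proof (rule indepI)
    fix c :: "nat \<times> nat => 'a" and i
    assume c: "!!z. z \<in> C ==> (\<Sum>i\<in>M s. c i * (\<phi> z * mon i z)) = 0" and i: "i \<in> M s"
    let ?ps = "%z. \<Sum>i\<in>M s. c i * mon i z"
    have "\<phi> z * ?ps z = 0" if "z \<in> C" for z
     using c[OF that] by (simp add: sum_distrib_left mult.left_commute)
    moreover have "Pol ?ps" by (intro polyfun_intros polyfunI[OF mon_Pl])
    ultimately have "\<forall>z\<in>C. ?ps z = 0" using domC[OF polyfunI[OF \<phi>]] nz by blast
    then show "c i = 0" using indepD[OF indep_mon'[of s], of c i] i by blast
   qed
   fix i assume i: "i \<in> M s"
   show "?V ka (%P. \<phi> P * mon i P)"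
   proof
    show "Pl (s + \<mu>) (%P. \<phi> P * mon i P)" using PF_mult[OF \<phi> mon_Pl'[OF i]] by (simp add: add.commute)
    show "\<forall>P\<in>S. ordge P (ka P) (%P. \<phi> P * mon i P)"
     using ordge_mult[OF k ordge_0[OF polyfunI[OF mon_Pl]]] eq by simp
   qed
  qed simp
  then show ?case by simp
 next
  case (Suc n)
  have "\<exists>P0\<in>S. ka P0 < k P0"
  proof (rule ccontr)
   assume "~ ?thesis"
   then have "(\<Sum>P\<in>S. k P) \<le> (\<Sum>P\<in>S. ka P)" by (intro sum_mono) (auto simp: not_less)
   then show False using Suc.prems by simp
  qed
  then obtain P0 where P0: "P0 \<in> S" "ka P0 < k P0" by blast
  let ?ka = "ka(P0 := Suc (ka P0))"
  have "(\<Sum>P\<in>S. ?ka P) = Suc (\<Sum>P\<in>S. ka P)"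
   using S(1) P0(1) by (simp add: sum.remove[of S P0])
  then have IH: "rich C (?V ?ka) (card (M s) + n)" using Suc P0 by (intro Suc.IH) auto
  define ll where "ll P Q = (if fst P ~= fst P0 then fst Q - fst P else snd Q - snd P)" for P Q :: "'a \<times> 'a"
  have ll1: "Pl 1 (ll P)" for P
   unfolding ll_def using PF_diff[OF Pl_fst PF_const] PF_diff[OF Pl_snd PF_const] by (cases "fst P = fst P0") simp_all
  have ll2: "ordge P 1 (ll P)" if "P \<in> S" for P
   unfolding ll_def using ordge_fst[of P] ordge_snd[of P] S(2)[OF that] by (cases "fst P = fst P0") simp_all
  have ll3: "ll P P0 ~= 0" if "P ~= P0" for P using that by (auto simp: ll_def prod_eq_iff)
  define \<epsilon> where "\<epsilon> Q = (\<Prod>P\<in>S-{P0}. ll P Q ^ k P)" for Q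
  have e0: "\<epsilon> P0 ~= 0" using ll3 S(1) by (auto simp: \<epsilon>_def)
  have ePl: "Pl (\<Sum>P\<in>S-{P0}. k P) \<epsilon>" unfolding \<epsilon>_def
   by (rule PF_prod) (use PF_power[OF ll1] in simp)
  \<comment> \<open>The function gained by lowering the order at \<open>P0\<close>: it vanishes
    there to order exactly \<open>ka P0\<close>, and at the other points to the full order
    \<open>k\<close>, which is at least \<open>ka\<close>.\<close>
  define \<omega> where "\<omega> Q = (fst Q - fst P0) ^ ka P0 * \<epsilon> Q" for Q
  have sumk: "ka P0 + (\<Sum>P\<in>S-{P0}. k P) \<le> s"
   using P0 sum.remove[OF S(1) P0(1), of k] by (simp add: s_def)
  have wPl: "Pl (s + \<mu>) \<omega>" unfolding \<omega>_def
   by (rule PF_mono[OF PF_mult[OF PF_power[OF PF_diff[OF Pl_fst PF_const]] ePl]]) (use sumk in simp)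
  have word: "ordge P (ka P) \<omega>" if P: "P \<in> S" for P
  proof (cases "P = P0")
   case True
   then show ?thesis unfolding \<omega>_def
    using ordge_mult[OF ordge_power[OF ordge_fst, of P0 "ka P0"] ordge_0[OF polyfunI[OF ePl]]] by simp
  next
   case False
   have "\<epsilon> = (%Q. ll P Q ^ k P * (\<Prod>P'\<in>S-{P0}-{P}. ll P' Q ^ k P'))"
    unfolding \<epsilon>_def using S(1) P False by (intro ext prod.remove) auto
   moreover have "ordge P (k P) (%Q. ll P Q ^ k P * (\<Prod>P'\<in>S-{P0}-{P}. ll P' Q ^ k P'))"
    using ordge_mult[OF ordge_power[OF ll2[OF P]] ordge_0] by (simp add: polyfun_prod polyfun_power polyfunI[OF ll1])
   ultimately have "ordge P (k P) \<epsilon>" by simp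
   then have "ordge P (k P) \<omega>" unfolding \<omega>_def by (rule ordge_poly_mult[rotated]) (intro polyfun_intros)
   then show ?thesis using ordge_mono Suc.prems(1)[OF P] by blast
  qed
  show ?case
  proof -
   from IH obtain be where b: "!!i. i < card (M s) + n ==> ?V ?ka (be i)" "indep C {..<card (M s) + n} be"
    unfolding rich_def by blast
   let ?N = "card (M s) + n"
   let ?\<gamma> = "%i. if i < ?N then be i else \<omega>"
   have "indep C {..<?N + 1} ?\<gamma>"
   proof (rule indepI)
    fix c :: "nat => 'a" and i
    assume c: "!!z. z \<in> C ==> (\<Sum>i<?N+1. c i * ?\<gamma> i z) = 0" and i: "i \<in> {..<?N+1}"
    have c': "(\<Sum>i<?N. c i * be i z) + c ?N * \<omega> z = 0" if "z \<in> C" for z using c[OF that] by simp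
    have os: "ordge P0 (Suc (ka P0)) (%z. \<Sum>i\<in>I. c i * be i z)" if "finite I" "I \<subseteq> {..<?N}" for I
     using that
    proof (induction I rule: finite_induct)
     case empty
     show ?case by (rule ordgeI[of "%_. 1" "%_. 0"]) (simp_all add: polyfun_const)
    next
     case (insert i I)
     have "ordge P0 (Suc (ka P0)) (be i)" using b(1)[of i] insert P0 by auto
     from ordge_add[OF ordge_poly_mult[OF polyfun_const this, of "c i"]] insert show ?case by simp
    qed
    from os[of "{..<?N}"] obtain ps \<eta> where h: "Pol ps" "Pol \<eta>" "ps P0 ~= 0"
     "!!P. P \<in> C ==> ps P * (\<Sum>i<?N. c i * be i P) = (fst P - fst P0) ^ Suc (ka P0) * \<eta> P"
     unfolding ordge_def by auto
    \<comment> \<open>The relation divided by the \<open>ka P0\<close>-th power of x - x0; at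
      \<open>P0\<close> only the term of \<omega> survives.\<close>
    let ?\<xi> = "%P. (fst P - fst P0) * \<eta> P + c ?N * (ps P * \<epsilon> P)"
    have "?\<xi> P0 = 0"
    proof (rule dense[of ?\<xi> "{fst P0}"])
     show "Pol ?\<xi>" by (intro polyfun_intros h polyfunI[OF ePl])
     show "P0 \<in> C" using S(2) P0 by blast
     fix P assume P: "P \<in> C" "fst P \<notin> {fst P0}"
     have "(fst P - fst P0) ^ ka P0 * ?\<xi> P = ps P * ((\<Sum>i<?N. c i * be i P) + c ?N * \<omega> P)"
      using h(4)[OF P(1)] by (simp add: \<omega>_def algebra_simps)
     also have "\<dots> = 0" using c'[OF P(1)] by simp
     finally show "?\<xi> P = 0" using P(2) by simp
    qed simp
    then have cN: "c ?N = 0" using h(3) e0 by simp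
    have "c j = 0" if "j < ?N" for j
     by (rule indepD[OF b(2), of c]) (use c' cN that in auto)
    then show "c i = 0" using cN i by (cases "i = ?N") auto
   qed
   moreover have "\<forall>i<?N+1. ?V ka (?\<gamma> i)"
   proof (intro allI impI)
    fix i assume "i < ?N + 1"
    show "?V ka (?\<gamma> i)"
    proof (cases "i < ?N")
     case True
     then have "?V ?ka (be i)" by (rule b(1))
     then have "ordge P (ka P) (be i)" if "P \<in> S" for P
      using ordge_mono[of P "?ka P" "be i" "ka P"] that by auto
     then show ?thesis using \<open>?V ?ka (be i)\<close> True by simp
    qed (simp add: wPl word)
   qed
   ultimately show ?thesis unfolding rich_def by (intro exI[of _ ?\<gamma>]) auto
  qed
 qed
 from this[of "%_. 0" "\<Sum>P\<in>S. k P"] have "rich C (?V (%_. 0)) (card (M s) + (\<Sum>P\<in>S. k P))" by simp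
 then have "card (M s) + (\<Sum>P\<in>S. k P) \<le> card (M (s + \<mu>))"
  by (rule rich_le_spanned[of C _ _ "M (s + \<mu>)" mon]) (auto intro: Pl_spanned)
 also have "\<dots> = card (M s) + d * \<mu>" by (rule card_M_add) (simp add: s_def)
 finally show ?thesis by simp
qed

lemma Pl_interp:
 fixes S :: "('a \<times> 'a) set"
 assumes "finite S" "P0 \<in> S"
 shows "EX L. Pl (card S) L & L P0 ~= 0 & (\<forall>P\<in>S. P ~= P0 --> L P = 0)"
proof -
 define ll where "ll P R = (if fst P ~= fst P0 then fst R - fst P else snd R - snd P)" for P R :: "'a \<times> 'a"
 have 1: "Pl 1 (ll P)" for P
  unfolding ll_def using PF_diff[OF Pl_fst PF_const] PF_diff[OF Pl_snd PF_const] by (cases "fst P = fst P0") simp_all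
 have "Pl (\<Sum>P\<in>S-{P0}. 1) (%R. \<Prod>P\<in>S-{P0}. ll P R)" by (rule PF_prod) (rule 1)
 then have "Pl (card S) (%R. \<Prod>P\<in>S-{P0}. ll P R)" by (rule PF_mono) (use assms in \<open>simp add: card_Diff_singleton\<close>)
 moreover have "(\<Prod>P\<in>S-{P0}. ll P P0) ~= 0" using assms by (auto simp: ll_def prod_eq_iff)
 moreover have "(\<Prod>P\<in>S-{P0}. ll P R) = 0" if "R \<in> S" "R ~= P0" for R
  by (rule prod_zero) (use assms that in \<open>auto intro!: bexI[of _ R] simp: ll_def\<close>)
 ultimately show ?thesis by blast
qed

end

declare split_paired_All [simp del] split_paired_Ex [simp del]

section \<open>Functions on the square of a curve\<close>

definition pw :: "nat => 'k::monoid_mult \<times> 'k => 'k \<times> 'k" where "pw Q P = (fst P ^ Q, snd P ^ Q)"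

lemma pw_sel [simp]: "fst (pw Q P) = fst P ^ Q" "snd (pw Q P) = snd P ^ Q" by (simp_all add: pw_def)

lemma pw_1 [simp]: "pw (Suc 0) P = P" by (simp add: pw_def)

definition BD :: "nat => nat => (('k::comm_ring_1 \<times> 'k) \<times> ('k \<times> 'k) => 'k) => bool" where
 "BD s t g \<longleftrightarrow> (ALL P. Pl t (%R. g (P, R))) & (ALL R. Pl s (%P. g (P, R)))"

text \<open>Polynomial in each of the two points separately. Vanishing on
  \<open>C \<times> C\<close> is always shown on slices, by \<open>dense\<close> or Bezout's
  theorem, so nothing about joint polynomials has to be known.\<close>

definition Reg :: "(('k::comm_ring_1 \<times> 'k) \<times> ('k \<times> 'k) => 'k) => bool" where
 "Reg g \<longleftrightarrow> (ALL P. Pol (%R. g (P, R))) & (ALL R. Pol (%P. g (P, R)))"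

lemma BD_Reg: "BD s t g ==> Reg g" unfolding BD_def Reg_def using polyfunI by blast
lemma BD_mono: "BD s t g ==> s \<le> s' ==> t \<le> t' ==> BD s' t' g" unfolding BD_def using PF_mono by blast
lemma BD_mult: "BD s t f ==> BD s' t' g ==> BD (s + s') (t + t') (%z. f z * g z)"
 unfolding BD_def by (auto intro: PF_mult)
lemma BD_add: "BD s t f ==> BD s t g ==> BD s t (%z. f z + g z)"
 unfolding BD_def by (auto intro: PF_add)
lemma BD_const: "BD s t (%_. c)" unfolding BD_def by (auto intro: PF_const)
lemma BD_scale: "BD s t f ==> BD s t (%z. c * f z)" using BD_mult[OF BD_const[of 0 0 c]] by simp
lemma BD_power: "BD s t f ==> BD (n * s) (n * t) (%z. f z ^ n)"
 unfolding BD_def by (auto intro: PF_power)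
lemma BD_sum: "(!!i. i \<in> I ==> BD s t (f i)) ==> BD s t (%z. \<Sum>i\<in>I. f i z)"
 unfolding BD_def by (auto intro: PF_sum)
lemma BD_left: "Pl s f ==> BD s 0 (%z. f (fst z))"
 unfolding BD_def by (auto intro: PF_const)
lemma BD_right: "Pl s f ==> BD 0 s (%z. f (snd z))"
 unfolding BD_def by (auto intro: PF_const)

lemma Reg_add: "Reg f ==> Reg g ==> Reg (%z. f z + g z)" unfolding Reg_def by (auto intro: polyfun_add)
lemma Reg_mult: "Reg f ==> Reg g ==> Reg (%z. f z * g z)" unfolding Reg_def by (auto intro: polyfun_mult)
lemma Reg_diff: "Reg f ==> Reg g ==> Reg (%z. f z - g z)" unfolding Reg_def by (auto intro: polyfun_diff)
lemma Reg_minus: "Reg f ==> Reg (%z. - f z)" unfolding Reg_def by (auto intro: polyfun_minus)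
lemma Reg_power: "Reg f ==> Reg (%z. f z ^ n)" unfolding Reg_def by (auto intro: polyfun_power)
lemma Reg_const: "Reg (%_. c)" unfolding Reg_def by (auto intro: polyfun_const)
lemma Reg_sum: "(!!i. i \<in> I ==> Reg (f i)) ==> Reg (%z. \<Sum>i\<in>I. f i z)" unfolding Reg_def by (auto intro: polyfun_sum)
lemma Reg_coord: "Reg (%z. fst (fst z))" "Reg (%z. snd (fst z))" "Reg (%z. fst (snd z))" "Reg (%z. snd (snd z))"
 unfolding Reg_def by (auto intro: polyfun_const Pol_fst Pol_snd)

lemma RegD: "Reg g ==> Pol (%R. g (P, R))" "Reg g ==> Pol (%P. g (P, R))" unfolding Reg_def by blast+

lemmas Reg_intros = Reg_add Reg_diff Reg_mult Reg_minus Reg_power Reg_const Reg_sum Reg_coord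

locale frob_curve = irr_curve +
 fixes q :: nat
 assumes q2: "q \<ge> 2" and frob: "!!x y :: 'a. (x + y) ^ q = x ^ q + y ^ q"
  and coef: "!!j k. a j k ^ q = a j k" and root_q: "!!x :: 'a. \<exists>\<xi>. \<xi> ^ q = x"
  and card_fix: "card {x :: 'a. x ^ q = x} = q"
begin

lemma frob_diff: "(x - y :: 'a) ^ q = x ^ q - y ^ q"
 using frob[of "x - y" y] by (simp add: algebra_simps)

lemma frob_sum: "(\<Sum>i\<in>I. f i :: 'a) ^ q = (\<Sum>i\<in>I. f i ^ q)"
 using q2 by (induction I rule: infinite_finite_induct) (auto simp: frob)

lemma frob_inj: "(x :: 'a) ^ q = y ^ q \<longleftrightarrow> x = y"
 using frob_diff[of x y] q2 by auto

lemma F_frob: "F (x ^ q) (y ^ q) = F x y ^ q"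
 unfolding curve_fun_def by (simp add: frob_sum power_mult_distrib coef power_mult[symmetric] mult.commute)

text \<open>Allows Q = 1 and Q = q to be treated at once: the graph of \<open>pw Q\<close> is the
  diagonal or the graph of Frobenius.\<close>

definition frobQ :: "nat => bool" where
 "frobQ Q \<longleftrightarrow> Q \<ge> 1 & (\<forall>x y :: 'a. (x - y) ^ Q = x ^ Q - y ^ Q) & (\<forall>P\<in>C. pw Q P \<in> C)"

lemma frobQ_1: "frobQ 1" by (simp add: frobQ_def)
lemma frobQ_q: "frobQ q" using q2 by (auto simp: frobQ_def frob_diff C_iff(2) F_frob)

lemma good_frob: "good (x ^ q) \<longleftrightarrow> good x"
proof -
 have "{y. F (x ^ q) y = 0} = (%y. y ^ q) ` {y. F x y = 0}"
 proof safe
  fix y assume y: "F (x ^ q) y = 0"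
  obtain z where z: "z ^ q = y" using root_q by blast
  then have "F x z = 0" using y F_frob[of x z] q2 by simp
  then show "y \<in> (%y. y ^ q) ` {y. F x y = 0}" using z by blast
 next
  fix y assume "F x y = 0"
  then show "F (x ^ q) (y ^ q) = 0" using q2 by (simp add: F_frob)
 qed
 moreover have "inj_on (%y. y ^ q) {y. F x y = 0}" by (auto simp: inj_on_def frob_inj)
 ultimately show ?thesis by (simp add: good_def card_image)
qed

text \<open>On \<open>C \<times> C\<close> the zeros of \<open>u Q\<close> consist of the graph of
  \<open>pw Q\<close> and a residual curve; \<open>thc Q\<close> vanishes on the graph but not at
  the residual points y2 \<noteq> y1^Q.\<close>

definition u :: "nat => ('a \<times> 'a) \<times> ('a \<times> 'a) => 'a" where "u Q z = fst (snd z) - fst (fst z) ^ Q"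
definition thc :: "nat => ('a \<times> 'a) \<times> ('a \<times> 'a) => 'a" where "thc Q z = snd (fst z) ^ Q - snd (snd z)"

lemma u_BD: "BD Q 1 (u Q)"
 unfolding BD_def u_def
proof (intro conjI allI)
 show "Pl 1 (%R. fst (snd (P, R)) - fst (fst (P, R)) ^ Q)" for P :: "'a \<times> 'a"
  using PF_diff[OF Pl_fst PF_const[where c="fst P ^ Q"]] by simp
 show "Pl Q (%P. fst (snd (P, R)) - fst (fst (P, R)) ^ Q)" for R :: "'a \<times> 'a"
  using PF_diff[OF PF_const[where c="fst R"] PF_power[OF Pl_fst, of Q]] by simp
qed

lemma Reg_u: "Reg (u Q)" by (rule BD_Reg[OF u_BD])
lemma Reg_thc: "Reg (thc Q)" unfolding thc_def by (intro Reg_intros)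

text \<open>Says that \<open>h / u Q ^ k\<close> has poles only where \<open>th\<close> vanishes.
  Thus \<open>thc Q\<close> permits poles along the graph of \<open>pw Q\<close>, and
  \<open>thd\<close> below, with Q = 1, along the residual curve of the diagonal.\<close>

definition V :: "(('a \<times> 'a) \<times> ('a \<times> 'a) => 'a) => nat => nat => (('a \<times> 'a) \<times> ('a \<times> 'a) => 'a) => bool" where
 "V th Q k h \<longleftrightarrow> (\<exists>\<eta>. Reg \<eta> & (\<forall>z\<in>C\<times>C. th z ^ k * h z = u Q z ^ k * \<eta> z))"

lemma VI: "Reg \<eta> ==> (!!z. z \<in> C \<times> C ==> th z ^ k * h z = u Q z ^ k * \<eta> z) ==> V th Q k h"
 unfolding V_def by blast

lemma V_0: "Reg h ==> V th Q 0 h" by (rule VI[of h]) auto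

lemma V_mult: assumes "V th Q k h" "V th Q l h'" shows "V th Q (k + l) (%z. h z * h' z)"
proof -
 from assms obtain \<eta> \<eta>' where e: "Reg \<eta>" "\<forall>z\<in>C\<times>C. th z ^ k * h z = u Q z ^ k * \<eta> z"
  "Reg \<eta>'" "\<forall>z\<in>C\<times>C. th z ^ l * h' z = u Q z ^ l * \<eta>' z" unfolding V_def by blast
 show ?thesis
 proof (rule VI[of "%z. \<eta> z * \<eta>' z"])
  fix z assume z: "z \<in> C \<times> C"
  have "th z ^ (k + l) * (h z * h' z) = (th z ^ k * h z) * (th z ^ l * h' z)" by (simp add: power_add mult_ac)
  also have "\<dots> = (u Q z ^ k * \<eta> z) * (u Q z ^ l * \<eta>' z)"
   unfolding e(2)[rule_format, OF z] e(4)[rule_format, OF z] ..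
  also have "\<dots> = u Q z ^ (k + l) * (\<eta> z * \<eta>' z)" by (simp add: power_add mult_ac)
  finally show "th z ^ (k + l) * (h z * h' z) = u Q z ^ (k + l) * (\<eta> z * \<eta>' z)" .
 qed (intro Reg_mult e)
qed

lemma V_cmult: "Reg f ==> V th Q k h ==> V th Q k (%z. f z * h z)"
 using V_mult[OF V_0[of f th Q]] by simp

lemma V_add: assumes "V th Q k h" "V th Q k h'" shows "V th Q k (%z. h z + h' z)"
proof -
 from assms obtain \<eta> \<eta>' where e: "Reg \<eta>" "\<forall>z\<in>C\<times>C. th z ^ k * h z = u Q z ^ k * \<eta> z"
  "Reg \<eta>'" "\<forall>z\<in>C\<times>C. th z ^ k * h' z = u Q z ^ k * \<eta>' z" unfolding V_def by blast
 then show ?thesis by (intro VI[of "%z. \<eta> z + \<eta>' z"]) (auto intro: Reg_add simp: distrib_left)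
qed

lemma V_power: assumes "V th Q 1 h" shows "V th Q n (%z. h z ^ n)"
proof (induction n)
 case 0
 show ?case using V_0[OF Reg_const] by simp
next
 case (Suc n)
 from V_mult[OF assms Suc] show ?case by simp
qed

lemma V_u: "Reg th ==> V th Q 1 (u Q)" by (rule VI[of th]) auto

text \<open>Sections with pole orders \<open>ap\<close> (in x1 = x2, where \<open>th\<close>
  vanishes) and \<open>be\<close> (along Frobenius), multiplied by
  \<open>u 1 ^ ap * u q ^ be\<close>. This factor has bidegree (ap + q be, ap + be), whence the
  bidegrees in \<open>VE\<close> and \<open>VF\<close>.\<close>

definition LL :: "nat => nat => (('a \<times> 'a) \<times> ('a \<times> 'a) => 'a) => nat => nat => (('a \<times> 'a) \<times> ('a \<times> 'a) => 'a) => bool" where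
 "LL \<mu> \<nu> th ap be g \<longleftrightarrow> BD \<mu> \<nu> g & V th 1 ap g & V (thc q) q be g"

lemma LL_add: "LL \<mu> \<nu> th ap be f ==> LL \<mu> \<nu> th ap be g ==> LL \<mu> \<nu> th ap be (%z. f z + g z)"
 unfolding LL_def by (auto intro: BD_add V_add)

lemma LL_scale: "LL \<mu> \<nu> th ap be f ==> LL \<mu> \<nu> th ap be (%z. c * f z)"
 unfolding LL_def by (auto intro: BD_scale V_cmult[OF Reg_const])

lemma LL_zero: "LL \<mu> \<nu> th ap be (%_. 0)"
 unfolding LL_def V_def by (auto intro!: BD_const exI[of _ "%_. 0"] Reg_const)

lemma LL_sum: "(!!i. i \<in> I ==> LL \<mu> \<nu> th ap be (f i)) ==> LL \<mu> \<nu> th ap be (%z. \<Sum>i\<in>I. f i z)"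
proof (induction I rule: infinite_finite_induct)
 case (insert i I)
 have "LL \<mu> \<nu> th ap be (%z. f i z + (\<Sum>i\<in>I. f i z))" by (rule LL_add) (use insert in auto)
 then show ?case using insert by simp
qed (simp_all add: LL_zero)

lemma bezout3:
 assumes \<phi>: "Pl \<mu> \<phi>" and S: "finite S1" "finite S2" "finite S3"
  and S': "!!P. P \<in> S1 \<union> S2 \<union> S3 ==> P \<in> C & good (fst P)"
  and dj: "S1 \<inter> S2 = {}" "S1 \<inter> S3 = {}" "S2 \<inter> S3 = {}"
  and o: "!!P. P \<in> S1 ==> ordge P k1 \<phi>" "!!P. P \<in> S2 ==> ordge P k2 \<phi>" "!!P. P \<in> S3 ==> ordge P k3 \<phi>"
  and big: "card S1 * k1 + card S2 * k2 + card S3 * k3 > d * \<mu>" and P: "P \<in> C"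
 shows "\<phi> P = 0"
proof (rule ccontr)
 assume "\<phi> P ~= 0"
 let ?k = "%P. if P \<in> S1 then k1 else if P \<in> S2 then k2 else k3"
 have "(\<Sum>P\<in>S1 \<union> S2 \<union> S3. ?k P) \<le> d * \<mu>"
 proof (rule bezout[OF \<phi>])
  show "\<exists>P\<in>C. \<phi> P ~= 0" using P \<open>\<phi> P ~= 0\<close> by blast
  show "finite (S1 \<union> S2 \<union> S3)" using S by simp
  fix P assume "P \<in> S1 \<union> S2 \<union> S3"
  then show "P \<in> C & Fy (fst P) (snd P) ~= 0" using S' good_Fy by (auto simp: C_iff(2))
  show "ordge P (?k P) \<phi>" using \<open>P \<in> S1 \<union> S2 \<union> S3\<close> by (auto intro: o)
 qed
 moreover have "(\<Sum>P\<in>S1 \<union> S2 \<union> S3. ?k P) = (\<Sum>P\<in>S1. ?k P) + (\<Sum>P\<in>S2. ?k P) + (\<Sum>P\<in>S3. ?k P)"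
  using S dj by (subst sum.union_disjoint, auto)+
 moreover have "(\<Sum>P\<in>S1. ?k P) = card S1 * k1" by simp
 moreover have "(\<Sum>P\<in>S2. ?k P) = (\<Sum>P\<in>S2. k2)" by (rule sum.cong) (use dj in auto)
 moreover have "(\<Sum>P\<in>S3. ?k P) = (\<Sum>P\<in>S3. k3)" by (rule sum.cong) (use dj in auto)
 ultimately show False using big by simp
qed

lemma card_roots_except:
 assumes "good x" "F x y = 0" shows "card {w. F x w = 0 & w ~= y} = d - 1"
proof -
 have "{w. F x w = 0 & w ~= y} = {w. F x w = 0} - {y}" by auto
 then show ?thesis using assms finite_roots by (simp add: good_def card_Diff_singleton)
qed

lemma V_ord_right:
 assumes V: "V th Q k g" and P: "P \<in> C" and R: "fst R = fst P ^ Q" "th (P, R) ~= 0" and th: "Reg th"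
 shows "ordge R k (%R. g (P, R))"
proof -
 from V obtain \<eta> where e: "Reg \<eta>" "\<forall>z\<in>C\<times>C. th z ^ k * g z = u Q z ^ k * \<eta> z" unfolding V_def by blast
 show ?thesis
  by (rule ordgeI[of "%R. th (P, R) ^ k" "%R. \<eta> (P, R)"])
   (use e P R th in \<open>auto simp: u_def intro!: RegD Reg_power\<close>)
qed

text \<open>As a function of the first point, \<open>u Q\<close> is a constant times the Q-th power
  of x - x0, since x \<mapsto> x^Q is additive; this gives the factor Q.\<close>

lemma V_ord_left:
 assumes V: "V th Q k g" and R: "R \<in> C" and P: "fst R = fst P ^ Q" "th (P, R) ~= 0" and th: "Reg th" and Q: "frobQ Q"
 shows "ordge P (Q * k) (%P. g (P, R))"
proof -
 from V obtain \<eta> where e: "Reg \<eta>" "\<forall>z\<in>C\<times>C. th z ^ k * g z = u Q z ^ k * \<eta> z" unfolding V_def by blast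
 show ?thesis
 proof (rule ordgeI[of "%P. th (P, R) ^ k" "%P. ((-1) ^ Q) ^ k * \<eta> (P, R)"])
  fix P' assume P': "P' \<in> C"
  have "u Q (P', R) = fst P ^ Q - fst P' ^ Q" using P by (simp add: u_def)
  also have "\<dots> = (fst P - fst P') ^ Q" using Q by (simp add: frobQ_def)
  also have "fst P - fst P' = (-1) * (fst P' - fst P)" by simp
  finally have "u Q (P', R) = (-1) ^ Q * (fst P' - fst P) ^ Q" by (simp only: power_mult_distrib)
  then show "th (P', R) ^ k * g (P', R) = (fst P' - fst P) ^ (Q * k) * (((- 1) ^ Q) ^ k * \<eta> (P', R))"
   using e P' R by (simp add: power_mult_distrib power_mult mult_ac)
 qed (use e P th in \<open>auto intro!: RegD Reg_power Reg_mult Reg_const\<close>)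
qed

text \<open>If n exceeded L1 L2, a nontrivial combination would vanish on a grid of L1 times L2
  points. For a second point R from the grid, the slice has forced zeros over the abscissa of R
  (\<open>zz\<close> points of order \<open>ap\<close>) and over its q-th root (d - 1 points of
  order q be); with the L1 grid zeros they exceed the Bezout bound. The slices for a generic first
  point then vanish by the same count with the L2 zeros so obtained.\<close>

lemma upper:
 assumes r: "rich (C \<times> C) (LL \<mu> \<nu> th ap be) n" and th: "Reg th"
  and z1: "!!P. P \<in> C ==> good (fst P) ==> card {y. F (fst P) y = 0 & th (P, (fst P, y)) ~= 0} = zz"
  and z2: "!!R. R \<in> C ==> good (fst R) ==> card {y. F (fst R) y = 0 & th ((fst R, y), R) ~= 0} = zz"
  and L1: "zz * ap + (d - 1) * (q * be) + L1 = d * \<mu> + 1" and L2: "zz * ap + (d - 1) * be + L2 = d * \<nu> + 1"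
 shows "n \<le> L1 * L2"
proof (rule ccontr)
 assume "~ ?thesis"
 then have n: "L1 * L2 < n" by simp
 \<comment> \<open>Abscissae fixed by Frobenius are avoided, so that the fibres over x and over its
   q-th power or root are disjoint.\<close>
 define G0 where "G0 = {x. good x & x ^ q ~= x}"
 have finG: "finite (- G0)"
 proof -
  have "- G0 = {x. card {y. F x y = 0} ~= d} \<union> {x. x ^ q = x}" by (auto simp: G0_def good_def)
  moreover have "finite {x::'a. x ^ q = x}" using card_fix q2 by (intro card_ge_0_finite) simp
  ultimately show ?thesis using cofin by simp
 qed
 have infG: "infinite (G0 - S)" if "finite S" for S
 proof
  assume "finite (G0 - S)"
  then have "finite ((G0 - S) \<union> S \<union> (- G0))" using that finG by simp
  moreover have "(G0 - S) \<union> S \<union> (- G0) = UNIV" by auto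
  ultimately show False using inf_field by simp
 qed
 obtain X2 where X2: "finite X2" "card X2 = L2" "X2 \<subseteq> G0" using infinite_arbitrarily_large[OF infG[of "{}"], of L2] by auto
 have "\<forall>x::'a. \<exists>\<xi>. \<xi> ^ q = x" using root_q by blast
 from choice[OF this] obtain rq :: "'a => 'a" where rq: "!!x. rq x ^ q = x" by blast
 obtain X1 where X1: "finite X1" "card X1 = L1" "X1 \<subseteq> G0 - (X2 \<union> rq ` X2)"
  using infinite_arbitrarily_large[OF infG[of "X2 \<union> rq ` X2"], of L1] X2(1) by auto
 define rt where "rt x = (x, SOME y. F x y = 0)" for x
 have rt1: "fst (rt x) = x" for x by (simp add: rt_def)
 have rt: "rt x \<in> C" if "good x" for x
 proof -
  have "EX y. F x y = 0"
  proof (rule ccontr)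
   assume "\<nexists>y. F x y = 0"
   then have "card {y. F x y = 0} = 0" by simp
   then show False using that d_pos by (simp add: good_def)
  qed
  from someI_ex[OF this] show ?thesis by (simp add: rt_def C_iff)
 qed
 from r obtain f where f: "!!i. i < n ==> LL \<mu> \<nu> th ap be (f i)" "indep (C \<times> C) {..<n} f" unfolding rich_def by blast
 have "EX c. (\<exists>i\<in>{..<n}. c i ~= 0) & (\<forall>j\<in>X1 \<times> X2. (\<Sum>i<n. c i * f i (rt (fst j), rt (snd j))) = 0)"
  by (rule homogeneous_system) (use X1 X2 n in auto)
 then obtain c where c: "\<exists>i<n. c i ~= 0"
  and c0: "!!x1 x2. x1 \<in> X1 ==> x2 \<in> X2 ==> (\<Sum>i<n. c i * f i (rt x1, rt x2)) = 0" by force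
 define g where "g z = (\<Sum>i<n. c i * f i z)" for z
 have "LL \<mu> \<nu> th ap be g" unfolding g_def by (intro LL_sum LL_scale f) simp
 then have gBD: "BD \<mu> \<nu> g" and gV: "V th 1 ap g" and gW: "V (thc q) q be g" by (auto simp: LL_def)
 have step1: "g (P, rt x2) = 0" if x2: "x2 \<in> X2" and P: "P \<in> C" for P x2
 proof -
  let ?R = "rt x2"
  have gx: "good x2" "x2 ^ q ~= x2" using x2 X2 by (auto simp: G0_def)
  have RC: "?R \<in> C" using rt gx by blast
  have gr: "good (rq x2)" using good_frob[of "rq x2"] gx rq by simp
  obtain \<eta> where \<eta>: "\<eta> ^ q = snd ?R" using root_q by blast
  have F\<eta>: "F (rq x2) \<eta> = 0" using F_frob[of "rq x2" \<eta>] RC q2 by (simp add: rq \<eta> C_iff(2) rt1)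
  let ?S1 = "(%y. (x2, y)) ` {y. F x2 y = 0 & th ((x2, y), ?R) ~= 0}"
  let ?S2 = "(%y. (rq x2, y)) ` {y. F (rq x2) y = 0 & y ~= \<eta>}"
  let ?S3 = "rt ` X1"
  have ne: "rq x2 ~= x2" using gx(2) rq[of x2] by metis
  have c1: "card ?S1 = zz" using z2[OF RC] gx by (subst card_image) (auto simp: rt1 inj_on_def)
  have c2: "card ?S2 = d - 1" using card_roots_except[OF gr F\<eta>] by (subst card_image) (auto simp: inj_on_def)
  have c3: "card ?S3 = L1" using X1 by (subst card_image) (auto simp: inj_on_def intro: rt1[THEN subst, rotated] dest: arg_cong[of _ _ fst] simp: rt1)
  show "(%P. g (P, ?R)) P = 0"
  proof (rule bezout3[where \<phi> = "%P. g (P, ?R)" and \<mu> = \<mu> and ?S1.0 = ?S1 and ?S2.0 = ?S2 and ?S3.0 = ?S3 and ?k1.0 = ap and ?k2.0 = "q * be" and ?k3.0 = 1])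
   show "Pl \<mu> (%P. g (P, ?R))" using gBD by (simp add: BD_def)
   show "finite ?S1" "finite ?S2" "finite ?S3" using finite_roots X1 by (auto intro: finite_subset[OF _ finite_roots])
   show "P \<in> C & good (fst P)" if "P \<in> ?S1 \<union> ?S2 \<union> ?S3" for P
    using that gx gr X1 rt by (auto simp: C_iff(1) rt1 G0_def)
   show "?S1 \<inter> ?S2 = {}" using ne by auto
   show "?S1 \<inter> ?S3 = {}" "?S2 \<inter> ?S3 = {}" using X1 x2 rt1 by (auto simp: subset_iff) (metis fst_conv image_eqI rt1)+
   show "ordge P ap (%P. g (P, ?R))" if "P \<in> ?S1" for P
    using V_ord_left[OF gV RC _ _ th frobQ_1, of P] that by (auto simp: rt1)
   show "ordge P (q * be) (%P. g (P, ?R))" if "P \<in> ?S2" for P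
    using V_ord_left[OF gW RC _ _ Reg_thc frobQ_q, of P] that rq by (auto simp: rt1 thc_def \<eta>[symmetric] frob_inj)
   show "ordge P 1 (%P. g (P, ?R))" if "P \<in> ?S3" for P
   proof (rule ordge_1)
    show "Pol (%P. g (P, ?R))" using gBD by (auto simp: BD_def intro: polyfunI)
    show "g (P, ?R) = 0" using c0 x2 that by (auto simp: g_def)
    show "P \<in> C" using that X1 rt by (auto simp: G0_def)
    then show "Fy (fst P) (snd P) ~= 0" using that X1 by (intro good_Fy) (auto simp: G0_def rt1 C_iff(2))
   qed
   show "card ?S1 * ap + card ?S2 * (q * be) + card ?S3 * 1 > d * \<mu>" unfolding c1 c2 c3 using L1 by simp
  qed (rule P)
 qed
 have step2: "g (P, R) = 0" if P: "P \<in> C" "good (fst P)" "fst P ^ q ~= fst P" "fst P \<notin> X2" "fst P ^ q \<notin> X2" and R: "R \<in> C" for P R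
 proof -
  let ?x = "fst P"
  let ?S1 = "(%y. (?x, y)) ` {y. F ?x y = 0 & th (P, (?x, y)) ~= 0}"
  let ?S2 = "(%y. (?x ^ q, y)) ` {y. F (?x ^ q) y = 0 & y ~= snd P ^ q}"
  let ?S3 = "rt ` X2"
  have Fq: "F (?x ^ q) (snd P ^ q) = 0" using P q2 by (simp add: F_frob C_iff(2))
  have c1: "card ?S1 = zz" using z1[OF P(1,2)] by (subst card_image) (auto simp: inj_on_def)
  have c2: "card ?S2 = d - 1" using card_roots_except[OF _ Fq] P(2) by (subst card_image) (auto simp: inj_on_def good_frob)
  have c3: "card ?S3 = L2" using X2 by (subst card_image) (auto simp: inj_on_def dest: arg_cong[of _ _ fst] simp: rt1)
  show "(%R. g (P, R)) R = 0"
  proof (rule bezout3[where \<phi> = "%R. g (P, R)" and \<mu> = \<nu> and ?S1.0 = ?S1 and ?S2.0 = ?S2 and ?S3.0 = ?S3 and ?k1.0 = ap and ?k2.0 = "be" and ?k3.0 = 1])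
   show "Pl \<nu> (%R. g (P, R))" using gBD by (simp add: BD_def)
   show "finite ?S1" "finite ?S2" "finite ?S3" using finite_roots X2 by (auto intro: finite_subset[OF _ finite_roots])
   show "R \<in> C & good (fst R)" if "R \<in> ?S1 \<union> ?S2 \<union> ?S3" for R
    using that P X2 rt by (auto simp: C_iff(1) rt1 G0_def good_frob)
   show "?S1 \<inter> ?S2 = {}" using P(3) by auto
   show "?S1 \<inter> ?S3 = {}" "?S2 \<inter> ?S3 = {}" using P(4,5) rt1 by auto (metis fst_conv rt1)+
   show "ordge R ap (%R. g (P, R))" if "R \<in> ?S1" for R
    using V_ord_right[OF gV P(1) _ _ th, of R] that by auto
   show "ordge R be (%R. g (P, R))" if "R \<in> ?S2" for R
    using V_ord_right[OF gW P(1) _ _ Reg_thc, of R] that by (auto simp: thc_def)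
   show "ordge R 1 (%R. g (P, R))" if R: "R \<in> ?S3" for R
   proof (rule ordge_1)
    show "Pol (%R. g (P, R))" using gBD by (auto simp: BD_def intro: polyfunI)
    show "g (P, R) = 0" using P(1) R by (auto intro: step1)
    show "R \<in> C" using R X2 rt by (auto simp: G0_def)
    then show "Fy (fst R) (snd R) ~= 0" using R X2 by (intro good_Fy) (auto simp: G0_def rt1 C_iff(2))
   qed
   show "card ?S1 * ap + card ?S2 * be + card ?S3 * 1 > d * \<nu>" unfolding c1 c2 c3 using L2 by simp
  qed (rule R)
 qed
 have "g (P, R) = 0" if P: "P \<in> C" and R: "R \<in> C" for P R
 proof -
  have "(%P. g (P, R)) P = 0"
  proof (rule dense[where \<phi> = "%P. g (P, R)" and S = "- G0 \<union> X2 \<union> rq ` X2"])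
   show "Pol (%P. g (P, R))" using gBD by (auto simp: BD_def intro: polyfunI)
   show "finite (- G0 \<union> X2 \<union> rq ` X2)" using finG X2 by simp
   fix P' assume P': "P' \<in> C" "fst P' \<notin> - G0 \<union> X2 \<union> rq ` X2"
   have "fst P' ^ q \<notin> X2"
   proof
    assume "fst P' ^ q \<in> X2"
    moreover have "rq (fst P' ^ q) = fst P'" using rq[of "fst P' ^ q"] by (simp add: frob_inj)
    ultimately show False using P' by force
   qed
   then show "g (P', R) = 0" using step2[of P' R] P' R by (auto simp: G0_def)
  qed (rule P)
  then show ?thesis .
 qed
 then have "(\<Sum>i<n. c i * f i z) = 0" if "z \<in> C \<times> C" for z using that by (cases z) (auto simp: g_def)
 from indepD[OF f(2), of c, OF this] c show False by auto
qed

end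

section \<open>Functions with prescribed leading coefficients along the graphs and the residual
  curve\<close>

context frob_curve
begin

text \<open>A correction of x1^e times the divided difference of \<open>F\<close> in y between y1^Q
  and y2. In the r-th term part of x1^e moves to the second point, using x1^Q = x2 on the graph; the
  amount \<open>min (e div Q) r\<close> keeps the bidegree within (Q d, d - 1) for all e \<le> Q
  d.\<close>

definition gg :: "nat => nat => ('a \<times> 'a) \<times> ('a \<times> 'a) => 'a" where
 "gg Q e z = (\<Sum>k\<le>d. \<Sum>j\<le>d-k. a j k * (\<Sum>r<k. fst (fst z) ^ (e - Q * min (e div Q) r) *
  fst (snd z) ^ (min (e div Q) r + j) * snd (fst z) ^ (Q * r) * snd (snd z) ^ (k - Suc r)))"

lemma gg_BD: assumes "e \<le> Q * d" "Q \<ge> 1" shows "BD (Q * d) (d - 1) (gg Q e)"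
proof -
 have T: "BD (Q * d) (d - 1) (%z::('a \<times> 'a) \<times> ('a \<times> 'a). fst (fst z) ^ (e - Q * min (e div Q) r) * fst (snd z) ^ (min (e div Q) r + j) * snd (fst z) ^ (Q * r) * snd (snd z) ^ (k - Suc r))"
 if k: "k \<in> {..d}" and j: "j \<in> {..d - k}" and r: "r \<in> {..<k}" for k j r
 proof -
 let ?m = "min (e div Q) r"
 have le1: "e - Q * ?m + Q * r \<le> Q * d"
 proof (cases "r \<le> e div Q")
  case True
  then have "Q * r \<le> e" by (metis mult.commute mult_le_mono1 times_div_less_eq_dividend le_trans)
  then show ?thesis using True assms by (simp add: min_def)
 next
  case False
  then have "?m = e div Q" by simp
  moreover have "e - Q * (e div Q) = e mod Q" by (simp add: minus_mult_div_eq_mod)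
  moreover have "e mod Q < Q" using assms by simp
  moreover have "Q + Q * r \<le> Q * d" using k r by (metis Suc_leI atMost_iff lessThan_iff le_trans mult_Suc_right mult_le_mono2)
  ultimately show ?thesis by linarith
 qed
 have le2: "?m + j + (k - Suc r) \<le> d - 1" using k j r by auto
 have 1: "Pl (Q * d) (%P. c * (fst P ^ (e - Q * ?m) * snd P ^ (Q * r)))" for c :: 'a
  by (rule PF_scale[OF PF_mono[OF Pl_monom le1]])
 have 2: "Pl (d - 1) (%P. c * (fst P ^ (?m + j) * snd P ^ (k - Suc r)))" for c :: 'a
  by (rule PF_scale[OF PF_mono[OF Pl_monom le2]])
 show ?thesis unfolding BD_def
 proof (intro conjI allI)
  fix P :: "'a \<times> 'a"
  show "Pl (d - 1) (%R. fst (fst (P, R)) ^ (e - Q * ?m) * fst (snd (P, R)) ^ (?m + j) * snd (fst (P, R)) ^ (Q * r) * snd (snd (P, R)) ^ (k - Suc r))"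
   using 2[of "fst P ^ (e - Q * ?m) * snd P ^ (Q * r)"] by (simp add: mult_ac)
  show "Pl (Q * d) (%R. fst (fst (R, P)) ^ (e - Q * ?m) * fst (snd (R, P)) ^ (?m + j) * snd (fst (R, P)) ^ (Q * r) * snd (snd (R, P)) ^ (k - Suc r))"
   using 1[of "fst P ^ (?m + j) * snd P ^ (k - Suc r)"] by (simp add: mult_ac)
 qed
 qed
 show ?thesis unfolding gg_def by (intro BD_sum BD_scale T)
qed

lemma min_div_le: "Q * min (e div Q) r \<le> (e::nat)"
 by (metis min.cobounded1 mult.commute mult_le_mono1 le_trans times_div_less_eq_dividend)

lemma gg_graph: "gg Q e (P, pw Q P) = fst P ^ e * Fy (fst P ^ Q) (snd P ^ Q)"
proof -
 have "fst P ^ (e - Q * min (e div Q) r) * (fst P ^ Q) ^ (min (e div Q) r + j) = fst P ^ e * (fst P ^ Q) ^ j" for r j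
  using min_div_le[of Q e r] by (simp add: power_add mult.assoc[symmetric] flip: power_mult) (simp flip: power_add)
 then have "gg Q e (P, pw Q P) = (\<Sum>k\<le>d. \<Sum>j\<le>d-k. a j k * (\<Sum>r<k. fst P ^ e * (fst P ^ Q) ^ j * (snd P ^ Q) ^ r * (snd P ^ Q) ^ (k - Suc r)))"
  unfolding gg_def by (simp add: power_mult)
 also have "\<dots> = fst P ^ e * Fy (fst P ^ Q) (snd P ^ Q)"
  unfolding Fy_def fy2_def sum_distrib_left by (intro sum.cong refl) (simp add: mult_ac)
 finally show ?thesis .
qed

text \<open>\<open>gg\<close> differs from x1^e times \<open>fy2\<close> by a multiple of
  \<open>u Q\<close>, and on \<open>C \<times> C\<close> the product of \<open>thc Q\<close> and
  \<open>fy2\<close> equals \<open>u Q\<close> times \<open>fx2\<close>.\<close>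

lemma gg_V: assumes "frobQ Q" shows "V (thc Q) Q 1 (gg Q e)"
proof -
 define \<rho> where "\<rho> z = (\<Sum>k\<le>d. \<Sum>j\<le>d-k. a j k * (\<Sum>r<k. fst (fst z) ^ (e - Q * min (e div Q) r) *
   (\<Sum>i<min (e div Q) r. (fst (fst z) ^ Q) ^ (min (e div Q) r - Suc i) * fst (snd z) ^ i) *
  fst (snd z) ^ j * snd (fst z) ^ (Q * r) * snd (snd z) ^ (k - Suc r)))" for z :: "('a \<times> 'a) \<times> ('a \<times> 'a)"
 have R\<rho>: "Reg \<rho>" unfolding \<rho>_def by (intro Reg_intros)
 have eq: "gg Q e z = fst (fst z) ^ e * fy2 (fst (snd z)) (snd (fst z) ^ Q) (snd (snd z)) + u Q z * \<rho> z" for z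
 proof -
  let ?x = "fst (fst z)" and ?X = "fst (snd z)"
  have "?x ^ (e - Q * m) * ?X ^ (m + j) * s * t = ?x ^ e * (?X ^ j * s * t) + u Q z * (?x ^ (e - Q * m) * (\<Sum>i<m. (?x ^ Q) ^ (m - Suc i) * ?X ^ i) * ?X ^ j * s * t)"
   if "Q * m \<le> e" for m j s t
  proof -
   have "?X ^ m = (?x ^ Q) ^ m + u Q z * (\<Sum>i<m. (?x ^ Q) ^ (m - Suc i) * ?X ^ i)"
    using power_diff_sumr2[of ?X m "?x ^ Q"] by (simp add: u_def algebra_simps)
   moreover have "?x ^ (e - Q * m) * (?x ^ Q) ^ m = ?x ^ e" using that by (simp flip: power_mult power_add)
   ultimately show ?thesis by (simp add: power_add) (simp add: algebra_simps)
  qed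
  from this[OF min_div_le] show ?thesis
   unfolding gg_def \<rho>_def fy2_def power_mult
   by (simp add: sum_distrib_left sum.distrib distrib_left mult_ac)
 qed
 show ?thesis
 proof (rule VI[of "%z. fst (fst z) ^ e * fx2 (fst (snd z)) (fst (fst z) ^ Q) (snd (fst z) ^ Q) + thc Q z * \<rho> z"])
  show "Reg (%z. fst (fst z) ^ e * fx2 (fst (snd z)) (fst (fst z) ^ Q) (snd (fst z) ^ Q) + thc Q z * \<rho> z)"
   unfolding fx2_def by (intro Reg_intros R\<rho> Reg_thc)
  fix z assume z: "z \<in> C \<times> C"
  then have F0: "F (fst (snd z)) (snd (snd z)) = 0" "F (fst (fst z) ^ Q) (snd (fst z) ^ Q) = 0"
   using assms by (auto simp: frobQ_def C_iff(2))
  have "thc Q z * fy2 (fst (snd z)) (snd (fst z) ^ Q) (snd (snd z)) = u Q z * fx2 (fst (snd z)) (fst (fst z) ^ Q) (snd (fst z) ^ Q)"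
   unfolding thc_def u_def fy2 fx2 using F0 by simp
  then show "thc Q z ^ 1 * gg Q e z = u Q z ^ 1 * (fst (fst z) ^ e * fx2 (fst (snd z)) (fst (fst z) ^ Q) (snd (fst z) ^ Q) + thc Q z * \<rho> z)"
   unfolding eq by (simp add: algebra_simps)
 qed
qed

lemma gg_prod:
 assumes "frobQ Q" "E \<le> J * (Q * d)"
 shows "EX G. BD (J * (Q * d)) (J * (d - 1)) G & V (thc Q) Q J G & (ALL P. G (P, pw Q P) = fst P ^ E * Fy (fst P ^ Q) (snd P ^ Q) ^ J)"
 using assms(2)
proof (induction J arbitrary: E)
 case 0
 then show ?case by (intro exI[of _ "%_. 1"]) (auto intro: BD_const V_0 Reg_const)
next
 case (Suc J)
 define e where "e = min E (Q * d)"
 have "E - e \<le> J * (Q * d)" using Suc.prems by (auto simp: e_def)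
 from Suc.IH[OF this] obtain G where G: "BD (J * (Q * d)) (J * (d - 1)) G" "V (thc Q) Q J G"
  "!!P. G (P, pw Q P) = fst P ^ (E - e) * Fy (fst P ^ Q) (snd P ^ Q) ^ J" by blast
 have Q: "Q \<ge> 1" using assms by (simp add: frobQ_def)
 have e: "e \<le> Q * d" by (simp add: e_def)
 show ?case
 proof (intro exI[of _ "%z. gg Q e z * G z"] conjI allI)
  show "BD (Suc J * (Q * d)) (Suc J * (d - 1)) (%z. gg Q e z * G z)"
   using BD_mult[OF gg_BD[OF e Q] G(1)] by simp
  show "V (thc Q) Q (Suc J) (%z. gg Q e z * G z)" using V_mult[OF gg_V[OF assms(1)] G(2)] by simp
  fix P :: "'a \<times> 'a"
  have "E = e + (E - e)" by (simp add: e_def)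
  with power_add[of "fst P" e "E - e"] have "fst P ^ E = fst P ^ e * fst P ^ (E - e)" by simp
  then show "gg Q e (P, pw Q P) * G (P, pw Q P) = fst P ^ E * Fy (fst P ^ Q) (snd P ^ Q) ^ Suc J"
   by (simp add: gg_graph G(3) mult_ac)
 qed
qed

text \<open>Bidegree (a, b) restricts to degree a + Q b on the graph. The factor
  \<open>Fy ^ J\<close> takes J Q (d - 1) of it, and every reduced monomial of the remaining degree
  is reached.\<close>

lemma graph_elem:
 assumes Q: "frobQ Q" and n1: "Q + d \<le> n1" and i: "i \<in> M (n1 + Q * n2 + J * (Q * d))"
 shows "EX h. BD (n1 + J * (Q * d)) (n2 + J * (d - 1)) h & V (thc Q) Q J h &
  (ALL P. h (P, pw Q P) = mon i P * Fy (fst P ^ Q) (snd P ^ Q) ^ J)"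
proof -
 obtain j e where ij: "i = (j, e)" "j < d" "e + j \<le> n1 + Q * n2 + J * (Q * d)" using i by (auto simp: M_def)
 define E where "E = min e (J * (Q * d))"
 from gg_prod[OF Q, of E J] obtain G where G: "BD (J * (Q * d)) (J * (d - 1)) G" "V (thc Q) Q J G"
  "!!P. G (P, pw Q P) = fst P ^ E * Fy (fst P ^ Q) (snd P ^ Q) ^ J" by (auto simp: E_def)
 have Q1: "Q \<ge> 1" using Q by (simp add: frobQ_def)
 \<comment> \<open>The remaining exponent of x is split between the two points; the assumption Q + d
   \<le> n1 leaves room for the remainder modulo Q and for the power of y.\<close>
 define c2 where "c2 = min ((e - E) div Q) n2"
 define c1 where "c1 = (e - E) - Q * c2"
 have cc: "c1 + Q * c2 = e - E" using min_div_le[of Q "e - E" n2] by (simp add: c1_def c2_def)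
 have c1le: "c1 + j \<le> n1"
 proof (cases "n2 \<le> (e - E) div Q")
  case True
  then have "c2 = n2" by (simp add: c2_def)
  moreover have "e - E + j \<le> n1 + Q * n2" using ij n1 by (auto simp: E_def)
  moreover have "c1 + Q * n2 = e - E" using cc \<open>c2 = n2\<close> by simp
  ultimately show ?thesis by linarith
 next
  case False
  then have "c2 = (e - E) div Q" by (simp add: c2_def)
  then have "c1 = (e - E) mod Q" by (simp add: c1_def minus_mult_div_eq_mod)
  then have "c1 < Q" using Q1 by simp
  then show ?thesis using n1 ij by linarith
 qed
 let ?c = "%z. (fst (fst z) ^ c1 * snd (fst z) ^ j) * (fst (snd z) ^ c2 * snd (snd z) ^ 0)"
 have cBD: "BD n1 n2 ?c"
  by (rule BD_mono[OF BD_mult[OF BD_left[OF Pl_monom[of c1 j]] BD_right[OF Pl_monom[of c2 0]]]])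
   (use c1le in \<open>auto simp: c2_def\<close>)
 show ?thesis
 proof (intro exI[of _ "%z. ?c z * G z"] conjI allI)
  show "BD (n1 + J * (Q * d)) (n2 + J * (d - 1)) (%z. ?c z * G z)" by (rule BD_mult[OF cBD G(1)])
  show "V (thc Q) Q J (%z. ?c z * G z)" by (rule V_cmult[OF BD_Reg[OF cBD] G(2)])
  fix P :: "'a \<times> 'a"
  have "e = (c1 + Q * c2) + E" unfolding cc by (simp add: E_def)
  with power_add[of "fst P" "c1 + Q * c2" E] have "fst P ^ e = fst P ^ (c1 + Q * c2) * fst P ^ E" by simp
  then show "?c (P, pw Q P) * G (P, pw Q P) = mon i P * Fy (fst P ^ Q) (snd P ^ Q) ^ J"
   by (simp add: G(3) ij mon_def power_add power_mult mult_ac)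
 qed
qed

text \<open>Complementary to \<open>thc 1\<close>: on x1 = x2 it vanishes where y1 \<noteq> y2 and
  equals \<open>Fy\<close> on the diagonal.\<close>

definition thd :: "('a \<times> 'a) \<times> ('a \<times> 'a) => 'a" where "thd z = fy2 (fst (snd z)) (snd (snd z)) (snd (fst z))"

lemma Reg_thd: "Reg thd" unfolding thd_def fy2_def by (intro Reg_intros)

lemma BD_coord: "BD 1 0 (%z. fst (fst z))" "BD 1 0 (%z. snd (fst z))" "BD 0 1 (%z. fst (snd z))" "BD 0 1 (%z. snd (snd z))"
 using BD_left[OF Pl_fst] BD_left[OF Pl_snd] BD_right[OF Pl_fst] BD_right[OF Pl_snd] by simp_all

text \<open>\<open>ww\<close> and \<open>vv\<close> have bidegree (1, 1) and restrict on x1 = x2 to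
  y2 - y1 and x (y2 - y1). Hence a product of I of them carries (y2 - y1)^I times any power of x up
  to the I-th.\<close>

definition ww :: "('a \<times> 'a) \<times> ('a \<times> 'a) => 'a" where "ww z = snd (snd z) + (-1) * snd (fst z)"
definition vv :: "('a \<times> 'a) \<times> ('a \<times> 'a) => 'a" where "vv z = fst (fst z) * snd (snd z) + (-1) * (snd (fst z) * fst (snd z))"

lemma ww_BD: "BD 1 1 ww" unfolding ww_def
 by (intro BD_add BD_scale; rule BD_mono[OF BD_coord(4)] BD_mono[OF BD_coord(2)]; simp)

lemma vv_BD: "BD 1 1 vv" unfolding vv_def
 using BD_add[OF BD_mult[OF BD_coord(1,4)] BD_scale[OF BD_mult[OF BD_coord(2,3)], of "-1"]] by simp

lemma ww_V: "V thd 1 1 ww"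
proof (rule VI[of "%z. - fx2 (fst (snd z)) (fst (fst z)) (snd (fst z))"])
 show "Reg (%z. - fx2 (fst (snd z)) (fst (fst z)) (snd (fst z)))" unfolding fx2_def by (intro Reg_intros)
 fix z assume "z \<in> C \<times> C"
 then have F0: "F (fst (snd z)) (snd (snd z)) = 0" "F (fst (fst z)) (snd (fst z)) = 0" by (auto simp: C_iff(2))
 have "ww z = snd (snd z) - snd (fst z)" "u 1 z = fst (snd z) - fst (fst z)" by (simp_all add: ww_def u_def)
 then show "thd z ^ 1 * ww z = u 1 z ^ 1 * - fx2 (fst (snd z)) (fst (fst z)) (snd (fst z))"
  using fy2[of "snd (snd z)" "snd (fst z)" "fst (snd z)"] fx2[of "fst (snd z)" "fst (fst z)" "snd (fst z)"] F0
  by (simp add: thd_def mult.commute)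
qed

lemma vv_V: "V thd 1 1 vv"
proof -
 have "vv = (%z. fst (fst z) * ww z + (- snd (fst z)) * u 1 z)" by (rule ext) (simp add: vv_def ww_def u_def algebra_simps)
 then show ?thesis using V_add[OF V_cmult[OF Reg_coord(1) ww_V] V_cmult[OF Reg_minus[OF Reg_coord(2)] V_u[OF Reg_thd, of 1]]] by simp
qed

lemma Y_elem:
 assumes m: "d \<le> m1" "d \<le> m2" and jl: "j < d" "l < d - 1" "e + j + l \<le> m1 + m2 + I"
 shows "EX h. BD (m1 + I) (m2 + I) h & V thd 1 I h &
  (ALL x y1 y2. h ((x,y1),(x,y2)) = (y2 - y1) ^ I * (x ^ e * y1 ^ j * y2 ^ l))"
proof -
 define i where "i = min e I"
 define e1 where "e1 = min (e - i) (m1 - j)"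
 define e2 where "e2 = e - i - e1"
 have e1: "e1 + j \<le> m1" using m jl by (auto simp: e1_def)
 have e2: "e2 + l \<le> m2" using m jl by (auto simp: e2_def e1_def i_def)
 have es: "e = e1 + e2 + i" by (auto simp: e2_def e1_def i_def)
 have iI: "i \<le> I" by (simp add: i_def)
 let ?c = "%z. (fst (fst z) ^ e1 * snd (fst z) ^ j) * (fst (snd z) ^ e2 * snd (snd z) ^ l)"
 let ?g = "%z. ww z ^ (I - i) * vv z ^ i"
 have cBD: "BD m1 m2 ?c"
  by (rule BD_mono[OF BD_mult[OF BD_left[OF Pl_monom[of e1 j]] BD_right[OF Pl_monom[of e2 l]]]]) (use e1 e2 in auto)
 have gBD: "BD I I ?g" using BD_mult[OF BD_power[OF ww_BD, of "I - i"] BD_power[OF vv_BD, of i]] iI by simp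
 have gV: "V thd 1 I ?g" using V_mult[OF V_power[OF ww_V, of "I - i"] V_power[OF vv_V, of i]] iI by simp
 show ?thesis
 proof (intro exI[of _ "%z. ?c z * ?g z"] conjI allI)
  show "BD (m1 + I) (m2 + I) (%z. ?c z * ?g z)" by (rule BD_mult[OF cBD gBD])
  show "V thd 1 I (%z. ?c z * ?g z)" by (rule V_cmult[OF BD_Reg[OF cBD] gV])
  fix x y1 y2
  have "vv ((x,y1),(x,y2)) = x * (y2 - y1)" "ww ((x,y1),(x,y2)) = y2 - y1" by (simp_all add: vv_def ww_def algebra_simps)
  moreover have "(y2 - y1) ^ I = (y2 - y1) ^ (I - i) * (y2 - y1) ^ i" using iI by (simp flip: power_add)
  moreover have "x ^ e = x ^ e1 * x ^ e2 * x ^ i" unfolding es by (simp add: power_add)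
  ultimately show "?c ((x,y1),(x,y2)) * ?g ((x,y1),(x,y2)) = (y2 - y1) ^ I * (x ^ e * y1 ^ j * y2 ^ l)"
   by (simp add: power_mult_distrib mult_ac)
 qed
qed

lemma fixed_finite: "finite {x::'a. x ^ q = x}" using card_fix q2 by (intro card_ge_0_finite) simp

lemma dense2:
 assumes "Reg r" "!!z. z \<in> C \<times> C ==> u q z ^ be * u 1 z ^ k * r z = 0" "z \<in> C \<times> C"
 shows "r z = 0"
proof -
 obtain P R where z: "z = (P, R)" "P \<in> C" "R \<in> C" using assms(3) by auto
 have "r (P, R) = 0"
 proof (rule dense[where \<phi> = "%R. r (P, R)" and S = "{fst P, fst P ^ q}"])
  show "Pol (%R. r (P, R))" by (rule RegD[OF assms(1)])
  fix R' assume R': "R' \<in> C" "fst R' \<notin> {fst P, fst P ^ q}"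
  then have "u q (P, R') ~= 0" "u 1 (P, R') ~= 0" by (auto simp: u_def)
  then show "r (P, R') = 0" using assms(2)[of "(P, R')"] z R' by simp
 qed (use z in auto)
 then show ?thesis using z by simp
qed

lemma indep_mon_w:
 assumes "finite S" "!!P. P \<in> C ==> good (fst P) ==> fst P \<notin> S ==> w P ~= 0"
 shows "indep C (M s) (%i P. mon i P * w P)"
proof (rule indepI)
 fix c :: "nat \<times> nat => 'a" and i
 assume c: "!!z. z \<in> C ==> (\<Sum>i\<in>M s. c i * (mon i z * w z)) = 0" and i: "i \<in> M s"
 show "c i = 0"
 proof (rule indepD[OF indep_mon[OF assms(1), of s] _ i])
  fix P assume P: "P \<in> {P \<in> C. fst P \<notin> S & good (fst P)}"
  have "(\<Sum>i\<in>M s. c i * mon i P) * w P = 0" using c[of P] P by (simp add: sum_distrib_right mult.assoc)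
  then show "(\<Sum>i\<in>M s. c i * mon i P) = 0" using assms(2)[of P] P by auto
 qed
qed

end

lemma power_sum_zero:
 fixes b :: "nat => 'k::field"
 assumes "!!y. y \<in> S ==> (\<Sum>j<n. b j * y ^ j) = 0" "n \<le> card S | infinite S" "j < n"
 shows "b j = 0"
proof -
 define p where "p = (\<Sum>j<n. monom (b j) j)"
 have cp: "coeff p i = (if i < n then b i else 0)" for i by (simp add: p_def coeff_sum)
 have dp: "degree p < n" using assms(3) by (intro degree_lessI) (auto simp: cp)
 have sub: "S \<subseteq> {y. poly p y = 0}" using assms(1) by (auto simp: p_def poly_sum poly_monom)
 have "p = 0"
 proof (rule ccontr)
  assume "p ~= 0"
  from poly_roots_finite[OF this] card_poly_roots_bound[OF this] sub assms(2) dp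
  show False by (metis (no_types, lifting) card_mono finite_subset le_trans not_less)
 qed
 then show ?thesis using cp[of j] assms(3) by simp
qed

section \<open>Lower bounds for dimensions: filtering by pole orders\<close>

context frob_curve
begin

text \<open>The part of \<open>LL\<close> with pole order at most \<open>I\<close> in x1 = x2 and no
  pole along Frobenius.\<close>

definition VE where "VE m1 m2 th ap be I g \<longleftrightarrow> LL (m1 + ap + q * be) (m2 + ap + be) th ap be g &
 (EX r. Reg r & (\<forall>z\<in>C\<times>C. g z = u q z ^ be * u 1 z ^ (ap - I) * r z))"

lemma LL_E:
 assumes "I \<le> ap" "BD (m1 + I) (m2 + I) h" "V th 1 I h" "Reg th"
 shows "LL (m1 + ap + q * be) (m2 + ap + be) th ap be (%z. u q z ^ be * u 1 z ^ (ap - I) * h z)"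
 unfolding LL_def
proof (intro conjI)
 show "BD (m1 + ap + q * be) (m2 + ap + be) (%z. u q z ^ be * u 1 z ^ (ap - I) * h z)"
  by (rule BD_mono[OF BD_mult[OF BD_mult[OF BD_power[OF u_BD, of be q] BD_power[OF u_BD, of "ap - I" 1]] assms(2)]])
   (use assms(1) in auto)
 have "V th 1 ap (%z. u 1 z ^ (ap - I) * h z)"
  using V_mult[OF V_power[OF V_u[OF assms(4), of 1], of "ap - I"] assms(3)] assms(1) by simp
 from V_cmult[OF Reg_power[OF Reg_u, of q be] this]
 show "V th 1 ap (%z. u q z ^ be * u 1 z ^ (ap - I) * h z)" by (simp add: mult.assoc)
 have "Reg (%z. u 1 z ^ (ap - I) * h z)" by (intro Reg_mult Reg_power Reg_u BD_Reg[OF assms(2)])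
 from V_mult[OF V_power[OF V_u[OF Reg_thc[of q], of q], of be] V_0[OF this]]
 show "V (thc q) q be (%z. u q z ^ be * u 1 z ^ (ap - I) * h z)" by (simp add: mult.assoc)
qed

lemma E_base: assumes "Reg th" shows "rich (C \<times> C) (VE m1 m2 th ap be 0) (card (M m1) * card (M m2))"
proof -
 let ?h = "%i z. mon (fst i) (fst z) * mon (snd i) (snd z)"
 let ?be = "%i z. u q z ^ be * u 1 z ^ (ap - 0) * ?h i z"
 have BDh: "BD m1 m2 (?h i)" if "i \<in> M m1 \<times> M m2" for i
  using BD_mult[OF BD_left[OF mon_Pl'[of "fst i" m1]] BD_right[OF mon_Pl'[of "snd i" m2]]] that by auto
 have "rich (C \<times> C) (VE m1 m2 th ap be 0) (card (M m1 \<times> M m2))"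
 proof (rule richI[of _ _ ?be])
  show "indep (C \<times> C) (M m1 \<times> M m2) ?be"
  proof (rule indepI)
   fix c :: "(nat \<times> nat) \<times> (nat \<times> nat) => 'a" and i
   assume c: "!!z. z \<in> C \<times> C ==> (\<Sum>i\<in>M m1 \<times> M m2. c i * ?be i z) = 0" and i: "i \<in> M m1 \<times> M m2"
   let ?r = "%z. \<Sum>i\<in>M m1 \<times> M m2. c i * ?h i z"
   have Rr: "Reg ?r" by (intro Reg_sum Reg_mult Reg_const) (auto intro!: BD_Reg[OF BD_left[OF mon_Pl]] BD_Reg[OF BD_right[OF mon_Pl]])
   have "u q z ^ be * u 1 z ^ ap * ?r z = 0" if "z \<in> C \<times> C" for z
    using c[OF that] by (simp add: sum_distrib_left mult_ac)
   then have r0: "?r z = 0" if "z \<in> C \<times> C" for z by (rule dense2[OF Rr _ that])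
   have 1: "(\<Sum>i2\<in>M m2. c (i1, i2) * mon i2 R) = 0" if R: "R \<in> C" and i1: "i1 \<in> M m1" for R i1
   proof (rule indepD[OF indep_mon'[of m1] _ i1])
    fix P assume "P \<in> C"
    with r0[of "(P, R)"] R have "(\<Sum>i\<in>M m1 \<times> M m2. c i * (mon (fst i) P * mon (snd i) R)) = 0" by simp
    then have "(\<Sum>i1\<in>M m1. \<Sum>i2\<in>M m2. c (i1,i2) * (mon i1 P * mon i2 R)) = 0"
     by (subst sum.cartesian_product) (simp add: case_prod_unfold)
    then show "(\<Sum>i1\<in>M m1. (\<Sum>i2\<in>M m2. c (i1, i2) * mon i2 R) * mon i1 P) = 0"
     by (simp add: sum_distrib_right sum_distrib_left mult_ac)
   qed
   obtain i1 i2 where i12: "i = (i1, i2)" "i1 \<in> M m1" "i2 \<in> M m2" using i by auto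
   have "c (i1, i2) = 0" by (rule indepD[OF indep_mon'[of m2] _ i12(3), of "%i2. c (i1, i2)"]) (use 1 i12 in auto)
   then show "c i = 0" using i12 by simp
  qed
  fix i assume i: "i \<in> M m1 \<times> M m2"
  show "VE m1 m2 th ap be 0 (?be i)" unfolding VE_def
   using LL_E[of 0 ap m1 m2 "?h i" th be] BDh[OF i] assms V_0[OF BD_Reg[OF BDh[OF i]]]
   by (intro conjI exI[of _ "?h i"]) (auto intro: BD_Reg)
 qed simp
 then show ?thesis by (simp add: card_cartesian_product)
qed

lemma E_step:
 assumes th: "Reg th" and I: "I < ap" and r0: "rich (C \<times> C) (VE m1 m2 th ap be I) n" and rf: "rich Z Rf m"
  and Rf: "!!f. Rf f ==> EX h. BD (m1 + Suc I) (m2 + Suc I) h & V th 1 (Suc I) h & (\<forall>y\<in>Z. h (\<iota> y) = f y)"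
  and \<iota>: "!!y. y \<in> Z ==> \<iota> y \<in> C \<times> C & u 1 (\<iota> y) = 0"
 shows "rich (C \<times> C) (VE m1 m2 th ap be (Suc I)) (n + m)"
proof (rule rich_lift[where A = "%z. u q z ^ be" and \<pi> = "u 1" and k = "ap - Suc I" and Reg = Reg and \<iota> = \<iota>, OF r0 _ rf])
 have S: "ap - I = Suc (ap - Suc I)" using I by simp
 fix f assume "VE m1 m2 th ap be I f"
 then obtain r where r: "LL (m1 + ap + q * be) (m2 + ap + be) th ap be f" "Reg r"
  "\<forall>z\<in>C\<times>C. f z = u q z ^ be * u 1 z ^ Suc (ap - Suc I) * r z" unfolding VE_def S by blast
 then show "VE m1 m2 th ap be (Suc I) f & (EX r. Reg r & (\<forall>z\<in>C\<times>C. f z = u q z ^ be * u 1 z ^ Suc (ap - Suc I) * r z))"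
  unfolding VE_def by (intro conjI exI[of _ "%z. u 1 z * r z"] exI[of _ r]) (auto intro!: Reg_mult Reg_u simp: mult_ac)
next
 fix f assume "Rf f"
 from Rf[OF this] obtain h where h: "BD (m1 + Suc I) (m2 + Suc I) h" "V th 1 (Suc I) h" "\<forall>y\<in>Z. h (\<iota> y) = f y" by blast
 have "VE m1 m2 th ap be (Suc I) (%z. u q z ^ be * u 1 z ^ (ap - Suc I) * h z)"
  unfolding VE_def using LL_E[OF Suc_leI[OF I] h(1,2) th] BD_Reg[OF h(1)] by (intro conjI exI[of _ h]) auto
 then show "EX h. Reg h & VE m1 m2 th ap be (Suc I) (%z. u q z ^ be * u 1 z ^ (ap - Suc I) * h z) & (\<forall>y\<in>Z. h (\<iota> y) = f y)"
  using h BD_Reg by blast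
next
 fix r z assume "Reg r" "!!z. z \<in> C \<times> C ==> u q z ^ be * u 1 z ^ (ap - Suc I) * r z = 0" "z \<in> C \<times> C"
 then show "r z = 0" by (rule dense2)
qed (use \<iota> in \<open>auto intro: Reg_u Reg_const Reg_add Reg_mult\<close>)

text \<open>The term 3 J - d J in the degree of the leading coefficients reflects the
  self-intersection d (3 - d) of the diagonal, which is 2 - 2g for a smooth plane curve of degree
  \<open>d\<close>.\<close>

lemma E_Delta:
 assumes m: "ap * d + d + 1 \<le> m1" "ap * d \<le> m2" and I: "I \<le> ap"
 shows "rich (C \<times> C) (VE m1 m2 (thc 1) ap be I) (card (M m1) * card (M m2) + (\<Sum>I<I. card (M (m1 + m2 + 3 * Suc I - d * Suc I))))"
 using I
proof (induction I)
 case 0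
 show ?case using E_base[OF Reg_thc] by simp
next
 case (Suc I)
 define J where "J = Suc I"
 have Ja: "J * d \<le> ap * d" unfolding J_def using Suc.prems by (rule mult_le_mono1)
 define k1 k2 where "k1 = m1 - J * d" and "k2 = m2 - J * d"
 then have k1: "m1 = k1 + J * d" and k2: "m2 = k2 + J * d" using m Ja by linarith+
 have k1d: "1 + d \<le> k1" using m Ja k1 by linarith
 have dd: "J * d = J * (d - 1) + J" using d_pos by (cases d) auto
 let ?T = "m1 + m2 + 3 * J - d * J"
 have T: "?T = (k1 + J) + 1 * (k2 + 2 * J) + J * (1 * d)" by (simp add: k1 k2 mult.commute)
 let ?f = "%i P. mon i P * Fy (fst P) (snd P) ^ J"
 let ?Rf = "%f. \<exists>i\<in>M ?T. f = ?f i"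
 have "rich (C \<times> C) (VE m1 m2 (thc 1) ap be (Suc I)) (card (M m1) * card (M m2) + (\<Sum>I<I. card (M (m1 + m2 + 3 * Suc I - d * Suc I))) + card (M ?T))"
 proof (rule E_step[OF Reg_thc])
  show "I < ap" using Suc by simp
  show "rich (C \<times> C) (VE m1 m2 (thc 1) ap be I) (card (M m1) * card (M m2) + (\<Sum>I<I. card (M (m1 + m2 + 3 * Suc I - d * Suc I))))"
   using Suc by simp
  show "rich C ?Rf (card (M ?T))"
  proof (rule richI)
   show "indep C (M ?T) ?f" by (rule indep_mon_w[of "{}"]) (auto dest: good_Fy simp: C_iff(2))
  qed auto
  show "(P, P) \<in> C \<times> C & u 1 (P, P) = 0" if "P \<in> C" for P using that by (simp add: u_def)
  fix f assume "?Rf f"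
  then obtain i where i: "i \<in> M ?T" "f = ?f i" by blast
  from graph_elem[OF frobQ_1, of "k1 + J" i "k2 + 2 * J" J] i(1)[unfolded T] k1d
  obtain h where h: "BD ((k1 + J) + J * (1 * d)) ((k2 + 2 * J) + J * (d - 1)) h" "V (thc 1) 1 J h"
   "!!P. h (P, pw 1 P) = mon i P * Fy (fst P ^ 1) (snd P ^ 1) ^ J" by auto
  have "k1 + J + J * (1 * d) = m1 + J" "k2 + 2 * J + J * (d - 1) = m2 + J" using k1 k2 dd by (simp, linarith)
  then have "BD (m1 + J) (m2 + J) h" using h(1) by (simp only:)
  then show "EX h. BD (m1 + Suc I) (m2 + Suc I) h & V (thc 1) 1 (Suc I) h & (\<forall>P\<in>C. h (P, P) = f P)"
   using h i by (intro exI[of _ h]) (simp add: J_def)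
 qed
 then show ?case by (simp add: J_def add.assoc)
qed

text \<open>The leading coefficients live on pairs of distinct points of a good fibre. There x^e
  y1^j y2^l with j < d and l < d - 1 are independent, because y2 takes d - 1 values for given y1, y1
  takes \<open>d\<close> values and x infinitely many.\<close>

lemma E_Y:
 assumes m: "d \<le> m1" "d \<le> m2" and I: "I \<le> ap"
 shows "rich (C \<times> C) (VE m1 m2 thd ap be I) (card (M m1) * card (M m2) + (\<Sum>I<I. d * (d - 1) * (m1 + m2 + Suc I + 1 - 2 * d)))"
 using I
proof (induction I)
 case 0
 show ?case using E_base[OF Reg_thd] by simp
next
 case (Suc I)
 define J where "J = Suc I"
 let ?T = "m1 + m2 + J + 1 - 2 * d"
 let ?K = "{..<d} \<times> {..<d-1} \<times> {..<?T}"
 let ?f = "%i (z::'a \<times> 'a \<times> 'a). (snd (snd z) - fst (snd z)) ^ J * (fst z ^ snd (snd i) * fst (snd z) ^ fst i * snd (snd z) ^ fst (snd i))"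
 let ?Rf = "%f. \<exists>i\<in>?K. f = ?f i"
 let ?Z = "{z::'a \<times> 'a \<times> 'a. good (fst z) & F (fst z) (fst (snd z)) = 0 & F (fst z) (snd (snd z)) = 0 & snd (snd z) ~= fst (snd z)}"
 let ?\<iota> = "%z. ((fst z, fst (snd z)), (fst z, snd (snd z)))"
 have "rich (C \<times> C) (VE m1 m2 thd ap be (Suc I)) (card (M m1) * card (M m2) + (\<Sum>I<I. d * (d - 1) * (m1 + m2 + Suc I + 1 - 2 * d)) + card ?K)"
 proof (rule E_step[OF Reg_thd, where \<iota> = ?\<iota> and Z = ?Z and Rf = ?Rf])
  show "I < ap" using Suc by simp
  show "rich (C \<times> C) (VE m1 m2 thd ap be I) (card (M m1) * card (M m2) + (\<Sum>I<I. d * (d - 1) * (m1 + m2 + Suc I + 1 - 2 * d)))"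
   using Suc by simp
  show "rich ?Z ?Rf (card ?K)"
  proof (rule richI)
   show "indep ?Z ?K ?f"
   proof (rule indepI)
    fix c :: "nat \<times> nat \<times> nat => 'a" and i
    assume c: "!!z. z \<in> ?Z ==> (\<Sum>i\<in>?K. c i * ?f i z) = 0" and i: "i \<in> ?K"
    obtain j l e where ie: "i = (j, l, e)" "j < d" "l < d - 1" "e < ?T" using i by auto
    have 1: "(\<Sum>l<d-1. (\<Sum>j<d. (\<Sum>e<?T. c (j,l,e) * x ^ e) * y1 ^ j) * y2 ^ l) = 0"
     if g: "good x" and y: "F x y1 = 0" "F x y2 = 0" "y2 ~= y1" for x y1 y2
    proof -
     have "(y2 - y1) ^ J * (\<Sum>l<d-1. (\<Sum>j<d. (\<Sum>e<?T. c (j,l,e) * x ^ e) * y1 ^ j) * y2 ^ l)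
       = (y2 - y1) ^ J * (\<Sum>j<d. \<Sum>l<d-1. \<Sum>e<?T. c (j,l,e) * (x ^ e * y1 ^ j * y2 ^ l))"
      by (subst (2) sum.swap) (simp add: sum_distrib_left sum_distrib_right mult_ac)
     also have "\<dots> = (\<Sum>i\<in>?K. c i * ?f i (x, y1, y2))"
      unfolding sum.cartesian_product sum_distrib_left
      by (intro sum.cong refl) (auto simp: mult_ac)
     also have "\<dots> = 0" by (rule c) (use g y in auto)
     finally show ?thesis using y(3) by simp
    qed
    have 2: "(\<Sum>j<d. (\<Sum>e<?T. c (j,l,e) * x ^ e) * y1 ^ j) = 0" if g: "good x" and y: "F x y1 = 0" for x y1
    proof (rule power_sum_zero[of "{y2. F x y2 = 0 & y2 ~= y1}" "%l. \<Sum>j<d. (\<Sum>e<?T. c (j,l,e) * x ^ e) * y1 ^ j" "d - 1"])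
     show "d - 1 \<le> card {y2. F x y2 = 0 & y2 ~= y1} | infinite {y2. F x y2 = 0 & y2 ~= y1}"
      using card_roots_except[OF g y] by simp
    qed (use 1 g y ie in auto)
    have 3: "(\<Sum>e<?T. c (j,l,e) * x ^ e) = 0" if g: "good x" for x
     by (rule power_sum_zero[of "{y. F x y = 0}" "%j. \<Sum>e<?T. c (j,l,e) * x ^ e" d]) (use 2 g ie in \<open>auto simp: good_def\<close>)
    have "c (j,l,e) = 0"
    proof (rule power_sum_zero[of "{x. good x}" "%e. c (j,l,e)" ?T])
     have "infinite {x. good x}"
     proof
      assume "finite {x. good x}"
      then have "finite ({x. good x} \<union> {x. card {y. F x y = 0} ~= d})" using cofin by simp
      moreover have "{x. good x} \<union> {x. card {y. F x y = 0} ~= d} = UNIV" by (auto simp: good_def)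
      ultimately show False using inf_field by simp
     qed
     then show "?T \<le> card {x. good x} | infinite {x. good x}" by simp
    qed (use 3 ie in auto)
    then show "c i = 0" using ie by simp
   qed
  qed (simp, blast)
  show "?\<iota> z \<in> C \<times> C & u 1 (?\<iota> z) = 0" if "z \<in> ?Z" for z using that by (simp add: u_def C_iff)
  fix f assume "?Rf f"
  then obtain j l e where i: "j < d" "l < d - 1" "e < ?T" "f = ?f (j,l,e)" by auto
  have "e + j + l \<le> m1 + m2 + J" using i by linarith
  from Y_elem[OF m i(1,2) this] obtain h where "BD (m1 + J) (m2 + J) h" "V thd 1 J h"
   "!!x y1 y2. h ((x,y1),(x,y2)) = (y2 - y1) ^ J * (x ^ e * y1 ^ j * y2 ^ l)" by blast
  then show "EX h. BD (m1 + Suc I) (m2 + Suc I) h & V thd 1 (Suc I) h & (\<forall>y\<in>?Z. h (?\<iota> y) = f y)"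
   using i by (intro exI[of _ h]) (simp add: J_def)
 qed
 moreover have "card ?K = d * (d - 1) * ?T" by (simp add: card_cartesian_product mult.assoc)
 ultimately show ?case by (simp add: J_def add.assoc mult.assoc)
qed

text \<open>Second stage: pole order \<open>ap\<close> in x1 = x2 is allowed in full, and pole order
  at most \<open>J\<close> along Frobenius. \<open>RF\<close> consists of the leading coefficients
  that can occur.\<close>

definition VF where "VF m1 m2 th ap be J g \<longleftrightarrow> LL (m1 + ap + q * be) (m2 + ap + be) th ap be g &
 (EX r. Reg r & (\<forall>z\<in>C\<times>C. g z = u q z ^ (be - J) * r z))"

definition RF where "RF m1 m2 th ap J f \<longleftrightarrow> (EX h. BD (m1 + ap + q * J) (m2 + ap + J) h & V th 1 ap h & V (thc q) q J h &
 (\<forall>P\<in>C. f P = h (P, pw q P)))"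

lemma VE_VF: "VE m1 m2 th ap be ap g ==> VF m1 m2 th ap be 0 g"
 unfolding VE_def VF_def by auto

lemma F_step:
 assumes th: "Reg th" and J: "J < be" and r0: "rich (C \<times> C) (VF m1 m2 th ap be J) n" and rf: "rich C (RF m1 m2 th ap (Suc J)) m"
 shows "rich (C \<times> C) (VF m1 m2 th ap be (Suc J)) (n + m)"
proof (rule rich_lift[where A = "%z. 1" and \<pi> = "u q" and k = "be - Suc J" and Reg = Reg and \<iota> = "%P. (P, pw q P)", OF r0 _ rf])
 have S: "be - J = Suc (be - Suc J)" using J by simp
 fix f assume "VF m1 m2 th ap be J f"
 then obtain r where r: "LL (m1 + ap + q * be) (m2 + ap + be) th ap be f" "Reg r"
  "\<forall>z\<in>C\<times>C. f z = u q z ^ Suc (be - Suc J) * r z" unfolding VF_def S by blast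
 then show "VF m1 m2 th ap be (Suc J) f & (EX r. Reg r & (\<forall>z\<in>C\<times>C. f z = 1 * u q z ^ Suc (be - Suc J) * r z))"
  unfolding VF_def by (intro conjI exI[of _ "%z. u q z * r z"] exI[of _ r]) (auto intro!: Reg_mult Reg_u simp: mult_ac)
next
 fix f assume "RF m1 m2 th ap (Suc J) f"
 then obtain h where h: "BD (m1 + ap + q * Suc J) (m2 + ap + Suc J) h" "V th 1 ap h" "V (thc q) q (Suc J) h"
  "\<forall>P\<in>C. f P = h (P, pw q P)" unfolding RF_def by blast
 define k where "k = be - Suc J"
 then have k: "be = k + Suc J" using J by auto
 have "LL (m1 + ap + q * be) (m2 + ap + be) th ap be (%z. u q z ^ k * h z)"
  unfolding LL_def
 proof (intro conjI)
  show "BD (m1 + ap + q * be) (m2 + ap + be) (%z. u q z ^ k * h z)"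
   by (rule BD_mono[OF BD_mult[OF BD_power[OF u_BD, of k q] h(1)]]) (simp_all add: k algebra_simps)
  show "V th 1 ap (%z. u q z ^ k * h z)" by (rule V_cmult[OF Reg_power[OF Reg_u] h(2)])
  show "V (thc q) q be (%z. u q z ^ k * h z)"
   using V_mult[OF V_power[OF V_u[OF Reg_thc[of q], of q], of k] h(3)] by (simp add: k)
 qed
 then have "VF m1 m2 th ap be (Suc J) (%z. 1 * u q z ^ (be - Suc J) * h z)"
  unfolding VF_def using BD_Reg[OF h(1)] k by (intro conjI exI[of _ h]) auto
 then show "EX h. Reg h & VF m1 m2 th ap be (Suc J) (%z. 1 * u q z ^ (be - Suc J) * h z) & (\<forall>y\<in>C. h (y, pw q y) = f y)"
  using h BD_Reg by (intro exI[of _ h]) auto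
next
 fix r z assume "Reg r" "!!z. z \<in> C \<times> C ==> 1 * u q z ^ (be - Suc J) * r z = 0" "z \<in> C \<times> C"
 then show "r z = 0" using dense2[of r "be - Suc J" 0 z] by simp
next
 fix P assume "P \<in> C"
 then show "(P, pw q P) \<in> C \<times> C & u q (P, pw q P) = 0" using frobQ_q by (simp add: u_def frobQ_def)
qed (auto intro: Reg_u Reg_const Reg_add Reg_mult)

text \<open>Leading coefficients along Frobenius are filtered once more, by powers of x^q - x, the
  restriction of \<open>u 1\<close>. Those divisible by its \<open>ap\<close>-th power are counted
  by \<open>M\<close>; each further step adds a dimension per point of \<open>S\<close>, by
  interpolation times a power of \<open>ka\<close>, which has a simple pole there. This is how the
  intersection of Frobenius with the polar curve enters, as \<open>ap * card S\<close>.\<close>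

lemma RF_rich:
 assumes th: "Reg th" and J: "J \<le> be" and ka: "BD d d ka" "V th 1 1 ka" "Pol (%P. ka (P, pw q P))"
  and S: "finite S" "!!P. P \<in> S ==> P \<in> C & fst P ^ q = fst P & ka (P, pw q P) ~= 0 & Fy (fst P ^ q) (snd P ^ q) ~= 0"
  and m: "ap * d + be * (q * d) + q + d + card S \<le> m1" "ap * d + be * d \<le> m2"
 shows "rich C (RF m1 m2 th ap J) (card (M (m1 + q * m2 + 3 * q * J - d * q * J)) + ap * card S)"
proof -
 let ?T = "m1 + q * m2 + 3 * q * J - d * q * J"
 let ?\<pi> = "%P::'a \<times> 'a. fst P ^ q - fst P"
 let ?W = "%i f. RF m1 m2 th ap J f & (EX r. Pol r & (\<forall>P\<in>C. f P = 1 * ?\<pi> P ^ (ap - i) * r P))"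
 have u1: "u 1 (P, pw q P) = ?\<pi> P" for P by (simp add: u_def)
 have Jb: "J * (q * d) \<le> be * (q * d)" "J * d \<le> be * d" using J by simp_all
 have Fq: "Fy (fst P ^ q) (snd P ^ q) ~= 0" if "P \<in> C" "good (fst P)" for P
  using that q2 by (intro good_Fy) (auto simp: good_frob F_frob C_iff(2))
 have PolFy: "Pol (%P. Fy (fst P ^ q) (snd P ^ q))" unfolding Fy_def by (intro polyfun_fy2 polyfun_intros)
 have "rich C (?W i) (card (M ?T) + i * card S)" if "i \<le> ap" for i
  using that
 proof (induction i)
  case 0
  define k1 k2 where "k1 = m1 - J * (q * d)" and "k2 = m2 - J * d"
  then have k1: "m1 = k1 + J * (q * d)" and k2: "m2 = k2 + J * d" using m Jb by linarith+
  have k1d: "q + d \<le> k1" using m Jb k1 by linarith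
  have dd: "J * d = J * (d - 1) + J" using d_pos by (cases d) auto
  have T: "?T = (k1 + q * J) + q * (k2 + 2 * J) + J * (q * d)" by (simp add: k1 k2 algebra_simps)
  let ?w = "%P. ?\<pi> P ^ ap * Fy (fst P ^ q) (snd P ^ q) ^ J"
  have "rich C (?W 0) (card (M ?T))"
  proof (rule richI[of _ _ "%i P. mon i P * ?w P"])
   show "indep C (M ?T) (%i P. mon i P * ?w P)"
    by (rule indep_mon_w[OF fixed_finite]) (use Fq in auto)
   fix i assume i: "i \<in> M ?T"
   from graph_elem[OF frobQ_q, of "k1 + q * J" i "k2 + 2 * J" J] i[unfolded T] k1d
   obtain h where h: "BD ((k1 + q * J) + J * (q * d)) ((k2 + 2 * J) + J * (d - 1)) h" "V (thc q) q J h"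
    "!!P. h (P, pw q P) = mon i P * Fy (fst P ^ q) (snd P ^ q) ^ J" by auto
   have "k1 + q * J + J * (q * d) = m1 + q * J" "k2 + 2 * J + J * (d - 1) = m2 + J" using k1 k2 dd by (simp, linarith)
   then have hBD: "BD (m1 + q * J) (m2 + J) h" using h(1) by (simp only:)
   have "RF m1 m2 th ap J (%P. mon i P * ?w P)" unfolding RF_def
   proof (intro exI[of _ "%z. u 1 z ^ ap * h z"] conjI ballI)
    show "BD (m1 + ap + q * J) (m2 + ap + J) (%z. u 1 z ^ ap * h z)"
     by (rule BD_mono[OF BD_mult[OF BD_power[OF u_BD, of ap 1] hBD]]) simp_all
    show "V th 1 ap (%z. u 1 z ^ ap * h z)"
     using V_mult[OF V_power[OF V_u[OF th, of 1], of ap] V_0[OF BD_Reg[OF hBD]]] by simp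
    show "V (thc q) q J (%z. u 1 z ^ ap * h z)" by (rule V_cmult[OF Reg_power[OF Reg_u] h(2)])
    show "mon i P * ?w P = u 1 (P, pw q P) ^ ap * h (P, pw q P)" for P unfolding u1 h(3) by (simp add: mult_ac)
   qed
   moreover have "EX r. Pol r & (\<forall>P\<in>C. mon i P * ?w P = 1 * ?\<pi> P ^ (ap - 0) * r P)"
    by (intro exI[of _ "%P. mon i P * Fy (fst P ^ q) (snd P ^ q) ^ J"] conjI polyfun_mult polyfun_power PolFy polyfunI[OF mon_Pl]) (simp add: mult_ac)
   ultimately show "?W 0 (%P. mon i P * ?w P)" by simp
  qed simp
  then show ?case by simp
 next
  case (Suc i)
  have "\<forall>P0\<in>S. EX L. Pl (card S) L & L P0 ~= 0 & (\<forall>P\<in>S. P ~= P0 --> L P = 0)" using Pl_interp[OF S(1)] by blast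
  from bchoice[OF this] obtain L where L: "!!P0. P0 \<in> S ==> Pl (card S) (L P0)" "!!P0. P0 \<in> S ==> L P0 P0 ~= 0"
   "!!P0 P. P0 \<in> S ==> P \<in> S ==> P ~= P0 ==> L P0 P = 0" by blast
  let ?v = "%P. ka (P, pw q P) ^ Suc i * Fy (fst P ^ q) (snd P ^ q) ^ J"
  let ?f = "%P0 P. L P0 P * ?v P"
  have "rich C (?W (Suc i)) (card (M ?T) + i * card S + card S)"
  proof (rule rich_lift[where A = "%_. 1" and \<pi> = ?\<pi> and k = "ap - Suc i" and Reg = Pol and \<iota> = "%P. P" and Z = S and Rf = "%f. \<exists>P0\<in>S. f = ?f P0"])
   show "rich C (?W i) (card (M ?T) + i * card S)" using Suc by simp
   have Si: "ap - i = Suc (ap - Suc i)" using Suc by simp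
   show "?W (Suc i) f & (EX r. Pol r & (\<forall>P\<in>C. f P = 1 * ?\<pi> P ^ Suc (ap - Suc i) * r P))" if W: "?W i f" for f
   proof -
    from W obtain r where r: "Pol r" "\<forall>P\<in>C. f P = 1 * ?\<pi> P ^ Suc (ap - Suc i) * r P" unfolding Si by blast
    have "Pol (%P. ?\<pi> P * r P)" by (intro polyfun_intros r(1))
    moreover have "\<forall>P\<in>C. f P = 1 * ?\<pi> P ^ (ap - Suc i) * (?\<pi> P * r P)" using r(2) by (simp add: mult_ac)
    ultimately show ?thesis using W r by blast
   qed
   show "rich S (%f. \<exists>P0\<in>S. f = ?f P0) (card S)"
   proof (rule richI[OF S(1)])
    show "indep S S ?f"
    proof (rule indepI)
     fix c P0 assume c: "!!z. z \<in> S ==> (\<Sum>i\<in>S. c i * ?f i z) = 0" and P0: "P0 \<in> S"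
     have "c i * ?f i P0 = 0" if i: "i \<in> S - {P0}" for i
     proof -
      have "P0 ~= i" "i \<in> S" using i by auto
      then have "L i P0 = 0" using L(3) P0 by blast
      then show ?thesis by simp
     qed
     then have "(\<Sum>i\<in>S-{P0}. c i * ?f i P0) = 0" by (intro sum.neutral ballI)
     then have "(\<Sum>i\<in>S. c i * ?f i P0) = c P0 * ?f P0 P0"
      using sum.remove[OF S(1) P0, of "%i. c i * ?f i P0"] by (simp only: add_0_right)
     then have "c P0 * ?f P0 P0 = 0" using c[OF P0] by simp
     moreover have "?f P0 P0 ~= 0" using L(2)[OF P0] S(2)[OF P0] unfolding mult_eq_0_iff power_eq_0_iff by blast
     ultimately show "c P0 = 0" by (auto simp only: mult_eq_0_iff)
    qed
   qed blast
   show "P \<in> C & ?\<pi> P = 0" if "P \<in> S" for P using S(2)[OF that] by simp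
   show "Pol ?\<pi>" by (intro polyfun_intros)
   show "r P = 0" if "Pol r" "!!P. P \<in> C ==> 1 * ?\<pi> P ^ (ap - Suc i) * r P = 0" "P \<in> C" for r P
    by (rule dense[OF that(1) fixed_finite _ that(3)]) (use that(2) in force)
   fix f assume "\<exists>P0\<in>S. f = ?f P0"
   then obtain P0 where P0: "P0 \<in> S" "f = ?f P0" by blast
   let ?h = "%z. (u 1 z ^ (ap - Suc i) * ka z ^ Suc i) * (L P0 (fst z) * gg q 0 z ^ J)"
   have gBD: "BD (q * d) (d - 1) (gg q 0)" using q2 by (intro gg_BD) auto
   have "RF m1 m2 th ap J (%P. 1 * ?\<pi> P ^ (ap - Suc i) * f P)" unfolding RF_def
   proof (intro exI[of _ ?h] conjI ballI)
    have 1: "BD ((ap - Suc i) * 1 + Suc i * d) ((ap - Suc i) * 1 + Suc i * d) (%z. u 1 z ^ (ap - Suc i) * ka z ^ Suc i)"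
     by (intro BD_mult BD_power u_BD ka(1))
    have 2: "BD (card S + J * (q * d)) (0 + J * (d - 1)) (%z. L P0 (fst z) * gg q 0 z ^ J)"
     by (intro BD_mult BD_power gBD BD_left L P0)
    have i2: "Suc i * d \<le> ap * d" using Suc.prems by (intro mult_le_mono1)
    have i3: "J * (d - 1) \<le> J * d" by simp
    show "BD (m1 + ap + q * J) (m2 + ap + J) ?h"
     by (rule BD_mono[OF BD_mult[OF 1 2]]) (use m Jb i2 i3 in linarith)+
    have "V th 1 ap (%z. u 1 z ^ (ap - Suc i) * ka z ^ Suc i)"
     using V_mult[OF V_power[OF V_u[OF th, of 1], of "ap - Suc i"] V_power[OF ka(2), of "Suc i"]] Suc.prems by simp
    from V_mult[OF this V_0[OF BD_Reg[OF 2]]] show "V th 1 ap ?h" by simp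
    have "V (thc q) q J (%z. L P0 (fst z) * gg q 0 z ^ J)"
     by (intro V_cmult V_power gg_V frobQ_q BD_Reg[OF BD_left[OF L(1)[OF P0(1)]]])
    from V_cmult[OF BD_Reg[OF 1] this] show "V (thc q) q J ?h" .
    show "1 * ?\<pi> P ^ (ap - Suc i) * f P = ?h (P, pw q P)" for P unfolding u1 P0(2) gg_graph by (simp add: mult_ac)
   qed
   moreover have Polf: "Pol f" unfolding P0(2) by (intro polyfun_mult polyfun_power PolFy ka(3) polyfunI[OF L(1)[OF P0(1)]])
   ultimately have "?W (Suc i) (%P. 1 * ?\<pi> P ^ (ap - Suc i) * f P)" by blast
   then show "EX h. Pol h & ?W (Suc i) (%P. 1 * ?\<pi> P ^ (ap - Suc i) * h P) & (\<forall>P\<in>S. h P = f P)" using Polf by blast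
  qed (auto intro: polyfun_add polyfun_mult polyfun_const)
  then show ?case by (simp add: algebra_simps)
 qed
 from rich_mono[OF this[of ap]] show ?thesis by simp
qed

lemma F_level:
 assumes th: "Reg th" and ka: "BD d d ka" "V th 1 1 ka" "Pol (%P. ka (P, pw q P))"
  and S: "finite S" "!!P. P \<in> S ==> P \<in> C & fst P ^ q = fst P & ka (P, pw q P) ~= 0 & Fy (fst P ^ q) (snd P ^ q) ~= 0"
  and m: "ap * d + be * (q * d) + q + d + card S \<le> m1" "ap * d + be * d \<le> m2"
  and E: "rich (C \<times> C) (VE m1 m2 th ap be ap) n" and J: "J \<le> be"
 shows "rich (C \<times> C) (VF m1 m2 th ap be J) (n + (\<Sum>J<J. card (M (m1 + q * m2 + 3 * q * Suc J - d * q * Suc J)) + ap * card S))"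
 using J
proof (induction J)
 case 0
 show ?case using rich_mono[OF E VE_VF] by simp
next
 case (Suc J)
 have "rich C (RF m1 m2 th ap (Suc J)) (card (M (m1 + q * m2 + 3 * q * Suc J - d * q * Suc J)) + ap * card S)"
  using RF_rich[OF th Suc.prems ka S m] by blast
 from F_step[OF th _ Suc.IH this] Suc.prems show ?case by (simp add: add.assoc)
qed

end

section \<open>From the dimension inequalities to upper bounds for numbers of points\<close>

lemma real_diff_ge: "real a - real b \<le> real (a - b)" by linarith

lemma sum_Suc_real: "(\<Sum>I<n. real (Suc I)) = real n * (real n + 1) / 2"
 by (induction n) (auto simp: field_simps)

text \<open>Division by sqrt q times n, for growing n, removes the constant and the
  rounding.\<close>

lemma asymptotic_bound:
 fixes T g c :: real
 assumes "q \<ge> 1" "g \<ge> 0" "!!n. n \<ge> 1 ==> T * real (nat \<lfloor>sqrt q * real n\<rfloor>) \<le> 2 * q * real n * g + c"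
 shows "T \<le> 2 * g * sqrt q"
proof (rule ccontr)
 assume "~ ?thesis"
 then have gt: "T > 2 * g * sqrt q" by simp
 moreover have "2 * g * sqrt q \<ge> 0" using assms by simp
 ultimately have T: "T > 0" by linarith
 have sq: "sqrt q > 0" using assms by simp
 define e where "e = T * sqrt q - 2 * q * g"
 have "2 * q * g = 2 * g * sqrt q * sqrt q" using assms by simp
 then have e: "e > 0" using gt sq unfolding e_def by (metis diff_gt_0_iff_gt mult_strict_right_mono)
 obtain n :: nat where n: "real n > (c + T) / e" "n \<ge> 1"
  by (metis reals_Archimedean2 le_less_trans max.strict_boundedE of_nat_1 of_nat_le_iff less_imp_le max_less_iff_conj not_less)
 have "real (nat \<lfloor>sqrt q * real n\<rfloor>) \<ge> sqrt q * real n - 1"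
  using sq by (subst of_nat_nat) auto
 then have "T * (sqrt q * real n - 1) \<le> 2 * q * real n * g + c"
  using assms(3)[OF n(2)] T by (meson mult_left_mono less_imp_le order_trans)
 then have "e * real n \<le> c + T" unfolding e_def by (simp add: algebra_simps)
 moreover have "e * real n > c + T" using n(1) e by (simp add: pos_divide_less_eq mult.commute)
 ultimately show False by simp
qed

context frob_curve
begin

text \<open>Points with \<open>Fy\<close> = 0 are left out and bounded in \<open>sing_pts\<close>. A
  point belongs to \<open>irrat_pts\<close> when the pair with its Frobenius image lies on the
  residual curve.\<close>

definition "rat_pts = {P\<in>C. fst P ^ q = fst P & snd P ^ q = snd P & Fy (fst P) (snd P) ~= 0}"
definition "irrat_pts = {P\<in>C. fst P ^ q = fst P & snd P ^ q ~= snd P & Fy (fst P) (snd P) ~= 0}"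

lemma finite_over_fixed: "finite {P\<in>C. fst P ^ q = fst P}"
proof (rule finite_subset)
 show "{P\<in>C. fst P ^ q = fst P} \<subseteq> Sigma {x. x ^ q = x} (%x. {y. F x y = 0})" by (auto simp: C_iff)
qed (intro finite_SigmaI fixed_finite finite_roots)

lemma finite_pts: "finite rat_pts" "finite irrat_pts"
 by (rule finite_subset[OF _ finite_over_fixed]; auto simp: rat_pts_def irrat_pts_def)+

lemma Fy_frob: "Fy (x ^ q) (y ^ q) = Fy x y ^ q"
 unfolding Fy_def fy2_def
 by (simp add: frob_sum power_mult_distrib coef power_mult[symmetric] mult.commute)

lemma fy2_zero: "F x z = 0 ==> F x y = 0 ==> z ~= y ==> fy2 x z y = 0"
 using fy2[of z y x] by simp

lemma VF_LL: "VF m1 m2 th ap be J g ==> LL (m1 + ap + q * be) (m2 + ap + be) th ap be g"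
 unfolding VF_def by blast

text \<open>The left side is the dimension produced by the two filtrations, the right side the bound
  of \<open>upper\<close>; zz = d - 1, since \<open>thc 1\<close> vanishes at just one point of a
  good fibre.\<close>

lemma Delta_ineq:
 assumes m: "ap * d + be * (q * d) + q + d + card rat_pts \<le> m1" "ap * d + be * d \<le> m2"
 shows "card (M m1) * card (M m2) + (\<Sum>I<ap. card (M (m1 + m2 + 3 * Suc I - d * Suc I)))
  + (\<Sum>J<be. card (M (m1 + q * m2 + 3 * q * Suc J - d * q * Suc J)) + ap * card rat_pts)
  \<le> (d * m1 + ap + q * be + 1) * (d * m2 + ap + be + 1)"
proof -
 have E: "rich (C \<times> C) (VE m1 m2 (thc 1) ap be ap) (card (M m1) * card (M m2) + (\<Sum>I<ap. card (M (m1 + m2 + 3 * Suc I - d * Suc I))))"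
  by (rule E_Delta) (use m q2 in auto)
 have K: "BD d d (gg 1 0)" by (rule BD_mono[OF gg_BD]) auto
 have PK: "Pol (%P. gg 1 0 (P, pw q P))" unfolding gg_def by simp (intro polyfun_intros)
 have S: "P \<in> C & fst P ^ q = fst P & gg 1 0 (P, pw q P) ~= 0 & Fy (fst P ^ q) (snd P ^ q) ~= 0" if "P \<in> rat_pts" for P
 proof -
  have "pw q P = pw 1 P" using that by (simp add: pw_def rat_pts_def)
  then show ?thesis using that gg_graph[of 1 0 P] by (simp add: rat_pts_def)
 qed
 note L = rich_mono[OF F_level[OF Reg_thc[of 1] K gg_V[OF frobQ_1] PK finite_pts(1) S m E order_refl] VF_LL]
 show ?thesis
 proof (rule upper[OF L Reg_thc[of 1], where zz = "d - 1"])
  show "card {y. F (fst P) y = 0 & thc 1 (P, fst P, y) ~= 0} = d - 1" if "P \<in> C" "good (fst P)" for P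
  proof -
   have "{y. F (fst P) y = 0 & thc 1 (P, fst P, y) ~= 0} = {y. F (fst P) y = 0 & y ~= snd P}" by (auto simp: thc_def)
   then show ?thesis using card_roots_except[of "fst P" "snd P"] that by (simp add: C_iff(2))
  qed
  show "card {y. F (fst R) y = 0 & thc 1 ((fst R, y), R) ~= 0} = d - 1" if "R \<in> C" "good (fst R)" for R
   using card_roots_except[of "fst R" "snd R"] that by (simp add: thc_def C_iff(2))
  obtain d' where d': "d = Suc d'" using d_pos by (cases d) auto
  show "(d - 1) * ap + (d - 1) * (q * be) + (d * m1 + ap + q * be + 1) = d * (m1 + ap + q * be) + 1"
   "(d - 1) * ap + (d - 1) * be + (d * m2 + ap + be + 1) = d * (m2 + ap + be) + 1"
   by (simp_all add: d' algebra_simps)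
 qed
qed

text \<open>The same comparison with poles on the residual curve. Now zz = 1: in a good fibre
  \<open>thd\<close> is nonzero at the diagonal point only.\<close>

lemma Y_ineq:
 assumes m: "ap * d + be * (q * d) + q + d + card irrat_pts \<le> m1" "ap * d + be * d + d \<le> m2"
 shows "card (M m1) * card (M m2) + (\<Sum>I<ap. d * (d - 1) * (m1 + m2 + Suc I + 1 - 2 * d))
  + (\<Sum>J<be. card (M (m1 + q * m2 + 3 * q * Suc J - d * q * Suc J)) + ap * card irrat_pts)
  \<le> (d * m1 + (d - 1) * ap + q * be + 1) * (d * m2 + (d - 1) * ap + be + 1)"
proof -
 have E: "rich (C \<times> C) (VE m1 m2 thd ap be ap) (card (M m1) * card (M m2) + (\<Sum>I<ap. d * (d - 1) * (m1 + m2 + Suc I + 1 - 2 * d)))"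
  by (rule E_Y) (use m in auto)
 have K: "BD d d ww" by (rule BD_mono[OF ww_BD]) (use d_pos in auto)
 have PK: "Pol (%P. ww (P, pw q P))" unfolding ww_def by simp (intro polyfun_intros)
 have S: "P \<in> C & fst P ^ q = fst P & ww (P, pw q P) ~= 0 & Fy (fst P ^ q) (snd P ^ q) ~= 0" if "P \<in> irrat_pts" for P
  using that q2 unfolding Fy_frob by (simp add: irrat_pts_def ww_def)
 have m2: "ap * d + be * d \<le> m2" using m by simp
 note L = rich_mono[OF F_level[OF Reg_thd K ww_V PK finite_pts(2) S m(1) m2 E order_refl] VF_LL]
 show ?thesis
 proof (rule upper[OF L Reg_thd, where zz = 1])
  show "card {y. F (fst P) y = 0 & thd (P, fst P, y) ~= 0} = 1" if P: "P \<in> C" "good (fst P)" for P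
  proof -
   have "{y. F (fst P) y = 0 & thd (P, fst P, y) ~= 0} = {snd P}"
    using P good_Fy[of "fst P" "snd P"] fy2_zero[of "fst P" _ "snd P"] by (auto simp: thd_def C_iff(2) Fy_def)
   then show ?thesis by simp
  qed
  show "card {y. F (fst R) y = 0 & thd ((fst R, y), R) ~= 0} = 1" if P: "R \<in> C" "good (fst R)" for R
  proof -
   have "{y. F (fst R) y = 0 & thd ((fst R, y), R) ~= 0} = {snd R}"
    using P good_Fy[of "fst R" "snd R"] fy2_zero[of "fst R" "snd R"] by (auto simp: thd_def C_iff(2) Fy_def)
   then show ?thesis by simp
  qed
  obtain d' where d': "d = Suc d'" using d_pos by (cases d) auto
  show "1 * ap + (d - 1) * (q * be) + (d * m1 + (d - 1) * ap + q * be + 1) = d * (m1 + ap + q * be) + 1"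
   "1 * ap + (d - 1) * be + (d * m2 + (d - 1) * ap + be + 1) = d * (m2 + ap + be) + 1"
   by (simp_all add: d' algebra_simps)
 qed
qed

lemma card_M_real: "real (card (M s)) \<ge> real d * (real s - real d)"
proof -
 have "real (card (M s)) \<ge> real (d * (s + 1 - d))" using card_M_ge by (simp only: of_nat_le_iff)
 moreover have "real d * (real s - real d) \<le> real (d * (s + 1 - d))"
  unfolding of_nat_mult by (intro mult_left_mono) linarith+
 ultimately show ?thesis by linarith
qed

lemma Gamma_sum:
 "(\<Sum>J<be. real (card (M (m + q * m + 3 * q * Suc J - d * q * Suc J)) + ap * N)) \<ge>
  d * (real m + q * real m - d) * be + d * q * (3 - real d) * (be * (real be + 1) / 2) + real ap * be * N"
proof -
 have "(\<Sum>J<be. real (card (M (m + q * m + 3 * q * Suc J - d * q * Suc J)) + ap * N)) \<ge>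
  (\<Sum>J<be. d * (real m + q * real m - d) + d * q * (3 - real d) * real (Suc J) + real ap * N)"
 proof (rule sum_mono)
  fix J
  let ?T = "m + q * m + 3 * q * Suc J - d * q * Suc J"
  have "real ?T \<ge> real m + q * real m + 3 * q * real (Suc J) - d * q * real (Suc J)"
   using real_diff_ge[of "m + q * m + 3 * q * Suc J" "d * q * Suc J"] by (simp add: algebra_simps)
  then have "real d * (real ?T - d) \<ge> real d * (real m + q * real m + 3 * q * real (Suc J) - d * q * real (Suc J) - d)"
   by (intro mult_left_mono) auto
  then show "d * (real m + q * real m - d) + d * q * (3 - real d) * real (Suc J) + real ap * N \<le> real (card (M ?T) + ap * N)"
   using card_M_real[of ?T] by (simp add: algebra_simps)
 qed
 also have "(\<Sum>J<be. d * (real m + q * real m - d) + d * q * (3 - real d) * real (Suc J) + real ap * N) =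
  d * (real m + q * real m - d) * be + d * q * (3 - real d) * (be * (real be + 1) / 2) + real ap * be * N"
  unfolding sum.distrib sum_distrib_left[symmetric] sum_Suc_real by (simp add: algebra_simps)
 finally show ?thesis .
qed

lemma floor_facts:
 assumes "n \<ge> 1" and "A = nat \<lfloor>sqrt (real q) * real n\<rfloor>"
 shows "(real A)\<^sup>2 \<le> real q * (real n)\<^sup>2" "A \<le> q * n"
proof -
 have "real A \<le> sqrt (real q) * real n" unfolding assms(2) by (subst of_nat_nat) auto
 then have "(real A)\<^sup>2 \<le> (sqrt (real q) * real n)\<^sup>2" by (intro power_mono) auto
 also have "\<dots> = real q * (real n)\<^sup>2" by (simp add: power_mult_distrib)
 finally show "(real A)\<^sup>2 \<le> real q * (real n)\<^sup>2" .
 have "real A \<le> sqrt (real q) * real n" by fact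
 also have "\<dots> \<le> real q * real n"
  using q2 by (intro mult_right_mono) (auto intro!: real_le_lsqrt simp: power2_eq_square)
 finally show "A \<le> q * n" by (metis of_nat_le_iff of_nat_mult)
qed

lemma bound_aux:
 fixes D A B Q K g T lin :: real
 assumes "A\<^sup>2 \<le> Q * B\<^sup>2" "0 \<le> A" "A \<le> Q * B" "B \<ge> 1" "D \<ge> 1" "Q \<ge> 1" "g \<ge> 0" "K \<ge> 0"
  and "A * B * T \<le> g * (A\<^sup>2 + Q * B\<^sup>2) + lin"
  and "lin \<le> 2 * D * (K * B) + 2 * D ^ 3 * (K * B) + 2 * D\<^sup>2 * (A + Q * B) + (2 * D * A + Q * B + B) + 1 + 4 * D\<^sup>2 * (A + B) + 2 * D ^ 3 * A"
 shows "T * A \<le> 2 * Q * B * g + (2 * D * K + 2 * D ^ 3 * K + 4 * D\<^sup>2 * Q + 2 * D * Q + Q + 2 + 4 * D\<^sup>2 * (Q + 1) + 2 * D ^ 3 * Q)"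
proof -
 have "lin \<le> 2 * D * (K * B) + 2 * D ^ 3 * (K * B) + 2 * D\<^sup>2 * (Q * B + Q * B) + (2 * D * (Q * B) + Q * B + B) + B + 4 * D\<^sup>2 * (Q * B + B) + 2 * D ^ 3 * (Q * B)"
 proof -
  have "D\<^sup>2 * A \<le> D\<^sup>2 * (Q * B)" "D * A \<le> D * (Q * B)" "D ^ 3 * A \<le> D ^ 3 * (Q * B)" using assms(3,5) by (auto intro!: mult_left_mono)
  then show ?thesis using assms(10,4) unfolding distrib_left by linarith
 qed
 moreover have "g * (A\<^sup>2 + Q * B\<^sup>2) \<le> g * (2 * (Q * B\<^sup>2))" using assms by (intro mult_left_mono) auto
 ultimately have "B * (T * A) \<le> B * (2 * Q * B * g + (2 * D * K + 2 * D ^ 3 * K + 4 * D\<^sup>2 * Q + 2 * D * Q + Q + 2 + 4 * D\<^sup>2 * (Q + 1) + 2 * D ^ 3 * Q))"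
  using assms(9) by (simp add: algebra_simps power2_eq_square)
 then show ?thesis using assms(4) by (subst (asm) mult_le_cancel_left_pos) auto
qed

text \<open>For bidegrees proportional to n the terms in m^2 and m n cancel in
  \<open>Delta_ineq\<close>. There remains A n (N - q - 1) \<le> g (A^2 + q n^2) up to terms linear
  in n, with g the genus of a smooth plane curve of degree \<open>d\<close>; taking A close to sqrt
  q times n balances the right side.\<close>

lemma weil_upper: "real (card rat_pts) \<le> real q + 1 + (real d - 1) * (real d - 2) * sqrt (real q)"
proof -
 define N where "N = card rat_pts"
 \<comment> \<open>Makes m = K n satisfy both degree conditions of \<open>Delta_ineq\<close> for
   every n \<ge> 1.\<close>
 define K where "K = 2 * q * d + q + 2 * d + N + 1"
 define g where "g = (real d - 1) * (real d - 2) / 2"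
 have g0: "g \<ge> 0"
 proof (cases "d = 1")
  case False
  then have "d \<ge> 2" using d_pos by simp
  then show ?thesis unfolding g_def by simp
 qed (simp add: g_def)
 have "real N - real q - 1 \<le> 2 * g * sqrt (real q)"
 proof (rule asymptotic_bound)
  show "real q \<ge> 1" using q2 by simp
  fix n :: nat assume n: "n \<ge> 1"
  define A where "A = nat \<lfloor>sqrt (real q) * real n\<rfloor>"
  note fl = floor_facts[OF n A_def]
  define m where "m = K * n"
  have "A * d \<le> q * n * d" using fl(2) by (rule mult_le_mono1)
  moreover have "q + 2 * d + N + 1 \<le> (q + 2 * d + N + 1) * n"
   using mult_le_mono2[OF n, of "q + 2 * d + N + 1"] by simp
  moreover have "m = 2 * (q * n * d) + (q + 2 * d + N + 1) * n" by (simp add: m_def K_def algebra_simps)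
  moreover have "n * (q * d) = q * n * d" by simp
  moreover have "n * d + d \<le> (q + 2 * d + N + 1) * n"
  proof -
   have "2 * d * n \<le> (q + 2 * d + N + 1) * n" by (rule mult_le_mono1) simp
   moreover have "d * 1 \<le> d * n" by (rule mult_le_mono2[OF n])
   moreover have "n * d = d * n" "2 * d * n = d * n + d * n" by simp_all
   ultimately show ?thesis by linarith
  qed
  ultimately have m1: "A * d + n * (q * d) + q + d + N \<le> m" and m2: "A * d + n * d + d \<le> m"
   by linarith+
  have md: "d \<le> m" using m1 by linarith
  let ?D = "real d" and ?A = "real A" and ?B = "real n" and ?Q = "real q" and ?M = "real m"
  have c1: "(?D * (?M - ?D))\<^sup>2 \<le> real (card (M m) * card (M m))"
   unfolding power2_eq_square of_nat_mult by (intro mult_mono card_M_real) (use md in auto)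
  have "(\<Sum>I<A. real (card (M (m + m + 3 * Suc I - d * Suc I)))) \<ge> (\<Sum>I<A. ?D * (2 * ?M - ?D) + ?D * (3 - ?D) * real (Suc I))"
  proof (rule sum_mono)
   fix I
   let ?T = "m + m + 3 * Suc I - d * Suc I"
   have "real ?T \<ge> 2 * ?M + 3 * real (Suc I) - ?D * real (Suc I)"
    using real_diff_ge[of "m + m + 3 * Suc I" "d * Suc I"] by (simp add: algebra_simps)
   then have "?D * (real ?T - ?D) \<ge> ?D * (2 * ?M + 3 * real (Suc I) - ?D * real (Suc I) - ?D)"
    by (intro mult_left_mono) auto
   then show "?D * (2 * ?M - ?D) + ?D * (3 - ?D) * real (Suc I) \<le> real (card (M ?T))"
    using card_M_real[of ?T] by (simp add: algebra_simps)
  qed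
  then have c2: "(\<Sum>I<A. real (card (M (m + m + 3 * Suc I - d * Suc I)))) \<ge> ?D * (2 * ?M - ?D) * ?A + ?D * (3 - ?D) * (?A * (?A + 1) / 2)"
   unfolding sum.distrib sum_distrib_left[symmetric] sum_Suc_real by (simp add: algebra_simps)
  have "real (card (M m) * card (M m) + (\<Sum>I<A. card (M (m + m + 3 * Suc I - d * Suc I)))
   + (\<Sum>J<n. card (M (m + q * m + 3 * q * Suc J - d * q * Suc J)) + A * N)) \<le> real ((d * m + A + q * n + 1) * (d * m + A + n + 1))"
   using Delta_ineq[of A n m m] m1 add_leD1[OF m2] unfolding N_def of_nat_le_iff by blast
  then have key: "(?D * (?M - ?D))\<^sup>2 + (?D * (2 * ?M - ?D) * ?A + ?D * (3 - ?D) * (?A * (?A + 1) / 2)) +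
   (?D * (?M + ?Q * ?M - ?D) * ?B + ?D * ?Q * (3 - ?D) * (?B * (?B + 1) / 2) + ?A * ?B * real N) \<le>
   (?D * ?M + ?A + ?Q * ?B + 1) * (?D * ?M + ?A + ?B + 1)"
   using c1 c2 Gamma_sum[of m n A N] by (simp only: of_nat_add of_nat_mult of_nat_sum of_nat_1)
  define lin where "lin = 2 * ?D * ?M + 2 * ?D ^ 3 * ?M - ?D ^ 4 + (2 * ?A + ?Q * ?B + ?B) + 1 + ?D\<^sup>2 * (?A + ?B) + ?D * (?D - 3) * (?A + ?Q * ?B) / 2"
  have "?A * ?B * (real N - ?Q - 1) \<le> g * (?A\<^sup>2 + ?Q * ?B\<^sup>2) + lin"
  proof -
   have "g * (?A\<^sup>2 + ?Q * ?B\<^sup>2) + lin - ?A * ?B * (real N - ?Q - 1) = (?D * ?M + ?A + ?Q * ?B + 1) * (?D * ?M + ?A + ?B + 1)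
    - ((?D * (?M - ?D))\<^sup>2 + (?D * (2 * ?M - ?D) * ?A + ?D * (3 - ?D) * (?A * (?A + 1) / 2)) +
   (?D * (?M + ?Q * ?M - ?D) * ?B + ?D * ?Q * (3 - ?D) * (?B * (?B + 1) / 2) + ?A * ?B * real N))"
    unfolding g_def lin_def by (simp add: field_simps power2_eq_square power3_eq_cube power4_eq_xxxx)
   then show ?thesis using key by linarith
  qed
  moreover have "lin \<le> 2 * ?D * (K * ?B) + 2 * ?D ^ 3 * (K * ?B) + 2 * ?D\<^sup>2 * (?A + ?Q * ?B) + (2 * ?D * ?A + ?Q * ?B + ?B) + 1 + 4 * ?D\<^sup>2 * (?A + ?B) + 2 * ?D ^ 3 * ?A"
  proof -
   have "2 * ?D * ?M = 2 * ?D * (K * ?B)" "2 * ?D ^ 3 * ?M = 2 * ?D ^ 3 * (K * ?B)" by (simp_all add: m_def)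
   moreover have "?D * (?D - 3) / 2 \<le> 2 * ?D\<^sup>2" by (simp add: power2_eq_square field_simps)
   then have "?D * (?D - 3) / 2 * (?A + ?Q * ?B) \<le> 2 * ?D\<^sup>2 * (?A + ?Q * ?B)" by (rule mult_right_mono) simp
   then have "?D * (?D - 3) * (?A + ?Q * ?B) / 2 \<le> 2 * ?D\<^sup>2 * (?A + ?Q * ?B)" by simp
   moreover have "?D\<^sup>2 * (?A + ?B) \<le> 4 * ?D\<^sup>2 * (?A + ?B)" by (rule mult_right_mono) auto
   moreover have "2 * ?A \<le> 2 * ?D * ?A" using d_pos by (intro mult_right_mono) auto
   moreover have "?D ^ 4 \<ge> 0" "2 * ?D ^ 3 * ?A \<ge> 0" by simp_all
   ultimately show ?thesis unfolding lin_def by linarith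
  qed
  ultimately show "(real N - ?Q - 1) * real (nat \<lfloor>sqrt ?Q * ?B\<rfloor>) \<le> 2 * ?Q * ?B * g + (2 * ?D * K + 2 * ?D ^ 3 * K + 4 * ?D\<^sup>2 * ?Q + 2 * ?D * ?Q + ?Q + 2 + 4 * ?D\<^sup>2 * (?Q + 1) + 2 * ?D ^ 3 * ?Q)"
   unfolding A_def[symmetric] using fl n d_pos q2 g0
   by (intro bound_aux[where lin = lin]) (auto simp flip: of_nat_mult)
 qed (rule g0)
 then show ?thesis unfolding g_def N_def by simp
qed

text \<open>The main term is the expected intersection number of Frobenius with the residual curve:
  d (q + 1) for the whole of x1 = x2, less q + 1 for the diagonal.\<close>

lemma weil_irrat: "real (card irrat_pts) \<le> (real d - 1) * (real q + 1) + (real d - 1) * (real d - 2) * sqrt (real q)"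
proof -
 define N where "N = card irrat_pts"
 define K where "K = 2 * q * d + q + 2 * d + N + 1"
 define g where "g = (real d - 1) * (real d - 2) / 2"
 have g0: "g \<ge> 0"
 proof (cases "d = 1")
  case False
  then have "d \<ge> 2" using d_pos by simp
  then show ?thesis unfolding g_def by simp
 qed (simp add: g_def)
 have "real N - (real d - 1) * (real q + 1) \<le> 2 * g * sqrt (real q)"
 proof (rule asymptotic_bound)
  show "real q \<ge> 1" using q2 by simp
  fix n :: nat assume n: "n \<ge> 1"
  define A where "A = nat \<lfloor>sqrt (real q) * real n\<rfloor>"
  note fl = floor_facts[OF n A_def]
  define m where "m = K * n"
  have "A * d \<le> q * n * d" using fl(2) by (rule mult_le_mono1)
  moreover have "q + 2 * d + N + 1 \<le> (q + 2 * d + N + 1) * n"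
   using mult_le_mono2[OF n, of "q + 2 * d + N + 1"] by simp
  moreover have "m = 2 * (q * n * d) + (q + 2 * d + N + 1) * n" by (simp add: m_def K_def algebra_simps)
  moreover have "n * (q * d) = q * n * d" by simp
  moreover have "n * d + d \<le> (q + 2 * d + N + 1) * n"
  proof -
   have "2 * d * n \<le> (q + 2 * d + N + 1) * n" by (rule mult_le_mono1) simp
   moreover have "d * 1 \<le> d * n" by (rule mult_le_mono2[OF n])
   moreover have "n * d = d * n" "2 * d * n = d * n + d * n" by simp_all
   ultimately show ?thesis by linarith
  qed
  ultimately have m1: "A * d + n * (q * d) + q + d + N \<le> m" and m2: "A * d + n * d + d \<le> m"
   by linarith+
  have md: "d \<le> m" using m1 by linarith
  let ?D = "real d" and ?A = "real A" and ?B = "real n" and ?Q = "real q" and ?M = "real m"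
  have c1: "(?D * (?M - ?D))\<^sup>2 \<le> real (card (M m) * card (M m))"
   unfolding power2_eq_square of_nat_mult by (intro mult_mono card_M_real) (use md in auto)
  have "(\<Sum>I<A. real (d * (d - 1) * (m + m + Suc I + 1 - 2 * d))) \<ge> (\<Sum>I<A. ?D * (?D - 1) * (2 * ?M - 2 * ?D) + ?D * (?D - 1) * real (Suc I))"
  proof (rule sum_mono)
   fix I
   have "real (m + m + Suc I + 1 - 2 * d) \<ge> 2 * ?M + real (Suc I) - 2 * ?D"
    using real_diff_ge[of "m + m + Suc I + 1" "2 * d"] by simp
   then have "?D * (?D - 1) * real (m + m + Suc I + 1 - 2 * d) \<ge> ?D * (?D - 1) * (2 * ?M + real (Suc I) - 2 * ?D)"
    using d_pos by (intro mult_left_mono) auto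
   moreover have "real (d - 1) = ?D - 1" using d_pos by (simp add: of_nat_diff)
   ultimately show "?D * (?D - 1) * (2 * ?M - 2 * ?D) + ?D * (?D - 1) * real (Suc I) \<le> real (d * (d - 1) * (m + m + Suc I + 1 - 2 * d))"
    unfolding of_nat_mult by (simp add: algebra_simps)
  qed
  then have c2: "(\<Sum>I<A. real (d * (d - 1) * (m + m + Suc I + 1 - 2 * d))) \<ge> ?D * (?D - 1) * (2 * ?M - 2 * ?D) * ?A + ?D * (?D - 1) * (?A * (?A + 1) / 2)"
   unfolding sum.distrib sum_distrib_left[symmetric] sum_Suc_real by (simp add: algebra_simps)
  have D1: "real (d - 1) = ?D - 1" using d_pos by (simp add: of_nat_diff)
  have "real (card (M m) * card (M m) + (\<Sum>I<A. d * (d - 1) * (m + m + Suc I + 1 - 2 * d))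
   + (\<Sum>J<n. card (M (m + q * m + 3 * q * Suc J - d * q * Suc J)) + A * N)) \<le> real ((d * m + (d - 1) * A + q * n + 1) * (d * m + (d - 1) * A + n + 1))"
   using Y_ineq[of A n m m] m1 m2 unfolding N_def of_nat_le_iff by blast
  then have key: "(?D * (?M - ?D))\<^sup>2 + (?D * (?D - 1) * (2 * ?M - 2 * ?D) * ?A + ?D * (?D - 1) * (?A * (?A + 1) / 2)) +
   (?D * (?M + ?Q * ?M - ?D) * ?B + ?D * ?Q * (3 - ?D) * (?B * (?B + 1) / 2) + ?A * ?B * real N) \<le>
   (?D * ?M + (?D - 1) * ?A + ?Q * ?B + 1) * (?D * ?M + (?D - 1) * ?A + ?B + 1)"
   using c1 c2[unfolded of_nat_mult D1] Gamma_sum[of m n A N] by (simp only: of_nat_add of_nat_mult of_nat_sum of_nat_1 D1)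
  define lin where "lin = 2 * ?D * ?M + 2 * ?D ^ 3 * ?M - ?D ^ 4 + (2 * (?D - 1) * ?A + ?Q * ?B + ?B) + 1 + 2 * ?D\<^sup>2 * (?D - 1) * ?A + ?D\<^sup>2 * ?B - ?D * (?D - 1) * ?A / 2 + ?D * (?D - 3) * (?Q * ?B) / 2"
  have "?A * ?B * (real N - (?D - 1) * (?Q + 1)) \<le> g * (?A\<^sup>2 + ?Q * ?B\<^sup>2) + lin"
  proof -
   have "g * (?A\<^sup>2 + ?Q * ?B\<^sup>2) + lin - ?A * ?B * (real N - (?D - 1) * (?Q + 1)) = (?D * ?M + (?D - 1) * ?A + ?Q * ?B + 1) * (?D * ?M + (?D - 1) * ?A + ?B + 1)
    - ((?D * (?M - ?D))\<^sup>2 + (?D * (?D - 1) * (2 * ?M - 2 * ?D) * ?A + ?D * (?D - 1) * (?A * (?A + 1) / 2)) +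
   (?D * (?M + ?Q * ?M - ?D) * ?B + ?D * ?Q * (3 - ?D) * (?B * (?B + 1) / 2) + ?A * ?B * real N))"
    unfolding g_def lin_def by (simp add: field_simps power2_eq_square power3_eq_cube power4_eq_xxxx)
   then show ?thesis using key by linarith
  qed
  moreover have "lin \<le> 2 * ?D * (K * ?B) + 2 * ?D ^ 3 * (K * ?B) + 2 * ?D\<^sup>2 * (?A + ?Q * ?B) + (2 * ?D * ?A + ?Q * ?B + ?B) + 1 + 4 * ?D\<^sup>2 * (?A + ?B) + 2 * ?D ^ 3 * ?A"
  proof -
   have "2 * ?D * ?M = 2 * ?D * (K * ?B)" "2 * ?D ^ 3 * ?M = 2 * ?D ^ 3 * (K * ?B)" by (simp_all add: m_def)
   moreover have "?D * (?D - 3) / 2 \<le> 2 * ?D\<^sup>2" by (simp add: power2_eq_square field_simps)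
   then have "?D * (?D - 3) / 2 * (?Q * ?B) \<le> 2 * ?D\<^sup>2 * (?Q * ?B)" by (rule mult_right_mono) simp
   then have "?D * (?D - 3) * (?Q * ?B) / 2 \<le> 2 * ?D\<^sup>2 * (?Q * ?B)" by simp
   moreover have "2 * ?D\<^sup>2 * (?A + ?Q * ?B) = 2 * ?D\<^sup>2 * ?A + 2 * ?D\<^sup>2 * (?Q * ?B)" by (rule distrib_left)
   moreover have "?D\<^sup>2 * ?B \<le> 4 * ?D\<^sup>2 * (?A + ?B)" by (intro mult_mono) auto
   moreover have "2 * (?D - 1) * ?A \<le> 2 * ?D * ?A" by (intro mult_right_mono) auto
   moreover have "2 * ?D\<^sup>2 * (?D - 1) * ?A \<le> 2 * ?D ^ 3 * ?A" by (intro mult_right_mono) (auto simp: power2_eq_square power3_eq_cube algebra_simps)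
   moreover have "?D ^ 4 \<ge> 0" "?D * (?D - 1) * ?A / 2 \<ge> 0" "2 * ?D\<^sup>2 * ?A \<ge> 0" using d_pos by simp_all
   ultimately show ?thesis unfolding lin_def by linarith
  qed
  ultimately show "(real N - (?D - 1) * (?Q + 1)) * real (nat \<lfloor>sqrt ?Q * ?B\<rfloor>) \<le> 2 * ?Q * ?B * g + (2 * ?D * K + 2 * ?D ^ 3 * K + 4 * ?D\<^sup>2 * ?Q + 2 * ?D * ?Q + ?Q + 2 + 4 * ?D\<^sup>2 * (?Q + 1) + 2 * ?D ^ 3 * ?Q)"
   unfolding A_def[symmetric] using fl n d_pos q2 g0
   by (intro bound_aux[where lin = lin]) (auto simp flip: of_nat_mult)
 qed (rule g0)
 then show ?thesis unfolding g_def N_def by simp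
qed

end

section \<open>All points over rational abscissae and the two-sided bound for monic curves\<close>

lemma rich_vanish1:
 assumes r: "rich \<Omega> V n" and lin: "!!f g c. V f ==> V g ==> V (%z. f z + c * g z)"
 shows "rich \<Omega> (%f. V f & f P = 0) (n - 1)"
proof (cases n)
 case 0
 then show ?thesis by (simp add: rich_def indep_def)
next
 case (Suc m)
 from r obtain be where b: "!!i. i < n ==> V (be i)" "indep \<Omega> {..<n} be" unfolding rich_def by blast
 show ?thesis
 proof (cases "\<forall>i<n. be i P = 0")
  case True
  have "indep \<Omega> {..<m} be"
  proof (rule indepI)
   fix c i assume c: "!!z. z \<in> \<Omega> ==> (\<Sum>i<m. c i * be i z) = 0" and i: "i \<in> {..<m}"
   have "(%i. if i < m then c i else 0) i = 0"
    by (rule indepD[OF b(2)]) (use c i Suc in auto)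
   then show "c i = 0" using i by simp
  qed
  then show ?thesis unfolding rich_def Suc using b(1) True Suc by (intro exI[of _ be]) auto
 next
  case False
  then obtain k where k: "k < n" "be k P ~= 0" by blast
  let ?\<gamma> = "%i z. be i z + (- (be i P / be k P)) * be k z"
  have "rich \<Omega> (%f. V f & f P = 0) (card ({..<n} - {k}))"
  proof (rule richI)
   show "indep \<Omega> ({..<n} - {k}) ?\<gamma>"
   proof (rule indepI)
    fix c i assume c: "!!z. z \<in> \<Omega> ==> (\<Sum>i\<in>{..<n}-{k}. c i * ?\<gamma> i z) = 0" and i: "i \<in> {..<n} - {k}"
    let ?e = "(%i. if i = k then - (\<Sum>i\<in>{..<n}-{k}. c i * (be i P / be k P)) else c i)"
    have "?e i = 0"
    proof (rule indepD[OF b(2)])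
     fix z assume "z \<in> \<Omega>"
     have "(\<Sum>i<n. ?e i * be i z) = ?e k * be k z + (\<Sum>i\<in>{..<n}-{k}. c i * be i z)"
      using k by (subst sum.remove[of _ k]) (auto intro!: sum.cong)
     also have "\<dots> = (\<Sum>i\<in>{..<n}-{k}. c i * ?\<gamma> i z)"
      by (simp add: algebra_simps sum_distrib_left sum_distrib_right sum_subtractf)
     finally show "(\<Sum>i<n. ?e i * be i z) = 0" using c[OF \<open>z \<in> \<Omega>\<close>] by simp
    qed (use i in auto)
    then show "c i = 0" using i by auto
   qed
   fix i assume "i \<in> {..<n} - {k}"
   then have i: "i < n" by simp
   show "V (?\<gamma> i) & ?\<gamma> i P = 0"
    by (rule conjI, rule lin[OF b(1)[OF i] b(1)[OF k(1)]]) (use k in simp)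
  qed simp
  then show ?thesis using k by simp
 qed
qed

lemma rich_vanish:
 assumes "finite S" and r: "rich \<Omega> V n" and lin: "!!f g c. V f ==> V g ==> V (%z. f z + c * g z)"
 shows "rich \<Omega> (%f. V f & (\<forall>P\<in>S. f P = 0)) (n - card S)"
 using assms(1)
proof (induction S rule: finite_induct)
 case empty
 then show ?case using r by simp
next
 case (insert P S)
 have "rich \<Omega> (%f. (V f & (\<forall>P\<in>S. f P = 0)) & f P = 0) (n - card S - 1)"
  by (rule rich_vanish1[OF insert.IH]) (use lin in auto)
 then show ?case using insert by (simp add: conj_commute conj_left_commute conj_assoc)
qed

lemma prod_linear_dvd:
 fixes p :: "'k::field poly"
 assumes "finite A" "!!r. r \<in> A ==> [:-r, 1:] ^ e r dvd p"
 shows "(\<Prod>r\<in>A. [:-r, 1:] ^ e r) dvd p"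
proof (cases "p = 0")
 case False
 show ?thesis using assms
 proof (induction A rule: finite_induct)
  case (insert r A)
  let ?P = "\<Prod>r\<in>A. [:-r, 1:] ^ e r"
  from insert obtain s where s: "p = ?P * s" by (auto simp: dvd_def)
  have "poly ?P r ~= 0" using insert by (auto simp: poly_prod)
  then have "order r ?P = 0" by (simp add: order_root)
  moreover have "order r p = order r ?P + order r s" unfolding s by (rule order_mult) (use False s in auto)
  moreover have "e r \<le> order r p" using insert False by (simp add: order_divides)
  ultimately have "[:-r, 1:] ^ e r dvd s" by (simp add: order_divides)
  then show ?case using insert unfolding s by (simp add: mult.commute mult_dvd_mono)
 qed simp
qed simp

lemma dvd_if_root_powers_dvd:
 fixes p r :: "'k::alg_closed_field poly"
 assumes "p ~= 0" "!!x. [:-x, 1:] ^ order x p dvd r"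
 shows "p dvd r"
proof -
 define A where "A = {x. poly p x = 0}"
 define P where "P = (\<Prod>x\<in>A. [:-x, 1:] ^ order x p)"
 have fin: "finite A" unfolding A_def by (rule poly_roots_finite[OF assms(1)])
 have "P dvd p" unfolding P_def by (rule prod_linear_dvd[OF fin]) (rule order_1)
 then obtain s where s: "p = P * s" by (auto simp: dvd_def)
 have deg: "degree s = 0"
 proof (rule ccontr)
  assume "degree s ~= 0"
  then obtain x where x: "poly s x = 0" using alg_closed_imp_poly_has_root[of s] by auto
  have "poly p x = 0" unfolding s poly_mult using x by simp
  then have xA: "x \<in> A" by (simp add: A_def)
  define k where "k = order x p"
  obtain R where R: "P = [:-x, 1:] ^ k * R"
   using prod.remove[OF fin xA, of "%x. [:-x, 1:] ^ order x p"] by (auto simp: P_def k_def)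
  obtain t where t: "s = [:-x, 1:] * t" using x by (auto simp: poly_eq_0_iff_dvd dvd_def)
  have "p = [:-x, 1:] ^ Suc k * (R * t)" unfolding s R t by (simp only: power_Suc mult_ac)
  then have "[:-x, 1:] ^ Suc k dvd p" by (rule dvdI)
  then show False using order_2[OF assms(1)] unfolding k_def by blast
 qed
 have "s dvd 1" using deg assms(1) s by (metis is_unit_iff_degree mult_zero_right)
 then have "P * s dvd P * 1" by (rule mult_dvd_mono[OF dvd_refl])
 then have "p dvd P" using s by simp
 moreover have "P dvd r" unfolding P_def by (rule prod_linear_dvd[OF fin]) (rule assms(2))
 ultimately show ?thesis by (rule dvd_trans)
qed

lemma poly_eqI_infinite:
 fixes p r :: "'k::idom poly"
 assumes "infinite (UNIV :: 'k set)" "!!y. poly p y = poly r y"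
 shows "p = r"
proof (rule ccontr)
 assume "p ~= r"
 then have "p - r ~= 0" by simp
 from poly_roots_finite[OF this] assms show False by simp
qed

lemma pderiv_sum': "pderiv (\<Sum>i\<in>I. f i) = (\<Sum>i\<in>I. pderiv (f i))"
 by (induction I rule: infinite_finite_induct) (auto simp: pderiv_add)

lemma Pl_poly_fst: assumes "degree p \<le> n" shows "Pl n (%P. poly p (fst P))"
proof -
 have "Pl n (%P. \<Sum>i\<le>degree p. coeff p i * (fst P ^ i * snd P ^ 0))"
  by (intro PF_sum PF_scale) (rule PF_mono[OF Pl_monom], use assms in auto)
 then show ?thesis by (simp add: poly_altdef)
qed

locale frob_curve_ac = frob_curve a d q for a :: "nat => nat => 'k::alg_closed_field" and d q
begin

lemma Fy_pderiv: "Fy x y = poly (pderiv (Fp x)) y"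
proof -
 have "(\<Sum>r<k. y ^ r * y ^ (k - Suc r)) = of_nat k * y ^ (k - 1)" for k
 proof -
  have "(\<Sum>r<k. y ^ r * y ^ (k - Suc r)) = (\<Sum>r<k. y ^ (k - 1))"
   by (intro sum.cong refl) (auto simp flip: power_add)
  then show ?thesis by simp
 qed
 then have "Fy x y = (\<Sum>k\<le>d. \<Sum>j\<le>d-k. a j k * x ^ j * (of_nat k * y ^ (k - 1)))" by (simp add: Fy_def fy2_def)
 also have "\<dots> = poly (pderiv (Fp x)) y"
  unfolding Fp_def pderiv_sum' pderiv_monom poly_sum poly_monom by (simp add: sum_distrib_left sum_distrib_right mult_ac)
 finally show ?thesis .
qed

lemma Fy_Pl: "Pl (d - 1) (%P. Fy (fst P) (snd P))"
 unfolding Fy_def fy2_def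
proof (intro PF_sum)
 fix k j assume k: "k \<in> {..d}" and j: "j \<in> {..d - k}"
 have "Pl (d - 1) (%P. a j k * (\<Sum>r<k. fst P ^ j * snd P ^ (r + (k - Suc r))))"
  by (intro PF_scale PF_sum) (rule PF_mono[OF Pl_monom], use k j in auto)
 moreover have "(%P. a j k * fst P ^ j * (\<Sum>r<k. snd P ^ r * snd P ^ (k - Suc r))) = (%P. a j k * (\<Sum>r<k. fst P ^ j * snd P ^ (r + (k - Suc r))))"
  by (rule ext) (simp only: power_add sum_distrib_left mult.assoc)
 ultimately show "Pl (d - 1) (%P. a j k * fst P ^ j * (\<Sum>r<k. snd P ^ r * snd P ^ (k - Suc r)))" by (simp only:)
qed

definition "all_pts = {P\<in>C. fst P ^ q = fst P & Fy (fst P) (snd P) ~= 0}"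

text \<open>Over each x in F_q, \<open>Fp x\<close> divides the square of its derivative times
  \<phi>: at a point with \<open>Fy\<close> \<noteq> 0 the function \<phi> vanishes, and at a root
  of multiplicity n \<ge> 2 the derivative has multiplicity at least n - 1, where 2 (n - 1) \<ge> n.
  So the normal form is zero over all these x and divisible by the product of the x - x0.\<close>

lemma divide_by_fixed:
 assumes \<phi>: "Pl T \<phi>" and van: "!!P. P \<in> all_pts ==> \<phi> P = 0"
 shows "\<exists>ps. Pl (T + 2 * (d - 1) - q) ps &
  (\<forall>P\<in>C. Fy (fst P) (snd P) ^ 2 * \<phi> P = poly (\<Prod>x\<in>{x. x ^ q = x}. [:-x, 1:]) (fst P) * ps P)"
proof -
 let ?D = "\<Prod>x\<in>{x::'k. x ^ q = x}. [:-x, 1:]"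
 let ?T = "T + 2 * (d - 1)"
 have degD: "degree ?D = q" by (subst degree_prod_eq_sum_degree) (auto simp: card_fix)
 have "Pl ?T (%P. Fy (fst P) (snd P) ^ 2 * \<phi> P)"
  using PF_mult[OF PF_power[OF Fy_Pl, of 2] \<phi>] by (simp add: add.commute)
 from Pl_NF[OF this] obtain c G where G: "Pol G"
  and nf: "!!P. Fy (fst P) (snd P) ^ 2 * \<phi> P = (\<Sum>i\<in>M ?T. c i * mon i P) + F (fst P) (snd P) * G P"
  unfolding NF_def by blast
 define r where "r j = (\<Sum>e\<in>{e. e + j \<le> ?T}. monom (c (j, e)) e)" for j
 have r_sum: "(\<Sum>i\<in>M ?T. c i * mon i P) = (\<Sum>j<d. poly (r j) (fst P) * snd P ^ j)" for P
 proof -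
  have "(\<Sum>i\<in>M ?T. c i * mon i P) = (\<Sum>j<d. \<Sum>e\<in>{e. e + j \<le> ?T}. c (j, e) * mon (j, e) P)"
   unfolding M_def by (subst sum.Sigma) auto
  then show ?thesis by (simp add: r_def poly_sum poly_monom mon_def sum_distrib_right mult.assoc)
 qed
 have slice: "EX p. ALL y. f (x, y) = poly p y" if "Pol f" for f and x :: 'k
 proof -
  from that obtain s where "Pl s f" unfolding polyfun_def by blast
  moreover have "EX p. degree p \<le> 1 & (ALL t. w (x, t) = poly p t)" if "w \<in> {fst, snd}" for w :: "'k \<times> 'k => 'k"
  proof (cases "w = fst")
   case True
   then show ?thesis by (intro exI[of _ "[:x:]"]) simp
  next
   case False
   then show ?thesis using that by (intro exI[of _ "[:0, 1:]"]) simp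
  qed
  ultimately show ?thesis using PF_poly[of "{fst, snd}" s f "%y. (x, y)"] by blast
 qed
 have rz: "poly (r j) x = 0" if x: "x ^ q = x" and j: "j < d" for x j
 proof -
  obtain p where p: "!!y. \<phi> (x, y) = poly p y" using slice[OF polyfunI[OF \<phi>]] by blast
  obtain pG where pG: "!!y. G (x, y) = poly pG y" using slice[OF G] by blast
  define A where "A = (\<Sum>j<d. monom (poly (r j) x) j)"
  have cA: "coeff A n = (if n < d then poly (r n) x else 0)" for n by (simp add: A_def coeff_sum)
  have dA: "degree A < d" using d_pos by (intro degree_lessI) (auto simp: cA)
  have "poly (pderiv (Fp x) ^ 2 * p) y = poly (A + Fp x * pG) y" for y
   using nf[of "(x, y)"] unfolding r_sum by (simp add: Fy_pderiv p pG poly_Fp A_def poly_sum poly_monom)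
  then have eq: "pderiv (Fp x) ^ 2 * p = A + Fp x * pG" by (rule poly_eqI_infinite[OF inf_field])
  have "Fp x dvd pderiv (Fp x) ^ 2 * p"
  proof (rule dvd_if_root_powers_dvd[OF Fp_nz])
   fix y
   let ?n = "order y (Fp x)"
   show "[:-y, 1:] ^ ?n dvd pderiv (Fp x) ^ 2 * p"
   proof (cases "?n \<le> 1")
    case True
    show ?thesis
    proof (cases "Fy x y = 0 | ?n = 0")
     case True
     show ?thesis
     proof (cases "?n = 0")
      case False
      then have "Fy x y = 0" using True by simp
      then have "[:-y, 1:] dvd pderiv (Fp x)" by (simp add: Fy_pderiv poly_eq_0_iff_dvd)
      then have "[:-y, 1:] ^ ?n dvd pderiv (Fp x)" 
      proof -
       have "?n = 1" using \<open>?n \<le> 1\<close> False by linarith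
       then show "[:-y, 1:] dvd pderiv (Fp x) ==> [:-y, 1:] ^ ?n dvd pderiv (Fp x)" by (simp only: power_one_right)
      qed
      then show ?thesis unfolding power2_eq_square by (intro dvd_mult2)
     qed simp
    next
     case F: False
     then have "poly (Fp x) y = 0" using order_root[of "Fp x" y] by simp
     then have "(x, y) \<in> all_pts" using x F by (simp add: all_pts_def C_iff poly_Fp)
     then have "poly p y = 0" using van[of "(x, y)"] p by simp
     then have "[:-y, 1:] dvd p" by (simp add: poly_eq_0_iff_dvd)
     moreover have "?n = 1" using F True by linarith
     ultimately show ?thesis by simp
    qed
   next
    case False
    then obtain k where k: "?n = Suc k" "k \<ge> 1" by (cases ?n) auto
    have "[:-y, 1:] ^ Suc k dvd Fp x" using order_1[of y "Fp x"] unfolding k .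
    then obtain s where s: "Fp x = [:-y, 1:] ^ Suc k * s" by (rule dvdE)
    have "[:-y, 1:] ^ k dvd pderiv (Fp x)" 
     unfolding s pderiv_mult pderiv_power_Suc 
     by (rule dvd_add, rule dvd_mult2, rule le_imp_power_dvd, simp, rule dvd_mult, rule dvd_mult2, rule dvd_smult, rule dvd_refl)
    then have "([:-y, 1:] ^ k) ^ 2 dvd pderiv (Fp x) ^ 2" by (rule dvd_power_same)
    moreover have "[:-y, 1:] ^ ?n dvd ([:-y, 1:] ^ k) ^ 2" unfolding k power_mult[symmetric] by (rule le_imp_power_dvd) (use k in simp)
    ultimately have "[:-y, 1:] ^ ?n dvd pderiv (Fp x) ^ 2" by (rule dvd_trans[rotated])
    then show ?thesis by (rule dvd_mult2)
   qed
  qed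
  then have "Fp x dvd A" unfolding eq by (simp add: dvd_add_left_iff)
  then have "A = 0" using dA degree_Fp[of x] dvd_imp_degree_le[of "Fp x" A] by (cases "A = 0") auto
  then show ?thesis using cA[of j] j by simp
 qed
 have "EX b. r j = ?D * b" if "j < d" for j
 proof -
  have "(\<Prod>x\<in>{x. x ^ q = x}. [:-x, 1:] ^ 1) dvd r j"
   by (rule prod_linear_dvd[OF fixed_finite]) (use rz[OF _ that] in \<open>simp add: poly_eq_0_iff_dvd\<close>)
  then show ?thesis by (simp add: dvd_def)
 qed
 then have "\<forall>j\<in>{..<d}. EX b. r j = ?D * b" by blast
 from bchoice[OF this] obtain b where b: "!!j. j < d ==> r j = ?D * b j" by blast
 define ps where "ps P = (\<Sum>j<d. poly (b j) (fst P) * snd P ^ j)" for P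
 have "Pl (?T - q) ps" unfolding ps_def
 proof (intro PF_sum)
  fix j assume "j \<in> {..<d}"
  then have j: "j < d" by simp
  show "Pl (?T - q) (%P. poly (b j) (fst P) * snd P ^ j)"
  proof (cases "b j = 0")
   case True
   then show ?thesis by (simp add: PF_const)
  next
   case False
   have Dnz: "?D ~= 0" using degD q2 by (metis degree_0 not_numeral_le_zero)
   have nz: "r j ~= 0" unfolding b[OF j] using False Dnz by (simp only: mult_eq_0_iff simp_thms not_False_eq_True)
   have "degree (r j) + j \<le> ?T"
   proof -
    have "coeff (r j) n = (if n + j \<le> ?T then c (j, n) else 0)" for n by (auto simp: r_def coeff_sum)
    then have "degree (r j) + j \<le> ?T" using nz leading_coeff_0_iff[of "r j"] by (metis)
    then show ?thesis .
   qed
   moreover have "degree (r j) = q + degree (b j)" unfolding b[OF j] using degree_mult_eq[OF Dnz False] degD by simp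
   ultimately have le: "degree (b j) + 1 * j * 1 \<le> ?T - q" by linarith
   show ?thesis
    using PF_mono[OF PF_mult[OF Pl_poly_fst[of "b j" "degree (b j)"] PF_power[OF Pl_snd, of j]], of "?T - q"] le by simp
  qed
 qed
 moreover have "Fy (fst P) (snd P) ^ 2 * \<phi> P = poly ?D (fst P) * ps P" if "P \<in> C" for P
 proof -
  have "Fy (fst P) (snd P) ^ 2 * \<phi> P = (\<Sum>j<d. poly (r j) (fst P) * snd P ^ j)" using nf[of P] that unfolding r_sum by (simp add: C_iff(2))
  also have "\<dots> = poly ?D (fst P) * ps P" unfolding ps_def sum_distrib_left by (intro sum.cong refl) (simp add: b mult.assoc)
  finally show ?thesis .
 qed
 ultimately show ?thesis by blast
qed

text \<open>Too few points would leave a large space of functions of degree q + d vanishing at them.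
  Dividing out the q rational abscissae embeds this space into the functions of degree d + 2 (d -
  1).\<close>

lemma all_pts_ge: "d * q \<le> card all_pts + 2 * d * (d - 1)"
proof -
 let ?D = "\<Prod>x\<in>{x::'k. x ^ q = x}. [:-x, 1:]"
 let ?T = "q + d"
 have fin: "finite all_pts" by (rule finite_subset[OF _ finite_over_fixed]) (auto simp: all_pts_def)
 have "rich C (Pl ?T) (card (M ?T))" by (rule richI[OF _ indep_mon']) (auto intro: mon_Pl')
 from rich_vanish[OF fin this] have "rich C (%f. Pl ?T f & (\<forall>P\<in>all_pts. f P = 0)) (card (M ?T) - card all_pts)"
  using PF_add[OF _ PF_scale] by blast
 then obtain be where b: "!!i. i < card (M ?T) - card all_pts ==> Pl ?T (be i) & (\<forall>P\<in>all_pts. be i P = 0)"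
  "indep C {..<card (M ?T) - card all_pts} be" unfolding rich_def by blast
 let ?n = "card (M ?T) - card all_pts"
 have "\<forall>i\<in>{..<?n}. \<exists>ps. Pl (?T + 2 * (d - 1) - q) ps & (\<forall>P\<in>C. Fy (fst P) (snd P) ^ 2 * be i P = poly ?D (fst P) * ps P)"
  using divide_by_fixed[of ?T] b(1) by blast
 from bchoice[OF this] obtain ps where psi: "!!i. i < ?n ==> Pl (?T + 2 * (d - 1) - q) (ps i)"
  "!!i P. i < ?n ==> P \<in> C ==> Fy (fst P) (snd P) ^ 2 * be i P = poly ?D (fst P) * ps i P" by blast
 have "indep C {..<?n} ps"
 proof (rule indepI)
  fix c i assume c: "!!z. z \<in> C ==> (\<Sum>i<?n. c i * ps i z) = 0" and i: "i \<in> {..<?n}"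
  let ?s = "%z. \<Sum>i<?n. c i * be i z"
  have Ps: "Pol ?s" by (intro polyfun_sum polyfun_mult polyfun_const) (use b(1) polyfunI in blast)
  have z: "Fy (fst P) (snd P) ^ 2 * ?s P = 0" if "P \<in> C" for P
  proof -
   have "Fy (fst P) (snd P) ^ 2 * ?s P = (\<Sum>i<?n. c i * (Fy (fst P) (snd P) ^ 2 * be i P))"
    by (simp add: sum_distrib_left mult.left_commute)
   also have "\<dots> = poly ?D (fst P) * (\<Sum>i<?n. c i * ps i P)"
    unfolding sum_distrib_left by (intro sum.cong refl) (simp add: psi(2) that mult.left_commute)
   finally show ?thesis using c[OF that] by simp
  qed
  have "?s P = 0" if "P \<in> C" for P
  proof (rule dense[OF Ps _ _ that])
   show "finite {x. ~ good x}" using cofin by (simp add: good_def)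
   show "?s P = 0" if "P \<in> C" "fst P \<notin> {x. ~ good x}" for P
    using z[OF that(1)] good_Fy[of "fst P" "snd P"] that by (simp add: C_iff(2))
  qed
  then show "c i = 0" using indepD[OF b(2), of c i] i by blast
 qed
 then have "rich C (Pl (?T + 2 * (d - 1) - q)) ?n" unfolding rich_def using psi(1) by blast
 then have "?n \<le> card (M (?T + 2 * (d - 1) - q))" by (rule rich_le_spanned) (auto intro: Pl_spanned)
 also have "?T + 2 * (d - 1) - q = d + 2 * (d - 1)" by simp
 also have "card (M (d + 2 * (d - 1))) = card (M d) + d * (2 * (d - 1))" by (rule card_M_add) simp
 finally have "?n \<le> card (M d) + d * (2 * (d - 1))" .
 moreover have "card (M ?T) = card (M d) + d * q" using card_M_add[of d q] by (simp add: add.commute)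
 ultimately show ?thesis by simp
qed

lemma all_pts_split: "card all_pts = card rat_pts + card irrat_pts"
proof -
 have "all_pts = rat_pts \<union> irrat_pts" "rat_pts \<inter> irrat_pts = {}" by (auto simp: all_pts_def rat_pts_def irrat_pts_def)
 then show ?thesis using finite_pts by (simp add: card_Un_disjoint)
qed

lemma multiple_roots: "card {y. F x y = 0 & Fy x y ~= 0} + 2 * card {y. F x y = 0 & Fy x y = 0} \<le> d"
proof -
 let ?A = "{y. F x y = 0 & Fy x y ~= 0}" and ?B = "{y. F x y = 0 & Fy x y = 0}"
 let ?e = "%y. if Fy x y = 0 then 2 else 1 :: nat"
 have fin: "finite ?A" "finite ?B" "finite {y. F x y = 0}" using finite_roots[of x] by (auto intro: finite_subset)
 let ?P = "\<Prod>y\<in>{y. F x y = 0}. [:-y, 1:] ^ ?e y"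
 have "?P dvd Fp x"
 proof (rule prod_linear_dvd[OF fin(3)])
  fix y assume "y \<in> {y. F x y = 0}"
  then have "[:-y, 1:] dvd Fp x" by (simp add: poly_Fp flip: poly_eq_0_iff_dvd)
  moreover have "[:-y, 1:] ^ 2 dvd Fp x" if "Fy x y = 0"
  proof -
   from calculation obtain s where s: "Fp x = [:-y, 1:] * s" by (auto simp: dvd_def)
   have "poly (pderiv (Fp x)) y = poly s y" unfolding s pderiv_mult poly_add poly_mult by (simp add: pderiv_pCons)
   then have "[:-y, 1:] dvd s" using that by (simp add: Fy_pderiv poly_eq_0_iff_dvd)
   then show ?thesis unfolding s power2_eq_square by (rule mult_dvd_mono[OF dvd_refl])
  qed
  ultimately show "[:-y, 1:] ^ ?e y dvd Fp x" by simp
 qed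
 from dvd_imp_degree_le[OF this Fp_nz] have "degree ?P \<le> d" unfolding degree_Fp .
 moreover have "degree ?P = (\<Sum>y\<in>{y. F x y = 0}. ?e y)"
  by (subst degree_prod_eq_sum_degree) (auto simp: degree_linear_power)
 moreover have "(\<Sum>y\<in>{y. F x y = 0}. ?e y) = (\<Sum>y\<in>?A. ?e y) + (\<Sum>y\<in>?B. ?e y)"
 proof -
  have AB: "{y. F x y = 0} = ?A \<union> ?B" by auto
  show ?thesis unfolding AB by (rule sum.union_disjoint[OF fin(1,2)]) auto
 qed
 moreover have "(\<Sum>y\<in>?A. ?e y) = card ?A" "(\<Sum>y\<in>?B. ?e y) = 2 * card ?B" by simp_all
 ultimately show ?thesis by linarith
qed

lemma sing_pts: "card all_pts + 2 * card {P\<in>C. fst P ^ q = fst P & Fy (fst P) (snd P) = 0} \<le> d * q"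
proof -
 let ?A = "%x. {y. F x y = 0 & Fy x y ~= 0}" and ?B = "%x. {y. F x y = 0 & Fy x y = 0}"
 have fin: "finite (?A x)" "finite (?B x)" for x using finite_roots[of x] by (auto intro: finite_subset)
 have "all_pts = Sigma {x. x ^ q = x} ?A" by (auto simp: all_pts_def C_iff)
 then have 1: "card all_pts = (\<Sum>x\<in>{x. x ^ q = x}. card (?A x))" by (simp add: card_SigmaI fin fixed_finite)
 have "{P\<in>C. fst P ^ q = fst P & Fy (fst P) (snd P) = 0} = Sigma {x. x ^ q = x} ?B" by (auto simp: C_iff)
 then have 2: "card {P\<in>C. fst P ^ q = fst P & Fy (fst P) (snd P) = 0} = (\<Sum>x\<in>{x. x ^ q = x}. card (?B x))"
  by (simp add: card_SigmaI fin fixed_finite)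
 have "card all_pts + 2 * card {P\<in>C. fst P ^ q = fst P & Fy (fst P) (snd P) = 0} = (\<Sum>x\<in>{x. x ^ q = x}. card (?A x) + 2 * card (?B x))"
  unfolding 1 2 by (simp add: sum.distrib sum_distrib_left)
 also have "\<dots> \<le> (\<Sum>x\<in>{x::'k. x ^ q = x}. d)" by (rule sum_mono) (rule multiple_roots)
 also have "\<dots> = d * q" by (simp add: card_fix mult.commute)
 finally show ?thesis .
qed

text \<open>The lower bound is the total from \<open>all_pts_ge\<close> minus the upper bound for
  \<open>irrat_pts\<close>. Points with \<open>Fy\<close> = 0 number at most d (d - 1), by comparing
  \<open>all_pts_ge\<close> with \<open>sing_pts\<close>.\<close>

theorem weil_monic:
 "\<bar>real (card {P\<in>C. fst P ^ q = fst P & snd P ^ q = snd P}) - real q\<bar>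
  \<le> (real d - 1) * (real d - 2) * sqrt (real q) + 2 * (real d)\<^sup>2 - real d"
proof -
 let ?N = "{P\<in>C. fst P ^ q = fst P & snd P ^ q = snd P}"
 let ?S = "{P\<in>C. fst P ^ q = fst P & Fy (fst P) (snd P) = 0}"
 have fS: "finite ?S" by (rule finite_subset[OF _ finite_over_fixed]) auto
 have fN: "finite ?N" by (rule finite_subset[OF _ finite_over_fixed]) auto
 have "?N \<subseteq> rat_pts \<union> ?S" by (auto simp: rat_pts_def)
 then have up: "card ?N \<le> card rat_pts + card ?S"
  using card_mono[of "rat_pts \<union> ?S" ?N] fS finite_pts card_Un_le[of rat_pts ?S] by simp
 have lo: "card rat_pts \<le> card ?N" by (rule card_mono[OF fN]) (auto simp: rat_pts_def)
 have "2 * card ?S \<le> 2 * d * (d - 1)" using all_pts_ge sing_pts by linarith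
 then have cS: "real (card ?S) \<le> real d * (real d - 1)"
 proof -
  assume "2 * card ?S \<le> 2 * d * (d - 1)"
  then have "card ?S \<le> d * (d - 1)" by simp
  then have "real (card ?S) \<le> real (d * (d - 1))" by (simp only: of_nat_le_iff)
  then show ?thesis using d_pos by (simp add: of_nat_diff)
 qed
 have "real (d * q) \<le> real (card all_pts + 2 * d * (d - 1))" using all_pts_ge by (simp only: of_nat_le_iff)
 then have tot: "real d * real q \<le> real (card rat_pts) + real (card irrat_pts) + 2 * real d * (real d - 1)"
  using d_pos by (simp add: all_pts_split of_nat_diff)
 have d1: "real d \<ge> 1" using d_pos by simp
 have dd: "real d * (real d - 1) + 1 \<le> 2 * (real d)\<^sup>2 - real d"
  using mult_mono[OF d1 d1] by (simp add: power2_eq_square algebra_simps)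
 have "real (card ?N) \<le> real q + 1 + (real d - 1) * (real d - 2) * sqrt (real q) + real d * (real d - 1)"
  using up weil_upper cS by linarith
 then have u: "real (card ?N) - real q \<le> (real d - 1) * (real d - 2) * sqrt (real q) + 2 * (real d)\<^sup>2 - real d"
  using dd by linarith
 have "real (card ?N) \<ge> real d * real q - 2 * real d * (real d - 1) - ((real d - 1) * (real q + 1) + (real d - 1) * (real d - 2) * sqrt (real q))"
  using lo tot weil_irrat by linarith
 moreover have "real d * real q - 2 * real d * (real d - 1) - (real d - 1) * (real q + 1) = real q - (2 * (real d)\<^sup>2 - real d - 1)"
  by (simp add: algebra_simps power2_eq_square)
 ultimately show ?thesis using u by linarith
qed

end

section \<open>Polynomial functions along lines\<close>

text \<open>Common setting for the plane, as pairs, and for affine space, as vectors;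
  \<open>ln z v t\<close> is the point z + t v.\<close>

locale lin_coords =
 fixes Xs :: "('v => 'k::field) set" and ln :: "'v => 'v => 'k => 'v" and o0 :: 'v
 assumes lin: "!!x z v t. x \<in> Xs ==> x (ln z v t) = x z + t * x v"
  and zero: "!!x. x \<in> Xs ==> x o0 = 0"
  and sep: "!!z w. (!!x. x \<in> Xs ==> x z = x w) ==> z = w"
  and ex_dir: "!!z w. EX v. ln z v 1 = w"
  and inf_field: "infinite (UNIV :: 'k set)"
begin

lemma ln_0 [simp]: "ln z v 0 = z" by (rule sep) (simp add: lin)
lemma ln_o0 [simp]: "ln o0 v 1 = v" by (rule sep) (simp add: lin zero)

lemma PF_line:
 assumes "PF Xs s f" shows "EX p. degree p \<le> s & (ALL t. f (ln z v t) = poly p t)"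
proof -
 have "EX p. degree p \<le> 1 & (ALL t. x (ln z v t) = poly p t)" if "x \<in> Xs" for x
  using that by (intro exI[of _ "[:x z, x v:]"]) (simp add: lin)
 then show ?thesis using PF_poly[OF assms, of "ln z v"] by blast
qed

lemma PF_0: assumes "PF Xs 0 f" shows "f z = f w"
proof -
 obtain v where v: "ln z v 1 = w" using ex_dir by blast
 from PF_line[OF assms, of z v] obtain p where p: "degree p \<le> 0" "!!t. f (ln z v t) = poly p t" by blast
 then obtain c where "p = [:c:]" by (metis degree_eq_zeroE le_zero_eq)
 then show ?thesis using p(2)[of 0] p(2)[of 1] v by simp
qed

lemma PF_domain:
 assumes "PF Xs s f" "PF Xs t g" "f z ~= 0" "g w ~= 0"
 shows "EX y. f y ~= 0 & g y ~= 0"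
proof -
 obtain v where v: "ln z v 1 = w" using ex_dir by blast
 from PF_line[OF assms(1), of z v] obtain p where p: "!!t. f (ln z v t) = poly p t" by blast
 from PF_line[OF assms(2), of z v] obtain r where r: "!!t. g (ln z v t) = poly r t" by blast
 have "p ~= 0" using p[of 0] assms(3) by auto
 moreover have "r ~= 0" using r[of 1] assms(4) v by auto
 ultimately have "p * r ~= 0" by simp
 then obtain t where "poly (p * r) t ~= 0" using poly_roots_finite inf_field by (metis (mono_tags, lifting) UNIV_eq_I mem_Collect_eq)
 then show ?thesis using p r by (intro exI[of _ "ln z v t"]) auto
qed

text \<open>\<open>D i z v\<close> is the i-th Hasse derivative at \<open>z\<close> in direction
  \<open>v\<close>, meaningful in every characteristic.\<close>

lemma taylor:
 assumes "PF Xs s f"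
 shows "EX D. (ALL z v t. f (ln z v t) = (\<Sum>i\<le>s. t ^ i * D i z v)) & (ALL i v. PF Xs (s - i) (%z. D i z v)) &
  (ALL i z. PF Xs i (%v. D i z v)) & (ALL i z v. i > s --> D i z v = 0)"
 using assms
proof (induction rule: PF.induct)
 case (PF_const s c)
 have "(\<Sum>i\<le>s. t ^ i * (if i = 0 then c else 0)) = c" for t :: 'k by (simp add: sum.delta if_distrib cong: if_cong)
 then show ?case by (intro exI[of _ "%i z v. if i = 0 then c else 0"]) (auto intro: PF.PF_const)
next
 case (PF_coord x s f)
 then obtain D where D: "!!z v t. f (ln z v t) = (\<Sum>i\<le>s. t ^ i * D i z v)" "!!i v. PF Xs (s - i) (%z. D i z v)"
  "!!i z. PF Xs i (%v. D i z v)" "!!i z v. i > s ==> D i z v = 0" by blast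
 define D' where "D' i z v = x z * D i z v + (if i = 0 then 0 else x v * D (i - 1) z v)" for i z v
 have 1: "x (ln z v t) * f (ln z v t) = (\<Sum>i\<le>Suc s. t ^ i * D' i z v)" for z v t
 proof -
  have "(\<Sum>i\<le>Suc s. t ^ i * D' i z v) = (\<Sum>i\<le>Suc s. t ^ i * (x z * D i z v)) + (\<Sum>i\<le>Suc s. t ^ i * (if i = 0 then 0 else x v * D (i - 1) z v))"
   by (simp only: D'_def distrib_left sum.distrib)
  also have "(\<Sum>i\<le>Suc s. t ^ i * (x z * D i z v)) = x z * (\<Sum>i\<le>s. t ^ i * D i z v)"
   by (simp add: D(4) sum_distrib_left mult.left_commute)
  also have "(\<Sum>i\<le>Suc s. t ^ i * (if i = 0 then 0 else x v * D (i - 1) z v)) = t * x v * (\<Sum>i\<le>s. t ^ i * D i z v)"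
   by (subst sum.atMost_Suc_shift) (simp add: sum_distrib_left mult_ac)
  finally show ?thesis by (simp add: lin PF_coord(1) D(1) distrib_right)
 qed
 have 2: "PF Xs (Suc s - i) (%z. D' i z v)" for i v
 proof (cases "i > s")
  case True
  then have "D' i z v = (if i = 0 then 0 else x v * D (i - 1) z v)" for z by (simp add: D'_def D(4))
  moreover have "PF Xs (s - (i - 1)) (%z. x v * D (i - 1) z v)" by (rule PF_scale[OF D(2)])
  ultimately show ?thesis using True by (cases i) simp_all
 next
  case False
  have "PF Xs (Suc (s - i)) (%z. x z * D i z v)" by (rule PF.PF_coord[OF PF_coord(1) D(2)])
  moreover have "Suc (s - i) = Suc s - i" using False by simp
  moreover have "PF Xs (Suc s - i) (%z. if i = 0 then 0 else x v * D (i - 1) z v)"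
  proof (cases i)
   case (Suc j)
   then show ?thesis using PF_scale[OF D(2)[of j v], of "x v"] by simp
  qed (simp add: PF.PF_const)
  ultimately show ?thesis unfolding D'_def by (intro PF_add) simp_all
 qed
 have 3: "PF Xs i (%v. D' i z v)" for i z
  unfolding D'_def
 proof (rule PF_add)
  show "PF Xs i (%v. x z * D i z v)" by (rule PF_scale[OF D(3)])
  show "PF Xs i (%v. if i = 0 then 0 else x v * D (i - 1) z v)"
  proof (cases i)
   case (Suc j)
   then show ?thesis using PF.PF_coord[OF PF_coord(1) D(3)[of j z]] by simp
  qed (simp add: PF.PF_const)
 qed
 have 4: "D' i z v = 0" if "i > Suc s" for i z v using that by (simp add: D'_def D(4))
 show ?case using 1 2 3 4 by (intro exI[of _ D'] conjI allI impI) blast+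
next
 case (PF_add s f g)
 from PF_add(3) obtain D where D: "!!z v t. f (ln z v t) = (\<Sum>i\<le>s. t ^ i * D i z v)" "!!i v. PF Xs (s - i) (%z. D i z v)"
  "!!i z. PF Xs i (%v. D i z v)" "!!i z v. i > s ==> D i z v = 0"
  by blast
 from PF_add(4) obtain E where E: "!!z v t. g (ln z v t) = (\<Sum>i\<le>s. t ^ i * E i z v)" "!!i v. PF Xs (s - i) (%z. E i z v)"
  "!!i z. PF Xs i (%v. E i z v)" "!!i z v. i > s ==> E i z v = 0" by blast
 show ?case
 proof (intro exI[of _ "%i z v. D i z v + E i z v"] conjI allI impI)
  show "f (ln z v t) + g (ln z v t) = (\<Sum>i\<le>s. t ^ i * (D i z v + E i z v))" for z v t
   by (simp add: D E distrib_left sum.distrib)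
 qed (auto intro: PF.PF_add D E simp: D(4) E(4))
qed

lemma top_nonzero:
 assumes D: "!!z v t. f (ln z v t) = (\<Sum>i\<le>s. t ^ i * D i z v)" "!!i v. PF Xs (s - i) (%z. D i z v)" "!!i z. PF Xs i (%v. D i z v)"
  and s: "s = 0 | ~ PF Xs (s - 1) f" and nz: "f w ~= 0"
 shows "EX v. ALL z. D s z v ~= 0"
proof -
 have const: "D s z v = D s o0 v" for z v using PF_0[of "%z. D s z v" z o0] D(2)[of s v] by simp
 have "EX v. D s o0 v ~= 0"
 proof (rule ccontr)
  assume "~ ?thesis"
  then have z: "D s o0 v = 0" for v by blast
  have fv: "f v = (\<Sum>i\<le>s. D i o0 v)" for v using D(1)[of o0 v 1] by simp
  show False
  proof (cases s)
   case 0
   then show False using fv[of w] z nz by simp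
  next
   case (Suc r)
   then have "f = (%v. \<Sum>i\<le>r. D i o0 v)" using fv z by auto
   moreover have "PF Xs r (%v. \<Sum>i\<le>r. D i o0 v)" by (rule PF_sum) (rule PF_mono[OF D(3)], simp)
   ultimately show False using s Suc by simp
  qed
 qed
 then show ?thesis using const by metis
qed

lemma exact_degree:
 assumes "PF Xs r f" obtains s where "PF Xs s f" "s = 0 | ~ PF Xs (s - 1) f" "s \<le> r"
proof -
 define s where "s = (LEAST s. PF Xs s f)"
 have "PF Xs s f" unfolding s_def by (rule LeastI[of _ r]) (rule assms)
 moreover have "s \<le> r" unfolding s_def by (rule Least_le) (rule assms)
 moreover have "~ PF Xs (s - 1) f" if "s ~= 0" using not_less_Least[of "s - 1" "%s. PF Xs s f"] that unfolding s_def by simp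
 ultimately show thesis using that[of s] by (cases "s = 0") simp_all
qed

lemma exact_degree_poly:
 assumes "PF Xs s f" "s = 0 | ~ PF Xs (s - 1) f" "f w ~= 0"
 shows "EX T. PF Xs s T & (EX v. T v ~= 0) & (ALL z v. EX p. (ALL t. f (ln z v t) = poly p t) & degree p \<le> s & coeff p s = T v)"
proof -
 from taylor[OF assms(1)] obtain D where D: "!!z v t. f (ln z v t) = (\<Sum>i\<le>s. t ^ i * D i z v)" "!!i v. PF Xs (s - i) (%z. D i z v)"
  "!!i z. PF Xs i (%v. D i z v)" by blast
 from top_nonzero[OF D assms(2,3)] obtain v0 where v0: "!!z. D s z v0 ~= 0" by blast
 have const: "D s z v = D s o0 v" for z v using PF_0[of "%z. D s z v" z o0] D(2)[of s v] by simp
 have "EX p. (ALL t. f (ln z v t) = poly p t) & degree p \<le> s & coeff p s = D s o0 v" for z v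
 proof (intro exI[of _ "\<Sum>i\<le>s. monom (D i z v) i"] conjI allI)
  have cf: "coeff (\<Sum>i\<le>s. monom (D i z v) i) n = (if n \<le> s then D n z v else 0)" for n by (simp add: coeff_sum)
  show "f (ln z v t) = poly (\<Sum>i\<le>s. monom (D i z v) i) t" for t by (simp add: D(1) poly_sum poly_monom mult.commute)
  show "degree (\<Sum>i\<le>s. monom (D i z v) i) \<le> s" by (rule degree_le) (simp add: cf)
  show "coeff (\<Sum>i\<le>s. monom (D i z v) i) s = D s o0 v" using cf[of s] const by simp
 qed
 then show ?thesis using v0[of o0] D(3)[of s o0] by (intro exI[of _ "%v. D s o0 v"] conjI exI[of _ v0]) blast+
qed

text \<open>There is a direction in which both leading forms are nonzero; on the line through the
  origin in that direction the exact degrees add up.\<close>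

lemma degree_additive:
 assumes fg: "PF Xs r (%z. f z * g z)" and f: "PF Xs r1 f" "f w1 ~= 0" and g: "PF Xs r2 g" "g w2 ~= 0"
 shows "EX s t. s + t \<le> r & PF Xs s f & PF Xs t g"
proof -
 obtain s where s: "PF Xs s f" "s = 0 | ~ PF Xs (s - 1) f" by (rule exact_degree[OF f(1)])
 obtain t where t: "PF Xs t g" "t = 0 | ~ PF Xs (t - 1) g" by (rule exact_degree[OF g(1)])
 from exact_degree_poly[OF s f(2)] obtain T v where T: "PF Xs s T" "T v ~= 0"
  "!!z v. EX p. (ALL t. f (ln z v t) = poly p t) & degree p \<le> s & coeff p s = T v" by blast
 from exact_degree_poly[OF t g(2)] obtain U v' where U: "PF Xs t U" "U v' ~= 0"
  "!!z v. EX p. (ALL x. g (ln z v x) = poly p x) & degree p \<le> t & coeff p t = U v" by blast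
 from PF_domain[OF T(1) U(1) T(2) U(2)] obtain y where y: "T y ~= 0" "U y ~= 0" by blast
 from T(3)[of o0 y] obtain p where p: "!!x. f (ln o0 y x) = poly p x" "degree p \<le> s" "coeff p s = T y" by blast
 from U(3)[of o0 y] obtain p' where p': "!!x. g (ln o0 y x) = poly p' x" "degree p' \<le> t" "coeff p' t = U y" by blast
 from PF_line[OF fg, of o0 y] obtain R where R: "degree R \<le> r" "!!x. f (ln o0 y x) * g (ln o0 y x) = poly R x" by blast
 have "R = p * p'" by (rule poly_eqI_infinite[OF inf_field]) (simp add: R(2)[symmetric] p(1) p'(1))
 moreover have "degree p = s" "degree p' = t" "p ~= 0" "p' ~= 0"
  using p p' y by (auto intro!: antisym le_degree)
 ultimately have "s + t \<le> r" using R(1) degree_mult_eq[of p p'] by simp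
 then show ?thesis using s t by blast
qed

end

section \<open>Linear systems with polynomial coefficients\<close>

text \<open>Replaces the rank over the fraction field of a domain of functions. Elimination is
  fraction-free with a pivot \<open>M j u\<close> that is not the zero function, and multiplying
  \<open>r\<close> by the pivot keeps it nonzero at the point eventually found.\<close>

lemma kernel_lift:
 fixes R :: "('v => 'k::field) set" and M :: "'j => 'i => 'v => 'k"
 assumes R0: "(%_. 0) \<in> R" and R1: "(%_. 1) \<in> R"
  and Rd: "!!f g. f \<in> R ==> g \<in> R ==> (%z. f z - g z) \<in> R"
  and Rm: "!!f g. f \<in> R ==> g \<in> R ==> (%z. f z * g z) \<in> R"
  and dom: "!!f g z w. f \<in> R ==> g \<in> R ==> f z ~= 0 ==> g w ~= 0 ==> EX y. f y ~= 0 & g y ~= 0"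
  and fin: "finite I"
  and M: "!!i j. i \<in> I ==> j \<in> J ==> M j i \<in> R" and r: "r \<in> R" "r z0 ~= 0"
  and ker: "!!x. (\<forall>i\<in>I. x i \<in> R) ==> (\<forall>j\<in>J. ALL z. (\<Sum>i\<in>I. x i z * M j i z) = 0) ==> (\<forall>i\<in>I. ALL z. x i z = 0)"
 shows "EX z. r z ~= 0 & (ALL x. (\<forall>j\<in>J. (\<Sum>i\<in>I. x i * M j i z) = 0) --> (\<forall>i\<in>I. x i = 0))"
 using fin M r ker
proof (induction I arbitrary: M r z0 rule: finite_induct)
 case empty
 then show ?case by auto
next
 case (insert u I)
 note M = insert.prems(1) and r = insert.prems(2,3) and ker = insert.prems(4)
 have "\<exists>j\<in>J. EX z. M j u z ~= 0"
 proof (rule ccontr)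
  assume c: "~ ?thesis"
  define e where "e i z = (if i = u then 1 else 0 :: 'k)" for i and z :: 'v
  have "\<forall>i\<in>insert u I. ALL z. e i z = 0"
  proof (rule ker)
   show "\<forall>i\<in>insert u I. e i \<in> R" using R0 R1 unfolding e_def by simp
   show "\<forall>j\<in>J. ALL z. (\<Sum>i\<in>insert u I. e i z * M j i z) = 0"
   proof (intro ballI allI sum.neutral)
    fix j z i assume "j \<in> J"
    then show "e i z * M j i z = 0" using c by (cases "i = u") (auto simp: e_def)
   qed
  qed
  then have "e u z0 = 0" by blast
  then show False by (simp add: e_def)
 qed
 then obtain j w where j: "j \<in> J" "M j u w ~= 0" by blast
 have sumu: "(\<Sum>i\<in>insert u I. f i) = f u + (\<Sum>i\<in>I. f i)" for f :: "'i => 'k"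
  using insert.hyps by simp
 define M' where "M' j' i z = M j u z * M j' i z - M j' u z * M j i z" for j' i z
 have M': "M' j' i \<in> R" if "i \<in> I" "j' \<in> J" for i j'
  unfolding M'_def using that j(1) by (intro Rd Rm M) auto
 obtain y where y: "r y ~= 0" "M j u y ~= 0" using dom[OF r(1) M[of u j] r(2) j(2)] j(1) by auto
 have "(%z. r z * M j u z) \<in> R" by (rule Rm[OF r(1) M]) (use j in auto)
 moreover have "r y * M j u y ~= 0" using y by simp
 moreover have "\<forall>i\<in>I. ALL z. x i z = 0" if x: "\<forall>i\<in>I. x i \<in> R" and x0: "\<forall>j'\<in>J. ALL z. (\<Sum>i\<in>I. x i z * M' j' i z) = 0" for x
 proof (intro ballI allI)
  fix i0 z0 assume i0: "i0 \<in> I"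
  \<comment> \<open>Back substitution: a kernel element of the reduced system, multiplied by the
    pivot, extends to the full system.\<close>
  define xx where "xx i z = (if i = u then - (\<Sum>i\<in>I. x i z * M j i z) else M j u z * x i z)" for i z
  have Rs: "(%z. - (\<Sum>i\<in>I'. x i z * M j i z)) \<in> R" if "I' \<subseteq> I" "finite I'" for I'
   using that(2,1)
  proof (induction I' rule: finite_induct)
   case empty
   then show ?case using R0 by simp
  next
   case (insert i I')
   have "(%z. - (\<Sum>i\<in>I'. x i z * M j i z) - x i z * M j i z) \<in> R"
    by (intro Rd Rm M insert.IH) (use insert x j in auto)
   moreover have "- (\<Sum>i\<in>insert i I'. x i z * M j i z) = - (\<Sum>i\<in>I'. x i z * M j i z) - x i z * M j i z" for z
    using insert.hyps by simp
   ultimately show ?case by simp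
  qed
  have "\<forall>i\<in>insert u I. ALL z. xx i z = 0"
  proof (rule ker)
   show "\<forall>i\<in>insert u I. xx i \<in> R"
   proof
    fix i assume i: "i \<in> insert u I"
    show "xx i \<in> R"
    proof (cases "i = u")
     case True
     then show ?thesis using Rs[of I] insert.hyps unfolding xx_def by simp
    next
     case False
     then have "(%z. M j u z * x i z) \<in> R" using i x j by (intro Rm M) auto
     then show ?thesis using False unfolding xx_def by simp
    qed
   qed
   show "\<forall>j\<in>J. ALL z. (\<Sum>i\<in>insert u I. xx i z * M j i z) = 0"
   proof (intro ballI allI)
    fix j' z assume j': "j' \<in> J"
    have "(\<Sum>i\<in>insert u I. xx i z * M j' i z) = xx u z * M j' u z + (\<Sum>i\<in>I. xx i z * M j' i z)" by (rule sumu)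
    also have "(\<Sum>i\<in>I. xx i z * M j' i z) = (\<Sum>i\<in>I. M j u z * x i z * M j' i z)"
     using insert.hyps by (intro sum.cong) (auto simp: xx_def)
    also have "xx u z * M j' u z = - (\<Sum>i\<in>I. x i z * M j i z * M j' u z)" by (simp add: xx_def sum_distrib_right)
    also have "- (\<Sum>i\<in>I. x i z * M j i z * M j' u z) + (\<Sum>i\<in>I. M j u z * x i z * M j' i z) = (\<Sum>i\<in>I. x i z * M' j' i z)"
     by (simp add: M'_def algebra_simps sum_subtractf)
    finally show "(\<Sum>i\<in>insert u I. xx i z * M j' i z) = 0" using x0 j' by simp
   qed
  qed
  then have "xx i0 z = 0" for z using i0 by blast
  moreover have "i0 ~= u" using i0 insert.hyps by blast
  ultimately have xx0: "M j u z * x i0 z = 0" for z unfolding xx_def by simp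
  show "x i0 z0 = 0"
  proof (rule ccontr)
   assume "x i0 z0 ~= 0"
   then have "EX y. x i0 y ~= 0 & M j u y ~= 0" using dom[of "x i0" "M j u" z0 w] x i0 M[of u j] j by auto
   then show False using xx0 by auto
  qed
 qed
 ultimately have "EX z. r z * M j u z ~= 0 & (ALL x. (\<forall>j\<in>J. (\<Sum>i\<in>I. x i * M' j i z) = 0) --> (\<forall>i\<in>I. x i = 0))"
  by (intro insert.IH[of M' "%z. r z * M j u z" y]) (use M' in auto)
 then obtain z where z: "r z ~= 0" "M j u z ~= 0" "!!x. (\<forall>j\<in>J. (\<Sum>i\<in>I. x i * M' j i z) = 0) ==> (\<forall>i\<in>I. x i = 0)" by auto
 show ?case
 proof (intro exI[of _ z] conjI allI impI z(1))
  fix x assume x: "\<forall>j\<in>J. (\<Sum>i\<in>insert u I. x i * M j i z) = 0"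
  have xj: "x u * M j' u z + (\<Sum>i\<in>I. x i * M j' i z) = 0" if "j' \<in> J" for j'
   using x[rule_format, OF that] sumu[of "%i. x i * M j' i z"] by simp
  have x0: "\<forall>i\<in>I. x i = 0"
  proof (rule z(3), rule ballI)
   fix j' assume j': "j' \<in> J"
   have "(\<Sum>i\<in>I. x i * M' j' i z) = M j u z * (\<Sum>i\<in>I. x i * M j' i z) - M j' u z * (\<Sum>i\<in>I. x i * M j i z)"
    by (simp add: M'_def algebra_simps sum_subtractf sum_distrib_left)
   also have "(\<Sum>i\<in>I. x i * M j' i z) = - (x u * M j' u z)" using xj[OF j'] by (simp add: eq_neg_iff_add_eq_0 add.commute)
   also have "(\<Sum>i\<in>I. x i * M j i z) = - (x u * M j u z)" using xj[OF j(1)] by (simp add: eq_neg_iff_add_eq_0 add.commute)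
   finally show "(\<Sum>i\<in>I. x i * M' j' i z) = 0" by simp
  qed
  then have "x u * M j u z = 0" using xj[OF j(1)] by simp
  then show "\<forall>i\<in>insert u I. x i = 0" using x0 z(2) by simp
 qed
qed

text \<open>Trivial kernel at \<open>z0\<close> means that some maximal minor is nonzero there, and
  as a determinant of size \<open>card I\<close> it has degree at most \<open>card I * e\<close>.
  One good point is thereby turned into a polynomial certificate of known degree.\<close>

lemma PF_minor:
 fixes M :: "'j => 'i => 'v => 'k::field"
 assumes fin: "finite I" "finite J" and M: "!!i j. i \<in> I ==> j \<in> J ==> PF Xs e (M j i)"
  and ker: "!!x. (\<forall>j\<in>J. (\<Sum>i\<in>I. x i * M j i z0) = 0) ==> (\<forall>i\<in>I. x i = 0)"
 shows "\<exists>\<Delta>. PF Xs (card I * e) \<Delta> & \<Delta> z0 ~= 0 &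
  (ALL z. \<Delta> z ~= 0 --> (ALL x. (\<forall>j\<in>J. (\<Sum>i\<in>I. x i * M j i z) = 0) --> (\<forall>i\<in>I. x i = 0)))"
proof -
 define triv where "triv J' \<longleftrightarrow> (ALL x. (\<forall>j\<in>J'. (\<Sum>i\<in>I. x i * M j i z0) = 0) --> (\<forall>i\<in>I. x i = 0))" for J'
 have ex: "EX J'. J' \<subseteq> J & triv J'" using ker unfolding triv_def by blast
 \<comment> \<open>A smallest set of rows with trivial kernel is square: fewer rows than unknowns
   would leave a solution, and the vectors \<open>Y\<close>, dual to the rows, are
   independent.\<close>
 define J' where "J' = arg_min card (%J'. J' \<subseteq> J & triv J')"
 have J': "J' \<subseteq> J" "triv J'" unfolding J'_def using arg_min_natI[of "%J'. J' \<subseteq> J & triv J'" _ card] ex by blast+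
 have min: "card J' \<le> card J''" if "J'' \<subseteq> J" "triv J''" for J''
  unfolding J'_def using arg_min_nat_le[of "%J'. J' \<subseteq> J & triv J'" J'' card] that by blast
 have finJ': "finite J'" using J'(1) fin(2) finite_subset by blast
 have ge: "card I \<le> card J'"
 proof (rule ccontr)
  assume "~ ?thesis"
  then obtain x where "\<exists>i\<in>I. x i ~= 0" "\<forall>j\<in>J'. (\<Sum>i\<in>I. x i * M j i z0) = 0"
   using homogeneous_system[OF finJ' fin(1), of "%i j. M j i z0"] by auto
  then show False using J'(2) unfolding triv_def by blast
 qed
 have "EX x. (\<forall>j'\<in>J'-{j}. (\<Sum>i\<in>I. x i * M j' i z0) = 0) & (\<Sum>i\<in>I. x i * M j i z0) ~= 0" if j: "j \<in> J'" for j
 proof (rule ccontr)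
  assume c: "~ ?thesis"
  have "triv (J' - {j})"
   unfolding triv_def
  proof (intro allI impI)
   fix x assume x: "\<forall>j'\<in>J'-{j}. (\<Sum>i\<in>I. x i * M j' i z0) = 0"
   then have "(\<Sum>i\<in>I. x i * M j i z0) = 0" using c by blast
   then have "\<forall>j'\<in>J'. (\<Sum>i\<in>I. x i * M j' i z0) = 0" using x by blast
   then show "\<forall>i\<in>I. x i = 0" using J'(2) unfolding triv_def by blast
  qed
  then have "card J' \<le> card (J' - {j})" using J'(1) by (intro min) auto
  moreover have "card (J' - {j}) < card J'" by (rule psubset_card_mono[OF finJ']) (use j in auto)
  ultimately show False by simp
 qed
 then obtain Y where Y: "!!j j'. j \<in> J' ==> j' \<in> J' - {j} ==> (\<Sum>i\<in>I. Y j i * M j' i z0) = 0"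
  "!!j. j \<in> J' ==> (\<Sum>i\<in>I. Y j i * M j i z0) ~= 0" using bchoice[of J' "%j x. (\<forall>j'\<in>J'-{j}. (\<Sum>i\<in>I. x i * M j' i z0) = 0) & (\<Sum>i\<in>I. x i * M j i z0) ~= 0"] by blast
 have le: "card J' \<le> card I"
 proof (rule ccontr)
  assume "~ ?thesis"
  then obtain c where c: "\<exists>j\<in>J'. c j ~= 0" "\<forall>i\<in>I. (\<Sum>j\<in>J'. c j * Y j i) = 0"
   using homogeneous_system[OF fin(1) finJ', of "%j i. Y j i"] by auto
  from c(1) obtain j where j: "j \<in> J'" "c j ~= 0" by blast
  have "0 = (\<Sum>i\<in>I. (\<Sum>j'\<in>J'. c j' * Y j' i) * M j i z0)" using c(2) by simp
  also have "\<dots> = (\<Sum>j'\<in>J'. c j' * (\<Sum>i\<in>I. Y j' i * M j i z0))"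
   unfolding sum_distrib_right sum_distrib_left by (subst sum.swap) (simp add: mult.assoc)
  also have "\<dots> = c j * (\<Sum>i\<in>I. Y j i * M j i z0)"
  proof (subst sum.remove[OF finJ' j(1)])
   have "(\<Sum>j'\<in>J' - {j}. c j' * (\<Sum>i\<in>I. Y j' i * M j i z0)) = 0"
   proof (rule sum.neutral, rule ballI)
    fix j' assume j': "j' \<in> J' - {j}"
    have "(\<Sum>i\<in>I. Y j' i * M j i z0) = 0" by (rule Y(1)) (use j j' in auto)
    then show "c j' * (\<Sum>i\<in>I. Y j' i * M j i z0) = 0" by simp
   qed
   then show "c j * (\<Sum>i\<in>I. Y j i * M j i z0) + (\<Sum>j'\<in>J' - {j}. c j' * (\<Sum>i\<in>I. Y j' i * M j i z0)) = c j * (\<Sum>i\<in>I. Y j i * M j i z0)" by simp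
  qed
  finally show False using j Y(2)[OF j(1)] by simp
 qed
 define n where "n = card I"
 obtain a where a: "bij_betw a {0..<n} I" using ex_bij_betw_nat_finite[OF fin(1)] unfolding n_def by blast
 obtain b where b: "bij_betw b {0..<n} J'" using ex_bij_betw_nat_finite[OF finJ'] le ge unfolding n_def by force
 define A where "A z = mat n n (%(k, l). M (b k) (a l) z)" for z
 have A: "A z \<in> carrier_mat n n" for z unfolding A_def by simp
 have Av: "vec_index (A z *\<^sub>v v) k = (\<Sum>i\<in>I. vec_index v (inv_into {0..<n} a i) * M (b k) i z)" if "v \<in> carrier_vec n" "k < n" for z v k
 proof -
  have "vec_index (A z *\<^sub>v v) k = (\<Sum>l\<in>{0..<n}. M (b k) (a l) z * vec_index v l)"
   using that by (simp add: A_def scalar_prod_def)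
  also have "\<dots> = (\<Sum>l\<in>{0..<n}. vec_index v (inv_into {0..<n} a (a l)) * M (b k) (a l) z)"
   using a by (intro sum.cong) (auto simp: bij_betw_def inv_into_f_f mult.commute)
  also have "\<dots> = (\<Sum>i\<in>I. vec_index v (inv_into {0..<n} a i) * M (b k) i z)" by (rule sum.reindex_bij_betw[OF a])
  finally show ?thesis .
 qed
 have PFd: "PF Xs (n * e) (%z. Determinant.det (A z))"
 proof -
  have "Determinant.det (A z) = (\<Sum>\<pi>\<in>{\<pi>. \<pi> permutes {0..<n}}. of_int (sign \<pi>) * (\<Prod>k\<in>{0..<n}. M (b k) (a (\<pi> k)) z))" for z
  proof -
   have "Determinant.det (A z) = (\<Sum>\<pi>\<in>{\<pi>. \<pi> permutes {0..<n}}. of_int (sign \<pi>) * (\<Prod>k\<in>{0..<n}. A z $$ (k, \<pi> k)))"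
   proof -
    have d: "dim_row (A z) = n" "dim_col (A z) = n" using A[of z] by auto
    show ?thesis unfolding Determinant.det_def d by (simp only: simp_thms if_True)
   qed
   also have "\<dots> = (\<Sum>\<pi>\<in>{\<pi>. \<pi> permutes {0..<n}}. of_int (sign \<pi>) * (\<Prod>k\<in>{0..<n}. M (b k) (a (\<pi> k)) z))"
   proof (intro sum.cong refl arg_cong2[where f = "(*)"] prod.cong)
    fix \<pi> k assume "\<pi> \<in> {\<pi>. \<pi> permutes {0..<n}}" "k \<in> {0..<n}"
    then have "k < n" "\<pi> k < n" using permutes_in_image[of \<pi> "{0..<n}" k] by auto
    then show "A z $$ (k, \<pi> k) = M (b k) (a (\<pi> k)) z" by (simp add: A_def)
   qed
   finally show ?thesis .
  qed
  moreover have "PF Xs (n * e) (%z. \<Sum>\<pi>\<in>{\<pi>. \<pi> permutes {0..<n}}. of_int (sign \<pi>) * (\<Prod>k\<in>{0..<n}. M (b k) (a (\<pi> k)) z))"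
  proof (intro PF_sum PF_scale)
   fix \<pi> assume \<pi>: "\<pi> \<in> {\<pi>. \<pi> permutes {0..<n}}"
   have "PF Xs (\<Sum>k\<in>{0..<n}. e) (%z. \<Prod>k\<in>{0..<n}. M (b k) (a (\<pi> k)) z)"
   proof (rule PF_prod)
    fix k assume k: "k \<in> {0..<n}"
    then have "\<pi> k \<in> {0..<n}" using \<pi> permutes_in_image[of \<pi> "{0..<n}" k] by blast
    then show "PF Xs e (M (b k) (a (\<pi> k)))" using a b k J'(1) by (intro M) (auto simp: bij_betw_def)
   qed
   then show "PF Xs (n * e) (%z. \<Prod>k\<in>{0..<n}. M (b k) (a (\<pi> k)) z)" by simp
  qed
  ultimately show ?thesis by simp
 qed
 have nz: "Determinant.det (A z0) ~= 0"
 proof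
  assume "Determinant.det (A z0) = 0"
  then obtain v where v: "v \<in> carrier_vec n" "v ~= 0\<^sub>v n" "A z0 *\<^sub>v v = 0\<^sub>v n" using det_0_iff_vec_prod_zero[OF A] by blast
  have "\<forall>i\<in>I. vec_index v (inv_into {0..<n} a i) = 0"
  proof -
   have "\<forall>j\<in>J'. (\<Sum>i\<in>I. vec_index v (inv_into {0..<n} a i) * M j i z0) = 0"
   proof
    fix j assume "j \<in> J'"
    then obtain k where k: "k < n" "j = b k" using b by (auto simp: bij_betw_def)
    then show "(\<Sum>i\<in>I. vec_index v (inv_into {0..<n} a i) * M j i z0) = 0" using Av[OF v(1) k(1), of z0] v(3) by simp
   qed
   then show ?thesis by (rule mp[OF spec[OF J'(2)[unfolded triv_def]]])
  qed
  then have "vec_index v l = 0" if "l < n" for l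
   using that bij_betw_inv_into_left[OF a, of l] bij_betwE[OF a] by force
  then have "v = 0\<^sub>v n" using v(1) by (intro eq_vecI) auto
  then show False using v(2) by simp
 qed
 have tr: "\<forall>i\<in>I. x i = 0" if d: "Determinant.det (A z) ~= 0" and x: "\<forall>j\<in>J. (\<Sum>i\<in>I. x i * M j i z) = 0" for z x
 proof -
  define v where "v = Matrix.vec n (%l. x (a l))"
  have v: "v \<in> carrier_vec n" unfolding v_def by simp
  have vi: "vec_index v (inv_into {0..<n} a i) = x i" if "i \<in> I" for i
   using bij_betw_inv_into_right[OF a that] bij_betwE[OF bij_betw_inv_into[OF a]] that by (simp add: v_def)
  have "A z *\<^sub>v v = 0\<^sub>v n"
  proof (rule eq_vecI)
   show "dim_vec (A z *\<^sub>v v) = dim_vec (0\<^sub>v n :: 'k Matrix.vec)" by (simp add: A_def)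
   fix k assume "k < dim_vec (0\<^sub>v n :: 'k Matrix.vec)"
   then have k: "k < n" by simp
   then have "b k \<in> J" using bij_betwE[OF b] J'(1) by auto
   then show "vec_index (A z *\<^sub>v v) k = vec_index (0\<^sub>v n) k" using Av[OF v k] vi x k by simp
  qed
  then have "v = 0\<^sub>v n" using d det_0_iff_vec_prod_zero[OF A] v by blast
  then have z: "vec_index v l = 0" if "l < n" for l using that by simp
  show ?thesis
  proof
   fix i assume i: "i \<in> I"
   then have "inv_into {0..<n} a i < n" using bij_betwE[OF bij_betw_inv_into[OF a]] by simp
   then show "x i = 0" using z vi[OF i] by simp
  qed
 qed
 show ?thesis using PFd nz tr unfolding n_def by blast
qed

no_notation Matrix.vec_index (infixl "$" 100)
no_notation fps_nth (infixl "$" 75)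
no_notation Matrix.scalar_prod (infix "\<bullet>" 70)
hide_const (open) Matrix.vec Matrix.row Matrix.mat Determinant.det
hide_type (open) Matrix.vec Matrix.mat

section \<open>Polynomial functions on affine space\<close>

definition crd :: "('k::comm_ring_1 ^ 'n::finite => 'k) set" where "crd = range (%i z. z $ i)"

definition expo :: "('n::finite => nat) => 'k::comm_ring_1 ^ 'n => 'k" where "expo m z = (\<Prod>i\<in>UNIV. (z $ i) ^ m i)"

definition Mon :: "nat => ('n::finite => nat) set" where "Mon s = {m. (\<Sum>i\<in>UNIV. m i) \<le> s}"

lemma finite_Mon: "finite (Mon s :: ('n::finite => nat) set)"
proof (rule finite_subset)
 show "(Mon s :: ('n => nat) set) \<subseteq> PiE UNIV (%_. {..s})"
 proof
  fix m :: "'n => nat" assume "m \<in> Mon s"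
  moreover have "m i \<le> (\<Sum>i\<in>UNIV. m i)" for i by (rule member_le_sum) auto
  ultimately have "m i \<le> s" for i unfolding Mon_def using order_trans by blast
  then show "m \<in> PiE UNIV (%_. {..s})" by auto
 qed
 show "finite (PiE UNIV (%_. {..s}) :: ('n => nat) set)" by (rule finite_PiE) auto
qed

lemma expo_Suc: "expo (m(i := Suc (m i))) z = z $ i * expo m z"
proof -
 have "expo (m(i := Suc (m i))) z = (z $ i) ^ Suc (m i) * (\<Prod>k\<in>UNIV - {i}. (z $ k) ^ (m(i := Suc (m i))) k)"
  unfolding expo_def by (subst prod.remove[of _ i]) auto
 also have "(\<Prod>k\<in>UNIV - {i}. (z $ k) ^ (m(i := Suc (m i))) k) = (\<Prod>k\<in>UNIV - {i}. (z $ k) ^ m k)" by (rule prod.cong) auto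
 also have "(z $ i) ^ Suc (m i) * (\<Prod>k\<in>UNIV - {i}. (z $ k) ^ m k) = z $ i * expo m z"
  unfolding expo_def by (subst (2) prod.remove[of _ i]) (auto simp: mult.assoc)
 finally show ?thesis .
qed

lemma sum_upd_Suc: "(\<Sum>k\<in>UNIV. (m(i := Suc (m i))) k) = Suc (\<Sum>k\<in>(UNIV::'n::finite set). m k)"
proof -
 have "(\<Sum>k\<in>UNIV. (m(i := Suc (m i))) k) = Suc (m i) + (\<Sum>k\<in>UNIV - {i}. (m(i := Suc (m i))) k)" by (subst sum.remove[of _ i]) auto
 also have "(\<Sum>k\<in>UNIV - {i}. (m(i := Suc (m i))) k) = (\<Sum>k\<in>UNIV - {i}. m k)" by (rule sum.cong) auto
 also have "Suc (m i) + (\<Sum>k\<in>UNIV - {i}. m k) = Suc (\<Sum>k\<in>UNIV. m k)" by (subst (2) sum.remove[of _ i]) auto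
 finally show ?thesis .
qed

lemma PF_expo: "PF crd (\<Sum>i\<in>UNIV. m i) (expo m)"
proof -
 have "PF crd (\<Sum>i\<in>UNIV. m i) (%z. \<Prod>i\<in>UNIV. (z $ i) ^ m i)"
 proof (rule PF_prod)
  show "PF crd (m i) (%z. (z $ i) ^ m i)" for i
   using PF_power[OF PF_var[of "%z. z $ i" crd], of "m i"] by (simp add: crd_def)
 qed
 then show ?thesis unfolding expo_def .
qed

lemma PF_rep:
 fixes g :: "'k::comm_ring_1 ^ 'n::finite => 'k"
 assumes "PF crd s g" shows "EX c. ALL z. g z = (\<Sum>m\<in>Mon s. c m * expo m z)"
 using assms
proof (induction rule: PF.induct)
 case (PF_const s c)
 have "(\<Sum>m\<in>Mon s. (if m = (%_. 0) then c else 0) * expo m z) = c" for z :: "'k ^ 'n"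
 proof -
  have "(\<Sum>m\<in>Mon s. (if m = (%_. 0) then c else 0) * expo m z) = (\<Sum>m\<in>Mon s. if m = (%_. 0) then c * expo m z else 0)"
   by (rule sum.cong) auto
  also have "\<dots> = c * expo (%_. 0) z" by (subst sum.delta[OF finite_Mon]) (simp add: Mon_def)
  finally show ?thesis by (simp add: expo_def)
 qed
 then show ?case by (intro exI[of _ "%m. if m = (%_. 0) then c else 0"]) simp
next
 case (PF_coord x s f)
 then obtain c where c: "!!z. f z = (\<Sum>m\<in>Mon s. c m * expo m z)" by blast
 from PF_coord obtain i where i: "x = (%z. z $ i)" unfolding crd_def by blast
 define u where "u m = m(i := Suc (m i))" for m :: "'n => nat"
 have inj: "inj u"
 proof (rule injI)
  fix m m' assume "u m = u m'"
  then have e: "u m k = u m' k" for k by simp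
  show "m = m'"
  proof
   fix k show "m k = m' k" using e[of k] by (cases "k = i") (auto simp: u_def)
  qed
 qed
 have sub: "u ` Mon s \<subseteq> Mon (Suc s)" unfolding u_def Mon_def by (auto simp: sum_upd_Suc simp del: fun_upd_apply)
 define c' where "c' m = (if m \<in> u ` Mon s then c (inv_into UNIV u m) else 0)" for m
 have "x z * f z = (\<Sum>m\<in>Mon (Suc s). c' m * expo m z)" for z
 proof -
  have "(\<Sum>m\<in>Mon (Suc s). c' m * expo m z) = (\<Sum>m\<in>u ` Mon s. c' m * expo m z)"
   by (rule sum.mono_neutral_right[OF finite_Mon sub]) (auto simp: c'_def)
  also have "\<dots> = (\<Sum>m\<in>Mon s. c' (u m) * expo (u m) z)" by (subst sum.reindex) (auto intro: inj_on_subset[OF inj])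
  also have "\<dots> = (\<Sum>m\<in>Mon s. z $ i * (c m * expo m z))"
   by (rule sum.cong) (auto simp: c'_def inv_f_f[OF inj] expo_Suc u_def[symmetric] mult_ac, auto simp: u_def expo_Suc)
  finally show ?thesis by (simp add: i c sum_distrib_left)
 qed
 then show ?case by blast
next
 case (PF_add s f g)
 from PF_add(3) obtain c where "!!z. f z = (\<Sum>m\<in>Mon s. c m * expo m z)" by blast
 moreover from PF_add(4) obtain c' where "!!z. g z = (\<Sum>m\<in>Mon s. c' m * expo m z)" by blast
 ultimately show ?case by (intro exI[of _ "%m. c m + c' m"]) (simp add: algebra_simps sum.distrib)
qed

text \<open>If all derivatives along the axes vanish, \<open>g\<close> is a combination of monomials
  with exponents divisible by \<open>p\<close>, and the coefficients have p-th roots.\<close>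

lemma pth_power:
 fixes g :: "'k::field ^ 'n::finite => 'k"
 assumes g: "PF crd s g" and p: "p > 0" and charp: "!!k. of_nat k = (0::'k) ==> p dvd k"
  and frobp: "!!x y :: 'k. (x + y) ^ p = x ^ p + y ^ p" and rootp: "!!x :: 'k. EX y. y ^ p = x"
  and der: "!!i z P. (!!t. g (z + t *s axis i 1) = poly P t) ==> pderiv P = 0"
 shows "EX h. PF crd (s div p) h & (ALL z. g z = h z ^ p)"
proof -
 have step: "EX c. (ALL z. g z = (\<Sum>m\<in>Mon s. c m * expo m z)) & (\<forall>m\<in>Mon s. c m ~= 0 --> (\<forall>i\<in>A. p dvd m i))" for A :: "'n set"
 proof (induction A rule: infinite_finite_induct)
  case (insert a A)
  then obtain c where c: "!!z. g z = (\<Sum>m\<in>Mon s. c m * expo m z)" "!!m. m \<in> Mon s ==> c m ~= 0 ==> \<forall>i\<in>A. p dvd m i" by blast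
  \<comment> \<open>The unwanted coefficients are dropped rather than shown to be zero; on every
    line parallel to the axis the sum stays the same polynomial.\<close>
  define c' where "c' m = (if p dvd m a then c m else 0)" for m
  have "g z = (\<Sum>m\<in>Mon s. c' m * expo m z)" for z
  proof -
   define r where "r m = (\<Prod>i\<in>UNIV-{a}. (z $ i) ^ m i)" for m
   define z' where "z' = z - (z $ a) *s axis a 1"
   have z'a: "(z' + t *s axis a 1) $ a = t" for t by (simp add: z'_def axis_def)
   have z'i: "(z' + t *s axis a 1) $ i = z $ i" if "i ~= a" for t i using that by (simp add: z'_def axis_def)
   have ex: "expo m (z' + t *s axis a 1) = t ^ m a * r m" for m t
    proof -
    have "(\<Prod>i\<in>UNIV-{a}. ((z' + t *s axis a 1) $ i) ^ m i) = r m" unfolding r_def by (intro prod.cong refl arg_cong2[where f = power] z'i) simp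
    then show ?thesis unfolding expo_def by (subst prod.remove[of _ a]) (simp_all only: z'a finite UNIV_I)
   qed
   define P where "P d = (\<Sum>m\<in>Mon s. monom (d m * r m) (m a))" for d
   have P: "(\<Sum>m\<in>Mon s. d m * expo m (z' + t *s axis a 1)) = poly (P d) t" for t d
    by (simp add: P_def poly_sum poly_monom ex mult_ac)
   have "g (z' + t *s axis a 1) = poly (P c) t" for t using c(1) P by simp
   from der[OF this] have d0: "pderiv (P c) = 0" by simp
   have cf: "coeff (P d) k = (\<Sum>m\<in>Mon s. if m a = k then d m * r m else 0)" for d k by (simp add: P_def coeff_sum)
   have "P c' = P c"
   proof (rule poly_eqI)
    fix k show "coeff (P c') k = coeff (P c) k"
    proof (cases "p dvd k")
     case True
     then show ?thesis unfolding cf by (intro sum.cong) (auto simp: c'_def)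
    next
     case False
     then have "k > 0" by (cases k) auto
     then have "of_nat k * coeff (P c) k = 0" using d0 coeff_pderiv[of "P c" "k - 1"] by simp
     then have "coeff (P c) k = 0" using charp[of k] False by auto
     moreover have "coeff (P c') k = 0" unfolding cf using False by (intro sum.neutral) (auto simp: c'_def)
     ultimately show ?thesis by simp
    qed
   qed
   moreover have "z' + (z $ a) *s axis a 1 = z" by (simp add: z'_def)
   ultimately show ?thesis using P[of c "z $ a"] P[of c' "z $ a"] c(1)[of z] by simp
  qed
  moreover have "\<forall>m\<in>Mon s. c' m ~= 0 --> (\<forall>i\<in>insert a A. p dvd m i)" using c(2) by (auto simp: c'_def split: if_splits)
  ultimately show ?case by blast
 qed (use PF_rep[OF g] in auto)
 from step[of UNIV] obtain c where c: "!!z. g z = (\<Sum>m\<in>Mon s. c m * expo m z)" "!!m i. m \<in> Mon s ==> c m ~= 0 ==> p dvd m i" by blast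
 obtain rt :: "'k => 'k" where rt: "!!x. rt x ^ p = x" using choice[of "%x y. y ^ p = x"] rootp by blast
 have fs: "(\<Sum>m\<in>A. f m) ^ p = (\<Sum>m\<in>A. f m ^ p)" for f :: "('n => nat) => 'k" and A
  using p by (induction A rule: infinite_finite_induct) (simp_all add: frobp zero_power)
 define Mc where "Mc = {m \<in> Mon s. c m ~= 0}"
 define h where "h z = (\<Sum>m\<in>Mc. rt (c m) * expo (%i. m i div p) z)" for z
 have "g z = h z ^ p" for z
 proof -
  have "h z ^ p = (\<Sum>m\<in>Mc. c m * expo m z)"
   unfolding h_def fs
  proof (rule sum.cong[OF refl])
   fix m assume "m \<in> Mc"
   then have "m i div p * p = m i" for i using c(2)[of m i] by (simp add: Mc_def)
   then have "expo (%i. m i div p) z ^ p = expo m z" unfolding expo_def by (simp add: prod_power_distrib power_mult[symmetric])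
   then show "(rt (c m) * expo (%i. m i div p) z) ^ p = c m * expo m z" by (simp add: power_mult_distrib rt)
  qed
  also have "\<dots> = (\<Sum>m\<in>Mon s. c m * expo m z)" unfolding Mc_def by (rule sum.mono_neutral_left[OF finite_Mon]) auto
  finally show ?thesis using c(1) by simp
 qed
 moreover have "PF crd (s div p) h"
  unfolding h_def
 proof (intro PF_sum PF_scale PF_mono[OF PF_expo])
  fix m assume m: "m \<in> Mc"
  then have "m i div p * p = m i" for i using c(2)[of m i] by (simp add: Mc_def)
  then have "(\<Sum>i\<in>UNIV. m i div p) * p = (\<Sum>i\<in>UNIV. m i)" by (simp add: sum_distrib_right)
  then show "(\<Sum>i\<in>UNIV. m i div p) \<le> s div p" using m p by (simp add: Mc_def Mon_def less_eq_div_iff_mult_less_eq)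
 qed
 ultimately show ?thesis by blast
qed

section \<open>Points over the finite field\<close>

locale fq =
 fixes q :: nat and ty :: "'k::field itself"
 assumes q2: "q \<ge> 2" and frob: "!!x y :: 'k. (x + y) ^ q = x ^ q + y ^ q"
  and card_fix: "card {x :: 'k. x ^ q = x} = q" and inf_field: "infinite (UNIV :: 'k set)"
begin

definition Fq :: "'k set" where "Fq = {x. x ^ q = x}"

definition Vq :: "('k ^ 'n::finite) set" where "Vq = {z. ALL i. z $ i \<in> Fq}"

lemma card_Fq: "card Fq = q" unfolding Fq_def by (rule card_fix)
lemma finite_Fq: "finite Fq" using card_Fq q2 card.infinite by force

lemma Fq_add: "x \<in> Fq ==> y \<in> Fq ==> x + y \<in> Fq" by (simp add: Fq_def frob)
lemma Fq_mult: "x \<in> Fq ==> y \<in> Fq ==> x * y \<in> Fq" by (simp add: Fq_def power_mult_distrib)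
lemma Fq_inverse: "x \<in> Fq ==> inverse x \<in> Fq" by (simp add: Fq_def power_inverse)
lemma Fq_0: "0 \<in> Fq" using q2 by (simp add: Fq_def)
lemma Fq_1: "1 \<in> Fq" by (simp add: Fq_def)
lemma Fq_uminus: "x \<in> Fq ==> - x \<in> Fq"
proof -
 assume x: "x \<in> Fq"
 have "0 = x ^ q + (- x) ^ q" using frob[of x "- x"] q2 by (simp add: zero_power)
 then show ?thesis using x by (simp add: Fq_def eq_neg_iff_add_eq_0 add.commute)
qed
lemma Fq_diff: "x \<in> Fq ==> y \<in> Fq ==> x - y \<in> Fq" using Fq_add[OF _ Fq_uminus, of x y] by simp

lemma Vq_add: "x \<in> Vq ==> y \<in> Vq ==> x + y \<in> Vq" by (simp add: Vq_def Fq_add)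
lemma Vq_diff: "x \<in> Vq ==> y \<in> Vq ==> x - y \<in> Vq" by (simp add: Vq_def Fq_diff)
lemma Vq_scale: "c \<in> Fq ==> y \<in> Vq ==> c *s y \<in> Vq" by (simp add: Vq_def Fq_mult)

lemma card_Vq: "card (Vq :: ('k ^ 'n::finite) set) = q ^ CARD('n)" and finite_Vq: "finite (Vq :: ('k ^ 'n::finite) set)"
proof -
 have "bij_betw vec_nth (Vq :: ('k ^ 'n) set) (PiE UNIV (%_. Fq))"
  by (rule bij_betwI[where g = vec_lambda]) (auto simp: Vq_def)
 then show "card (Vq :: ('k ^ 'n) set) = q ^ CARD('n)" "finite (Vq :: ('k ^ 'n) set)"
  using bij_betw_same_card[of vec_nth Vq "PiE (UNIV::'n set) (%_. Fq)"] bij_betw_finite[of vec_nth Vq "PiE (UNIV::'n set) (%_. Fq)"]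
  by (simp_all add: card_PiE card_Fq finite_PiE finite_Fq)
qed

lemma PF_vline:
 assumes "PF crd s (f :: 'k ^ 'n::finite => 'k)" shows "EX p. degree p \<le> s & (ALL t. f (z + t *s v) = poly p t)"
proof -
 have "EX p. degree p \<le> 1 & (ALL t. x (z + t *s v) = poly p t)" if "x \<in> crd" for x
  using that by (intro exI[of _ "[:x z, x v:]"]) (auto simp: crd_def)
 then show ?thesis using PF_poly[OF assms, of "%t. z + t *s v"] by blast
qed

lemma PF_nonzero_Vq:
 assumes f: "PF crd s (f :: 'k ^ 'n::finite => 'k)" and w: "f w ~= 0" and s: "s < q"
 shows "\<exists>z\<in>Vq. f z ~= 0"
proof -
 have "EX z. f z ~= 0 & (\<forall>i\<in>A. z $ i \<in> Fq)" for A :: "'n set"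
 proof (induction A rule: infinite_finite_induct)
  case (insert a A)
  then obtain z where z: "f z ~= 0" "\<forall>i\<in>A. z $ i \<in> Fq" by blast
  from PF_vline[OF f, of z "axis a 1"] obtain p where p: "degree p \<le> s" "!!t. f (z + t *s axis a 1) = poly p t" by blast
  have p0: "p ~= 0" using p(2)[of 0] z by auto
  have "\<exists>x\<in>Fq. poly p (x - z $ a) ~= 0"
  proof (rule ccontr)
   assume c: "~ ?thesis"
   have "card Fq = card ((%x. x - z $ a) ` Fq)" by (rule card_image[symmetric]) (auto simp: inj_on_def)
   also have "\<dots> \<le> card {x. poly p x = 0}" by (rule card_mono) (use c poly_roots_finite[OF p0] in auto)
   also have "\<dots> \<le> s" using card_poly_roots_bound[OF p0] p(1) by simp
   finally show False using s card_Fq by simp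
  qed
  then obtain x where x: "x \<in> Fq" "poly p (x - z $ a) ~= 0" by blast
  show ?case
  proof (intro exI[of _ "z + (x - z $ a) *s axis a 1"] conjI)
   show "f (z + (x - z $ a) *s axis a 1) ~= 0" using x(2) by (simp only: p(2) not_False_eq_True)
   show "\<forall>i\<in>insert a A. (z + (x - z $ a) *s axis a 1) $ i \<in> Fq" using x z by (auto simp: axis_def)
  qed
 qed (use w in auto)
 from this[of UNIV] show ?thesis by (auto simp: Vq_def)
qed

text \<open>Counting along the lines through a point where \<open>f\<close> does not vanish.\<close>

lemma schwartz_zippel:
 assumes f: "PF crd s (f :: 'k ^ 'n::finite => 'k)" and w: "f w ~= 0" and s: "s < q"
 shows "card {z\<in>Vq. f z = 0} * (q - 1) \<le> s * q ^ CARD('n)"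
proof -
 obtain z0 where z0: "z0 \<in> Vq" "f z0 ~= 0" using PF_nonzero_Vq[OF assms] by blast
 \<comment> \<open>For c \<noteq> 0 this dilation permutes \<open>Vq\<close>; leaving out c = 0
   produces the factor q - 1.\<close>
 define \<phi> where "\<phi> c z = z0 + c *s (z - z0)" for c and z :: "'k ^ 'n"
 let ?Z = "{z\<in>Vq. f z = 0}" and ?F = "Fq - {0}"
 have cF: "card ?F = q - 1" using card_Fq Fq_0 finite_Fq by simp
 have bij: "card {z\<in>Vq. f (\<phi> c z) = 0} = card ?Z" if c: "c \<in> ?F" for c
 proof (rule bij_betw_same_card[of "\<phi> c"], rule bij_betwI[where g = "\<phi> (inverse c)"])
  show "\<phi> c \<in> {z \<in> Vq. f (\<phi> c z) = 0} \<rightarrow> {z \<in> Vq. f z = 0}"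
   using c z0 by (auto simp: \<phi>_def intro!: Vq_add Vq_scale Vq_diff)
  show "\<phi> (inverse c) \<in> {z \<in> Vq. f z = 0} \<rightarrow> {z \<in> Vq. f (\<phi> c z) = 0}"
   using c z0 by (auto simp: \<phi>_def vector_smult_assoc intro!: Vq_add Vq_scale Vq_diff Fq_inverse)
 qed (use c in \<open>auto simp: \<phi>_def vector_smult_assoc\<close>)
 have "card ?Z * (q - 1) = (\<Sum>c\<in>?F. card {z\<in>Vq. f (\<phi> c z) = 0})" using bij cF by simp
 also have "\<dots> = card (SIGMA c:?F. {z\<in>Vq. f (\<phi> c z) = 0})" by (rule card_SigmaI[symmetric]) (use finite_Fq finite_Vq in auto)
 also have "\<dots> = card (SIGMA z:Vq. {c\<in>?F. f (\<phi> c z) = 0})"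
  by (rule bij_betw_same_card[of "%(x, y). (y, x)"], rule bij_betwI[where g = "%(x, y). (y, x)"]) auto
 also have "\<dots> = (\<Sum>z\<in>Vq. card {c\<in>?F. f (\<phi> c z) = 0})" by (rule card_SigmaI) (use finite_Fq finite_Vq in auto)
 also have "\<dots> \<le> (\<Sum>z\<in>(Vq :: ('k ^ 'n) set). s)"
 proof (rule sum_mono)
  fix z
  from PF_vline[OF f, of z0 "z - z0"] obtain p where p: "degree p \<le> s" "!!t. f (z0 + t *s (z - z0)) = poly p t" by blast
  have p0: "p ~= 0" using p(2)[of 0] z0 by auto
  have "card {c\<in>?F. f (\<phi> c z) = 0} \<le> card {c. poly p c = 0}"
   by (rule card_mono) (use p p0 poly_roots_finite in \<open>auto simp: \<phi>_def\<close>)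
  also have "\<dots> \<le> s" using card_poly_roots_bound[OF p0] p(1) by simp
  finally show "card {c\<in>?F. f (\<phi> c z) = 0} \<le> s" .
 qed
 finally show ?thesis by (simp add: card_Vq mult.commute)
qed

end

section \<open>Plane curves from irreducible polynomials\<close>

text \<open>In a polynomial of polynomials the outer variable is y = \<open>snd\<close> and the
  coefficients are polynomials in x = \<open>fst\<close>.\<close>

definition ev :: "'k::comm_ring_1 poly poly => 'k \<times> 'k => 'k" where
 "ev p P = poly (poly p [:snd P:]) (fst P)"

definition tdeg :: "nat => 'k::comm_ring_1 poly poly => bool" where
 "tdeg s p \<longleftrightarrow> (ALL k j. coeff (coeff p k) j ~= 0 --> j + k \<le> s)"

lemma ev_mult: "ev (p * r) P = ev p P * ev r P" and ev_add: "ev (p + r) P = ev p P + ev r P"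
 and ev_0: "ev 0 P = 0" and ev_diff: "ev (p' - r') P' = ev p' P' - ev r' P'"
 for p' r' :: "'k::comm_ring_1 poly poly"
 by (simp_all add: ev_def)

lemma ev_eq: "ev p (x, y) = (\<Sum>k\<le>degree p. poly (coeff p k) x * y ^ k)"
 by (simp add: ev_def poly_altdef[of p] poly_sum)

lemma poly_sum_atMost: "degree p \<le> n ==> poly p x = (\<Sum>i\<le>n. coeff p i * x ^ i)"
 for p :: "'k::comm_ring_1 poly"
 unfolding poly_altdef by (rule sum.mono_neutral_left) (auto simp: coeff_eq_0)

lemma degree_map_eval: "degree (map_poly (%c. poly c x) p) \<le> degree p" for p :: "'k::comm_ring_1 poly poly"
 by (rule degree_le) (simp add: coeff_map_poly coeff_eq_0)

lemma ev_map: "ev p (x, y) = poly (map_poly (%c. poly c x) p) y"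
proof -
 from poly_sum_atMost[OF degree_map_eval[of x p], of y] show ?thesis by (simp add: ev_eq coeff_map_poly)
qed

lemma ev_inj:
 fixes p :: "'k::idom poly poly"
 assumes inf: "infinite (UNIV :: 'k set)" and e: "!!P. ev p P = ev r P" shows "p = r"
proof -
 have "poly (p - r) [:y:] = 0" for y
  by (rule poly_eqI_infinite[OF inf]) (use e[of "(_, y)"] in \<open>simp add: ev_def\<close>)
 then have "range (%y. [:y:]) \<subseteq> {c. poly (p - r) c = 0}" by auto
 moreover have "infinite (range (%y::'k. [:y:]))" using inf by (simp add: finite_image_iff inj_on_def)
 ultimately have "p - r = 0" using poly_roots_finite[of "p - r"] finite_subset by blast
 then show ?thesis by simp
qed

lemma Pl_ev:
 assumes "Pl s f" shows "EX p. tdeg s p & (ALL P. f P = ev p P)"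
 using assms
proof (induction rule: PF.induct)
 case (PF_const s c)
 show ?case by (rule exI[of _ "[:[:c:]:]"]) (auto simp: tdeg_def ev_def coeff_pCons split: nat.splits)
next
 case (PF_coord x s f)
 then obtain p where p: "tdeg s p" "!!P. f P = ev p P" by blast
 from PF_coord(1) consider "x = fst" | "x = snd" by blast
 then show ?case
 proof cases
  case 1
  have "tdeg (Suc s) (smult [:0, 1:] p)"
   using p(1) by (auto simp: tdeg_def coeff_pCons split: nat.splits)
  then show ?thesis using p(2) 1 by (intro exI[of _ "smult [:0, 1:] p"]) (simp add: ev_def)
 next
  case 2
  have "tdeg (Suc s) (pCons 0 p)" using p(1) by (auto simp: tdeg_def coeff_pCons split: nat.splits)
  then show ?thesis using p(2) 2 by (intro exI[of _ "pCons 0 p"]) (simp add: ev_def)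
 qed
next
 case (PF_add s f g)
 from PF_add(3) obtain p where p: "tdeg s p" "!!P. f P = ev p P" by blast
 from PF_add(4) obtain r where r: "tdeg s r" "!!P. g P = ev r P" by blast
 have "tdeg s (p + r)"
  unfolding tdeg_def
 proof (intro allI impI)
  fix k j assume "coeff (coeff (p + r) k) j ~= 0"
  then have "coeff (coeff p k) j ~= 0 | coeff (coeff r k) j ~= 0" by auto
  then show "j + k \<le> s" using p(1) r(1) unfolding tdeg_def by blast
 qed
 then show ?case using p r by (intro exI[of _ "p + r"]) (simp add: ev_add)
qed

lemma ev_curve_fun:
 assumes "tdeg s p" shows "ev p (x, y) = curve_fun (%j k. coeff (coeff p k) j) s x y"
proof -
 have d: "degree p \<le> s" by (rule degree_le) (use assms in \<open>force simp: tdeg_def poly_eq_iff\<close>)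
 have dk: "degree (coeff p k) \<le> s - k" for k by (rule degree_le) (use assms in \<open>force simp: tdeg_def\<close>)
 have "ev p (x, y) = (\<Sum>k\<le>s. poly (coeff p k) x * y ^ k)"
  unfolding ev_eq by (rule sum.mono_neutral_left) (use d in \<open>auto simp: coeff_eq_0\<close>)
 also have "\<dots> = (\<Sum>k\<le>s. (\<Sum>j\<le>s-k. coeff (coeff p k) j * x ^ j) * y ^ k)"
  using poly_sum_atMost[OF dk] by simp
 finally show ?thesis by (simp add: curve_fun_def sum_distrib_right)
qed

lemma Pol_ev: "Pol (ev p)"
proof -
 have "Pol (%P. \<Sum>k\<le>degree p. poly (coeff p k) (fst P) * snd P ^ k)"
  by (intro polyfun_intros polyfunI[OF Pl_poly_fst[OF order_refl]])
 moreover have "ev p = (%P. \<Sum>k\<le>degree p. poly (coeff p k) (fst P) * snd P ^ k)"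
 proof
  fix P show "ev p P = (\<Sum>k\<le>degree p. poly (coeff p k) (fst P) * snd P ^ k)" using ev_eq[of p "fst P" "snd P"] by simp
 qed
 ultimately show ?thesis by simp
qed

lemma Pol_ex_ev: assumes "Pol f" shows "EX p. f = ev p"
 using assms Pl_ev unfolding polyfun_def by blast

text \<open>The Sylvester matrix with \<open>g\<close> treated as a polynomial of degree
  \<open>d\<close>: by \<open>syl_sum\<close>, kernel vectors are pairs A, B of degree below
  \<open>d\<close> with A f + B g = 0.\<close>

definition syl :: "nat => 'r::comm_ring_1 poly => 'r poly => nat => nat => 'r" where
 "syl d f g j i = (if i < d then (if i \<le> j then coeff f (j - i) else 0) else (if i - d \<le> j then coeff g (j - (i - d)) else 0))"

lemma coeff_monom_mult': "coeff (monom c i * f) j = (if i \<le> j then c * coeff f (j - i) else 0)"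
 for f :: "'r::comm_ring_1 poly" by (simp add: coeff_monom_mult)

lemma syl_sum:
 fixes f g :: "'r::comm_ring_1 poly"
 shows "(\<Sum>i<2*d. x i * syl d f g j i) = coeff ((\<Sum>i<d. monom (x i) i) * f + (\<Sum>i<d. monom (x (d + i)) i) * g) j"
proof -
 have "(\<Sum>i<2*d. x i * syl d f g j i) = (\<Sum>i<d. x i * syl d f g j i) + (\<Sum>i\<in>{d..<2*d}. x i * syl d f g j i)"
  by (subst sum.union_disjoint[symmetric]) (auto intro!: sum.cong)
 also have "(\<Sum>i\<in>{d..<2*d}. x i * syl d f g j i) = (\<Sum>i<d. x (d + i) * syl d f g j (d + i))"
  by (rule sum.reindex_bij_witness[of _ "%i. d + i" "%i. i - d"]) auto
 moreover have "(\<Sum>i<d. x i * syl d f g j i) = coeff ((\<Sum>i<d. monom (x i) i) * f) j"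
  unfolding sum_distrib_right coeff_sum by (rule sum.cong) (auto simp: syl_def coeff_monom_mult')
 moreover have "(\<Sum>i<d. x (d + i) * syl d f g j (d + i)) = coeff ((\<Sum>i<d. monom (x (d + i)) i) * g) j"
  unfolding sum_distrib_right coeff_sum by (rule sum.cong) (auto simp: syl_def coeff_monom_mult')
 ultimately show ?thesis by simp
qed

lemma degree_sum_monom_less: "d > 0 ==> degree (\<Sum>i<d. monom (x i) i) < d"
 by (rule degree_lessI) (auto simp: coeff_sum)

lemma coeff_sum_monom_less: "coeff (\<Sum>i<d. monom (x i) i) k = (if k < d then x k else 0)"
 by (simp add: coeff_sum)

lemma sum_monom_coeff: "degree p < d ==> (\<Sum>i<d. monom (coeff p i) i) = p"
 by (rule poly_eqI) (auto simp: coeff_sum_monom_less coeff_eq_0)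

lemma syl_common_root:
 fixes f g :: "'k::field poly"
 assumes d: "degree f = d" "degree g < d" and r: "poly f r = 0" "poly g r = 0"
 shows "EX x. (ALL j. (\<Sum>i<2*d. x i * syl d f g j i) = 0) & (\<exists>i<2*d. x i ~= 0)"
proof -
 from r obtain U W where U: "f = [:-r, 1:] * U" and W: "g = [:-r, 1:] * W" unfolding poly_eq_0_iff_dvd dvd_def by blast
 have d0: "d > 0" using d by simp
 then have f0: "f ~= 0" "U ~= 0" using d U by auto
 have dU: "degree U < d" using degree_mult_eq[of "[:-r, 1:]" U] U f0 d by simp
 have dW: "degree W < d"
 proof (cases "W = 0")
  case False
  then show ?thesis using degree_mult_eq[of "[:-r, 1:]" W] W d by simp
 qed (use d0 in simp)
 define x where "x i = (if i < d then coeff W i else - coeff U (i - d))" for i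
 have "(\<Sum>i<d. monom (x i) i) = (\<Sum>i<d. monom (coeff W i) i)" by (rule sum.cong) (auto simp: x_def)
 then have 1: "(\<Sum>i<d. monom (x i) i) = W" using sum_monom_coeff[OF dW] by simp
 have "(\<Sum>i<d. monom (x (d + i)) i) = - (\<Sum>i<d. monom (coeff U i) i)" by (simp add: x_def minus_monom[symmetric] sum_negf)
 then have 2: "(\<Sum>i<d. monom (x (d + i)) i) = - U" using sum_monom_coeff[OF dU] by simp
 have "W * (l * U) + - U * (l * W) = 0" for l by (simp add: mult_ac)
 then have "W * f + - U * g = 0" unfolding U W .
 then have "(\<Sum>i<2*d. x i * syl d f g j i) = 0" for j unfolding syl_sum 1 2 by simp
 moreover obtain k where "coeff U k ~= 0" "k < d" using f0 dU le_degree[of U] leading_coeff_0_iff[of U] by blast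
 then have "x (d + k) ~= 0 & d + k < 2 * d" by (simp add: x_def)
 ultimately show ?thesis by blast
qed

lemma card_roots_simple:
 fixes p :: "'k::alg_closed_field poly"
 assumes p: "p ~= 0" and s: "!!x. poly p x = 0 ==> poly (pderiv p) x ~= 0"
 shows "card {x. poly p x = 0} = degree p"
proof -
 let ?A = "{x. poly p x = 0}"
 have fin: "finite ?A" by (rule poly_roots_finite[OF p])
 have "p dvd (\<Prod>r\<in>?A. [:-r, 1:])"
 proof (rule dvd_if_root_powers_dvd[OF p])
  fix x
  show "[:- x, 1:] ^ order x p dvd (\<Prod>r\<in>?A. [:-r, 1:])"
  proof (cases "poly p x = 0")
   case False
   then show ?thesis by (simp add: order_0I)
  next
   case True
   have "~ [:-x, 1:] ^ 2 dvd p"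
   proof
    assume "[:-x, 1:] ^ 2 dvd p"
    then obtain k where "p = [:-x, 1:] ^ 2 * k" by (elim dvdE)
    then have k: "p = [:-x, 1:] * ([:-x, 1:] * k)" by (simp only: power2_eq_square mult.assoc)
    have "poly (pderiv p) x = 0" unfolding k by (simp only: pderiv_mult) simp
    then show False using s[OF True] by simp
   qed
   then have "~ 2 \<le> order x p" using order_divides[of x 2 p] p by auto
   moreover have "order x p ~= 0" using True order_root p by blast
   ultimately have "order x p = 1" by simp
   moreover have "[:- x, 1:] dvd (\<Prod>r\<in>?A. [:-r, 1:])" by (rule dvd_prodI[OF fin]) (use True in simp)
   ultimately show ?thesis by simp
  qed
 qed
 moreover have "(\<Prod>r\<in>?A. [:-r, 1:]) ~= 0" using fin by auto
 ultimately have "degree p \<le> degree (\<Prod>r\<in>?A. [:-r, 1:])" by (rule dvd_imp_degree_le)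
 also have "\<dots> = card ?A" by (subst degree_prod_eq_sum_degree) auto
 finally show ?thesis using card_poly_roots_bound[OF p] by simp
qed

lemma infinite_alg_closed: "infinite (UNIV :: 'k::alg_closed_field set)"
proof
 assume fin: "finite (UNIV :: 'k set)"
 define p :: "'k poly" where "p = (\<Prod>a\<in>UNIV. [:-a, 1:])"
 have "degree p = CARD('k)" unfolding p_def by (subst degree_prod_eq_sum_degree) (auto simp: fin)
 then have "degree (p + 1) > 0" using fin degree_add_eq_left[of 1 p] by (simp add: card_gt_0_iff)
 then obtain x where "poly (p + 1) x = 0" using alg_closed_imp_poly_has_root by blast
 moreover have "poly p x = 0" unfolding p_def using fin by (auto simp: poly_prod intro!: prod_zero exI[of _ x])
 ultimately show False by simp
qed

interpretation plane: lin_coords "{fst, snd} :: ('k::alg_closed_field \<times> 'k => 'k) set" "%z v t. (fst z + t * fst v, snd z + t * snd v)" "(0, 0)"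
proof (unfold_locales)
 fix z w :: "'k \<times> 'k"
 show "EX v. (fst z + 1 * fst v, snd z + 1 * snd v) = w" by (rule exI[of _ "(fst w - fst z, snd w - snd z)"]) simp
 assume "!!x. x \<in> {fst, snd} ==> x z = x w"
 then show "z = w" by (intro prod_eqI) auto
next
 show "infinite (UNIV :: 'k set)" by (rule infinite_alg_closed)
qed auto

text \<open>Here \<open>s\<close> and \<open>t\<close> are mere degree bounds. By
  \<open>degree_additive\<close> the factors of a nonzero function of degree \<open>e\<close> always
  admit bounds with sum at most \<open>e\<close>, so this is irreducibility in the usual
  sense.\<close>

definition irr :: "nat => ('k::comm_ring_1 \<times> 'k => 'k) => bool" where
 "irr e h \<longleftrightarrow> Pl e h & e \<ge> 1 & ~ Pl (e - 1) h &
  (ALL f g s t. Pl s f --> Pl t g --> s + t \<le> e --> (ALL P. h P = f P * g P) --> s = 0 | t = 0)"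

locale irr_plane = monic_curve a d for a :: "nat => nat => 'k::{alg_closed_field,field_gcd}" and d +
 assumes irrF: "irr d (%P. curve_fun a d (fst P) (snd P))"
begin

definition pF :: "'k poly poly" where "pF = (\<Sum>k\<le>d. monom (\<Sum>j\<le>d-k. monom (a j k) j) k)"

lemma coeff_pF: "coeff pF k = (if k \<le> d then \<Sum>j\<le>d-k. monom (a j k) j else 0)" by (simp add: pF_def coeff_sum)

lemma poly_coeff_pF: "poly (coeff pF k) x = coeff (Fp x) k"
 by (simp add: coeff_pF coeff_Fp poly_sum poly_monom)

lemma degree_pF: "degree pF = d" and lead_pF: "coeff pF d = 1"
proof -
 show 1: "coeff pF d = 1" by (simp add: coeff_pF monic one_poly_def monom_0)
 have "degree pF \<le> d" by (rule degree_le) (simp add: coeff_pF)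
 moreover have "d \<le> degree pF" by (rule le_degree) (simp add: 1)
 ultimately show "degree pF = d" by simp
qed

lemma pF_nz: "pF ~= 0" using lead_pF by auto

lemma map_pF: "map_poly (%c. poly c x) pF = Fp x" by (rule poly_eqI) (simp add: coeff_map_poly poly_coeff_pF)

lemma ev_pF: "ev pF (x, y) = F x y" by (simp add: ev_map map_pF poly_Fp)

lemma ev_pF': "ev pF P = F (fst P) (snd P)" using ev_pF[of "fst P" "snd P"] by simp

text \<open>Unique factorisation of polynomials, supplied by the sort \<open>field_gcd\<close>,
  turns irreducibility into primality.\<close>

lemma prime_pF: "prime_elem pF"
proof -
 have inf: "infinite (UNIV :: 'k set)" by (rule inf_field)
 have unit: "is_unit A" if c: "!!P. ev A P = ev A (0, 0)" and nz: "A ~= 0" for A :: "'k poly poly"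
 proof -
  have "A = [:[:ev A (0, 0):]:]" by (rule ev_inj[OF inf]) (use c in \<open>simp add: ev_def\<close>)
  moreover define c where "c = ev A (0, 0)"
  ultimately have Ac: "A = [:[:c:]:]" by simp
  then have "c ~= 0" using nz by auto
  then have "1 = A * [:[:inverse c:]:]" unfolding Ac by (simp add: one_pCons)
  then show ?thesis by (rule dvdI)
 qed
 have "irreducible pF"
 proof (rule comm_semiring_1_class.irreducibleI)
  show "pF ~= 0" by (rule pF_nz)
  show "~ is_unit pF"
  proof
   assume "is_unit pF"
   then have "degree pF \<le> degree (1 :: 'k poly poly)" by (rule dvd_imp_degree_le) simp
   then show False using degree_pF d_pos by simp
  qed
  fix A B assume AB: "pF = A * B"
  then have nz: "A ~= 0" "B ~= 0" using pF_nz by auto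
  obtain sA sB where PlAB: "Pl sA (ev A)" "Pl sB (ev B)" using Pol_ev[of A] Pol_ev[of B] unfolding polyfun_def by blast
  have "EX P. ev A P ~= 0" using ev_inj[OF inf, of A 0] nz by (auto simp: ev_0)
  then obtain P where P: "ev A P ~= 0" by blast
  have "EX P. ev B P ~= 0" using ev_inj[OF inf, of B 0] nz by (auto simp: ev_0)
  then obtain Q where Q: "ev B Q ~= 0" by blast
  have e: "F (fst P) (snd P) = ev A P * ev B P" for P unfolding ev_pF'[symmetric] AB by (rule ev_mult)
  have "Pl d (%P. ev A P * ev B P)" using irrF by (simp add: irr_def e)
  from plane.degree_additive[OF this PlAB(1) P PlAB(2) Q] obtain s t where st: "s + t \<le> d" "Pl s (ev A)" "Pl t (ev B)" by blast
  then have "s = 0 | t = 0" using irrF e unfolding irr_def by blast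
  then show "is_unit A | is_unit B"
  proof
   assume "s = 0"
   then have "is_unit A" using st by (intro unit plane.PF_0 nz) simp
   then show ?thesis ..
  next
   assume "t = 0"
   then have "is_unit B" using st by (intro unit plane.PF_0 nz) simp
   then show ?thesis ..
  qed
 qed
 then show ?thesis by (rule irreducible_imp_prime_elem)
qed

lemma not_dvd: assumes "p ~= 0" "degree p < d" shows "~ pF dvd p"
 using assms degree_pF dvd_imp_degree_le[of pF p] by auto

text \<open>Takes the place of the resultant. In a relation A pF + B p = 0 over the polynomials in
  x, primality of \<open>pF\<close> forces B = 0, as B and p have smaller degree in y. So the
  Sylvester system has trivial kernel at some x, and a minor nonzero there vanishes at every
  abscissa of a common zero.\<close>

lemma finite_common:
 assumes p: "p ~= 0" "degree p < d"
 shows "finite {x. EX y. F x y = 0 & ev p (x, y) = 0}"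
proof -
 define Mp where "Mp j i = syl d pF p j i" for j i
 define M' where "M' j i x = poly (Mp j i) x" for j i x
 have syl_hom: "M' j i x = syl d (Fp x) (map_poly (%c. poly c x) p) j i" for j i x
  by (simp add: M'_def Mp_def syl_def poly_coeff_pF coeff_map_poly)
 define R where "R = range (poly :: 'k poly => 'k => 'k)"
 have "EX x. (1::'k) ~= 0 & (ALL v. (\<forall>j\<in>{..<2*d}. (\<Sum>i\<in>{..<2*d}. v i * M' j i x) = 0) --> (\<forall>i\<in>{..<2*d}. v i = 0))"
 proof (rule kernel_lift[where R = R and r = "%_. 1"])
  show "(%_. 0) \<in> R" unfolding R_def by (rule range_eqI[of _ _ 0]) auto
  show "(%_. 1) \<in> R" "(%_. 1) \<in> R" unfolding R_def by (rule range_eqI[of _ _ 1], auto)+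
  show "(%z. f z - g z) \<in> R" "(%z. f z * g z) \<in> R" if "f \<in> R" "g \<in> R" for f g
  proof -
   from that obtain p r where "f = poly p" "g = poly r" unfolding R_def by blast
   then have "(%z. f z - g z) = poly (p - r)" "(%z. f z * g z) = poly (p * r)" by auto
   then show "(%z. f z - g z) \<in> R" "(%z. f z * g z) \<in> R" unfolding R_def by blast+
  qed
  show "EX y. f y ~= 0 & g y ~= 0" if fg: "f \<in> R" "g \<in> R" "f z ~= 0" "g w ~= 0" for f g z w
  proof -
   from fg obtain p r where pr: "f = poly p" "g = poly r" unfolding R_def by blast
   then have "p * r ~= 0" using fg by auto
   then have "EX y. poly (p * r) y ~= 0" using poly_eqI_infinite[OF inf_field, of "p * r" 0] by auto
   then show ?thesis using pr by auto
  qed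
  show "M' j i \<in> R" for i j unfolding R_def M'_def by blast
  fix v assume v: "\<forall>i\<in>{..<2*d}. v i \<in> R" "\<forall>j\<in>{..<2*d}. ALL z. (\<Sum>i\<in>{..<2*d}. v i z * M' j i z) = 0"
  from v(1) have "\<forall>i\<in>{..<2*d}. EX u. v i = poly u" unfolding R_def by blast
  from bchoice[OF this] obtain u where u: "!!i. i < 2 * d ==> v i = poly (u i)" by auto
  define A B where "A = (\<Sum>i<d. monom (u i) i)" and "B = (\<Sum>i<d. monom (u (d + i)) i)"
  have dAB: "degree A < d" "degree B < d" using d_pos unfolding A_def B_def by (auto intro!: degree_sum_monom_less)
  have "A * pF + B * p = 0"
  proof (rule poly_eqI)
   fix j
   show "coeff (A * pF + B * p) j = coeff 0 j"
   proof (cases "j < 2 * d")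
    case True
    have "(\<Sum>i<2*d. u i * Mp j i) = 0"
    proof (rule poly_eqI_infinite[OF inf_field])
     fix y
     have "poly (\<Sum>i<2*d. u i * Mp j i) y = (\<Sum>i\<in>{..<2*d}. v i y * M' j i y)"
      unfolding poly_sum poly_mult M'_def by (rule sum.cong) (auto simp: u)
     then show "poly (\<Sum>i<2*d. u i * Mp j i) y = poly 0 y" using v(2) True by simp
    qed
    then show ?thesis unfolding Mp_def syl_sum A_def B_def by simp
   next
    case False
    have "degree (A * pF) < 2 * d" "degree (B * p) < 2 * d"
     using degree_mult_le[of A pF] degree_mult_le[of B p] dAB degree_pF p by linarith+
    then show ?thesis using False by (simp add: coeff_eq_0)
   qed
  qed
  then have e: "B * p = - (A * pF)" by (simp add: eq_neg_iff_add_eq_0 add.commute)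
  then have "pF dvd B * p" by simp
  then have "pF dvd B | pF dvd p" using prime_elem_dvd_mult_iff[OF prime_pF] by blast
  then have B0: "B = 0" using not_dvd[OF p] not_dvd[of B] dAB by blast
  then have A0: "A = 0" using e pF_nz by simp
  show "\<forall>i\<in>{..<2*d}. ALL z. v i z = 0"
  proof (intro ballI allI)
   fix i z assume i: "i \<in> {..<2*d}"
   have "u i = 0"
   proof (cases "i < d")
    case True
    then show ?thesis using A0 coeff_sum_monom_less[of u d i] unfolding A_def by simp
   next
    case False
    then have "i - d < d" "d + (i - d) = i" using i by auto
    then show ?thesis using B0 coeff_sum_monom_less[of "%i. u (d + i)" d "i - d"] unfolding B_def by simp
   qed
   then show "v i z = 0" using u i by simp
  qed
 qed auto
 then obtain x0 where x0: "!!v. (\<forall>j\<in>{..<2*d}. (\<Sum>i\<in>{..<2*d}. v i * M' j i x0) = 0) ==> (\<forall>i\<in>{..<2*d}. v i = 0)" by blast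
 define e where "e = (\<Sum>j<2*d. \<Sum>i<2*d. degree (Mp j i))"
 have poly_PF: "PF {%x. x} n (poly r)" if "degree r \<le> n" for r :: "'k poly" and n
 proof -
  have "PF {%x::'k. x} n (%x. \<Sum>i\<le>n. coeff r i * x ^ i)"
   by (intro PF_sum PF_scale, rule PF_mono[OF PF_power[OF PF_var]]) auto
  moreover have "poly r = (%x. \<Sum>i\<le>n. coeff r i * x ^ i)" using poly_sum_atMost[OF that] by blast
  ultimately show ?thesis by simp
 qed
 have M'PF: "PF {%x. x} e (M' j i)" if ij: "i \<in> {..<2*d}" "j \<in> {..<2*d}" for i j
 proof -
  have "degree (Mp j i) \<le> (\<Sum>i<2*d. degree (Mp j i))" by (rule member_le_sum) (use ij in auto)
  also have "\<dots> \<le> e" unfolding e_def by (rule member_le_sum[of j "{..<2*d}" "%j. \<Sum>i<2*d. degree (Mp j i)"]) (use ij in auto)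
  finally show ?thesis unfolding M'_def by (rule poly_PF)
 qed
 have "\<exists>\<Delta>. PF {%x. x} (card {..<2*d} * e) \<Delta> & \<Delta> x0 ~= 0 &
  (ALL z. \<Delta> z ~= 0 --> (ALL v. (\<forall>j\<in>{..<2*d}. (\<Sum>i\<in>{..<2*d}. v i * M' j i z) = 0) --> (\<forall>i\<in>{..<2*d}. v i = 0)))"
  by (rule PF_minor[OF _ _ M'PF]) (use x0 in auto)
 then obtain \<Delta> where D: "PF {%x. x} (card {..<2*d} * e) \<Delta>" "\<Delta> x0 ~= 0"
  "!!z v. \<Delta> z ~= 0 ==> (\<forall>j\<in>{..<2*d}. (\<Sum>i\<in>{..<2*d}. v i * M' j i z) = 0) ==> (\<forall>i\<in>{..<2*d}. v i = 0)" by blast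
 have "EX r. degree r \<le> card {..<2*d} * e & (ALL t. \<Delta> t = poly r t)"
  by (rule PF_poly[OF D(1), of "%t. t"]) (auto intro!: exI[of _ "[:0, 1:]"])
 then obtain r where r: "!!t. \<Delta> t = poly r t" by blast
 have "r ~= 0" using r[of x0] D(2) by auto
 then have fin: "finite {x. poly r x = 0}" by (rule poly_roots_finite)
 have "{x. EX y. F x y = 0 & ev p (x, y) = 0} \<subseteq> {x. poly r x = 0}"
 proof (rule ccontr)
  assume "~ ?thesis"
  then obtain x y where xy: "F x y = 0" "ev p (x, y) = 0" "\<Delta> x ~= 0" using r by auto
  have "degree (map_poly (%c. poly c x) p) < d" using p(2) degree_map_eval[of x p] by simp
  moreover have "poly (Fp x) y = 0" "poly (map_poly (%c. poly c x) p) y = 0" using xy by (simp_all add: poly_Fp ev_map)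
  ultimately obtain v where "ALL j. (\<Sum>i<2*d. v i * M' j i x) = 0" "\<exists>i<2*d. v i ~= 0"
   using syl_common_root[OF degree_Fp, of _ x y] unfolding syl_hom by blast
  then show False using D(3)[OF xy(3), of v] by auto
 qed
 then show ?thesis using fin finite_subset by blast
qed

lemma ex_root: "EX y. F x y = 0"
proof -
 have "degree (Fp x) > 0" using degree_Fp[of x] d_pos by linarith
 then show ?thesis using alg_closed_imp_poly_has_root[of "Fp x"] by (simp add: poly_Fp)
qed

lemma small_vanish: assumes "degree p < d" "!!P. P \<in> C ==> ev p P = 0" shows "p = 0"
proof (rule ccontr)
 assume "p ~= 0"
 have "{x. EX y. F x y = 0 & ev p (x, y) = 0} = UNIV"
 proof -
  have "EX y. F x y = 0 & ev p (x, y) = 0" for x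
  proof -
   obtain y where "F x y = 0" using ex_root by blast
   then show ?thesis using assms(2)[of "(x, y)"] by (auto simp: C_def)
  qed
  then show ?thesis by blast
 qed
 then show False using finite_common[OF \<open>p ~= 0\<close> assms(1)] inf_field by simp
qed

lemma sum_mon_ev: "EX r. degree r < d & (ALL P. (\<Sum>i\<in>M s. c i * mon i P) = ev r P)"
proof -
 define r where "r = (\<Sum>j<d. monom (\<Sum>e\<in>{e. e + j \<le> s}. monom (c (j, e)) e) j)"
 have "degree r < d" unfolding r_def using d_pos by (intro degree_sum_monom_less) simp
 moreover have "(\<Sum>i\<in>M s. c i * mon i P) = ev r P" for P
 proof -
  have "(\<Sum>i\<in>M s. c i * mon i P) = (\<Sum>j<d. \<Sum>e\<in>{e. e + j \<le> s}. c (j, e) * mon (j, e) P)"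
   unfolding M_def by (subst sum.Sigma) (auto simp: case_prod_beta)
  also have "\<dots> = ev r P" unfolding r_def ev_def
   by (simp add: poly_sum poly_monom mon_def sum_distrib_right mult.assoc)
  finally show ?thesis .
 qed
 ultimately show ?thesis by blast
qed

lemma domain_C:
 assumes "Pol \<phi>" "Pol ps" "!!P. P \<in> C ==> \<phi> P * ps P = 0"
 shows "(\<forall>P\<in>C. \<phi> P = 0) | (\<forall>P\<in>C. ps P = 0)"
proof -
 obtain p r where pr: "\<phi> = ev p" "ps = ev r" using Pol_ex_ev[OF assms(1)] Pol_ex_ev[OF assms(2)] by blast
 obtain s where "Pl s (%P. \<phi> P * ps P)" using polyfun_mult[OF assms(1,2)] unfolding polyfun_def by blast
 from Pl_NF[OF this] obtain c G where G: "Pol G" "!!P. \<phi> P * ps P = (\<Sum>i\<in>M s. c i * mon i P) + F (fst P) (snd P) * G P"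
  unfolding NF_def by blast
 obtain w where w: "degree w < d" "!!P. (\<Sum>i\<in>M s. c i * mon i P) = ev w P" using sum_mon_ev by blast
 have "w = 0" by (rule small_vanish[OF w(1)]) (use G(2) assms(3) in \<open>simp add: w(2)[symmetric] C_def\<close>)
 obtain g where g: "G = ev g" using Pol_ex_ev[OF G(1)] by blast
 have "p * r = pF * g"
  by (rule ev_inj[OF inf_field]) (use G(2) in \<open>simp add: ev_mult pr w(2) \<open>w = 0\<close> ev_0 ev_pF' g\<close>)
 then have "pF dvd p | pF dvd r" using prime_elem_dvd_mult_iff[OF prime_pF] by (metis dvd_triv_left)
 moreover have "\<forall>P\<in>C. ev u P = 0" if "pF dvd u" for u
  using that by (auto simp: dvd_def ev_mult ev_pF' C_def)
 ultimately show ?thesis using pr by blast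
qed

lemma irr_curveI:
 assumes nz: "pderiv pF ~= 0" shows "irr_curve a d"
proof unfold_locales
 have dp: "degree (pderiv pF) < d" using degree_pF d_pos by (intro degree_lessI) (auto simp: coeff_pderiv coeff_eq_0)
 have mp: "map_poly (%c. poly c x) (pderiv pF) = pderiv (Fp x)" for x
  by (rule poly_eqI) (simp add: coeff_map_poly coeff_pderiv poly_coeff_pF)
 have "{x. card {y. F x y = 0} ~= d} \<subseteq> {x. EX y. F x y = 0 & ev (pderiv pF) (x, y) = 0}"
 proof (rule ccontr)
  assume "~ ?thesis"
  then obtain x where x: "card {y. F x y = 0} ~= d" "!!y. F x y = 0 ==> ev (pderiv pF) (x, y) ~= 0" by auto
  then show False using card_roots_simple[OF Fp_nz, of x] by (simp add: poly_Fp degree_Fp ev_map mp)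
 qed
 then show "finite {x. card {y. F x y = 0} ~= d}" using finite_common[OF nz dp] finite_subset by blast
next
 fix s t \<phi> ps assume "Pl s \<phi>" "Pl t ps" and z: "!!x y. F x y = 0 ==> \<phi> (x, y) * ps (x, y) = 0"
 moreover have "\<phi> P * ps P = 0" if "P \<in> C" for P using z[of "fst P" "snd P"] that by (simp add: C_def)
 ultimately have "(\<forall>P\<in>C. \<phi> P = 0) | (\<forall>P\<in>C. ps P = 0)" by (intro domain_C polyfunI)
 then show "(ALL x y. F x y = 0 --> \<phi> (x, y) = 0) | (ALL x y. F x y = 0 --> ps (x, y) = 0)"
  unfolding C_def by auto
qed

end

context irr_curve
begin

text \<open>Smoothness is avoided by counting without multiplicity: interpolation functions at the
  points of \<open>S\<close> are independent modulo the multiples of \<phi>, which vanish on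
  \<open>S\<close>.\<close>

lemma bezout_points:
 assumes \<phi>: "Pl \<mu> \<phi>" and nz: "\<exists>P\<in>C. \<phi> P ~= 0" and S: "finite S" "!!P. P \<in> S ==> P \<in> C & \<phi> P = 0"
 shows "card S \<le> d * \<mu>"
proof -
 define s where "s = d + card S"
 have "\<forall>P0\<in>S. EX L. Pl (card S) L & L P0 ~= 0 & (\<forall>P\<in>S. P ~= P0 --> L P = 0)" using Pl_interp[OF S(1)] by blast
 from bchoice[OF this] obtain L where L: "!!P0. P0 \<in> S ==> Pl (card S) (L P0)" "!!P0. P0 \<in> S ==> L P0 P0 ~= 0"
  "!!P0 P. P0 \<in> S ==> P \<in> S ==> P ~= P0 ==> L P0 P = 0" by blast
 define be where "be = case_sum (%i P. \<phi> P * mon i P) L"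
 have sumI: "(\<Sum>u\<in>M s <+> S. c u * be u z) = (\<Sum>i\<in>M s. c (Inl i) * (\<phi> z * mon i z)) + (\<Sum>P\<in>S. c (Inr P) * L P z)" for c z
  by (subst sum.Plus) (auto simp: S(1) be_def)
 have "card (M s <+> S) \<le> card (M (s + \<mu>))"
 proof (rule indep_le_spanned[where \<Omega> = C and be = be and \<gamma> = mon])
  show "indep C (M s <+> S) be"
  proof (rule indepI)
   fix c u assume c: "!!z. z \<in> C ==> (\<Sum>u\<in>M s <+> S. c u * be u z) = 0" and u: "u \<in> M s <+> S"
   have cS: "c (Inr P) = 0" if P: "P \<in> S" for P
   proof -
    have "(\<Sum>R\<in>S. c (Inr R) * L R P) = c (Inr P) * L P P"
    proof -
     have "(\<Sum>R\<in>S - {P}. c (Inr R) * L R P) = 0"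
     proof (rule sum.neutral, rule ballI)
      fix R assume "R \<in> S - {P}"
      then have "L R P = 0" using L(3)[of R P] P by blast
      then show "c (Inr R) * L R P = 0" by simp
     qed
     then show ?thesis by (simp add: sum.remove[OF S(1) P])
    qed
    then show ?thesis using c[of P] S(2)[OF P] L(2)[OF P] unfolding sumI by simp
   qed
   let ?ps = "%z. \<Sum>i\<in>M s. c (Inl i) * mon i z"
   have "\<phi> z * ?ps z = 0" if "z \<in> C" for z
    using c[OF that] unfolding sumI by (simp add: cS sum_distrib_left mult.left_commute)
   moreover have "Pol ?ps" by (intro polyfun_intros polyfunI[OF mon_Pl])
   ultimately have "\<forall>z\<in>C. ?ps z = 0" using domC[OF polyfunI[OF \<phi>]] nz by blast
   then have cM: "c (Inl i) = 0" if "i \<in> M s" for i using indepD[OF indep_mon'[of s], of "%i. c (Inl i)" i] that by blast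
   show "c u = 0" using u cS cM by auto
  qed
  fix u assume "u \<in> M s <+> S"
  then show "spanned C (M (s + \<mu>)) mon (be u)"
  proof
   fix i assume i: "u = Inl i" "i \<in> M s"
   have "Pl (s + \<mu>) (%P. \<phi> P * mon i P)" using PF_mult[OF \<phi> mon_Pl'[OF i(2)]] by (simp add: add.commute)
   then show ?thesis using i Pl_spanned by (simp add: be_def)
  next
   fix P assume P: "u = Inr P" "P \<in> S"
   have "Pl (s + \<mu>) (L P)" by (rule PF_mono[OF L(1)[OF P(2)]]) (simp add: s_def)
   then show ?thesis using P Pl_spanned by (simp add: be_def)
  qed
 qed (use S in auto)
 moreover have "card (M (s + \<mu>)) = card (M s) + d * \<mu>" by (rule card_M_add) (simp add: s_def)
 ultimately show ?thesis using S(1) by (simp add: card_Plus)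
qed

end

section \<open>Rational points of plane curves\<close>

interpretation vecs: lin_coords "crd :: ('k::alg_closed_field ^ 'n::finite => 'k) set" "%z v t. z + t *s v" "0"
proof (unfold_locales)
 fix z w :: "'k ^ 'n"
 show "EX v. z + 1 *s v = w" by (rule exI[of _ "w - z"]) simp
 assume h: "!!x. x \<in> crd ==> x z = x w"
 have "z $ i = w $ i" for i using h[of "%z. z $ i"] by (simp add: crd_def)
 then show "z = w" by (simp add: Finite_Cartesian_Product.vec_eq_iff)
next
 show "infinite (UNIV :: 'k set)" by (rule infinite_alg_closed)
qed (auto simp: crd_def)

lemma irrD:
 assumes "irr e h" "Pl s f" "Pl t g" "s + t \<le> e" "!!P. h P = f P * g P" shows "s = 0 | t = 0"
proof -
 have "ALL f g s t. Pl s f --> Pl t g --> s + t \<le> e --> (ALL P. h P = f P * g P) --> s = 0 | t = 0"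
  using assms(1) unfolding irr_def by (elim conjE)
 from this[rule_format, of s f t g] assms(2-) show ?thesis by blast
qed

text \<open>\<Theta> is the leading form, of degree \<delta>, times a first derivative that is
  linear in the direction. If all first derivatives vanished, \<open>pth_power\<close> would make
  \<open>g\<close> a p-th power.\<close>

lemma ex_direction:
 fixes g :: "'k::alg_closed_field ^ 'n::finite => 'k"
 assumes g: "PF crd \<delta> g" "~ PF crd (\<delta> - 1) g" "\<delta> \<ge> 1" and p: "CHAR('k) > 0"
  and np: "~ (EX h s. PF crd s h & (ALL z. g z = h z ^ CHAR('k)) & s * CHAR('k) \<le> \<delta>)"
 shows "\<exists>\<Theta> T. PF crd (\<delta> + 1) \<Theta> & (EX v. \<Theta> v ~= 0) &
  (ALL v. \<Theta> v ~= 0 --> T v ~= 0 & (EX z P. (ALL t. g (z + t *s v) = poly P t) & pderiv P ~= 0)) &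
  (ALL z v. EX P. (ALL t. g (z + t *s v) = poly P t) & degree P \<le> \<delta> & coeff P \<delta> = T v)"
proof -
 have prime: "prime CHAR('k)" using prime_CHAR_semidom p by blast
 have nz: "EX w. g w ~= 0"
 proof (rule ccontr)
  assume "~ ?thesis"
  then have g0: "g = (%_. 0)" by auto
  have "PF crd (\<delta> - 1) g" unfolding g0 by (rule PF_const)
  then show False using g(2) by simp
 qed
 then obtain w where w: "g w ~= 0" by blast
 from vecs.exact_degree_poly[OF g(1) _ w] g(2) obtain T v0 where T: "PF crd \<delta> T" "T v0 ~= 0"
  "!!z v. EX P. (ALL t. g (z + t *s v) = poly P t) & degree P \<le> \<delta> & coeff P \<delta> = T v" by blast
 from vecs.taylor[OF g(1)] obtain D where D: "!!z v t. g (z + t *s v) = (\<Sum>i\<le>\<delta>. t ^ i * D i z v)"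
  "!!i z. PF crd i (%v. D i z v)" by blast
 have D1: "poly (pderiv P) t = D 1 (z + t *s v) v" if P: "!!t. g (z + t *s v) = poly P t" for z v P t
 proof -
  define Q where "Q = (\<Sum>i\<le>\<delta>. monom (D i (z + t *s v) v) i)"
  have "pcompose P [:t, 1:] = Q"
  proof (rule poly_eqI_infinite[OF infinite_alg_closed])
   fix y
   have "poly Q y = g ((z + t *s v) + y *s v)" unfolding D(1) Q_def by (simp add: poly_sum poly_monom mult.commute)
   also have "\<dots> = poly P (t + y)" unfolding P[symmetric] by (simp add: vector_sadd_rdistrib add.assoc)
   finally show "poly (pcompose P [:t, 1:]) y = poly Q y" by (simp add: poly_pcompose add.commute)
  qed
  then have "coeff (pderiv (pcompose P [:t, 1:])) 0 = coeff (pderiv Q) 0" by simp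
  also have "coeff (pderiv Q) 0 = coeff Q 1" by (simp add: coeff_pderiv)
  also have "\<dots> = D 1 (z + t *s v) v" using g(3) by (simp add: Q_def coeff_sum)
  finally show ?thesis by (simp add: pderiv_pcompose poly_0_coeff_0[symmetric] poly_pcompose pderiv_pCons)
 qed
 have "EX z1 v1. D 1 z1 v1 ~= 0"
 proof (rule ccontr)
  assume c: "~ ?thesis"
  have "EX h. PF crd (\<delta> div CHAR('k)) h & (ALL z. g z = h z ^ CHAR('k))"
  proof (rule pth_power[OF g(1) p])
   show "(x + y) ^ CHAR('k) = x ^ CHAR('k) + y ^ CHAR('k)" for x y :: 'k
    by (rule freshmans_dream[OF prime refl])
   show "EX y. y ^ CHAR('k) = x" for x :: 'k by (rule nth_root_exists[OF p])
   show "CHAR('k) dvd k" if "of_nat k = (0::'k)" for k using that by (simp add: of_nat_eq_0_iff_char_dvd)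
   fix i z P assume "!!t. g (z + t *s axis i 1) = poly P t"
   from D1[OF this] c have "poly (pderiv P) t = 0" for t by simp
   then show "pderiv P = 0" by (intro poly_eqI_infinite[OF infinite_alg_closed]) simp
  qed
  then obtain h where h: "PF crd (\<delta> div CHAR('k)) h" "ALL z. g z = h z ^ CHAR('k)" by blast
  moreover have "\<delta> div CHAR('k) * CHAR('k) \<le> \<delta>" by simp
  ultimately show False using np by blast
 qed
 then obtain z1 v1 where z1: "D 1 z1 v1 ~= 0" by blast
 from vecs.PF_domain[OF T(1) D(2)[of 1 z1] T(2) z1] obtain y where y: "T y ~= 0" "D 1 z1 y ~= 0" by blast
 define \<Theta> where "\<Theta> v = T v * D 1 z1 v" for v
 have c1: "PF crd (\<delta> + 1) \<Theta>" unfolding \<Theta>_def by (rule PF_mult[OF T(1) D(2)])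
 have c2: "EX v. \<Theta> v ~= 0" using y by (intro exI[of _ y]) (simp add: \<Theta>_def)
 have c3: "ALL v. \<Theta> v ~= 0 --> T v ~= 0 & (EX z P. (ALL t. g (z + t *s v) = poly P t) & pderiv P ~= 0)"
 proof (intro allI impI)
  fix v assume "\<Theta> v ~= 0"
  then have v: "T v ~= 0" "D 1 z1 v ~= 0" by (auto simp: \<Theta>_def)
  from T(3)[of z1 v] obtain P where P: "!!t. g (z1 + t *s v) = poly P t" by blast
  from D1[OF P, of 0] v have "pderiv P ~= 0" by auto
  then show "T v ~= 0 & (EX z P. (ALL t. g (z + t *s v) = poly P t) & pderiv P ~= 0)" using P v by blast
 qed
 have c4: "ALL z v. EX P. (ALL t. g (z + t *s v) = poly P t) & degree P \<le> \<delta> & coeff P \<delta> = T v" using T(3) by blast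
 show ?thesis by (intro exI[of _ \<Theta>] exI[of _ T] conjI c1 c2 c3 c4)
qed

locale fqa = fq q ty for q and ty :: "'k::{alg_closed_field,field_gcd} itself" +
 assumes char_pos: "CHAR('k) > 0"
begin

definition pw :: "'k \<times> 'k => 'k \<times> 'k" where "pw P = (fst P ^ q, snd P ^ q)"
definition Rq :: "('k \<times> 'k) set" where "Rq = Fq \<times> Fq"
definition NP :: "('k \<times> 'k => 'k) => nat" where "NP h = card {P\<in>Rq. h P = 0}"

lemma finite_Rq: "finite Rq" using finite_Fq by (simp add: Rq_def)

text \<open>The new y-axis is an F_q-direction with \<Theta> \<noteq> 0, which exists since \<Theta>
  has degree e + 1 < q. Coordinate changes over F_q permute \<open>Rq\<close> and commute with
  Frobenius, so counts and stability carry over.\<close>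

lemma irr_normal:
 assumes h: "irr e h" and e: "e + 1 < q"
 shows "\<exists>a m m' \<gamma>. irr_curve a e & \<gamma> ~= 0 & (ALL P. h (m P) = \<gamma> * curve_fun a e (fst P) (snd P)) &
  (ALL P. m (m' P) = P) & (ALL P. m' (m P) = P) & (\<forall>P\<in>Rq. m P \<in> Rq) & (\<forall>P\<in>Rq. m' P \<in> Rq) &
  (ALL P. m (pw P) = pw (m P)) & (ALL P. m' (pw P) = pw (m' P)) & (ALL s f. Pl s f --> Pl s (%P. f (m P)))"
proof -
 let ?p = "CHAR('k)"
 have prime: "prime ?p" using prime_CHAR_semidom char_pos by blast
 then have p2: "?p \<ge> 2" by (simp add: prime_ge_2_nat)
 have hP: "Pl e h" "e \<ge> 1" "~ Pl (e - 1) h" using h by (auto simp: irr_def)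
 define g where "g z = h (z $ 1, z $ 2)" for z :: "'k ^ 2"
 have toV: "PF crd s (%z :: 'k ^ 2. f (z $ 1, z $ 2))" if "Pl s f" for s f
 proof (rule PF_comp_affine[OF that, of crd "%z. (z $ 1, z $ 2)"])
  have crdi: "PF crd 1 (%z :: 'k ^ 2. z $ i)" for i by (rule PF_var) (auto simp: crd_def)
  fix x :: "'k \<times> 'k => 'k" assume "x \<in> {fst, snd}"
  then show "PF crd 1 (%z :: 'k ^ 2. x (z $ 1, z $ 2))" using crdi[of 1] crdi[of 2] by auto
 qed
 define pv :: "'k \<times> 'k => 'k ^ 2" where "pv P = (\<chi> i. if i = 1 then fst P else snd P)" for P
 have pv1: "pv P $ 1 = fst P" "pv P $ 2 = snd P" for P by (simp_all add: pv_def)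
 have toP: "Pl s (%P. f (pv P))" if "PF crd s f" for s f
 proof (rule PF_comp_affine[OF that, of "{fst, snd}" pv])
  fix x :: "'k ^ 2 => 'k" assume "x \<in> crd"
  then obtain i where i: "x = (%z. z $ i)" unfolding crd_def by blast
  show "Pl 1 (%w. x (pv w))" using Pl_fst Pl_snd by (cases "i = 1") (simp_all add: i pv_def)
 qed
 have gpv: "g (pv P) = h P" for P by (simp add: g_def pv1)
 have gPF: "PF crd e g" unfolding g_def by (rule toV[OF hP(1)])
 have gn: "~ PF crd (e - 1) g" using toP[of "e - 1" g] hP(3) by (auto simp: gpv)
 have np: False if h1: "PF crd s h1" "ALL z. g z = h1 z ^ ?p" "s * ?p \<le> e" for h1 s
 proof -
  define k where "k P = h1 (pv P)" for P
  have k: "Pl s k" unfolding k_def by (rule toP[OF h1(1)])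
  have hk: "h P = k P ^ ?p" for P using h1(2) gpv[of P] by (simp add: k_def)
  have "h P = k P * k P ^ (?p - 1)" for P unfolding hk using p2 by (simp flip: power_Suc)
  moreover have "Pl ((?p - 1) * s) (%P. k P ^ (?p - 1))" by (rule PF_power[OF k])
  moreover have "s + (?p - 1) * s \<le> e" using h1(3) p2 by (simp add: algebra_simps diff_mult_distrib)
  ultimately have "s = 0 | (?p - 1) * s = 0" by (intro irrD[OF h k])
  then have "s = 0" using p2 by simp
  moreover have "h = (%P. k P ^ ?p)" using hk by blast
  ultimately have "Pl 0 h" using PF_power[OF k, of ?p] by simp
  then show False using hP(3) PF_mono[of _ 0 h "e - 1"] by blast
 qed
 have "~ (EX h1 s. PF crd s h1 & (ALL z. g z = h1 z ^ ?p) & s * ?p \<le> e)" using np by blast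
 from ex_direction[OF gPF gn hP(2) char_pos this] obtain \<Theta> T where \<Theta>: "PF crd (e + 1) \<Theta>" "EX v. \<Theta> v ~= 0"
  "!!v. \<Theta> v ~= 0 ==> T v ~= 0 & (EX z P. (ALL t. g (z + t *s v) = poly P t) & pderiv P ~= 0)"
  "!!z v. EX P. (ALL t. g (z + t *s v) = poly P t) & degree P \<le> e & coeff P e = T v" by blast
 from \<Theta>(2) obtain v' where "\<Theta> v' ~= 0" by blast
 from PF_nonzero_Vq[OF \<Theta>(1) this e] obtain v where v: "v \<in> Vq" "\<Theta> v ~= 0" by blast
 from \<Theta>(3)[OF v(2)] obtain z P0 where Tv: "T v ~= 0" and zP: "!!t. g (z + t *s v) = poly P0 t" "pderiv P0 ~= 0" by blast
 have v12: "v $ 1 \<in> Fq" "v $ 2 \<in> Fq" using v by (auto simp: Vq_def)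
 have v0: "v $ 1 ~= 0 | v $ 2 ~= 0"
 proof (rule ccontr)
  assume "~ ?thesis"
  then have "v = 0" by (simp add: Finite_Cartesian_Product.vec_eq_iff forall_2)
  then have "poly P0 t = poly [:g z:] t" for t using zP(1)[of t] by simp
  then have "P0 = [:g z:]" by (rule poly_eqI_infinite[OF infinite_alg_closed])
  then show False using zP(2) by (simp add: pderiv_pCons)
 qed
 define m where "m P = (if v $ 1 ~= 0 then (snd P * v $ 1, fst P + snd P * v $ 2) else (fst P, snd P * v $ 2))" for P
 define m' where "m' P = (if v $ 1 ~= 0 then (snd P - fst P * inverse (v $ 1) * v $ 2, fst P * inverse (v $ 1)) else (fst P, snd P * inverse (v $ 2)))" for P
 have mm: "m (m' P) = P" "m' (m P) = P" for P using v0 by (auto simp: m_def m'_def prod_eq_iff field_simps)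
 have mR: "m P \<in> Rq" "m' P \<in> Rq" if "P \<in> Rq" for P
  using that v12 by (auto simp: m_def m'_def Rq_def intro!: Fq_add Fq_mult Fq_diff Fq_inverse)
 have vq: "(v $ 1) ^ q = v $ 1" "(v $ 2) ^ q = v $ 2" using v12 by (auto simp: Fq_def)
 have mpw: "m (pw P) = pw (m P)" for P by (simp add: m_def pw_def power_mult_distrib frob vq)
 have m'pw: "m' (pw P) = pw (m' P)" for P by (metis mpw mm)
 have mPl: "Pl s (%P. f (m P))" if f: "Pl s f" for s f
 proof (rule PF_comp_affine[OF f, of "{fst, snd}" m])
  have 1: "Pl 1 (%P. snd P * c)" "Pl 1 (%P. fst P + snd P * c)" "Pl 1 (%P. fst P)" for c :: 'k
   using PF_scale[OF Pl_snd, of c] PF_add[OF Pl_fst PF_scale[OF Pl_snd, of c]] Pl_fst by (simp_all add: mult.commute)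
  fix x :: "'k \<times> 'k => 'k" assume "x \<in> {fst, snd}"
  then show "Pl 1 (%P. x (m P))" using 1 by (cases "v $ 1 = 0") (auto simp: m_def)
 qed
 have m'Pl: "Pl s (%P. f (m' P))" if f: "Pl s f" for s f
 proof (rule PF_comp_affine[OF f, of "{fst, snd}" m'])
  have 1: "Pl 1 (%P. snd P * c)" "Pl 1 (%P. fst P * c)" "Pl 1 (%P. snd P - fst P * c)" "Pl 1 (%P. fst P)" for c :: 'k
   using PF_scale[OF Pl_snd, of c] PF_scale[OF Pl_fst, of c] PF_diff[OF Pl_snd PF_scale[OF Pl_fst, of c]] Pl_fst by (simp_all add: mult.commute)
  fix x :: "'k \<times> 'k => 'k" assume "x \<in> {fst, snd}"
  then show "Pl 1 (%P. x (m' P))" using 1(1,2,4) 1(3)[of "inverse (v $ 1) * v $ 2"] by (cases "v $ 1 = 0") (auto simp: m'_def mult.assoc)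
 qed
 define \<gamma> where "\<gamma> = T v"
 have \<gamma>: "\<gamma> ~= 0" using Tv by (simp add: \<gamma>_def)
 have pvm: "pv (m (x, y + t)) = pv (m (x, y)) + t *s v" for x y t
  by (simp add: Finite_Cartesian_Product.vec_eq_iff forall_2 pv1 m_def algebra_simps)
 have hm: "Pl e (%P. inverse \<gamma> * h (m P))" by (rule PF_scale[OF mPl[OF hP(1)]])
 from Pl_ev[OF this] obtain u where u: "tdeg e u" "!!P. inverse \<gamma> * h (m P) = ev u P" by blast
 define a where "a = (%j k. coeff (coeff u k) j)"
 have cf: "inverse \<gamma> * h (m (x, y)) = curve_fun a e x y" for x y
  using ev_curve_fun[OF u(1), of x y] u(2)[of "(x, y)"] by (simp add: a_def)
 have a1: "a 0 e = 1"
 proof -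
  from \<Theta>(4)[of "pv (m (0, 0))" v] obtain P where P: "!!t. g (pv (m (0, 0)) + t *s v) = poly P t" "coeff P e = \<gamma>" unfolding \<gamma>_def by blast
  define Q where "Q = (\<Sum>k\<le>e. monom (a 0 k) k)"
  have "smult (inverse \<gamma>) P = Q"
  proof (rule poly_eqI_infinite[OF infinite_alg_closed])
   fix y
   have "poly P y = h (m (0, y))" using P(1)[of y] pvm[of 0 0 y] by (simp add: gpv[symmetric])
   then have "inverse \<gamma> * poly P y = curve_fun a e 0 y" using cf by simp
   also have "\<dots> = poly Q y"
    unfolding curve_fun_def Q_def poly_sum poly_monom
   proof (rule sum.cong[OF refl])
    fix k
    have "(\<Sum>j\<le>e-k. a j k * 0 ^ j * y ^ k) = (\<Sum>j\<in>{0}. a j k * 0 ^ j * y ^ k)"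
     by (rule sum.mono_neutral_right) auto
    then show "(\<Sum>j\<le>e-k. a j k * 0 ^ j * y ^ k) = a 0 k * y ^ k" by simp
   qed
   finally show "poly (smult (inverse \<gamma>) P) y = poly Q y" by simp
  qed
  then have "coeff (smult (inverse \<gamma>) P) e = coeff Q e" by simp
  then show ?thesis using P(2) \<gamma> by (simp add: Q_def coeff_sum)
 qed
 have hcf: "h (m P) = \<gamma> * curve_fun a e (fst P) (snd P)" for P using cf[of "fst P" "snd P"] \<gamma> by (simp add: field_simps)
 interpret monic_curve a e by unfold_locales (use hP(2) a1 infinite_alg_closed in auto)
 have irrF: "irr e (%P. curve_fun a e (fst P) (snd P))"
  unfolding irr_def
 proof (intro conjI allI impI)
  have eqF: "curve_fun a e (fst P) (snd P) = inverse \<gamma> * h (m P)" for P using cf[of "fst P" "snd P"] by simp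
  show "Pl e (%P. curve_fun a e (fst P) (snd P))" unfolding eqF by (rule hm)
  show "e \<ge> 1" by (rule hP)
  show "~ Pl (e - 1) (%P. curve_fun a e (fst P) (snd P))"
  proof
   assume "Pl (e - 1) (%P. curve_fun a e (fst P) (snd P))"
   from PF_scale[OF m'Pl[OF this], of \<gamma>] have "Pl (e - 1) (%P. h (m (m' P)))" by (simp add: hcf)
   then show False using hP(3) by (simp add: mm)
  qed
  fix f k s t assume fk: "Pl s f" "Pl t k" "s + t \<le> e" and eq: "ALL P. curve_fun a e (fst P) (snd P) = f P * k P"
  have "h P = (\<gamma> * f (m' P)) * k (m' P)" for P using hcf[of "m' P"] eq by (simp add: mm mult.assoc)
  then show "s = 0 | t = 0" using h PF_scale[OF m'Pl[OF fk(1)], of \<gamma>] m'Pl[OF fk(2)] fk(3) unfolding irr_def by blast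
 qed
 interpret irr_plane a e by unfold_locales (rule irrF)
 have "pderiv pF ~= 0"
 proof
  assume c: "pderiv pF = 0"
  define x y where "x = fst (m' (z $ 1, z $ 2))" and "y = snd (m' (z $ 1, z $ 2))"
  have "m (x, y) = (z $ 1, z $ 2)" using mm(1) by (simp add: x_def y_def)
  then have pvz: "pv (m (x, y)) = z" by (simp add: Finite_Cartesian_Product.vec_eq_iff forall_2 pv1)
  have "P0 = smult \<gamma> (pcompose (Fp x) [:y, 1:])"
  proof (rule poly_eqI_infinite[OF infinite_alg_closed])
   fix t
   have "poly P0 t = h (m (x, y + t))" using zP(1)[of t] pvm[of x y t] pvz by (simp add: gpv[symmetric])
   then show "poly P0 t = poly (smult \<gamma> (pcompose (Fp x) [:y, 1:])) t" using hcf[of "(x, y + t)"] by (simp add: poly_pcompose poly_Fp add.commute)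
  qed
  moreover have "pderiv (Fp x) = 0"
  proof (rule poly_eqI)
   fix k have "coeff (pderiv (Fp x)) k = poly (coeff (pderiv pF) k) x" by (simp add: coeff_pderiv poly_coeff_pF)
   then show "coeff (pderiv (Fp x)) k = coeff 0 k" using c by simp
  qed
  ultimately have "pderiv P0 = 0" by (simp add: pderiv_smult pderiv_pcompose)
  then show False using zP(2) by simp
 qed
 from irr_curveI[OF this] show ?thesis
  using \<gamma> hcf mm mR mpw m'pw mPl by (intro exI[of _ a] exI[of _ m] exI[of _ m'] exI[of _ \<gamma>]) blast
qed

text \<open>The error term of \<open>weil_monic\<close>. It is superadditive with room for an
  overlap of r s points (\<open>E_add\<close>), so the same bound survives products.\<close>

definition E :: "nat => real" where
 "E s = (if s = 0 then 0 else (real s - 1) * (real s - 2) * sqrt (real q) + 2 * (real s)\<^sup>2 - real s)"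

lemma NP_bij:
 assumes "!!P. m (m' P) = P" "!!P. m' (m P) = P" "!!P. P \<in> Rq ==> m P \<in> Rq" "!!P. P \<in> Rq ==> m' P \<in> Rq"
 shows "card {P\<in>Rq. Q (m P)} = card {P\<in>Rq. Q P}"
 by (rule bij_betw_same_card[of m], rule bij_betwI[where g = m']) (use assms in \<open>auto simp del: split_paired_All\<close>)

lemma irr_overlap:
 assumes h: "irr e h" and e: "e + 1 < q" and f: "Pl \<mu> f" and nv: "h P0 = 0" "f P0 ~= 0"
 shows "card {P\<in>Rq. h P = 0 & f P = 0} \<le> e * \<mu>"
proof -
 from irr_normal[OF h e] obtain a m m' \<gamma> where n: "irr_curve a e" "\<gamma> ~= 0" "!!P. h (m P) = \<gamma> * curve_fun a e (fst P) (snd P)"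
  "!!P. m (m' P) = P" "!!P. m' (m P) = P" "!!P. P \<in> Rq ==> m P \<in> Rq" "!!P. P \<in> Rq ==> m' P \<in> Rq"
  "!!s f. Pl s f ==> Pl s (%P. f (m P))" by blast
 interpret irr_curve a e by (rule n(1))
 have "card {P\<in>Rq. h P = 0 & f P = 0} = card {P\<in>Rq. h (m P) = 0 & f (m P) = 0}"
  by (rule NP_bij[OF n(4-7), symmetric])
 also have "\<dots> \<le> e * \<mu>"
 proof (rule bezout_points[OF n(8)[OF f]])
  show "\<exists>P\<in>C. f (m P) ~= 0" using nv n(3)[of "m' P0"] n(2) by (intro bexI[of _ "m' P0"]) (auto simp: n(4) C_iff(2))
  show "finite {P\<in>Rq. h (m P) = 0 & f (m P) = 0}" using finite_Rq by simp
  fix P assume "P \<in> {P\<in>Rq. h (m P) = 0 & f (m P) = 0}"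
  then show "P \<in> C & f (m P) = 0" using n(2,3) by (simp add: C_iff(2))
 qed
 finally show ?thesis .
qed

text \<open>\<open>b\<close> has the q-th roots of the coefficients and defines the preimage of the
  curve under Frobenius. If this is a different curve, the rational points lie on both and Bezout's
  theorem applies. If it contains \<open>C\<close>, the difference of the two monic equations has
  smaller degree in y and is zero, so the coefficients lie in F_q.\<close>

lemma irr_count:
 assumes h: "irr e h" and e: "e + 1 < q"
 shows "(!!P. h P = 0 ==> h (pw P) = 0) ==> \<bar>real (NP h) - real q\<bar> \<le> E e"
  and "h P0 = 0 ==> h (pw P0) ~= 0 ==> NP h \<le> e * e"
proof -
 from irr_normal[OF h e] obtain a m m' \<gamma> where n: "irr_curve a e" "\<gamma> ~= 0" "!!P. h (m P) = \<gamma> * curve_fun a e (fst P) (snd P)"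
  "!!P. m (m' P) = P" "!!P. m' (m P) = P" "!!P. P \<in> Rq ==> m P \<in> Rq" "!!P. P \<in> Rq ==> m' P \<in> Rq"
  "!!P. m (pw P) = pw (m P)" "!!P. m' (pw P) = pw (m' P)" "!!s f. Pl s f ==> Pl s (%P. f (m P))" by blast
 interpret irr_curve a e by (rule n(1))
 have hC: "h (m P) = 0 \<longleftrightarrow> P \<in> C" for P using n(2,3) by (simp add: C_iff(2))
 have NPh: "NP h = card {P\<in>Rq. P \<in> C}" unfolding NP_def using NP_bij[OF n(4-7), of "%P. h P = 0"] hC by simp
 have rt: "EX y. y ^ q = x" for x :: 'k using q2 by (intro nth_root_exists) simp
 define \<tau> where "\<tau> x = (SOME y. y ^ q = x)" for x :: 'k
 have \<tau>: "\<tau> x ^ q = x" for x unfolding \<tau>_def using someI_ex[OF rt] .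
 define b where "b j k = \<tau> (a j k)" for j k
 have fs: "(\<Sum>i\<in>A. f i) ^ q = (\<Sum>i\<in>A. f i ^ q)" for f :: "nat => 'k" and A
  using q2 by (induction A rule: infinite_finite_induct) (simp_all add: frob zero_power)
 have comm: "(x ^ i) ^ q = (x ^ q) ^ i" for x :: 'k and i by (metis power_mult mult.commute)
 have bq: "curve_fun b e x y ^ q = F (x ^ q) (y ^ q)" for x y
  unfolding curve_fun_def fs by (simp add: power_mult_distrib b_def \<tau> comm)
 have bPl: "Pl e (%P. curve_fun b e (fst P) (snd P))"
  unfolding curve_fun_def
 proof (intro PF_sum)
  fix k j assume kj: "k \<in> {..e}" "j \<in> {..e-k}"
  have "Pl e (%P. b j k * (fst P ^ j * snd P ^ k))" by (rule PF_scale, rule PF_mono[OF Pl_monom]) (use kj in auto)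
  then show "Pl e (%P. b j k * fst P ^ j * snd P ^ k)" by (simp add: mult.assoc)
 qed
 have b0: "curve_fun b e (fst P) (snd P) = 0 \<longleftrightarrow> h (pw (m P)) = 0" for P
 proof -
  have "curve_fun b e (fst P) (snd P) = 0 \<longleftrightarrow> curve_fun b e (fst P) (snd P) ^ q = 0" using q2 by simp
  also have "\<dots> \<longleftrightarrow> pw P \<in> C" by (simp add: bq pw_def C_iff(2))
  also have "\<dots> \<longleftrightarrow> h (pw (m P)) = 0" by (simp add: hC[symmetric] n(8))
  finally show ?thesis .
 qed
 show "NP h \<le> e * e" if P0: "h P0 = 0" "h (pw P0) ~= 0"
  unfolding NPh
 proof (rule bezout_points[OF bPl])
  show "\<exists>P\<in>C. curve_fun b e (fst P) (snd P) ~= 0"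
   by (rule bexI[of _ "m' P0"]) (use P0 in \<open>simp_all add: hC[symmetric] b0 n(4)\<close>)
  show "finite {P \<in> Rq. P \<in> C}" using finite_Rq by simp
  fix P assume P: "P \<in> {P \<in> Rq. P \<in> C}"
  then have "m P \<in> Rq" using n(6) by simp
  then have "pw (m P) = m P" by (auto simp: pw_def Rq_def Fq_def)
  then show "P \<in> C & curve_fun b e (fst P) (snd P) = 0" using P by (simp add: b0 hC)
 qed
 show "\<bar>real (NP h) - real q\<bar> \<le> E e" if st: "!!P. h P = 0 ==> h (pw P) = 0"
 proof -
  have bC: "curve_fun b e (fst P) (snd P) = 0" if "P \<in> C" for P using st that by (simp add: b0 hC)
  have b1: "b 0 e ^ q = 1" using monic \<tau> by (simp add: b_def)
  have coef: "a j k ^ q = a j k" if "j + k \<le> e" for j k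
  proof -
   have bd: "b 0 e = 1"
   proof -
    have "(b 0 e + - 1) ^ q = b 0 e ^ q + (- 1) ^ q" by (rule frob)
    also have "(- 1 :: 'k) ^ q = - 1" using Fq_uminus[OF Fq_1] by (simp add: Fq_def)
    finally show ?thesis using b1 by (simp add: power_0_left)
   qed
   define c where "c i = b (snd i) (fst i) - a (snd i) (fst i)" for i
   have cs: "(\<Sum>i\<in>M e. c i * mon i P) = curve_fun b e (fst P) (snd P) - F (fst P) (snd P)" for P
   proof -
    have MS: "M e = Sigma {..<e} (%k. {..e-k})" unfolding M_def by auto
    have "(\<Sum>i\<in>M e. c i * mon i P) = (\<Sum>k<e. \<Sum>j\<le>e-k. c (k, j) * mon (k, j) P)" unfolding MS by (subst sum.Sigma) (auto simp: case_prod_beta)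
    also have "\<dots> = (\<Sum>k\<le>e. \<Sum>j\<le>e-k. c (k, j) * mon (k, j) P)"
     by (rule sum.mono_neutral_left) (auto simp: c_def bd monic less_le)
    also have "\<dots> = curve_fun b e (fst P) (snd P) - F (fst P) (snd P)"
     unfolding curve_fun_def sum_subtractf[symmetric] by (intro sum.cong refl) (simp add: c_def mon_def algebra_simps)
    finally show ?thesis .
   qed
   have c0: "c i = 0" if "i \<in> M e" for i
    by (rule indepD[OF indep_mon'[of e] _ that]) (simp add: cs bC, simp add: C_iff(2))
   have "b j k = a j k"
   proof (cases "k < e")
    case True
    then have "(k, j) \<in> M e" using that by (auto simp: M_def)
    then show ?thesis using c0[of "(k, j)"] by (simp add: c_def)
   next
    case False
    then have "k = e" "j = 0" using that by auto
    then show ?thesis using bd monic by simp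
   qed
   then show ?thesis using \<tau>[of "a j k"] by (simp add: b_def)
  qed
  \<comment> \<open>Sets the coefficients outside the triangle to zero, so that invariance under
    Frobenius holds for all indices.\<close>
  define a' where "a' j k = (if j + k \<le> e then a j k else 0)" for j k
  have cf: "curve_fun a' e x y = F x y" for x y
   unfolding curve_fun_def by (intro sum.cong refl) (auto simp: a'_def)
  have "frob_curve_ac a' e q"
  proof unfold_locales
   show "1 \<le> e" by (rule d_pos)
   show "a' 0 e = 1" by (simp add: a'_def monic)
   show "finite {x. card {y. curve_fun a' e x y = 0} ~= e}" using cofin by (simp add: cf)
   show "a' j k ^ q = a' j k" for j k using coef q2 by (simp add: a'_def)
   show "(ALL x y. curve_fun a' e x y = 0 --> \<phi> (x, y) = 0) | (ALL x y. curve_fun a' e x y = 0 --> ps (x, y) = 0)"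
    if "Pl s \<phi>" "Pl t ps" "!!x y. curve_fun a' e x y = 0 ==> \<phi> (x, y) * ps (x, y) = 0" for s t \<phi> ps
    using dom[OF that(1,2)] that(3) by (simp add: cf)
  qed (use q2 frob rt card_fix infinite_alg_closed in auto)
  then interpret w: frob_curve_ac a' e q .
  have "{P\<in>w.C. fst P ^ q = fst P & snd P ^ q = snd P} = {P\<in>Rq. P \<in> C}"
   by (auto simp: w.C_def C_def cf Rq_def Fq_def)
  then show ?thesis using w.weil_monic d_pos unfolding NPh E_def by simp
 qed
qed

lemma irr_factor:
 assumes "Pl s f" "~ Pl (s - 1) f" "s \<ge> 1"
 shows "EX h e k. irr e h & e \<le> s & Pl (s - e) k & (ALL P. f P = k P * h P)"
 using assms
proof (induction s arbitrary: f rule: less_induct)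
 case (less s)
 show ?case
 proof (cases "irr s f")
  case True
  then show ?thesis by (intro exI[of _ f] exI[of _ s] exI[of _ "%_. 1"]) (auto intro: PF_const)
 next
  case False
  then obtain f1 g s1 t where g: "Pl s1 f1" "Pl t g" "s1 + t \<le> s" "!!P. f P = f1 P * g P" "s1 ~= 0" "t ~= 0"
   using less.prems unfolding irr_def by blast
  have "~ Pl (t - 1) g"
  proof
   assume "Pl (t - 1) g"
   from PF_mult[OF g(1) this] have "Pl (s1 + (t - 1)) f" by (simp add: g(4)[symmetric])
   then have "Pl (s - 1) f" by (rule PF_mono) (use g in auto)
   then show False using less.prems by simp
  qed
  with less.IH[of t g] g obtain h e k where h: "irr e h" "e \<le> t" "Pl (t - e) k" "!!P. g P = k P * h P" by auto
  have "Pl (s1 + (t - e)) (%P. f1 P * k P)" by (rule PF_mult[OF g(1) h(3)])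
  then have "Pl (s - e) (%P. f1 P * k P)" by (rule PF_mono) (use g h in auto)
  then show ?thesis using h g by (intro exI[of _ h] exI[of _ e] exI[of _ "%P. f1 P * k P"]) (auto simp: mult.assoc)
 qed
qed

lemma E_mono: assumes "s \<le> t" shows "E s \<le> E t"
proof (cases "s = 0")
 case True
 show ?thesis
 proof (cases "t = 0")
  case False
  have "(real t - 1) * (real t - 2) \<ge> 0" using False by (cases "t = 1") auto
  then have "(real t - 1) * (real t - 2) * sqrt (real q) \<ge> 0" by (rule mult_nonneg_nonneg) simp
  moreover have "real t \<le> real t * real t" using mult_left_mono[of 1 "real t" "real t"] False by simp
  moreover have "E t = (real t - 1) * (real t - 2) * sqrt (real q) + 2 * (real t * real t) - real t" "E s = 0"
   using True False by (simp_all add: E_def power2_eq_square)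
  moreover have "real t \<ge> 0" by simp
  ultimately show ?thesis by linarith
 qed (simp add: True)
next
 case False
 have st: "real s \<le> real t" "real s \<ge> 1" using assms False by auto
 have "(real s - 1) * (real s - 2) \<le> (real t - 1) * (real t - 2)"
 proof (cases "t = s")
  case False
  then have "real t \<ge> real s + 1" using assms by linarith
  then have "0 \<le> (real t - real s) * (real t + real s - 3)" using st by (intro mult_nonneg_nonneg) auto
  then show ?thesis by (simp add: algebra_simps)
 qed simp
 then have "(real s - 1) * (real s - 2) * sqrt (real q) \<le> (real t - 1) * (real t - 2) * sqrt (real q)" by (intro mult_right_mono) auto
 moreover have "0 \<le> (real t - real s) * (2 * (real t + real s) - 1)" using st by (intro mult_nonneg_nonneg) auto
 then have "2 * (real s)\<^sup>2 - real s \<le> 2 * (real t)\<^sup>2 - real t" by (simp add: algebra_simps power2_eq_square)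
 ultimately show ?thesis using False assms by (simp add: E_def)
qed

lemma E_add: assumes "s \<ge> 1" shows "E r + E s + real (r * s) \<le> E (r + s)"
proof (cases "r = 0")
 case False
 have rs: "real r * real s \<ge> 1" using False assms by (simp flip: of_nat_mult)
 have "(real (r + s) - 1) * (real (r + s) - 2) = (real r - 1) * (real r - 2) + (real s - 1) * (real s - 2) + 2 * (real r * real s - 1)"
  by (simp add: algebra_simps)
 then have "(real (r + s) - 1) * (real (r + s) - 2) \<ge> (real r - 1) * (real r - 2) + (real s - 1) * (real s - 2)" using rs by simp
 then have "((real r - 1) * (real r - 2) + (real s - 1) * (real s - 2)) * sqrt (real q) \<le> (real (r + s) - 1) * (real (r + s) - 2) * sqrt (real q)"
  by (rule mult_right_mono) simp
 moreover have "2 * (real (r + s))\<^sup>2 - real (r + s) = 2 * (real r)\<^sup>2 - real r + (2 * (real s)\<^sup>2 - real s) + 4 * (real r * real s)"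
  by (simp add: power2_eq_square algebra_simps)
 ultimately show ?thesis using False assms rs by (simp add: E_def distrib_right)
qed (simp add: E_def)

text \<open>An irreducible factor \<open>h\<close> is split off. A Frobenius stable one contributes
  q up to \<open>E e\<close>, any other at most e^2 points; the overlap with the cofactor, at most e
  (s - e), is absorbed by \<open>E_add\<close>. A factor that vanishes only where the cofactor does
  adds no points.\<close>

lemma plane_count:
 assumes "Pl s f" "f P0 ~= 0" "s + 1 < q"
 shows "\<exists>j :: nat. \<bar>real (NP f) - real j * real q\<bar> \<le> E s"
 using assms
proof (induction s arbitrary: f P0 rule: less_induct)
 case (less s)
 show ?case
 proof (cases "s = 0")
  case True
  then have "f P ~= 0" for P using plane.PF_0[of f P P0] less.prems by simp
  then show ?thesis by (intro exI[of _ 0]) (simp add: NP_def E_def True)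
 next
  case False
  show ?thesis
  proof (cases "Pl (s - 1) f")
   case True
   then obtain j :: nat where "\<bar>real (NP f) - real j * real q\<bar> \<le> E (s - 1)" using less.IH[of "s - 1" f P0] less.prems False by auto
   then show ?thesis using E_mono[of "s - 1" s] by (intro exI[of _ j]) linarith
  next
   case nP: False
   from irr_factor[OF less.prems(1) nP] False obtain h e k where h: "irr e h" "e \<le> s" "Pl (s - e) k" "!!P. f P = k P * h P" by auto
   have e1: "e \<ge> 1" using h(1) by (simp add: irr_def)
   have eq: "e + 1 < q" using h(2) less.prems(3) by simp
   have "k P0 ~= 0" using h(4)[of P0] less.prems(2) by auto
   moreover have "s - e < s" "s - e + 1 < q" using h(2) e1 less.prems(3) by linarith+
   ultimately obtain j :: nat where j: "\<bar>real (NP k) - real j * real q\<bar> \<le> E (s - e)" using less.IH[of "s - e" k P0] h(3) by blast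
   have Eadd: "E (s - e) + E e + real ((s - e) * e) \<le> E s" using E_add[OF e1, of "s - e"] h(2) by simp
   show ?thesis
   proof (cases "EX P. h P = 0 & k P ~= 0")
    case F: False
    have "{P\<in>Rq. f P = 0} = {P\<in>Rq. k P = 0}" using F h(4) by auto
    then have "NP f = NP k" by (simp add: NP_def)
    then show ?thesis using j E_mono[of "s - e" s] by (intro exI[of _ j]) auto
   next
    case T: True
    then obtain P1 where P1: "h P1 = 0" "k P1 ~= 0" by blast
    let ?O = "card {P\<in>Rq. h P = 0 & k P = 0}"
    have ov: "?O \<le> e * (s - e)" by (rule irr_overlap[OF h(1) eq h(3) P1])
    have "{P\<in>Rq. f P = 0} = {P\<in>Rq. k P = 0} \<union> {P\<in>Rq. h P = 0}" using h(4) by auto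
    moreover have "{P\<in>Rq. k P = 0} \<inter> {P\<in>Rq. h P = 0} = {P\<in>Rq. h P = 0 & k P = 0}" by auto
    ultimately have cnt: "NP f + ?O = NP k + NP h" unfolding NP_def
     using card_Un_Int[of "{P\<in>Rq. k P = 0}" "{P\<in>Rq. h P = 0}"] finite_Rq by simp
    have cnt': "real (NP f) = real (NP k) + real (NP h) - real ?O" using cnt by linarith
    have ov': "real ?O \<le> real ((s - e) * e)" using ov by (simp only: of_nat_le_iff mult.commute)
    have ov0: "real ?O \<ge> 0" by simp
    show ?thesis
    proof (cases "EX P. h P = 0 & h (pw P) ~= 0")
     case True
     then obtain P2 where "h P2 = 0" "h (pw P2) ~= 0" by blast
     from irr_count(2)[OF h(1) eq this] have b: "real (NP h) \<le> real (e * e)" by (simp only: of_nat_le_iff)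
     have Ee: "real (e * e) \<le> E e"
     proof -
      have "(real e - 1) * (real e - 2) \<ge> 0" using e1 by (cases "e = 1") auto
      then have "(real e - 1) * (real e - 2) * sqrt (real q) \<ge> 0" by (rule mult_nonneg_nonneg) simp
      moreover have "real e \<le> real e * real e" using mult_left_mono[of 1 "real e" "real e"] e1 by simp
      moreover have "E e = (real e - 1) * (real e - 2) * sqrt (real q) + 2 * (real e * real e) - real e"
       using e1 by (simp add: E_def power2_eq_square)
      ultimately show ?thesis unfolding of_nat_mult by linarith
     qed
     have "real (NP h) \<ge> 0" by simp
     then show ?thesis using j b Ee Eadd cnt' ov' ov0 by (intro exI[of _ j]) linarith
    next
     case False
     then have b: "\<bar>real (NP h) - real q\<bar> \<le> E e" by (intro irr_count(1)[OF h(1) eq]) blast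
     have "real (Suc j) * real q = real j * real q + real q" by (simp add: algebra_simps)
     then show ?thesis using j b Eadd cnt' ov' ov0 by (intro exI[of _ "Suc j"]) linarith
    qed
   qed
  qed
 qed
qed

end

section \<open>Irreducible hypersurfaces\<close>

text \<open>After cancelling contents, \<open>g\<close> is a multiple of the product of the
  primitive parts; the leading coefficient of that of \<open>b\<close> then divides a unit.\<close>

lemma gauss_monic:
 fixes g b Q :: "'k::field_gcd poly poly"
 assumes e: "smult l g = b * Q" and l: "l ~= 0" and u: "is_unit (lead_coeff g)"
 shows "EX B. b = smult (lead_coeff b) B & lead_coeff B = 1 & B dvd g"
proof -
 let ?pb = "primitive_part b" and ?pQ = "primitive_part Q"
 have "content (smult l g) = normalize l * content g" by (rule content_smult)
 then have c: "normalize l * content g = content b * content Q" unfolding e by (simp add: content_mult)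
 have "l dvd content b * content Q" unfolding c[symmetric] by simp
 then obtain w where w: "content b * content Q = l * w" by (elim dvdE)
 have "smult l g = smult (content b) ?pb * smult (content Q) ?pQ" unfolding e by simp
 also have "\<dots> = smult (content b * content Q) (?pb * ?pQ)" by (simp only: mult_smult_left mult_smult_right smult_smult mult.commute)
 also have "\<dots> = smult l (smult w (?pb * ?pQ))" by (simp add: w)
 finally have "smult l (g - smult w (?pb * ?pQ)) = 0" by (simp add: smult_diff_right)
 then have g: "g = smult w (?pb * ?pQ)" using l by simp
 have "lead_coeff g = lead_coeff ?pb * (w * lead_coeff ?pQ)" unfolding g by (simp only: lead_coeff_smult lead_coeff_mult mult_ac)
 then have "lead_coeff ?pb dvd lead_coeff g" by (rule dvdI)
 then have "is_unit (lead_coeff ?pb)" using u dvd_trans by blast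
 then obtain i where i: "1 = lead_coeff ?pb * i" by (elim dvdE)
 define B where "B = smult i ?pb"
 have pB: "?pb = smult (lead_coeff ?pb) B" unfolding B_def smult_smult i[symmetric] by simp
 have lB: "lead_coeff B = 1" unfolding B_def lead_coeff_smult using i by (simp only: mult.commute)
 have b: "b = smult (content b) ?pb" by simp
 have "b = smult (content b * lead_coeff ?pb) B" using b pB by (metis smult_smult)
 moreover from this have "lead_coeff b = content b * lead_coeff ?pb" using lB by (metis lead_coeff_smult mult.right_neutral)
 moreover have "B dvd g"
 proof (rule dvdI)
  show "g = B * smult (w * lead_coeff ?pb) ?pQ" using g pB by (metis mult_smult_left mult_smult_right smult_smult)
 qed
 ultimately show ?thesis using lB by metis
qed

text \<open>Division of power series whose j-th coefficient has degree at most j. The constant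
  initial term \<open>c\<close> is inverted, and the recursion only multiplies coefficients of
  indices r and j - r, so the quotient obeys the same degree bounds.\<close>

lemma graded_div:
 fixes ka l :: "nat => 'v => 'k::field"
 assumes k: "!!j. PF Xs j (ka j)" and l: "!!j. PF Xs j (l j)" and l0: "!!w. l 0 w = c" "c ~= 0"
 shows "\<exists>be. (ALL j. PF Xs j (be j)) & (ALL w B. (ALL j. ka j w = (\<Sum>r=0..j. B r * l (j - r) w)) --> (ALL j. B j = be j w))"
proof -
 define be where "be j w = fps_nth (Abs_fps (%j. ka j w) * inverse (Abs_fps (%j. l j w))) j" for j w
 have inv: "inverse (Abs_fps (%j. l j w)) * Abs_fps (%j. l j w) = 1" for w by (rule inverse_mult_eq_1) (simp add: l0)
 have rec: "ka j w = (\<Sum>r=0..j. be r w * l (j - r) w)" for j w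
 proof -
  have "ka j w = fps_nth (Abs_fps (%j. ka j w) * (inverse (Abs_fps (%j. l j w)) * Abs_fps (%j. l j w))) j" unfolding inv by simp
  also have "\<dots> = fps_nth ((Abs_fps (%j. ka j w) * inverse (Abs_fps (%j. l j w))) * Abs_fps (%j. l j w)) j" by (simp only: mult.assoc)
  also have "\<dots> = (\<Sum>r=0..j. be r w * l (j - r) w)" by (subst fps_mult_nth) (simp add: be_def)
  finally show ?thesis .
 qed
 have PF: "PF Xs j (be j)" for j
 proof (induction j rule: less_induct)
  case (less j)
  have "be j w = inverse c * (ka j w - (\<Sum>r<j. be r w * l (j - r) w))" for w
  proof -
   have "{0..j} = insert j {..<j}" by auto
   then have "ka j w = be j w * c + (\<Sum>r<j. be r w * l (j - r) w)" using rec[of j w] by (simp add: l0)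
   then show ?thesis using l0(2) by (simp add: field_simps)
  qed
  then have e: "be j = (%w. inverse c * (ka j w - (\<Sum>r<j. be r w * l (j - r) w)))" by blast
  show ?case unfolding e
  proof (intro PF_scale PF_diff PF_sum k)
   fix r assume "r \<in> {..<j}"
   then show "PF Xs j (%z. be r z * l (j - r) z)" using PF_mult[OF less.IH[of r] l[of "j - r"]] by simp
  qed
 qed
 have uniq: "B j = be j w" if B: "!!j. ka j w = (\<Sum>r=0..j. B r * l (j - r) w)" for w B j
 proof (induction j rule: less_induct)
  case (less j)
  have s: "{0..j} = insert j {..<j}" by auto
  have "B j * c + (\<Sum>r<j. B r * l (j - r) w) = be j w * c + (\<Sum>r<j. be r w * l (j - r) w)"
   using rec[of j w] B[of j] by (simp add: l0 s)
  moreover have "(\<Sum>r<j. B r * l (j - r) w) = (\<Sum>r<j. be r w * l (j - r) w)" using less.IH by (intro sum.cong) auto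
  ultimately show ?case using l0(2) by simp
 qed
 show ?thesis
 proof (intro exI[of _ be] conjI allI impI)
  show "PF Xs j (be j)" for j by (rule PF)
  fix w B j assume "ALL j. ka j w = (\<Sum>r=0..j. B r * l (j - r) w)"
  then show "B j = be j w" by (intro uniq) blast
 qed
qed

lemma PF_crd: "PF crd 1 (%z. z $ i)" by (rule PF_var) (auto simp: crd_def)

lemma PF_comp_crd:
 assumes "PF crd s f" "!!i. PF Y 1 (%w. h w $ i)" shows "PF Y s (%w. f (h w))"
 by (rule PF_comp_affine[OF assms(1)]) (use assms(2) in \<open>auto simp: crd_def\<close>)

text \<open>\<open>min\<close> makes \<open>g\<close> the reduced equation and \<open>prime\<close>
  is irreducibility, both phrased through zero sets as in the theorem. Statements about factors of
  \<open>g\<close>, such as \<open>no_factor\<close>, are derived from them.\<close>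

locale hyper =
 fixes g :: "'k::{alg_closed_field,field_gcd} ^ 'n::finite => 'k" and \<delta> :: nat
 assumes g: "PF crd \<delta> g" and d1: "\<delta> \<ge> 1"
  and min: "!!f s. PF crd s f ==> (!!z. f z = 0 \<longleftrightarrow> g z = 0) ==> \<delta> \<le> s"
  and prime: "!!f h s t. PF crd s f ==> PF crd t h ==> (!!z. g z = 0 ==> f z * h z = 0) ==>
    (ALL z. g z = 0 --> f z = 0) | (ALL z. g z = 0 --> h z = 0)"
  and char_pos: "CHAR('k) > 0"
begin

lemma exact: "~ PF crd (\<delta> - 1) g" using min[of "\<delta> - 1" g] d1 by fastforce

text \<open>By \<open>prime\<close> one factor vanishes wherever \<open>g\<close> does; it then has
  the same zeros as \<open>g\<close> in smaller degree.\<close>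

lemma no_factor:
 assumes "PF crd s A" "PF crd t B" "!!z. g z = A z * B z" "s < \<delta>" "t < \<delta>" shows False
proof -
 have "(ALL z. g z = 0 --> A z = 0) | (ALL z. g z = 0 --> B z = 0)"
  by (rule prime[OF assms(1,2)]) (simp add: assms(3))
 then show False using min[OF assms(1)] min[OF assms(2)] assms(3-5) by force
qed

lemma not_power: "~ (EX h s. PF crd s h & (ALL z. g z = h z ^ CHAR('k)) & s * CHAR('k) \<le> \<delta>)"
proof (intro notI, elim exE conjE)
 fix h s assume h: "PF crd s h" "ALL z. g z = h z ^ CHAR('k)" "s * CHAR('k) \<le> \<delta>"
 have p2: "CHAR('k) \<ge> 2" using prime_CHAR_semidom char_pos prime_ge_2_nat by blast
 have "\<delta> \<le> s" by (rule min[OF h(1)]) (use h(2) p2 in simp)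
 moreover have "s * 2 \<le> s * CHAR('k)" using p2 by simp
 ultimately show False using h(3) d1 by linarith
qed

end

locale hyper_dir = hyper g \<delta> for g :: "'k::{alg_closed_field,field_gcd} ^ 'n::finite => 'k" and \<delta> +
 fixes v :: "'k ^ 'n" and \<gamma> :: 'k
 assumes lead: "!!z. EX P. (ALL t. g (z + t *s v) = poly P t) & degree P \<le> \<delta> & coeff P \<delta> = \<gamma>"
  and \<gamma>: "\<gamma> ~= 0" and sepv: "EX z P. (ALL t. g (z + t *s v) = poly P t) & pderiv P ~= 0"
begin

definition G :: "'k ^ 'n => 'k poly" where "G z = (SOME P. ALL t. g (z + t *s v) = poly P t)"

lemma poly_G: "poly (G z) t = g (z + t *s v)"
proof -
 have "EX P. ALL t. g (z + t *s v) = poly P t" using lead[of z] by blast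
 then have "ALL t. g (z + t *s v) = poly (G z) t" unfolding G_def by (rule someI_ex)
 then have "g (z + t *s v) = poly (G z) t" by (rule spec)
 then show ?thesis by (rule sym)
qed

lemma G_eqI: "(!!t. g (z + t *s v) = poly P t) ==> G z = P"
 by (rule poly_eqI_infinite[OF infinite_alg_closed]) (simp add: poly_G)

lemma degree_G: "degree (G z) = \<delta>" and coeff_G: "coeff (G z) \<delta> = \<gamma>"
proof -
 from lead[of z] obtain P where P: "!!t. g (z + t *s v) = poly P t" "degree P \<le> \<delta>" "coeff P \<delta> = \<gamma>" by blast
 have "G z = P" by (rule G_eqI[OF P(1)])
 then show "coeff (G z) \<delta> = \<gamma>" "degree (G z) = \<delta>" using P(2,3) \<gamma> le_degree[of P \<delta>] by auto
qed

lemma coeff_G_PF: "PF crd (\<delta> - i) (%z. coeff (G z) i)"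
proof -
 from vecs.taylor[OF g] obtain D where D: "!!z v t. g (z + t *s v) = (\<Sum>i\<le>\<delta>. t ^ i * D i z v)"
  "!!i v. PF crd (\<delta> - i) (%z. D i z v)" "!!i z v. i > \<delta> ==> D i z v = 0" by blast
 have "G z = (\<Sum>i\<le>\<delta>. monom (D i z v) i)" for z
  by (rule G_eqI) (simp add: D(1) poly_sum poly_monom mult.commute)
 then have "coeff (G z) i = D i z v" for z using D(3)[of i z v] by (simp add: coeff_sum)
 then show ?thesis using D(2) by simp
qed

definition k0 :: 'n where "k0 = (SOME k. v $ k ~= 0)"

lemma v_k0: "v $ k0 ~= 0"
proof -
 have "EX k. v $ k ~= 0"
 proof (rule ccontr)
  assume "~ ?thesis"
  then have "v = 0" by (simp add: Finite_Cartesian_Product.vec_eq_iff)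
  then have "G z = [:g z:]" for z by (intro G_eqI) simp
  moreover from sepv obtain z P where "!!t. g (z + t *s v) = poly P t" "pderiv P ~= 0" by blast
  ultimately show False using G_eqI[of z P] by (auto simp: pderiv_pCons)
 qed
 from someI_ex[OF this] show ?thesis by (simp add: k0_def)
qed

text \<open>A linear form with value 1 on \<open>v\<close>, so that it serves as last coordinate;
  \<open>pr\<close> projects along \<open>v\<close> to its kernel, \<open>R0\<close> consists of the
  polynomials in the other coordinates, and \<open>VF N\<close> of those of degree below N in
  \<open>lam\<close>.\<close>

definition lam :: "'k ^ 'n => 'k" where "lam z = inverse (v $ k0) * z $ k0"
definition pr :: "'k ^ 'n => 'k ^ 'n" where "pr z = z - lam z *s v"

lemma lam_v [simp]: "lam v = 1" using v_k0 by (simp add: lam_def)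
lemma lam_add [simp]: "lam (x + y) = lam x + lam y" by (simp add: lam_def algebra_simps)
lemma lam_diff [simp]: "lam (x - y) = lam x - lam y" by (simp add: lam_def algebra_simps)
lemma lam_scale [simp]: "lam (c *s x) = c * lam x" by (simp add: lam_def)
lemma lam_pr [simp]: "lam (pr z) = 0" by (simp add: pr_def)
lemma pr_lam: "pr z + lam z *s v = z" by (simp add: pr_def)
lemma pr_id: "lam z = 0 ==> pr z = z" by (simp add: pr_def)
lemma pr_pr [simp]: "pr (pr z) = pr z" by (rule pr_id) simp
lemma pr_line [simp]: "pr (z + t *s v) = pr z" by (simp add: pr_def vector_sadd_rdistrib)

lemma PF_lam: "PF crd 1 lam" unfolding lam_def by (rule PF_scale[OF PF_crd])

lemma PF_pr: "PF crd 1 (%z. pr z $ i)"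
proof -
 have "PF crd 1 (%z. z $ i - v $ i * lam z)" by (rule PF_diff[OF PF_crd PF_scale[OF PF_lam]])
 then show ?thesis by (simp add: pr_def mult.commute)
qed

definition R0 :: "('k ^ 'n => 'k) set" where "R0 = {f. polyfun crd f & (ALL z. f (pr z) = f z)}"

lemma R0_line: "f \<in> R0 ==> f (z + t *s v) = f z" unfolding R0_def by (metis (mono_tags, lifting) mem_Collect_eq pr_line)
lemma R0_pr: "f \<in> R0 ==> f (pr z) = f z" unfolding R0_def by blast
lemma R0_const: "(%_. c) \<in> R0" by (simp add: R0_def polyfun_const)
lemma R0_add: "f \<in> R0 ==> h \<in> R0 ==> (%z. f z + h z) \<in> R0" by (simp add: R0_def polyfun_add)
lemma R0_diff: "f \<in> R0 ==> h \<in> R0 ==> (%z. f z - h z) \<in> R0" by (simp add: R0_def polyfun_diff)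
lemma R0_mult: "f \<in> R0 ==> h \<in> R0 ==> (%z. f z * h z) \<in> R0" by (simp add: R0_def polyfun_mult)
lemma R0_comp: "PF crd s f ==> (%z. f (pr z)) \<in> R0"
 using PF_comp_crd[of s f crd pr] PF_pr by (auto simp: R0_def polyfun_def)

lemma polyfun_domain:
 assumes "polyfun crd f" "polyfun crd h" "f z ~= 0" "h w ~= (0::'k)" shows "EX y. f y ~= 0 & h y ~= 0"
 using assms vecs.PF_domain unfolding polyfun_def by blast

lemma prime': assumes "polyfun crd f" "polyfun crd h" "!!z. g z = 0 ==> f z * h z = 0"
 shows "(ALL z. g z = 0 --> f z = 0) | (ALL z. g z = 0 --> h z = 0)"
proof -
 from assms(1,2) obtain s t where st: "PF crd s f" "PF crd t h" unfolding polyfun_def by blast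
 show ?thesis by (rule prime[OF st assms(3)])
qed

lemma R0_vanish: assumes f: "f \<in> R0" "!!z. g z = 0 ==> f z = 0" shows "f z = 0"
proof -
 have "degree (G z) > 0" using degree_G d1 by simp
 then obtain t where "poly (G z) t = 0" using alg_closed_imp_poly_has_root by blast
 then have "f (z + t *s v) = 0" using f(2) poly_G by simp
 then show ?thesis using R0_line[OF f(1)] by simp
qed

definition VF :: "nat => ('k ^ 'n => 'k) => bool" where
 "VF N f \<longleftrightarrow> (EX c. (ALL i. c i \<in> R0) & (ALL z. f z = (\<Sum>i<N. c i z * lam z ^ i)))"

lemma VF_polyfun: assumes "VF N f" shows "polyfun crd f"
proof -
 from assms obtain c where c: "!!i. c i \<in> R0" "!!z. f z = (\<Sum>i<N. c i z * lam z ^ i)" unfolding VF_def by blast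
 have "polyfun crd (%z. \<Sum>i<N. c i z * lam z ^ i)"
  by (intro polyfun_sum polyfun_mult polyfun_power polyfunI[OF PF_lam]) (use c in \<open>auto simp: R0_def\<close>)
 moreover have "f = (%z. \<Sum>i<N. c i z * lam z ^ i)" using c(2) by blast
 ultimately show ?thesis by simp
qed

lemma VF_add: assumes "VF N f" "VF N h" shows "VF N (%z. f z + h z)"
proof -
 from assms obtain c c' where c: "!!i. c i \<in> R0" "!!z. f z = (\<Sum>i<N. c i z * lam z ^ i)"
  "!!i. c' i \<in> R0" "!!z. h z = (\<Sum>i<N. c' i z * lam z ^ i)" unfolding VF_def by blast
 show ?thesis unfolding VF_def
  by (rule exI[of _ "%i z. c i z + c' i z"]) (simp add: c R0_add sum.distrib distrib_right)
qed

lemma VF_scale: assumes "VF N f" "r \<in> R0" shows "VF N (%z. r z * f z)"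
proof -
 from assms obtain c where c: "!!i. c i \<in> R0" "!!z. f z = (\<Sum>i<N. c i z * lam z ^ i)" unfolding VF_def by blast
 show ?thesis unfolding VF_def
  by (rule exI[of _ "%i z. r z * c i z"]) (simp add: c R0_mult assms(2) sum_distrib_left mult.assoc)
qed

lemma VF_shift: assumes "VF N f" shows "VF (N + k) (%z. f z * lam z ^ k)"
proof -
 from assms obtain c where c: "!!i. c i \<in> R0" "!!z. f z = (\<Sum>i<N. c i z * lam z ^ i)" unfolding VF_def by blast
 define c' where "c' i = (if i < k then (%_. 0) else c (i - k))" for i
 have "(\<Sum>i<N+k. c' i z * lam z ^ i) = f z * lam z ^ k" for z
 proof -
  have "(\<Sum>i<N+k. c' i z * lam z ^ i) = (\<Sum>i\<in>{k..<N+k}. c' i z * lam z ^ i)"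
   by (rule sum.mono_neutral_right) (auto simp: c'_def)
  also have "\<dots> = (\<Sum>i<N. c' (i + k) z * lam z ^ (i + k))"
   by (rule sum.reindex_bij_witness[of _ "%i. i + k" "%i. i - k"]) auto
  also have "\<dots> = f z * lam z ^ k" unfolding c(2) sum_distrib_right by (rule sum.cong) (auto simp: c'_def power_add)
  finally show ?thesis .
 qed
 then show ?thesis unfolding VF_def by (intro exI[of _ c']) (auto simp: c'_def c R0_const)
qed

lemma VF_mono: assumes "VF N f" "N \<le> N'" shows "VF N' f"
proof -
 from assms obtain c where c: "!!i. c i \<in> R0" "!!z. f z = (\<Sum>i<N. c i z * lam z ^ i)" unfolding VF_def by blast
 define c' where "c' i = (if i < N then c i else (%_. 0))" for i
 have "(\<Sum>i<N'. c' i z * lam z ^ i) = (\<Sum>i<N. c i z * lam z ^ i)" for z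
  by (rule sum.mono_neutral_cong_right) (use assms in \<open>auto simp: c'_def\<close>)
 then show ?thesis unfolding VF_def by (intro exI[of _ c']) (auto simp: c'_def c R0_const)
qed

lemma VF_zero_coeff:
 assumes c: "!!i. i < N ==> c i \<in> R0" "!!z. (\<Sum>i<N. c i z * lam z ^ i) = 0" and i: "i < N"
 shows "c i z = 0"
proof -
 have "(\<Sum>i<N. monom (c i z) i) = 0"
 proof (rule poly_eqI_infinite[OF infinite_alg_closed])
  fix t
  have "(\<Sum>i<N. c i (pr z + t *s v) * lam (pr z + t *s v) ^ i) = 0" by (rule c(2))
  moreover have "c i (pr z + t *s v) = c i z" if "i < N" for i using c(1)[OF that] by (simp add: R0_line R0_pr)
  ultimately show "poly (\<Sum>i<N. monom (c i z) i) t = poly 0 t" by (simp add: poly_sum poly_monom)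
 qed
 then have "coeff (\<Sum>i<N. monom (c i z) i) i = 0" by simp
 then show ?thesis using i by (simp add: coeff_sum)
qed

lemma g_eq_G: "g z = poly (G (pr z)) (lam z)" by (simp add: poly_G pr_lam)

lemma VF_g: "VF (Suc \<delta>) g"
 unfolding VF_def
proof (intro exI[of _ "%i z. coeff (G (pr z)) i"] conjI allI)
 show "(%z. coeff (G (pr z)) i) \<in> R0" for i by (rule R0_comp[OF coeff_G_PF])
 show "g z = (\<Sum>i<Suc \<delta>. coeff (G (pr z)) i * lam z ^ i)" for z
  unfolding g_eq_G[of z] poly_altdef degree_G lessThan_Suc_atMost by simp
qed

lemma pseudo_division:
 assumes lc: "lc \<in> R0" and b': "VF m b'" and b: "!!z. b z = b' z + lc z * lam z ^ m" and f: "VF N f"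
 shows "EX k Q r. polyfun crd Q & VF m r & (ALL z. lc z ^ k * f z = b z * Q z + r z)"
 using f
proof (induction N arbitrary: f)
 case 0
 then have "VF m f" by (rule VF_mono) simp
 then show ?case by (intro exI[of _ 0] exI[of _ "%_. 0"] exI[of _ f]) (simp add: polyfun_const)
next
 case (Suc N)
 show ?case
 proof (cases "Suc N \<le> m")
  case True
  then have "VF m f" using Suc.prems VF_mono by blast
  then show ?thesis by (intro exI[of _ 0] exI[of _ "%_. 0"] exI[of _ f]) (simp add: polyfun_const)
 next
  case False
  from Suc.prems obtain c where c: "!!i. c i \<in> R0" "!!z. f z = (\<Sum>i<Suc N. c i z * lam z ^ i)" unfolding VF_def by blast
  define f' where "f' z = (\<Sum>i<N. c i z * lam z ^ i)" for z
  have f': "VF N f'" unfolding VF_def f'_def using c(1) by blast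
  define h where "h z = lc z * f' z + (- c N z) * (b' z * lam z ^ (N - m))" for z
  have mc: "(%z. - c N z) \<in> R0" using R0_diff[OF R0_const[of 0] c(1)[of N]] by simp
  have "VF N (%z. b' z * lam z ^ (N - m))" using VF_shift[OF b', of "N - m"] False by simp
  then have "VF N h" unfolding h_def by (rule VF_add[OF VF_scale[OF f' lc] VF_scale[OF _ mc]])
  from Suc.IH[OF this] obtain k Q r where k: "polyfun crd Q" "VF m r" "!!z. lc z ^ k * h z = b z * Q z + r z" by blast
  have pw: "lam z ^ N = lam z ^ m * lam z ^ (N - m)" for z using False by (simp flip: power_add)
  have lf: "lc z * f z = h z + b z * (c N z * lam z ^ (N - m))" for z
   by (simp add: c(2) h_def f'_def b pw algebra_simps)
  have "lc z ^ Suc k * f z = lc z ^ k * (lc z * f z)" for z by (simp add: mult_ac)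
  then have lfk: "lc z ^ Suc k * f z = lc z ^ k * h z + b z * (lc z ^ k * c N z * lam z ^ (N - m))" for z
   unfolding lf by (simp add: algebra_simps)
  have e: "lc z ^ Suc k * f z = b z * (Q z + lc z ^ k * c N z * lam z ^ (N - m)) + r z" for z
   unfolding lfk k(3) distrib_left by (simp only: add_ac)
  have "polyfun crd (%z. Q z + lc z ^ k * c N z * lam z ^ (N - m))"
   by (intro polyfun_add polyfun_mult polyfun_power k(1) polyfunI[OF PF_lam]) (use lc c(1) in \<open>auto simp: R0_def\<close>)
  then show ?thesis using e k(2) by blast
 qed
qed

lemma plane_fun:
 assumes "PF crd s f" shows "Pl s (%P. f (z0 + fst P *s w + snd P *s v))"
proof (rule PF_comp_crd[OF assms])
 fix i
 have "Pl 1 (%P. z0 $ i + w $ i * fst P + v $ i * snd P)" by (rule PF_add[OF PF_add[OF PF_const PF_scale[OF Pl_fst]] PF_scale[OF Pl_snd]])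
 then show "Pl 1 (%P. (z0 + fst P *s w + snd P *s v) $ i)" by (simp add: mult.commute)
qed

text \<open>A divisor of a power of \<open>g\<close> (up to functions of the base) of smaller degree in the direction
 \<open>v\<close> is made monic along every line through \<open>z0\<close> by Gauss' lemma; the power series expansions at
 \<open>z0\<close> show that the quotients assemble to a polynomial.\<close>

lemma VF_vanish:
 assumes f: "VF \<delta> f" "!!z. g z = 0 ==> f z = 0" shows "f z = 0"
proof (rule ccontr)
 assume fz: "f z ~= 0"
 let ?P = "%m. EX b. VF (Suc m) b & (EX z. b z ~= 0) & (ALL z. g z = 0 --> b z = 0)"
 obtain \<delta>' where \<delta>': "\<delta> = Suc \<delta>'" using d1 by (cases \<delta>) auto
 have P0: "?P \<delta>'" using f fz unfolding \<delta>' by blast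
 \<comment> \<open>A counterexample of least degree in the direction \<open>v\<close>. Remainders of
   smaller degree are then zero, so pseudo-division gives lc^k g = b Q.\<close>
 define m where "m = (LEAST m. ?P m)"
 have Pm: "?P m" unfolding m_def by (rule LeastI[of ?P, OF P0])
 have "m \<le> \<delta>'" unfolding m_def by (rule Least_le[of ?P, OF P0])
 then have m\<delta>: "m < \<delta>" using \<delta>' by simp
 have small: "r z = 0" if r: "VF m r" "!!z. g z = 0 ==> r z = 0" for r z
 proof (rule ccontr)
  assume rz: "r z ~= 0"
  show False
  proof (cases m)
   case 0
   then show False using r(1) rz by (simp add: VF_def)
  next
   case (Suc m')
   then have "?P m'" using r rz by blast
   then have "m \<le> m'" unfolding m_def by (rule Least_le[of ?P])
   then show False using Suc by simp
  qed
 qed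
 from Pm obtain b z1 where b: "VF (Suc m) b" "b z1 ~= 0" "!!z. g z = 0 ==> b z = 0" by blast
 from b(1) obtain c where c: "!!i. c i \<in> R0" "!!z. b z = (\<Sum>i<Suc m. c i z * lam z ^ i)" unfolding VF_def by blast
 define lc where "lc = c m"
 define b' where "b' z = (\<Sum>i<m. c i z * lam z ^ i)" for z
 have b': "VF m b'" unfolding VF_def b'_def using c(1) by blast
 have bb': "b z = b' z + lc z * lam z ^ m" for z by (simp add: c(2) b'_def lc_def)
 have lcR: "lc \<in> R0" unfolding lc_def by (rule c)
 have "EX z. lc z ~= 0"
 proof (rule ccontr)
  assume "~ ?thesis"
  then have "b z = b' z" for z by (simp add: bb')
  then have "b = b'" by blast
  then have "VF m b" using b' by simp
  from small[OF this b(3)] b(2) show False by blast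
 qed
 then obtain z00 where "lc z00 ~= 0" by blast
 \<comment> \<open>The centre of the expansions: since \<open>lc\<close> is nonzero there, it is
   invertible as a power series along every line through \<open>z0\<close>.\<close>
 define z0 where "z0 = pr z00"
 have lz0: "lam z0 = 0" and lcz0: "lc z0 ~= 0" using \<open>lc z00 ~= 0\<close> R0_pr[OF lcR] by (simp_all add: z0_def)
 from pseudo_division[OF lcR b' bb' VF_g] obtain k Q r where
  kQ: "polyfun crd Q" "VF m r" "!!z. lc z ^ k * g z = b z * Q z + r z" by blast
 have "r z = 0" for z
 proof (rule small[OF kQ(2)])
  fix z assume "g z = 0"
  then show "r z = 0" using kQ(3)[of z] b(3)[of z] by simp
 qed
 then have gQ: "lc z ^ k * g z = b z * Q z" for z using kQ(3) by simp
 have "ALL i. EX s. PF crd s (c i)" using c(1) by (auto simp: R0_def polyfun_def)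
 from choice[OF this] obtain sc where sc: "!!i. PF crd (sc i) (c i)" by blast
 have "ALL i. EX D. (ALL w t. c i (z0 + t *s w) = (\<Sum>j\<le>sc i. t ^ j * D j w)) & (ALL j. PF crd j (D j)) & (ALL j w. j > sc i --> D j w = 0)"
 proof
  fix i
  from vecs.taylor[OF sc[of i]] obtain D where D: "!!z v t. c i (z + t *s v) = (\<Sum>j\<le>sc i. t ^ j * D j z v)"
   "!!j z. PF crd j (%v. D j z v)" "!!j z v. j > sc i ==> D j z v = 0" by blast
  show "EX D. (ALL w t. c i (z0 + t *s w) = (\<Sum>j\<le>sc i. t ^ j * D j w)) & (ALL j. PF crd j (D j)) & (ALL j w. j > sc i --> D j w = 0)"
   by (rule exI[of _ "%j. D j z0"]) (use D in blast)
 qed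
 from choice[OF this] obtain ka where ka: "!!i w t. c i (z0 + t *s w) = (\<Sum>j\<le>sc i. t ^ j * ka i j w)"
  "!!i j. PF crd j (ka i j)" "!!i j w. j > sc i ==> ka i j w = 0" by blast
 have ka0: "ka m 0 w = lc z0" for w
 proof -
  have "lc z0 = (\<Sum>j\<le>sc m. 0 ^ j * ka m j w)" using ka(1)[of m 0 w] by (simp add: lc_def)
  also have "\<dots> = (\<Sum>j\<in>{0}. 0 ^ j * ka m j w)" by (rule sum.mono_neutral_right) auto
  finally show ?thesis by simp
 qed
 define Cw where "Cw w i = (\<Sum>j\<le>sc i. monom (ka i j w) j)" for w i
 have coeff_Cw: "coeff (Cw w i) j = ka i j w" for w i j using ka(3)[of i j w] by (simp add: Cw_def coeff_sum)
 have poly_Cw: "poly (Cw w i) t = c i (z0 + t *s w)" for w i t by (simp add: Cw_def poly_sum poly_monom ka(1) mult.commute)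
 define bw where "bw w = (\<Sum>i<Suc m. monom (Cw w i) i)" for w
 have Cm: "Cw w m ~= 0" for w
 proof
  assume "Cw w m = 0"
  then show False using coeff_Cw[of w m 0] ka0 lcz0 by simp
 qed
 have coeff_bw: "coeff (bw w) i = (if i < Suc m then Cw w i else 0)" for w i by (simp only: bw_def coeff_sum_monom_less)
 have deg_bw: "degree (bw w) = m" for w
 proof (rule antisym)
  show "degree (bw w) \<le> m" by (rule degree_le) (simp add: coeff_bw)
  show "m \<le> degree (bw w)" by (rule le_degree) (simp add: coeff_bw Cm)
 qed
 have lead_bw: "lead_coeff (bw w) = Cw w m" for w by (simp add: deg_bw coeff_bw)
 have pt: "lam (z0 + t *s w + s *s v) = s" if "lam w = 0" for w t s using that by (simp add: lz0)
 have ev_bw: "ev (bw w) (t, s) = b (z0 + t *s w + s *s v)" if w: "lam w = 0" for w t s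
 proof -
  have "ev (bw w) (t, s) = (\<Sum>i<Suc m. poly (Cw w i) t * s ^ i)"
   unfolding ev_eq deg_bw lessThan_Suc_atMost by (rule sum.cong) (auto simp: coeff_bw)
  also have "\<dots> = b (z0 + t *s w + s *s v)" unfolding c(2) by (simp only: poly_Cw R0_line[OF c(1)] pt[OF w])
  finally show ?thesis .
 qed
 \<comment> \<open>In the plane through \<open>w\<close> and \<open>v\<close> the equation has a
   constant leading coefficient in s, which is what Gauss' lemma needs. The cofactor has a term
   s^(\<delta> - m) with nonzero constant coefficient, hence total degree at least \<delta> - m, and
   only m is left for B.\<close>
 have B_ex: "EX B. tdeg m B & (ALL i. Cw w i = Cw w m * coeff B i | i > m) & (ALL t s. ev B (t, s) = 0 --> g (z0 + t *s w + s *s v) = 0) & degree B \<le> m"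
  if w: "lam w = 0" for w
 proof -
  have gPl: "Pl \<delta> (%P. g (z0 + fst P *s w + snd P *s v))" by (rule plane_fun[OF g])
  from Pl_ev[OF gPl] obtain gw where gw: "tdeg \<delta> gw" "!!P. g (z0 + fst P *s w + snd P *s v) = ev gw P" by blast
  have deg_gw: "degree gw \<le> \<delta>" by (rule degree_le) (use gw(1) in \<open>force simp: tdeg_def poly_eq_iff\<close>)
  have cgw: "coeff gw \<delta> = [:\<gamma>:]"
  proof (rule poly_eqI_infinite[OF infinite_alg_closed])
   fix t
   have "G (z0 + t *s w) = map_poly (%c. poly c t) gw"
    by (rule G_eqI) (use gw(2)[of "(t, _)"] in \<open>simp add: ev_map\<close>)
   then have "coeff (map_poly (%c. poly c t) gw) \<delta> = \<gamma>" using coeff_G[of "z0 + t *s w"] by simp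
   then show "poly (coeff gw \<delta>) t = poly [:\<gamma>:] t" by (simp add: coeff_map_poly)
  qed
  have dgw: "degree gw = \<delta>" using deg_gw le_degree[of gw \<delta>] cgw \<gamma> by simp
  have "is_unit (lead_coeff gw)" unfolding dgw cgw
  proof (rule dvdI)
   show "1 = [:\<gamma>:] * [:inverse \<gamma>:]" using \<gamma> by (simp add: one_pCons)
  qed
  moreover from kQ(1) obtain sQ where "PF crd sQ Q" unfolding polyfun_def by blast
  from Pl_ev[OF plane_fun[OF this]] obtain Qw where Qw: "!!P. Q (z0 + fst P *s w + snd P *s v) = ev Qw P" by blast
  have eQ: "smult (Cw w m ^ k) gw = bw w * Qw"
  proof (rule ev_inj[OF infinite_alg_closed])
   fix P :: "'k \<times> 'k"
   obtain t s where P: "P = (t, s)" by (cases P)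
   let ?z = "z0 + t *s w + s *s v"
   have "ev (smult (Cw w m ^ k) gw) P = poly (Cw w m) t ^ k * ev gw P" by (simp add: ev_def P)
   also have "poly (Cw w m) t = lc ?z" unfolding poly_Cw lc_def R0_line[OF c(1)] ..
   also have "ev gw P = g ?z" using gw(2)[of P] by (simp add: P)
   also have "lc ?z ^ k * g ?z = b ?z * Q ?z" by (rule gQ)
   also have "\<dots> = ev (bw w) P * ev Qw P" using Qw[of P] ev_bw[OF w, of t s] by (simp add: P)
   finally show "ev (smult (Cw w m ^ k) gw) P = ev (bw w * Qw) P" by (simp add: ev_mult)
  qed
  ultimately have "EX B. bw w = smult (lead_coeff (bw w)) B & lead_coeff B = 1 & B dvd gw"
   using gauss_monic[OF eQ] Cm by simp
  then obtain B where B: "bw w = smult (Cw w m) B" "lead_coeff B = 1" "B dvd gw" unfolding lead_bw by blast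
  have dB: "degree B = m" using B(1) deg_bw[of w] Cm[of w] by (simp add: degree_smult_eq)
  from B(3) obtain Q2 where Q2: "gw = B * Q2" by (elim dvdE)
  have nz: "gw ~= 0" using cgw \<gamma> by auto
  then have nz2: "B ~= 0" "Q2 ~= 0" using Q2 by auto
  have dQ2: "degree Q2 = \<delta> - m" using degree_mult_eq[OF nz2] Q2 dgw dB by simp
  have lQ2: "coeff Q2 (\<delta> - m) = [:\<gamma>:]" using lead_coeff_mult[of B Q2] B(2) by (simp add: Q2[symmetric] dgw cgw dQ2)
  obtain s1 s2 where s12: "Pl s1 (ev B)" "Pl s2 (ev Q2)" using Pol_ev[of B] Pol_ev[of Q2] unfolding polyfun_def by blast
  have "EX P. ev B P ~= 0" "EX P. ev Q2 P ~= 0"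
   using ev_inj[OF infinite_alg_closed, of B 0] ev_inj[OF infinite_alg_closed, of Q2 0] nz2 by (auto simp: ev_0 simp del: split_paired_Ex split_paired_All)
  then obtain P1 P2 where P12: "ev B P1 ~= 0" "ev Q2 P2 ~= 0" by blast
  have "Pl \<delta> (%P. ev B P * ev Q2 P)" using gPl unfolding gw(2) Q2 ev_mult .
  from plane.degree_additive[OF this s12(1) P12(1) s12(2) P12(2)] obtain s t where st: "s + t \<le> \<delta>" "Pl s (ev B)" "Pl t (ev Q2)" by blast
  from Pl_ev[OF st(2)] obtain B' where B': "tdeg s B'" "!!P. ev B P = ev B' P" by blast
  have "B = B'" by (rule ev_inj[OF infinite_alg_closed B'(2)])
  from Pl_ev[OF st(3)] obtain Q' where Q': "tdeg t Q'" "!!P. ev Q2 P = ev Q' P" by blast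
  have "Q2 = Q'" by (rule ev_inj[OF infinite_alg_closed Q'(2)])
  then have "coeff (coeff Q' (\<delta> - m)) 0 ~= 0" using lQ2 \<gamma> by simp
  then have "0 + (\<delta> - m) \<le> t" using Q'(1) unfolding tdeg_def by blast
  then have "s \<le> m" using st(1) m\<delta> by simp
  then have "tdeg m B" using B'(1) \<open>B = B'\<close> unfolding tdeg_def by fastforce
  moreover have "Cw w i = Cw w m * coeff B i | i > m" for i using arg_cong[OF B(1), of "%p. coeff p i"] by (auto simp: coeff_bw)
  moreover have "g (z0 + t *s w + s *s v) = 0" if "ev B (t, s) = 0" for t s
   using gw(2)[of "(t, s)"] that by (simp add: Q2 ev_mult)
  ultimately show ?thesis using dB by (intro exI[of _ B]) blast
 qed
 have "ALL i. \<exists>be. (ALL j. PF crd j (be j)) & (ALL w B. (ALL j. ka i j w = (\<Sum>r=0..j. B r * ka m (j - r) w)) --> (ALL j. B j = be j w))"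
 proof
  fix i
  show "\<exists>be. (ALL j. PF crd j (be j)) & (ALL w B. (ALL j. ka i j w = (\<Sum>r=0..j. B r * ka m (j - r) w)) --> (ALL j. B j = be j w))"
   by (rule graded_div[of crd "ka i" "ka m" "lc z0", OF ka(2) ka(2) ka0 lcz0])
 qed
 from choice[OF this] obtain be where be: "!!i j. PF crd j (be i j)"
  "!!i w B j. (!!j. ka i j w = (\<Sum>r=0..j. B r * ka m (j - r) w)) ==> B j = be i j w" by blast
 \<comment> \<open>Glues the monic factors of all planes: their coefficients are the quotients from
   \<open>graded_div\<close>, which are polynomial in \<open>w\<close>, summed at t = 1.\<close>
 define bt where "bt z = (\<Sum>i\<le>m. lam z ^ i * (\<Sum>j\<le>m-i. be i j (pr z - z0)))" for z
 have PFbt: "PF crd m bt"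
  unfolding bt_def
 proof (intro PF_sum)
  fix i assume i: "i \<in> {..m}"
  have "PF crd (m - i) (%z. \<Sum>j\<le>m-i. be i j (pr z - z0))"
  proof (intro PF_sum)
   fix j assume j: "j \<in> {..m-i}"
   have "PF crd j (%z. be i j (pr z - z0))"
   proof (rule PF_comp_crd[OF be(1)])
    fix l show "PF crd 1 (%w. (pr w - z0) $ l)" using PF_diff[OF PF_pr PF_const[of _ _ "z0 $ l"]] by simp
   qed
   then show "PF crd (m - i) (%z. be i j (pr z - z0))" by (rule PF_mono) (use j in auto)
  qed
  from PF_mult[OF PF_power[OF PF_lam, of i] this] show "PF crd m (%z. lam z ^ i * (\<Sum>j\<le>m-i. be i j (pr z - z0)))" using i by simp
 qed
 have bt: "lc z * bt z = b z & (bt z = 0 --> g z = 0)" for z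
 proof -
  define w where "w = pr z - z0"
  have w: "lam w = 0" by (simp add: w_def lz0)
  have zz: "z0 + 1 *s w + lam z *s v = z" by (simp add: w_def pr_lam)
  from B_ex[OF w] obtain B where B: "tdeg m B" "!!i. i \<le> m ==> Cw w i = Cw w m * coeff B i"
   "!!t s. ev B (t, s) = 0 ==> g (z0 + t *s w + s *s v) = 0" "degree B \<le> m" by force
  have Bc: "coeff (coeff B i) j = be i j w" if "i \<le> m" for i j
  proof (rule be(2))
   fix j
   have "ka i j w = coeff (coeff B i * Cw w m) j" unfolding coeff_Cw[symmetric] B(2)[OF that] by (simp add: mult.commute)
   then show "ka i j w = (\<Sum>r=0..j. coeff (coeff B i) r * ka m (j - r) w)" by (simp add: coeff_mult coeff_Cw atMost_atLeast0)
  qed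
  have Bi: "poly (coeff B i) 1 = (\<Sum>j\<le>m-i. be i j w)" if "i \<le> m" for i
  proof -
   have "degree (coeff B i) \<le> m - i" by (rule degree_le) (use B(1) in \<open>force simp: tdeg_def\<close>)
   from poly_sum_atMost[OF this, of 1] show ?thesis using Bc[OF that] by simp
  qed
  have "ev B (1, lam z) = (\<Sum>i\<le>m. poly (coeff B i) 1 * lam z ^ i)"
   unfolding ev_eq by (rule sum.mono_neutral_left) (use B(4) in \<open>auto simp: coeff_eq_0\<close>)
  also have bts: "\<dots> = bt z" unfolding bt_def w_def[symmetric] by (rule sum.cong) (auto simp: Bi mult.commute)
  finally have evB: "ev B (1, lam z) = bt z" .
  have "b z = ev (bw w) (1, lam z)" using ev_bw[OF w, of 1 "lam z"] zz by simp
  also have "\<dots> = (\<Sum>i\<le>m. poly (Cw w i) 1 * lam z ^ i)"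
   unfolding ev_eq deg_bw by (rule sum.cong) (auto simp: coeff_bw)
  also have "\<dots> = (\<Sum>i\<le>m. poly (Cw w m) 1 * (poly (coeff B i) 1 * lam z ^ i))"
  proof (rule sum.cong[OF refl])
   fix i assume "i \<in> {..m}"
   then have "Cw w i = Cw w m * coeff B i" by (intro B(2)) simp
   then have "poly (Cw w i) 1 = poly (Cw w m) 1 * poly (coeff B i) 1" by (metis poly_mult)
   then show "poly (Cw w i) 1 * lam z ^ i = poly (Cw w m) 1 * (poly (coeff B i) 1 * lam z ^ i)" by (simp only: mult.assoc)
  qed
  also have "\<dots> = poly (Cw w m) 1 * bt z" unfolding sum_distrib_left[symmetric] bts ..
  also have "poly (Cw w m) 1 = lc z" using R0_pr[OF lcR, of z] by (simp add: poly_Cw lc_def w_def)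
  finally show ?thesis using B(3)[of 1 "lam z"] evB zz by auto
 qed
 \<comment> \<open>b = lc bt vanishes on the hypersurface but \<open>lc\<close> does not, so
   \<open>bt\<close> does. Conversely zeros of \<open>bt\<close> are zeros of \<open>g\<close>, so
   \<open>bt\<close> has the zeros of \<open>g\<close> in degree m < \<delta>.\<close>
 have "(ALL z. g z = 0 --> lc z = 0) | (ALL z. g z = 0 --> bt z = 0)"
  by (rule prime') (use lcR PFbt b(3) bt in \<open>auto simp: R0_def polyfun_def\<close>)
 then have "!!z. g z = 0 ==> bt z = 0" using R0_vanish[OF lcR] lcz0 by blast
 then have "\<delta> \<le> m" using bt by (intro min[OF PFbt]) blast
 then show False using m\<delta> by simp
qed

end

section \<open>Power series roots\<close>

text \<open>Power series in t whose j-th coefficient has degree at most j in the parameter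
  \<open>w\<close>, as expansions in t w do.\<close>

definition Gr :: "('v => 'k::field) set => ('v => 'k fps) => bool" where
 "Gr Xs \<phi> \<longleftrightarrow> (ALL j. PF Xs j (%w. fps_nth (\<phi> w) j))"

lemma Gr_const: "Gr Xs (%_. f)" by (simp add: Gr_def PF_const)
lemma Gr_add: "Gr Xs \<phi> ==> Gr Xs ps ==> Gr Xs (%w. \<phi> w + ps w)" by (simp add: Gr_def PF_add)
lemma Gr_minus: "Gr Xs \<phi> ==> Gr Xs (%w. - \<phi> w)" by (simp add: Gr_def PF_minus)

lemma Gr_mult: assumes "Gr Xs \<phi>" "Gr Xs ps" shows "Gr Xs (%w. \<phi> w * ps w)"
 unfolding Gr_def fps_mult_nth
proof (intro allI PF_sum)
 fix j i :: nat assume "i \<in> {0..j}"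
 then show "PF Xs j (%w. fps_nth (\<phi> w) i * fps_nth (ps w) (j - i))"
  using PF_mult[of Xs i "%w. fps_nth (\<phi> w) i" "j - i" "%w. fps_nth (ps w) (j - i)"] assms by (simp add: Gr_def)
qed

lemma Gr_sum: "(!!i. i \<in> I ==> Gr Xs (\<phi> i)) ==> Gr Xs (%w. \<Sum>i\<in>I. \<phi> i w)"
 by (induction I rule: infinite_finite_induct) (auto intro: Gr_const Gr_add)

lemma Gr_prod: "(!!i. i \<in> I ==> Gr Xs (\<phi> i)) ==> Gr Xs (%w. \<Prod>i\<in>I. \<phi> i w)"
 by (induction I rule: infinite_finite_induct) (auto intro: Gr_const Gr_mult)

lemma Gr_power: "Gr Xs \<phi> ==> Gr Xs (%w. \<phi> w ^ n)" by (induction n) (auto intro: Gr_const Gr_mult)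

lemma poly_taylor1: "EX E. poly F (x + y) = poly F x + y * poly (pderiv F) x + y\<^sup>2 * E"
 for F :: "'r::idom poly"
proof (induction F)
 case 0
 show ?case by (rule exI[of _ 0]) simp
next
 case (pCons a F)
 then obtain E where E: "poly F (x + y) = poly F x + y * poly (pderiv F) x + y\<^sup>2 * E" by blast
 show ?case
  by (rule exI[of _ "poly (pderiv F) x + (x + y) * E"])
   (simp add: E pderiv_pCons power2_eq_square algebra_simps)
qed

lemma poly_diff_dvd: "EX E. poly F x = poly F y + (x - y) * E" for F :: "'r::idom poly"
proof -
 obtain E where "poly F (y + (x - y)) = poly F y + (x - y) * poly (pderiv F) y + (x - y)\<^sup>2 * E" using poly_taylor1 by blast
 then show ?thesis by (intro exI[of _ "poly (pderiv F) y + (x - y) * E"]) (simp add: power2_eq_square algebra_simps)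
qed

lemma poly_fps_cong:
 fixes F :: "'k::field fps poly"
 assumes "!!i. i \<le> j ==> fps_nth x i = fps_nth y i" shows "fps_nth (poly F x) j = fps_nth (poly F y) j"
proof -
 obtain E where E: "poly F x = poly F y + (x - y) * E" using poly_diff_dvd by blast
 have "fps_nth ((x - y) * E) j = 0" unfolding fps_mult_nth by (rule sum.neutral) (use assms in auto)
 then show ?thesis by (simp add: E)
qed

text \<open>Newton's method, one coefficient at a time. The derivative at the approximate root has
  initial term \<open>d\<close>, independent of \<open>w\<close>, so each correction is a constant
  times a coefficient that already satisfies the degree bound.\<close>

lemma hensel_graded:
 fixes F :: "'v => 'k::field fps poly"
 assumes deg: "!!w. degree (F w) \<le> N" and gr: "!!i. Gr Xs (%w. coeff (F w) i)"
  and r: "!!w. fps_nth (poly (F w) (fps_const r)) 0 = 0"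
  and der: "!!w. fps_nth (poly (pderiv (F w)) (fps_const r)) 0 = d" "d ~= 0"
 shows "EX S. Gr Xs S & (ALL w. fps_nth (S w) 0 = r & poly (F w) (S w) = 0)"
proof -
 have GrF: "Gr Xs (%w. poly (F w) (S w))" if "Gr Xs S" for S
  unfolding poly_sum_atMost[OF deg] by (intro Gr_sum Gr_mult Gr_power gr that)
 define cc where "cc M S w = - fps_nth (poly (F w) (S w)) (Suc M) / d" for M S w
 define Q where "Q = rec_nat (%w. fps_const r) (%M S w. S w + fps_const (cc M S w) * fps_X ^ Suc M)"
 have Q0: "Q 0 w = fps_const r" for w by (simp add: Q_def)
 have QS: "Q (Suc M) w = Q M w + fps_const (cc M (Q M) w) * fps_X ^ Suc M" for M w by (simp add: Q_def)
 have ynth: "fps_nth (fps_const c * fps_X ^ Suc M) i = (if i = Suc M then c else 0)" for c :: 'k and M i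
  by (simp del: power_Suc)
 have inv: "Gr Xs (Q M) & (ALL w. fps_nth (Q M w) 0 = r) & (ALL w j. j \<le> M --> fps_nth (poly (F w) (Q M w)) j = 0)" for M
 proof (induction M)
  case 0
  have "Q 0 = (%w. fps_const r)" using Q0 by blast
  then show ?case using r by (simp add: Gr_const)
 next
  case (Suc M)
  have PFc: "PF Xs (Suc M) (%w. cc M (Q M) w)"
  proof -
   have "PF Xs (Suc M) (%w. (- inverse d) * fps_nth (poly (F w) (Q M w)) (Suc M))"
    using GrF[of "Q M"] Suc by (intro PF_scale) (simp add: Gr_def)
   then show ?thesis by (simp add: cc_def divide_inverse mult.commute)
  qed
  have 1: "Gr Xs (Q (Suc M))"
   unfolding Gr_def
  proof
   fix j
   have "PF Xs j (%w. fps_nth (Q M w) j)" using Suc by (simp add: Gr_def)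
   moreover have "PF Xs j (%w. if j = Suc M then cc M (Q M) w else 0)" using PFc by (cases "j = Suc M") (simp_all add: PF_const)
   ultimately show "PF Xs j (%w. fps_nth (Q (Suc M) w) j)" unfolding QS fps_add_nth ynth by (rule PF_add)
  qed
  have 2: "fps_nth (Q (Suc M) w) 0 = r" for w unfolding QS fps_add_nth ynth using Suc by simp
  have 3: "fps_nth (poly (F w) (Q (Suc M) w)) j = 0" if j: "j \<le> Suc M" for w j
  proof (cases "j \<le> M")
   case True
   have "fps_nth (poly (F w) (Q (Suc M) w)) j = fps_nth (poly (F w) (Q M w)) j"
    by (rule poly_fps_cong) (use True in \<open>simp add: QS ynth del: power_Suc\<close>)
   then show ?thesis using Suc True by simp
  next
   case False
   then have j: "j = Suc M" using j by simp
   let ?c = "cc M (Q M) w"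
   let ?y = "fps_const ?c * fps_X ^ Suc M"
   obtain E where E: "poly (F w) (Q M w + ?y) = poly (F w) (Q M w) + ?y * poly (pderiv (F w)) (Q M w) + ?y\<^sup>2 * E" using poly_taylor1 by blast
   have d0: "fps_nth (poly (pderiv (F w)) (Q M w)) 0 = d"
    using poly_fps_cong[of 0 "Q M w" "fps_const r" "pderiv (F w)"] Suc der(1)[of w] by simp
   have a: "fps_nth (?y * f) (Suc M) = ?c * fps_nth f 0" for f
   proof -
    have "fps_nth (?y * f) (Suc M) = (\<Sum>i=0..Suc M. if i = Suc M then ?c * fps_nth f (Suc M - i) else 0)"
     unfolding fps_mult_nth[of ?y]
    proof (rule sum.cong[OF refl])
     fix i
     show "fps_nth ?y i * fps_nth f (Suc M - i) = (if i = Suc M then ?c * fps_nth f (Suc M - i) else 0)"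
      unfolding ynth by (cases "i = Suc M") simp_all
    qed
    also have "\<dots> = ?c * fps_nth f (Suc M - Suc M)" by (subst sum.delta) simp_all
    finally show ?thesis by simp
   qed
   have "?y\<^sup>2 * E = ?y * (?y * E)" by (simp only: power2_eq_square mult.assoc)
   then have "fps_nth (?y\<^sup>2 * E) (Suc M) = ?c * fps_nth (?y * E) 0" by (simp only: a)
   also have "fps_nth (?y * E) 0 = 0" by (simp only: fps_mult_nth_0 ynth) simp
   finally have "fps_nth (?y\<^sup>2 * E) (Suc M) = 0" by simp
   then have "fps_nth (poly (F w) (Q (Suc M) w)) (Suc M) = fps_nth (poly (F w) (Q M w)) (Suc M) + ?c * d"
    unfolding QS E fps_add_nth a d0 by simp
   then show ?thesis using der(2) j by (simp add: cc_def)
  qed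
  show ?case using 1 2 3 by blast
 qed
 have stable: "fps_nth (Q (j + m) w) j = fps_nth (Q j w) j" for j m w
  by (induction m) (simp_all add: QS ynth del: power_Suc)
 have stable': "fps_nth (Q M w) i = fps_nth (Q i w) i" if "i \<le> M" for i M w
  using stable[of i "M - i" w] that by simp
 define S where "S w = Abs_fps (%j. fps_nth (Q j w) j)" for w
 have "Gr Xs S" unfolding Gr_def S_def using inv by (simp add: Gr_def)
 moreover have "fps_nth (S w) 0 = r" for w using inv[of 0] by (simp add: S_def)
 moreover have "poly (F w) (S w) = 0" for w
 proof (rule fps_ext)
  fix j
  have "fps_nth (poly (F w) (S w)) j = fps_nth (poly (F w) (Q j w)) j"
  proof (rule poly_fps_cong)
   fix i assume "i \<le> j"
   from stable'[OF this, of w] show "fps_nth (S w) i = fps_nth (Q j w) i" unfolding S_def fps_nth_Abs_fps by (rule sym)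
  qed
  then show "fps_nth (poly (F w) (S w)) j = fps_nth 0 j" using inv[of j] by simp
 qed
 ultimately show ?thesis by blast
qed

definition fp :: "'k::field poly poly => 'k fps poly" where "fp u = map_poly fps_of_poly u"

lemma coeff_fp: "coeff (fp u) i = fps_of_poly (coeff u i)" by (simp add: fp_def coeff_map_poly)

lemma fp_mult: "fp (u * w) = fp u * fp w"
 by (rule poly_eqI) (simp add: coeff_fp coeff_mult fps_of_poly_sum fps_of_poly_mult)

lemma degree_fp: "degree (fp u) = degree u"
proof (cases "u = 0")
 case False
 show ?thesis
 proof (rule antisym)
  show "degree (fp u) \<le> degree u" by (rule degree_le) (simp add: coeff_fp coeff_eq_0)
  have "lead_coeff u ~= 0" using False by simp
  then have "coeff (fp u) (degree u) ~= 0" unfolding coeff_fp by (simp del: leading_coeff_0_iff)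
  then show "degree u \<le> degree (fp u)" by (rule le_degree)
 qed
qed (simp add: fp_def)

lemma fp_poly: "fps_of_poly (poly u s) = poly (fp u) (fps_of_poly s)"
 by (induction u) (simp_all add: fp_def map_poly_pCons fps_of_poly_add fps_of_poly_mult)

lemma ev_comp: "ev u (x, poly s x) = poly (poly u s) x" for u :: "'k::comm_ring_1 poly poly"
 by (induction u) (simp_all add: ev_def)

lemma nth0_poly: "fps_nth (poly F x) 0 = poly (map_poly (%f. fps_nth f 0) F) (fps_nth x 0)"
 for F :: "'k::field fps poly"
 by (induction F) (simp_all add: map_poly_pCons)

lemma prod_roots_eq:
 fixes p :: "'r::idom poly"
 assumes fin: "finite A" and inj: "inj_on s A" and root: "!!r. r \<in> A ==> poly p (s r) = 0" and deg: "degree p = card A"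
 shows "p = smult (lead_coeff p) (\<Prod>r\<in>A. [:- s r, 1:])"
proof -
 have "(\<Prod>r\<in>A. [:- s r, 1:]) dvd p"
  using fin inj root
 proof (induction A rule: finite_induct)
  case (insert a A)
  then obtain k where k: "p = (\<Prod>r\<in>A. [:- s r, 1:]) * k" by (auto elim: dvdE)
  have "poly (\<Prod>r\<in>A. [:- s r, 1:]) (s a) ~= 0" using insert by (auto simp: poly_prod)
  moreover have "poly p (s a) = 0" using insert by simp
  ultimately have "poly k (s a) = 0" using k by simp
  then obtain k' where "k = [:- s a, 1:] * k'" unfolding poly_eq_0_iff_dvd by (elim dvdE)
  moreover have "(\<Prod>r\<in>insert a A. [:- s r, 1:]) = [:- s a, 1:] * (\<Prod>r\<in>A. [:- s r, 1:])" by (rule prod.insert[OF insert(1,2)])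
  ultimately have "p = (\<Prod>r\<in>insert a A. [:- s r, 1:]) * k'" using k by (simp only: mult_ac)
  then show ?case by (rule dvdI)
 qed simp
 then obtain k where k: "p = (\<Prod>r\<in>A. [:- s r, 1:]) * k" by (elim dvdE)
 have nz: "(\<Prod>r\<in>A. [:- s r, 1:]) ~= 0" using fin by auto
 have dA: "degree (\<Prod>r\<in>A. [:- s r, 1:]) = card A" by (subst degree_prod_eq_sum_degree) auto
 have lA: "lead_coeff (\<Prod>r\<in>A. [:- s r, 1:]) = 1" by (simp add: lead_coeff_prod)
 show ?thesis
 proof (cases "p = 0")
  case False
  then have "k ~= 0" using k by auto
  then have "degree k = 0" using degree_mult_eq[OF nz, of k] k deg dA by simp
  then obtain c where c: "k = [:c:]" by (metis degree_eq_zeroE)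
  have lp: "lead_coeff p = c" unfolding k lead_coeff_mult lA c by simp
  show ?thesis unfolding lp using k c by simp
 qed simp
qed

lemma irr_scale: assumes h: "irr e h" and c: "c ~= (0::'k::field)" shows "irr e (%P. c * h P)"
 unfolding irr_def
proof (intro conjI allI impI)
 show "Pl e (%P. c * h P)" "1 \<le> e" using h PF_scale by (auto simp: irr_def)
 show "~ Pl (e - 1) (%P. c * h P)"
 proof
  assume "Pl (e - 1) (%P. c * h P)"
  from PF_scale[OF this, of "inverse c"] c have "Pl (e - 1) h" by (simp flip: mult.assoc)
  then show False using h by (simp add: irr_def)
 qed
 fix f k s t assume fk: "Pl s f" "Pl t k" "s + t \<le> e" "ALL P. c * h P = f P * k P"
 show "s = 0 | t = 0"
 proof (rule irrD[OF h PF_scale[OF fk(1), of "inverse c"] fk(2,3)])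
  fix P
  have "h P = inverse c * (c * h P)" using c by simp
  also have "\<dots> = inverse c * f P * k P" using fk(4) by (simp add: mult.assoc del: split_paired_All)
  finally show "h P = inverse c * f P * k P" .
 qed
qed

section \<open>Base points with separable fibre\<close>

context hyper_dir
begin

definition simple :: "'k ^ 'n => bool" where "simple z \<longleftrightarrow> (ALL t. poly (G z) t = 0 --> poly (pderiv (G z)) t ~= 0)"

lemma degree_pderiv_G: "degree (pderiv (G z)) < \<delta>"
 using degree_G[of z] d1 by (intro degree_lessI) (auto simp: coeff_pderiv coeff_eq_0)

lemma coeff_pderiv_G_PF: "PF crd \<delta> (%z. coeff (pderiv (G z)) i)"
 unfolding coeff_pderiv by (rule PF_scale[OF PF_mono[OF coeff_G_PF]]) simp

lemma syl_G_PF: "PF crd \<delta> (%z. syl \<delta> (G z) (pderiv (G z)) j i)"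
 unfolding syl_def using PF_mono[OF coeff_G_PF, of _ \<delta>] coeff_pderiv_G_PF
 by (cases "i < \<delta>"; cases "i \<le> j"; cases "i - \<delta> \<le> j") (simp_all add: PF_const)

lemma syl_G_zero:
 assumes "!!j. j < 2 * \<delta> ==> (\<Sum>i<2*\<delta>. x i * syl \<delta> (G z) (pderiv (G z)) j i) = 0"
 shows "(\<Sum>i<\<delta>. monom (x i) i) * G z + (\<Sum>i<\<delta>. monom (x (\<delta> + i)) i) * pderiv (G z) = 0" (is "?A * _ + ?B * _ = 0")
proof (rule poly_eqI)
 fix j
 show "coeff (?A * G z + ?B * pderiv (G z)) j = coeff 0 j"
 proof (cases "j < 2 * \<delta>")
  case True
  then show ?thesis using assms[OF True] unfolding syl_sum by simp
 next
  case False
  have "degree ?A < \<delta>" "degree ?B < \<delta>" using d1 by (auto intro!: degree_sum_monom_less)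
  then have "degree (?A * G z) < 2 * \<delta>" "degree (?B * pderiv (G z)) < 2 * \<delta>"
   using degree_mult_le[of ?A "G z"] degree_mult_le[of ?B "pderiv (G z)"] degree_G[of z] degree_pderiv_G[of z] by linarith+
  then show ?thesis using False by (simp add: coeff_eq_0)
 qed
qed

text \<open>By \<open>kernel_lift\<close> it is enough that the Sylvester system of \<open>g\<close>
  and its derivative g' along \<open>v\<close> has trivial kernel over \<open>R0\<close>. In A g + B
  g' = 0, irreducibility makes B or g' vanish on the hypersurface and \<open>VF_vanish\<close> makes
  it zero; g' is not, by \<open>sepv\<close>, so B = 0 and then A = 0.\<close>

lemma ex_simple: "EX z. simple z"
proof (rule ccontr)
 assume ns: "~ ?thesis"
 define M where "M j i z = syl \<delta> (G (pr z)) (pderiv (G (pr z))) j i" for j i z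
 define I where "I = {..<2*\<delta>}"
 have "EX z. (1::'k) ~= 0 & (ALL x. (\<forall>j\<in>I. (\<Sum>i\<in>I. x i * M j i z) = 0) --> (\<forall>i\<in>I. x i = 0))"
 proof (rule kernel_lift[where R = R0 and r = "%_. 1"])
  show "EX y. f y ~= 0 & h y ~= 0" if "f \<in> R0" "h \<in> R0" "f z ~= 0" "h w ~= 0" for f h z w
   using polyfun_domain[of f h z w] that by (simp add: R0_def)
  show "M j i \<in> R0" for j i unfolding M_def by (rule R0_comp[OF syl_G_PF])
  fix x assume x: "\<forall>i\<in>I. x i \<in> R0" "\<forall>j\<in>I. ALL z. (\<Sum>i\<in>I. x i z * M j i z) = 0"
  define A where "A z = (\<Sum>i<\<delta>. x i z * lam z ^ i)" for z
  define B where "B z = (\<Sum>i<\<delta>. x (\<delta> + i) z * lam z ^ i)" for z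
  define g' where "g' z = poly (pderiv (G (pr z))) (lam z)" for z
  have mono0: "VF \<delta> (%z. \<Sum>i<\<delta>. c i z * lam z ^ i)" if c: "!!i. i < \<delta> ==> c i \<in> R0" for c
   unfolding VF_def
  proof (intro exI[of _ "%i. if i < \<delta> then c i else (%_. 0)"] conjI allI)
   show "(if i < \<delta> then c i else (%_. 0)) \<in> R0" for i using c R0_const by simp
  qed (rule sum.cong, auto)
  have VB: "VF \<delta> B" and VA: "VF \<delta> A" unfolding B_def A_def using x(1) by (auto intro!: mono0 simp: I_def)
  have Vg': "VF \<delta> g'"
  proof -
   have "VF \<delta> (%z. \<Sum>i<\<delta>. coeff (pderiv (G (pr z))) i * lam z ^ i)" by (rule mono0) (rule R0_comp[OF coeff_pderiv_G_PF])
   moreover have "g' z = (\<Sum>i<\<delta>. coeff (pderiv (G (pr z))) i * lam z ^ i)" for z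
   proof -
    have d: "degree (pderiv (G (pr z))) \<le> \<delta> - 1" using degree_pderiv_G[of "pr z"] by simp
    have "{..\<delta> - 1} = {..<\<delta>}" using d1 by auto
    then show ?thesis unfolding g'_def poly_sum_atMost[OF d] by simp
   qed
   then have "g' = (%z. \<Sum>i<\<delta>. coeff (pderiv (G (pr z))) i * lam z ^ i)" by blast
   ultimately show ?thesis by simp
  qed
  have AB: "A z * g z + B z * g' z = 0" for z
  proof -
   have "(\<Sum>i<\<delta>. monom (x i z) i) * G (pr z) + (\<Sum>i<\<delta>. monom (x (\<delta> + i) z) i) * pderiv (G (pr z)) = 0"
    by (rule syl_G_zero[of "%i. x i z"]) (use x(2) in \<open>simp add: M_def I_def\<close>)
   then have "poly ((\<Sum>i<\<delta>. monom (x i z) i) * G (pr z) + (\<Sum>i<\<delta>. monom (x (\<delta> + i) z) i) * pderiv (G (pr z))) (lam z) = 0" by simp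
   then show ?thesis by (simp add: A_def B_def g'_def g_eq_G[of z] poly_sum poly_monom)
  qed
  have "(ALL z. g z = 0 --> B z = 0) | (ALL z. g z = 0 --> g' z = 0)"
  proof (rule prime'[OF VF_polyfun[OF VB] VF_polyfun[OF Vg']])
   fix z assume "g z = 0"
   then show "B z * g' z = 0" using AB[of z] by simp
  qed
  moreover have "~ (ALL z. g z = 0 --> g' z = 0)"
  proof
   assume "ALL z. g z = 0 --> g' z = 0"
   then have z: "g' z = 0" for z using VF_vanish[OF Vg'] by blast
   from sepv obtain z P where P: "!!t. g (z + t *s v) = poly P t" "pderiv P ~= 0" by blast
   have "G z = P" by (rule G_eqI[OF P(1)])
   have shift: "G z = pcompose (G (pr z)) [:lam z, 1:]"
    by (rule G_eqI) (simp add: poly_pcompose poly_G pr_def vector_sadd_rdistrib algebra_simps)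
   have "pderiv (G (pr z)) = 0"
   proof (rule poly_eqI_infinite[OF infinite_alg_closed])
    fix t show "poly (pderiv (G (pr z))) t = poly 0 t" using z[of "pr z + t *s v"] by (simp add: g'_def)
   qed
   then have "pderiv (G z) = 0" unfolding shift by (simp add: pderiv_pcompose)
   then show False using P(2) \<open>G z = P\<close> by simp
  qed
  ultimately have "!!z. g z = 0 ==> B z = 0" by blast
  then have B0: "B z = 0" for z by (rule VF_vanish[OF VB])
  have A0: "A z = 0" for z
  proof (rule ccontr)
   assume "A z ~= 0"
   moreover obtain w where "g w ~= 0" 
   proof -
    have "G 0 ~= 0" using degree_G[of 0] d1 by auto
    then have "~ (ALL w. poly (G 0) w = poly 0 w)" using poly_eqI_infinite[OF infinite_alg_closed, of "G 0" 0] by blast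
    then obtain w where "poly (G 0) w ~= 0" by auto
    then show thesis by (intro that) (simp only: poly_G not_False_eq_True)
   qed
   ultimately obtain y where "A y ~= 0" "g y ~= 0" using polyfun_domain[OF VF_polyfun[OF VA] polyfunI[OF g]] by blast
   then show False using AB[of y] B0 by simp
  qed
  show "\<forall>i\<in>I. ALL z. x i z = 0"
  proof (intro ballI allI)
   fix i z assume i: "i \<in> I"
   show "x i z = 0"
   proof (cases "i < \<delta>")
    case True
    then show ?thesis by (intro VF_zero_coeff[of \<delta> x]) (use x(1) A0 in \<open>auto simp: A_def I_def\<close>)
   next
    case False
    have "x (\<delta> + (i - \<delta>)) z = 0"
     by (rule VF_zero_coeff[of \<delta> "%i. x (\<delta> + i)"]) (use x(1) B0 i False in \<open>auto simp: B_def I_def\<close>)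
    then show ?thesis using False by simp
   qed
  qed
 qed (auto simp: I_def intro: R0_const R0_diff R0_mult)
 then obtain z where z: "!!x. (\<forall>j\<in>I. (\<Sum>i\<in>I. x i * M j i z) = 0) ==> (\<forall>i\<in>I. x i = 0)" by blast
 from ns obtain t where t: "poly (G (pr z)) t = 0" "poly (pderiv (G (pr z))) t = 0" unfolding simple_def by blast
 from syl_common_root[OF degree_G degree_pderiv_G t] obtain x where "ALL j. (\<Sum>i<2*\<delta>. x i * M j i z) = 0" "\<exists>i<2*\<delta>. x i ~= 0"
  unfolding M_def by blast
 then show False using z[of x] by (auto simp: I_def)
qed

lemma card_simple_roots: "simple z ==> card {t. poly (G z) t = 0} = \<delta>"
 using card_roots_simple[of "G z"] degree_G[of z] d1 by (force simp: simple_def)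

text \<open>A maximal minor in the role of the discriminant: 2\<delta> columns with entries of
  degree at most \<delta>.\<close>

lemma simple_certificate:
 "\<exists>\<Delta>. PF crd (2 * \<delta> * \<delta>) \<Delta> & (EX z. \<Delta> z ~= 0) & (ALL z. \<Delta> z ~= 0 --> simple z)"
proof -
 from ex_simple obtain z0 where z0: "simple z0" by blast
 define M where "M j i z = syl \<delta> (G z) (pderiv (G z)) j i" for j i z
 have "\<exists>\<Delta>. PF crd (card {..<2*\<delta>} * \<delta>) \<Delta> & \<Delta> z0 ~= 0 &
  (ALL z. \<Delta> z ~= 0 --> (ALL x. (\<forall>j\<in>{..<2*\<delta>}. (\<Sum>i\<in>{..<2*\<delta>}. x i * M j i z) = 0) --> (\<forall>i\<in>{..<2*\<delta>}. x i = 0)))"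
 proof (rule PF_minor)
  show "PF crd \<delta> (M j i)" for j i unfolding M_def by (rule syl_G_PF)
  fix x assume x: "\<forall>j\<in>{..<2*\<delta>}. (\<Sum>i\<in>{..<2*\<delta>}. x i * M j i z0) = 0"
  define A where "A = (\<Sum>i<\<delta>. monom (x i) i)"
  define B where "B = (\<Sum>i<\<delta>. monom (x (\<delta> + i)) i)"
  have AB: "A * G z0 + B * pderiv (G z0) = 0" unfolding A_def B_def by (rule syl_G_zero) (use x in \<open>simp add: M_def\<close>)
  have B0: "B = 0"
  proof (rule ccontr)
   assume "B ~= 0"
   have "{t. poly (G z0) t = 0} \<subseteq> {t. poly B t = 0}"
   proof
    fix t assume "t \<in> {t. poly (G z0) t = 0}"
    then have "poly (G z0) t = 0" "poly (pderiv (G z0)) t ~= 0" using z0 by (auto simp: simple_def)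
    then show "t \<in> {t. poly B t = 0}" using arg_cong[OF AB, of "%p. poly p t"] by simp
   qed
   then have "\<delta> \<le> card {t. poly B t = 0}" using card_mono[OF poly_roots_finite[OF \<open>B ~= 0\<close>]] card_simple_roots[OF z0] by metis
   also have "\<dots> \<le> degree B" by (rule card_poly_roots_bound[OF \<open>B ~= 0\<close>])
   also have "\<dots> < \<delta>" unfolding B_def using d1 by (intro degree_sum_monom_less) simp
   finally show False by simp
  qed
  have "G z0 ~= 0" using degree_G[of z0] d1 by auto
  then have A0: "A = 0" using AB B0 by simp
  show "\<forall>i\<in>{..<2*\<delta>}. x i = 0"
  proof
   fix i assume i: "i \<in> {..<2*\<delta>}"
   show "x i = 0"
   proof (cases "i < \<delta>")
    case True
    then show ?thesis using A0 coeff_sum_monom_less[of x \<delta> i] unfolding A_def by simp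
   next
    case False
    then have "i - \<delta> < \<delta>" "\<delta> + (i - \<delta>) = i" using i by auto
    then show ?thesis using B0 coeff_sum_monom_less[of "%i. x (\<delta> + i)" \<delta> "i - \<delta>"] unfolding B_def by simp
   qed
  qed
 qed auto
 then obtain \<Delta> where D: "PF crd (card {..<2*\<delta>} * \<delta>) \<Delta>" "\<Delta> z0 ~= 0"
  "!!z x. \<Delta> z ~= 0 ==> (\<forall>j\<in>{..<2*\<delta>}. (\<Sum>i\<in>{..<2*\<delta>}. x i * M j i z) = 0) ==> (\<forall>i\<in>{..<2*\<delta>}. x i = 0)" by blast
 have "simple z" if "\<Delta> z ~= 0" for z
 proof (rule ccontr)
  assume "~ simple z"
  then obtain t where t: "poly (G z) t = 0" "poly (pderiv (G z)) t = 0" unfolding simple_def by blast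
  from syl_common_root[OF degree_G degree_pderiv_G t] obtain x where "ALL j. (\<Sum>i<2*\<delta>. x i * M j i z) = 0" "\<exists>i<2*\<delta>. x i ~= 0"
   unfolding M_def by blast
  then show False using D(3)[OF that, of x] by auto
 qed
 then show ?thesis using D(1,2) by (intro exI[of _ \<Delta>]) auto
qed

end

section \<open>Irreducible plane sections\<close>

locale hyper_pt = hyper_dir g \<delta> v \<gamma> for g :: "'k::{alg_closed_field,field_gcd} ^ 'n::finite => 'k" and \<delta> v \<gamma> +
 fixes p :: "'k ^ 'n"
 assumes simple_p: "simple p"
begin

definition Rt :: "'k set" where "Rt = {t. poly (G p) t = 0}"

lemma card_Rt: "card Rt = \<delta>" and finite_Rt: "finite Rt"
proof -
 show "card Rt = \<delta>" unfolding Rt_def by (rule card_simple_roots[OF simple_p])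
 then show "finite Rt" using d1 card.infinite by fastforce
qed

definition ka :: "nat => nat => 'k ^ 'n => 'k" where
 "ka = (SOME ka. ALL i. (ALL w t. coeff (G (p + t *s w)) i = (\<Sum>j\<le>\<delta>-i. t ^ j * ka i j w)) &
  (ALL j. PF crd j (ka i j)) & (ALL j w. j > \<delta> - i --> ka i j w = 0))"

lemma ka: "coeff (G (p + t *s w)) i = (\<Sum>j\<le>\<delta>-i. t ^ j * ka i j w)" "PF crd j (ka i j)" "j > \<delta> - i ==> ka i j w = 0"
proof -
 have "ALL i. EX D. (ALL w t. coeff (G (p + t *s w)) i = (\<Sum>j\<le>\<delta>-i. t ^ j * D j w)) &
  (ALL j. PF crd j (D j)) & (ALL j w. j > \<delta> - i --> D j w = 0)"
 proof
  fix i
  from vecs.taylor[OF coeff_G_PF[of i]] obtain D where D: "!!z v t. coeff (G (z + t *s v)) i = (\<Sum>j\<le>\<delta>-i. t ^ j * D j z v)"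
   "!!j z. PF crd j (%v. D j z v)" "!!j z v. j > \<delta> - i ==> D j z v = 0" by blast
  show "EX D. (ALL w t. coeff (G (p + t *s w)) i = (\<Sum>j\<le>\<delta>-i. t ^ j * D j w)) & (ALL j. PF crd j (D j)) & (ALL j w. j > \<delta> - i --> D j w = 0)"
   by (rule exI[of _ "%j. D j p"]) (use D in blast)
 qed
 from choice[OF this] have "\<exists>ka. ALL i. (ALL w t. coeff (G (p + t *s w)) i = (\<Sum>j\<le>\<delta>-i. t ^ j * ka i j w)) &
  (ALL j. PF crd j (ka i j)) & (ALL j w. j > \<delta> - i --> ka i j w = 0)" .
 from someI_ex[OF this] have *: "ALL i. (ALL w t. coeff (G (p + t *s w)) i = (\<Sum>j\<le>\<delta>-i. t ^ j * ka i j w)) &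
  (ALL j. PF crd j (ka i j)) & (ALL j w. j > \<delta> - i --> ka i j w = 0)" unfolding ka_def .
 show "coeff (G (p + t *s w)) i = (\<Sum>j\<le>\<delta>-i. t ^ j * ka i j w)" using * by blast
 show "PF crd j (ka i j)" using * by blast
 show "j > \<delta> - i ==> ka i j w = 0" using * by blast
qed

lemma ka_0: "ka i 0 w = coeff (G p) i"
proof -
 have "coeff (G p) i = (\<Sum>j\<le>\<delta>-i. 0 ^ j * ka i j w)" using ka(1)[of 0 w i] by simp
 also have "\<dots> = (\<Sum>j\<in>{0}. 0 ^ j * ka i j w)" by (rule sum.mono_neutral_right) auto
 finally show ?thesis by simp
qed

text \<open>The section by the plane through \<open>p\<close> spanned by \<open>w\<close> and
  \<open>v\<close>; the outer variable is the coordinate along \<open>v\<close>.\<close>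

definition hw :: "'k ^ 'n => 'k poly poly" where "hw w = (\<Sum>i<Suc \<delta>. monom (\<Sum>j<Suc (\<delta>-i). monom (ka i j w) j) i)"

lemma coeff_hw: "coeff (hw w) i = (if i \<le> \<delta> then \<Sum>j<Suc (\<delta>-i). monom (ka i j w) j else 0)"
 unfolding hw_def coeff_sum_monom_less less_Suc_eq_le ..

lemma coeff2_hw: "coeff (coeff (hw w) i) j = (if i \<le> \<delta> then ka i j w else 0)"
 using ka(3)[of i j w] by (simp add: coeff_hw coeff_sum_monom_less del: sum.lessThan_Suc)

lemma poly_coeff_hw: "poly (coeff (hw w) i) t = coeff (G (p + t *s w)) i"
proof (cases "i \<le> \<delta>")
 case True
 then show ?thesis unfolding coeff_hw ka(1) by (simp add: poly_sum poly_monom mult.commute lessThan_Suc_atMost del: sum.lessThan_Suc)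
next
 case False
 then show ?thesis using degree_G[of "p + t *s w"] by (simp add: coeff_hw coeff_eq_0)
qed

lemma map_hw: "map_poly (%c. poly c t) (hw w) = G (p + t *s w)" by (rule poly_eqI) (simp add: coeff_map_poly poly_coeff_hw)

lemma ev_hw: "ev (hw w) (t, s) = g (p + t *s w + s *s v)" by (simp add: ev_map map_hw poly_G)

lemma ev_hw': "ev (hw w) P = g (p + fst P *s w + snd P *s v)" using ev_hw[of w "fst P" "snd P"] by simp

lemma tdeg_hw: "tdeg \<delta> (hw w)"
 unfolding tdeg_def
proof (intro allI impI)
 fix k j assume "coeff (coeff (hw w) k) j ~= 0"
 then have "k \<le> \<delta>" "~ j > \<delta> - k" using ka(3)[of k j w] by (auto simp: coeff2_hw split: if_splits)
 then show "j + k \<le> \<delta>" by simp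
qed

lemma lead_hw: "coeff (hw w) \<delta> = [:\<gamma>:]" and degree_hw: "degree (hw w) = \<delta>"
proof -
 show 1: "coeff (hw w) \<delta> = [:\<gamma>:]" by (simp add: coeff_hw ka_0 coeff_G monom_0)
 have "degree (hw w) \<le> \<delta>" by (rule degree_le) (simp add: coeff_hw)
 moreover have "\<delta> \<le> degree (hw w)" by (rule le_degree) (simp add: 1 \<gamma>)
 ultimately show "degree (hw w) = \<delta>" by simp
qed

text \<open>The branch of the section over t = 0 that starts at the root \<open>r\<close>; simple
  roots at \<open>p\<close> yield \<delta> of them.\<close>

definition S :: "'k => 'k ^ 'n => 'k fps" where
 "S r = (SOME S. Gr crd S & (ALL w. fps_nth (S w) 0 = r & poly (fp (hw w)) (S w) = 0))"

lemma S: assumes r: "r \<in> Rt" shows "Gr crd (S r)" "fps_nth (S r w) 0 = r" "poly (fp (hw w)) (S r w) = 0"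
proof -
 have m: "map_poly (%f. fps_nth f 0) (fp (hw w)) = G p" for w
  using degree_G[of p] by (intro poly_eqI) (simp add: coeff_map_poly coeff_fp coeff2_hw ka_0 coeff_eq_0)
 have m': "map_poly (%f. fps_nth f 0) (pderiv (fp (hw w))) = pderiv (G p)" for w
 proof (rule poly_eqI)
  fix i
  have "coeff (G p) (Suc i) = fps_nth (coeff (fp (hw w)) (Suc i)) 0" unfolding m[of w, symmetric] by (simp add: coeff_map_poly)
  then show "coeff (map_poly (%f. fps_nth f 0) (pderiv (fp (hw w)))) i = coeff (pderiv (G p)) i"
   by (simp add: coeff_map_poly coeff_pderiv fps_of_nat[symmetric] del: of_nat_Suc)
 qed
 have "EX S. Gr crd S & (ALL w. fps_nth (S w) 0 = r & poly (fp (hw w)) (S w) = 0)"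
 proof (rule hensel_graded[where N = \<delta> and d = "poly (pderiv (G p)) r"])
  show "degree (fp (hw w)) \<le> \<delta>" for w by (simp add: degree_fp degree_hw)
  show "Gr crd (%w. coeff (fp (hw w)) i)" for i
   unfolding Gr_def coeff_fp fps_of_poly_nth coeff2_hw using ka(2) by (cases "i \<le> \<delta>") (simp_all add: PF_const)
  show "fps_nth (poly (fp (hw w)) (fps_const r)) 0 = 0" for w unfolding nth0_poly m using r by (simp add: Rt_def)
  show "fps_nth (poly (pderiv (fp (hw w))) (fps_const r)) 0 = poly (pderiv (G p)) r" for w unfolding nth0_poly m' by simp
  show "poly (pderiv (G p)) r ~= 0" using simple_p r by (simp add: simple_def Rt_def)
 qed
 from someI_ex[OF this] have *: "Gr crd (S r) & (ALL w. fps_nth (S r w) 0 = r & poly (fp (hw w)) (S r w) = 0)" unfolding S_def .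
 show "Gr crd (S r)" using * by (rule conjunct1)
 show "fps_nth (S r w) 0 = r" "poly (fp (hw w)) (S r w) = 0" using * by blast+
qed

lemma inj_S: "inj_on (%r. S r w) A" if "A \<subseteq> Rt"
proof (rule inj_onI)
 fix x y assume "x \<in> A" "y \<in> A" "S x w = S y w"
 then show "x = y" using S(2)[of x w] S(2)[of y w] that by auto
qed

abbreviation section_irr :: "'k ^ 'n => bool" where
 "section_irr w \<equiv> irr \<delta> (%P. g (p + fst P *s w + snd P *s v))"

lemma split_section:
 assumes "~ section_irr w"
 shows "EX a b e1 e2. e1 \<ge> 1 & e2 \<ge> 1 & e1 + e2 = \<delta> & hw w = a * b & tdeg e1 a & tdeg e2 b & degree a = e1 & degree b = e2"
proof -
 have h: "Pl \<delta> (%P. g (p + fst P *s w + snd P *s v))" by (rule plane_fun[OF g])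
 have n: "~ Pl (\<delta> - 1) (%P. g (p + fst P *s w + snd P *s v))"
 proof
  assume "Pl (\<delta> - 1) (%P. g (p + fst P *s w + snd P *s v))"
  from Pl_ev[OF this] obtain u where u: "tdeg (\<delta> - 1) u" "!!P. ev (hw w) P = ev u P" unfolding ev_hw' by blast
  have "hw w = u" by (rule ev_inj[OF infinite_alg_closed u(2)])
  then have "coeff (coeff u \<delta>) 0 ~= 0" using lead_hw[of w] \<gamma> by simp
  then have "0 + \<delta> \<le> \<delta> - 1" using u(1) unfolding tdeg_def by blast
  then show False using d1 by simp
 qed
 from assms h n d1 obtain f k s t where fk: "Pl s f" "Pl t k" "s + t \<le> \<delta>"
  "!!P. g (p + fst P *s w + snd P *s v) = f P * k P" "s ~= 0" "t ~= 0" unfolding irr_def by blast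
 from Pl_ev[OF fk(1)] obtain a where a: "tdeg s a" "!!P. f P = ev a P" by blast
 from Pl_ev[OF fk(2)] obtain b where b: "tdeg t b" "!!P. k P = ev b P" by blast
 have ab: "hw w = a * b" by (rule ev_inj[OF infinite_alg_closed]) (simp add: ev_hw' fk(4) a b ev_mult)
 have dle: "degree u \<le> e" if "tdeg e u" for e and u :: "'k poly poly"
  by (rule degree_le) (use that in \<open>force simp: tdeg_def poly_eq_iff\<close>)
 have "hw w ~= 0" using lead_hw[of w] \<gamma> by auto
 then have "a ~= 0" "b ~= 0" using ab by auto
 then have "degree a + degree b = \<delta>" using degree_mult_eq[of a b] degree_hw[of w] ab by simp
 then have "degree a = s" "degree b = t" "s + t = \<delta>" using dle[OF a(1)] dle[OF b(1)] fk(3) by linarith+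
 then show ?thesis using ab a(1) b(1) fk(5,6) by (intro exI[of _ a] exI[of _ b] exI[of _ s] exI[of _ t]) auto
qed

definition KI :: "(nat \<times> nat) set" where "KI = {(k, j). k < \<delta> & j < \<delta> & k + j \<le> \<delta> - 1}"

lemma KI_sub: "KI \<subseteq> {..<\<delta>} \<times> {..<\<delta>}" by (auto simp: KI_def)
lemma finite_KI: "finite KI" by (rule finite_subset[OF KI_sub]) simp
lemma card_KI: "card KI \<le> \<delta> * \<delta>" using card_mono[OF _ KI_sub] by simp

text \<open>Matrix of the linear system expressing that a polynomial of degree at most \<delta> - 1,
  hence possibly a proper factor, vanishes on the branch \<open>r\<close> in order J.\<close>

definition Mk :: "'k => nat => nat \<times> nat => 'k ^ 'n => 'k" where
 "Mk r J i w = fps_nth (fps_X ^ snd i * S r w ^ fst i) J"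

definition Px :: "(nat \<times> nat => 'k) => 'k poly poly" where
 "Px x = (\<Sum>i\<in>KI. monom (monom (x i) (snd i)) (fst i))"

lemma coeff_Px: "coeff (coeff (Px x) k) j = (if (k, j) \<in> KI then x (k, j) else 0)"
proof -
 have "coeff (coeff (Px x) k) j = (\<Sum>i\<in>KI. if i = (k, j) then x i else 0)"
  unfolding Px_def coeff_sum by (rule sum.cong) (auto simp: coeff_monom split: if_splits)
 then show ?thesis using finite_KI by (simp add: sum.delta)
qed

lemma fp_Px: "poly (fp (Px x)) f = (\<Sum>i\<in>KI. fps_const (x i) * (fps_X ^ snd i * f ^ fst i))"
proof -
 have "fp (Px x) = (\<Sum>i\<in>KI. monom (fps_const (x i) * fps_X ^ snd i) (fst i))"
  by (rule poly_eqI) (simp add: coeff_fp Px_def coeff_sum fps_of_poly_sum fps_of_poly_monom if_distrib[of fps_of_poly] cong: if_cong)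
 then show ?thesis by (simp add: poly_sum poly_monom mult.assoc)
qed

lemma Mk_sum: "(\<Sum>i\<in>KI. x i * Mk r J i w) = fps_nth (poly (fp (Px x)) (S r w)) J"
 unfolding fp_Px Mk_def fps_sum_nth by simp

lemma tdeg_Px: "tdeg (\<delta> - 1) (Px x)"
 unfolding tdeg_def coeff_Px by (auto simp: KI_def)

lemma triv_imp_irr:
 assumes r: "r \<in> Rt" and triv: "!!x. (\<forall>J\<in>{..\<delta>*(\<delta>-1)}. (\<Sum>i\<in>KI. x i * Mk r J i w) = 0) ==> (\<forall>i\<in>KI. x i = 0)"
 shows "section_irr w"
proof (rule ccontr)
 assume "~ section_irr w"
 from split_section[OF this] obtain a b e1 e2 where ab: "e1 \<ge> 1" "e2 \<ge> 1" "e1 + e2 = \<delta>" "hw w = a * b" "tdeg e1 a" "tdeg e2 b" by blast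
 have contra: False if c: "tdeg e c" "e \<le> \<delta> - 1" "c ~= 0" "poly (fp c) (S r w) = 0" for c e
 proof -
  define x where "x i = coeff (coeff c (fst i)) (snd i)" for i
  have "Px x = c"
  proof (intro poly_eqI)
   fix k j
   have "(k, j) \<in> KI" if "coeff (coeff c k) j ~= 0"
   proof -
    have "j + k \<le> e" using c(1) that unfolding tdeg_def by blast
    then show ?thesis using c(2) d1 by (auto simp: KI_def)
   qed
   then show "coeff (coeff (Px x) k) j = coeff (coeff c k) j" by (auto simp: coeff_Px x_def)
  qed
  then have "\<forall>i\<in>KI. x i = 0" by (intro triv) (simp add: Mk_sum c(4))
  then have "Px x = 0" by (simp add: Px_def)
  then show False using \<open>Px x = c\<close> c(3) by simp
 qed
 have nz: "a ~= 0" "b ~= 0" using ab(4) lead_hw[of w] \<gamma> by auto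
 have "poly (fp a) (S r w) * poly (fp b) (S r w) = 0" using S(3)[OF r, of w] unfolding ab(4) fp_mult by simp
 then have "poly (fp a) (S r w) = 0 | poly (fp b) (S r w) = 0" by simp
 then show False using contra[OF ab(5) _ nz(1)] contra[OF ab(6) _ nz(2)] ab(1-3) by force
qed

lemma shift_power:
 fixes u :: "'k poly"
 assumes "!!i. i < n ==> coeff u i = 0" shows "u = monom 1 n * poly_shift n u"
 by (rule poly_eqI) (use assms in \<open>auto simp: coeff_monom_mult' coeff_poly_shift\<close>)

lemma cutoff_vanish:
 fixes u :: "'k poly poly"
 assumes "!!J. J \<le> K ==> fps_nth (poly (fp u) f) J = 0" "!!i. i \<le> K ==> coeff sp i = fps_nth f i"
 shows "EX e. ALL x. ev u (x, poly sp x) = x ^ Suc K * poly e x"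
proof -
 have "coeff (poly u sp) J = 0" if "J < Suc K" for J
 proof -
  have "coeff (poly u sp) J = fps_nth (poly (fp u) (fps_of_poly sp)) J" by (simp flip: fp_poly)
  also have "\<dots> = fps_nth (poly (fp u) f) J" by (rule poly_fps_cong) (use assms(2) that in simp)
  finally show ?thesis using assms(1) that by simp
 qed
 from shift_power[OF this] have e: "poly u sp = monom 1 (Suc K) * poly_shift (Suc K) (poly u sp)" .
 have "ev u (x, poly sp x) = x ^ Suc K * poly (poly_shift (Suc K) (poly u sp)) x" for x
  unfolding ev_comp by (subst e) (simp only: poly_mult poly_monom mult_1)
 then show ?thesis by blast
qed

text \<open>A solution vanishes at a smooth point of the irreducible section to order \<delta>
  (\<delta> - 1) + 1, one more than Bezout's theorem allows for degree \<delta> - 1. So it vanishes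
  on the section and, its degree being too small, is zero. This determines the truncation
  order.\<close>

lemma irr_imp_triv:
 assumes irr: "section_irr w" and r: "r \<in> Rt" and x: "\<forall>J\<in>{..\<delta>*(\<delta>-1)}. (\<Sum>i\<in>KI. x i * Mk r J i w) = 0"
 shows "\<forall>i\<in>KI. x i = 0"
proof (rule ccontr)
 assume nx: "~ ?thesis"
 define K where "K = \<delta> * (\<delta> - 1)"
 define a where "a = (%j k. inverse \<gamma> * coeff (coeff (hw w) k) j)"
 have cf: "curve_fun a \<delta> x y = inverse \<gamma> * ev (hw w) (x, y)" for x y
  unfolding ev_curve_fun[OF tdeg_hw] curve_fun_def a_def by (simp add: sum_distrib_left mult.assoc)
 have a1: "a 0 \<delta> = 1" using \<gamma> by (simp add: a_def lead_hw)
 have irrF: "irr \<delta> (%P. curve_fun a \<delta> (fst P) (snd P))"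
  using irr_scale[OF irr, of "inverse \<gamma>"] \<gamma> by (simp add: cf ev_hw')
 interpret c: irr_plane a \<delta> by unfold_locales (use d1 a1 irrF infinite_alg_closed in auto)
 have Fp0: "c.Fp 0 = smult (inverse \<gamma>) (G p)"
  by (rule poly_eqI_infinite[OF infinite_alg_closed]) (simp add: c.poly_Fp cf ev_hw poly_G)
 have "pderiv c.pF ~= 0"
 proof
  assume z: "pderiv c.pF = 0"
  have "coeff (pderiv (c.Fp 0)) k = 0" for k
  proof -
   have "coeff (pderiv (c.Fp 0)) k = poly (coeff (pderiv c.pF) k) 0" by (simp add: coeff_pderiv c.poly_coeff_pF)
   then show ?thesis using z by simp
  qed
  then have "pderiv (c.Fp 0) = 0" by (simp add: poly_eq_iff)
  then have "pderiv (G p) = 0" using \<gamma> unfolding Fp0 by (simp add: pderiv_smult)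
  then show False using simple_p r by (simp add: simple_def Rt_def)
 qed
 from c.irr_curveI[OF this] interpret k: irr_curve a \<delta> .
 have F: "c.F x y = inverse \<gamma> * ev (hw w) (x, y)" for x y by (rule cf)
 have "{y. c.F 0 y = 0} = Rt" using \<gamma> by (auto simp: F ev_hw Rt_def poly_G)
 then have good0: "c.good 0" by (simp add: c.good_def card_Rt)
 have P0: "(0, r) \<in> c.C" using r \<gamma> by (simp add: c.C_iff F ev_hw Rt_def poly_G)
 have Fy0: "c.Fy 0 r ~= 0" by (rule c.good_Fy[OF good0]) (use P0 in \<open>simp add: c.C_iff\<close>)
 \<comment> \<open>The branch is cut off to a polynomial, since \<open>ordge\<close> works with
   polynomial functions only.\<close>
 define sp where "sp = (\<Sum>i<Suc K. monom (fps_nth (S r w) i) i)"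
 have csp: "coeff sp i = fps_nth (S r w) i" if "i \<le> K" for i using that by (simp add: sp_def coeff_sum_monom_less del: sum.lessThan_Suc)
 have sp0: "poly sp 0 = r" using csp[of 0] S(2)[OF r, of w] by (simp add: poly_0_coeff_0)
 obtain e1 where e1: "!!x. ev (hw w) (x, poly sp x) = x ^ Suc K * poly e1 x"
  using cutoff_vanish[of K "hw w" "S r w" sp] S(3)[OF r, of w] csp by auto
 obtain e2 where e2: "!!y. ev (Px x) (y, poly sp y) = y ^ Suc K * poly e2 y"
  using cutoff_vanish[of K "Px x" "S r w" sp] x csp unfolding Mk_sum K_def by auto
 have Polsp: "Pol (%P. poly u (fst P))" for u by (rule polyfunI[OF Pl_poly_fst[OF order_refl]])
 have o1: "k.ordge (0, r) (Suc K) (%P. snd P - poly sp (fst P))"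
 proof (rule k.ordgeI[of "%P. c.fy2 (fst P) (snd P) (poly sp (fst P))" "%P. - (inverse \<gamma> * poly e1 (fst P))"])
  show "Pol (%P. c.fy2 (fst P) (snd P) (poly sp (fst P)))" by (intro c.polyfun_fy2 Pol_fst Pol_snd Polsp)
  show "Pol (%P. - (inverse \<gamma> * poly e1 (fst P)))" by (intro polyfun_minus polyfun_mult polyfun_const Polsp)
  show "c.fy2 (fst (0, r)) (snd (0, r)) (poly sp (fst (0, r))) ~= 0" using Fy0 sp0 by (simp add: c.Fy_def)
  fix P assume "P \<in> c.C"
  then have "(snd P - poly sp (fst P)) * c.fy2 (fst P) (snd P) (poly sp (fst P)) = - c.F (fst P) (poly sp (fst P))"
   unfolding c.fy2 by (simp add: c.C_iff(2))
  then show "c.fy2 (fst P) (snd P) (poly sp (fst P)) * (snd P - poly sp (fst P)) = (fst P - fst (0, r)) ^ Suc K * - (inverse \<gamma> * poly e1 (fst P))"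
   unfolding F e1 by (simp add: mult_ac)
 qed
 have "poly (Px x - [:poly (Px x) sp:]) sp = 0" by simp
 then obtain E where E: "Px x - [:poly (Px x) sp:] = [:- sp, 1:] * E" unfolding poly_eq_0_iff_dvd by (elim dvdE)
 have evP: "ev (Px x) P = fst P ^ Suc K * poly e2 (fst P) + ev E P * (snd P - poly sp (fst P))" for P
 proof -
  have "Px x = [:poly (Px x) sp:] + [:- sp, 1:] * E" using E by (simp only: diff_eq_eq add.commute)
  then have "ev (Px x) P = ev ([:poly (Px x) sp:] + [:- sp, 1:] * E) P" by simp
  also have "\<dots> = poly (poly (Px x) sp) (fst P) + ev E P * (snd P - poly sp (fst P))" unfolding ev_add ev_mult by (simp add: ev_def algebra_simps)
  finally show ?thesis using e2 by (simp add: ev_comp)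
 qed
 have o2: "k.ordge (0, r) (Suc K) (%P. fst P ^ Suc K * poly e2 (fst P))"
  by (rule k.ordgeI[of "%_. 1" "%P. poly e2 (fst P)"]) (auto intro: polyfun_const Polsp)
 have oP: "k.ordge (0, r) (Suc K) (%P. ev (Px x) P)" unfolding evP by (rule k.ordge_add[OF o2 k.ordge_poly_mult[OF Pol_ev o1]])
 have "Px x ~= 0"
 proof
  assume "Px x = 0"
  then have "x (k, j) = 0" if "(k, j) \<in> KI" for k j using coeff_Px[of x k j] that by simp
  then show False using nx by auto
 qed
 have dP: "degree (Px x) < \<delta>" using d1 tdeg_Px[of x] by (intro degree_lessI) (force simp: tdeg_def poly_eq_iff)+
 have nzC: "\<exists>P\<in>c.C. ev (Px x) P ~= 0"
 proof (rule ccontr)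
  assume "~ ?thesis"
  then have "Px x = 0" by (intro c.small_vanish[OF dP]) blast
  then show False using \<open>Px x ~= 0\<close> by simp
 qed
 have PlP: "Pl (\<delta> - 1) (ev (Px x))"
 proof -
  have "Pl (\<delta> - 1) (%P. \<Sum>i\<in>KI. x i * (fst P ^ snd i * snd P ^ fst i))"
   by (intro PF_sum PF_scale PF_mono[OF Pl_monom]) (auto simp: KI_def)
  moreover have "ev (Px x) P = (\<Sum>i\<in>KI. x i * (fst P ^ snd i * snd P ^ fst i))" for P
   by (simp add: ev_def Px_def poly_sum poly_monom mult.assoc)
  then have "ev (Px x) = (%P. \<Sum>i\<in>KI. x i * (fst P ^ snd i * snd P ^ fst i))" by blast
  ultimately show ?thesis by simp
 qed
 have "(\<Sum>P\<in>{(0::'k, r)}. Suc K) \<le> \<delta> * (\<delta> - 1)"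
 proof (rule k.bezout[OF PlP nzC])
  show "P \<in> c.C & c.Fy (fst P) (snd P) ~= 0" if "P \<in> {(0, r)}" for P using that P0 Fy0 by simp
  show "k.ordge P (Suc K) (ev (Px x))" if "P \<in> {(0, r)}" for P using that oP by simp
 qed simp
 then show False by (simp add: K_def)
qed

text \<open>The constant term in y of the product of the y - \<open>S r w\<close> over
  \<open>I\<close>, the candidate for a factor of the section.\<close>

definition \<rho> :: "'k set => 'k ^ 'n => 'k fps" where "\<rho> I w = (\<Prod>r\<in>I. - S r w)"

lemma Gr_\<rho>: "I \<subseteq> Rt ==> Gr crd (\<rho> I)"
 unfolding \<rho>_def using S(1) by (intro Gr_prod Gr_minus) auto

lemma \<rho>_coeff:
 assumes c: "tdeg e c" "degree c = e" and J: "J \<subseteq> Rt" "card J = e" "!!r. r \<in> J ==> poly (fp c) (S r w) = 0"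
 shows "fps_of_poly (coeff c 0) = fps_const (coeff (coeff c e) 0) * \<rho> J w"
proof -
 have fJ: "finite J" using finite_subset[OF J(1) finite_Rt] .
 have "fp c = smult (lead_coeff (fp c)) (\<Prod>r\<in>J. [:- S r w, 1:])"
  by (rule prod_roots_eq[OF fJ inj_S[OF J(1)] J(3)]) (simp_all add: degree_fp c(2) J(2))
 then have "poly (fp c) 0 = poly (smult (lead_coeff (fp c)) (\<Prod>r\<in>J. [:- S r w, 1:])) 0" by (rule arg_cong[where f = "%p. poly p 0"])
 also have "\<dots> = lead_coeff (fp c) * \<rho> J w" by (simp add: poly_prod \<rho>_def)
 finally have "poly (fp c) 0 = lead_coeff (fp c) * \<rho> J w" .
 moreover have "poly (fp c) 0 = fps_of_poly (coeff c 0)" by (simp add: poly_0_coeff_0 coeff_fp)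
 moreover have "lead_coeff (fp c) = fps_const (coeff (coeff c e) 0)"
 proof -
  have "degree (coeff c e) \<le> 0" by (rule degree_le) (use c(1) in \<open>force simp: tdeg_def\<close>)
  then obtain d where "coeff c e = [:d:]" by (metis degree_eq_zeroE le_zero_eq)
  then show ?thesis by (simp add: degree_fp c(2) coeff_fp fps_of_poly_const)
 qed
 ultimately show ?thesis by simp
qed

lemma \<rho>_vanish:
 assumes c: "tdeg e c" "degree c = e" "c ~= 0" and J: "J \<subseteq> Rt" "card J = e" "!!r. r \<in> J ==> poly (fp c) (S r w) = 0" and j: "j > e"
 shows "fps_nth (\<rho> J w) j = 0"
proof -
 have "coeff (coeff c 0) j = 0" using c(1) j unfolding tdeg_def by force
 then have "coeff (coeff c e) 0 * fps_nth (\<rho> J w) j = 0" using arg_cong[OF \<rho>_coeff[OF c(1,2) J], of "%f. fps_nth f j"] by simp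
 moreover have "coeff (coeff c e) 0 ~= 0"
 proof
  assume z: "coeff (coeff c e) 0 = 0"
  have "coeff (coeff c e) i = 0" for i using z c(1) unfolding tdeg_def by (cases i) force+
  then have "coeff c e = 0" by (simp add: poly_eq_iff)
  then show False using c(2,3) by auto
 qed
 ultimately show ?thesis by simp
qed

text \<open>\<open>I\<close> consists of the branches on which one factor vanishes. Counting roots,
  each factor has exactly as many branches as its degree, so its constant term is
  \<open>\<rho>\<close> up to a scalar and has degree at most that number.\<close>

lemma section_subset:
 assumes "~ section_irr w"
 shows "\<exists>I\<subseteq>Rt. I ~= {} & I ~= Rt & (\<forall>j>card I. fps_nth (\<rho> I w) j = 0) & (\<forall>j>card (Rt - I). fps_nth (\<rho> (Rt - I) w) j = 0)"
proof -
 from split_section[OF assms] obtain a b e1 e2 where ab: "e1 \<ge> 1" "e2 \<ge> 1" "e1 + e2 = \<delta>" "hw w = a * b" "tdeg e1 a" "tdeg e2 b" "degree a = e1" "degree b = e2" by blast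
 have nz: "a ~= 0" "b ~= 0" using ab(4) lead_hw[of w] \<gamma> by auto
 define I where "I = {r\<in>Rt. poly (fp a) (S r w) = 0}"
 have I: "I \<subseteq> Rt" by (auto simp: I_def)
 have bR: "poly (fp b) (S r w) = 0" if "r \<in> Rt - I" for r
 proof -
  have "poly (fp a) (S r w) * poly (fp b) (S r w) = 0" using S(3)[of r w] that unfolding ab(4) fp_mult by simp
  then show ?thesis using that by (auto simp: I_def)
 qed
 have le: "card J \<le> degree c" if c: "c ~= 0" and J: "J \<subseteq> Rt" "!!r. r \<in> J ==> poly (fp c) (S r w) = 0" for J c
 proof -
  have fz: "fp c ~= 0"
  proof
   assume "fp c = 0"
   then have "coeff (fp c) (degree c) = 0" by simp
   then show False using c unfolding coeff_fp by simp
  qed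
  have "card J = card ((%r. S r w) ` J)" by (rule card_image[symmetric, OF inj_S[OF J(1)]])
  also have "\<dots> \<le> card {x. poly (fp c) x = 0}" by (rule card_mono[OF poly_roots_finite[OF fz]]) (use J(2) in auto)
  also have "\<dots> \<le> degree c" using card_poly_roots_bound[OF fz] by (simp add: degree_fp)
  finally show ?thesis .
 qed
 have "card I \<le> e1" using le[OF nz(1) I] ab(7) by (simp add: I_def)
 moreover have "card (Rt - I) \<le> e2" using le[OF nz(2), of "Rt - I"] bR ab(8) by auto
 moreover have "card I + card (Rt - I) = \<delta>" using card_Rt finite_Rt I by (metis card_Diff_subset card_mono finite_subset le_add_diff_inverse)
 ultimately have cI: "card I = e1" "card (Rt - I) = e2" using ab(3) by linarith+
 have "fps_nth (\<rho> I w) j = 0" if "j > e1" for j by (rule \<rho>_vanish[OF ab(5,7) nz(1) I cI(1) _ that]) (simp add: I_def)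
 moreover have "fps_nth (\<rho> (Rt - I) w) j = 0" if "j > e2" for j by (rule \<rho>_vanish[OF ab(6,8) nz(2) _ cI(2) bR that]) auto
 moreover have "I ~= {}" "I ~= Rt" using cI ab(1,2) by auto
 ultimately show ?thesis using I cI by (intro exI[of _ I]) simp
qed

lemma polyfun_common_nonzero:
 assumes "finite A" "!!I. I \<in> A ==> polyfun crd (\<phi> I) & (EX w. \<phi> I w ~= (0::'k))"
 shows "EX w. \<forall>I\<in>A. \<phi> I w ~= 0"
 using assms
proof (induction A rule: finite_induct)
 case (insert a A)
 then obtain w1 where w1: "\<forall>I\<in>A. \<phi> I w1 ~= 0" by auto
 from insert obtain w2 where w2: "\<phi> a w2 ~= 0" by blast
 have "polyfun crd (%w. \<Prod>I\<in>A. \<phi> I w)" using insert by (intro polyfun_prod) auto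
 moreover have "(\<Prod>I\<in>A. \<phi> I w1) ~= 0" using w1 insert(1) by simp
 ultimately obtain y where "\<phi> a y ~= 0" "(\<Prod>I\<in>A. \<phi> I y) ~= 0" using polyfun_domain[of "\<phi> a" "%w. \<Prod>I\<in>A. \<phi> I w" w2 w1] insert w2 by auto
 then show ?case using insert(1) by (intro exI[of _ y]) auto
qed auto

text \<open>If every section split, then, as there are finitely many sets of branches and products
  of nonzero polynomials are nonzero, a single set would work for all \<open>w\<close>. The series
  \<open>\<rho>\<close> of this set and of its complement would terminate for all \<open>w\<close>;
  at t = 1 they give polynomials in \<open>w\<close> whose product is g (p + w) up to \<gamma>,
  against \<open>no_factor\<close>.\<close>

lemma ex_section_irr: "EX w. section_irr w"
proof (rule ccontr)
 assume n: "~ ?thesis"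
 define \<I> where "\<I> = {I. I \<subseteq> Rt & I ~= {} & I ~= Rt}"
 have fin: "finite \<I>" by (rule finite_subset[of _ "Pow Rt"]) (auto simp: \<I>_def finite_Rt)
 have "\<exists>I\<in>\<I>. ALL w. (\<forall>j>card I. fps_nth (\<rho> I w) j = 0) & (\<forall>j>card (Rt - I). fps_nth (\<rho> (Rt - I) w) j = 0)"
 proof (rule ccontr)
  assume c: "~ ?thesis"
  have "\<forall>I\<in>\<I>. \<exists>\<phi>. (polyfun crd \<phi> & (EX w. \<phi> w ~= (0::'k))) & (ALL w. (\<forall>j>card I. fps_nth (\<rho> I w) j = 0) & (\<forall>j>card (Rt - I). fps_nth (\<rho> (Rt - I) w) j = 0) --> \<phi> w = 0)"
  proof
   fix I assume I: "I \<in> \<I>"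
   then have sub: "I \<subseteq> Rt" "Rt - I \<subseteq> Rt" by (auto simp: \<I>_def)
   from c I obtain w j where "(j > card I & fps_nth (\<rho> I w) j ~= 0) | (j > card (Rt - I) & fps_nth (\<rho> (Rt - I) w) j ~= 0)" by blast
   then show "\<exists>\<phi>. (polyfun crd \<phi> & (EX w. \<phi> w ~= (0::'k))) & (ALL w. (\<forall>j>card I. fps_nth (\<rho> I w) j = 0) & (\<forall>j>card (Rt - I). fps_nth (\<rho> (Rt - I) w) j = 0) --> \<phi> w = 0)"
   proof
    assume "j > card I & fps_nth (\<rho> I w) j ~= 0"
    then show ?thesis using Gr_\<rho>[OF sub(1)] by (intro exI[of _ "%w. fps_nth (\<rho> I w) j"]) (auto simp: Gr_def polyfun_def)
   next
    assume "j > card (Rt - I) & fps_nth (\<rho> (Rt - I) w) j ~= 0"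
    then show ?thesis using Gr_\<rho>[OF sub(2)] by (intro exI[of _ "%w. fps_nth (\<rho> (Rt - I) w) j"]) (auto simp: Gr_def polyfun_def)
   qed
  qed
  from bchoice[OF this] obtain \<phi> where \<phi>: "!!I. I \<in> \<I> ==> polyfun crd (\<phi> I) & (EX w. \<phi> I w ~= (0::'k))"
   "!!I w. I \<in> \<I> ==> (\<forall>j>card I. fps_nth (\<rho> I w) j = 0) ==> (\<forall>j>card (Rt - I). fps_nth (\<rho> (Rt - I) w) j = 0) ==> \<phi> I w = 0" by blast
  from polyfun_common_nonzero[OF fin, of \<phi>] \<phi>(1) obtain w where w: "\<forall>I\<in>\<I>. \<phi> I w ~= 0" by blast
  from n have "~ section_irr w" by blast
  from section_subset[OF this] obtain I where "I \<in> \<I>" "\<forall>j>card I. fps_nth (\<rho> I w) j = 0" "\<forall>j>card (Rt - I). fps_nth (\<rho> (Rt - I) w) j = 0"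
   by (auto simp: \<I>_def)
  then show False using \<phi>(2)[of I w] w by blast
 qed
 then obtain I where I: "I \<in> \<I>" and van: "!!w j. j > card I ==> fps_nth (\<rho> I w) j = 0" "!!w j. j > card (Rt - I) ==> fps_nth (\<rho> (Rt - I) w) j = 0" by blast
 have sub: "I \<subseteq> Rt" "Rt - I \<subseteq> Rt" using I by (auto simp: \<I>_def)
 have cards: "card I < \<delta>" "card (Rt - I) < \<delta>"
  using psubset_card_mono[OF finite_Rt, of I] psubset_card_mono[OF finite_Rt, of "Rt - I"] I card_Rt by (auto simp: \<I>_def)
 define al where "al J w = (\<Sum>j<Suc (card J). monom (fps_nth (\<rho> J w) j) j)" for J w
 have fal: "fps_of_poly (al J w) = \<rho> J w" if "!!j. j > card J ==> fps_nth (\<rho> J w) j = 0" for J w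
  by (rule fps_ext) (use that in \<open>simp add: al_def coeff_sum_monom_less del: sum.lessThan_Suc\<close>)
 have PFal: "PF crd (card J) (%z. poly (al J (z - p)) 1)" if "J \<subseteq> Rt" for J
 proof -
  have "PF crd (card J) (%w. \<Sum>j<Suc (card J). fps_nth (\<rho> J w) j)"
   by (intro PF_sum PF_mono[of crd _ _ "card J"]) (use Gr_\<rho>[OF that] in \<open>auto simp: Gr_def\<close>)
  then have "PF crd (card J) (%w. poly (al J w) 1)" by (simp add: al_def poly_sum poly_monom del: sum.lessThan_Suc)
  then show ?thesis
  proof (rule PF_comp_crd)
   fix i show "PF crd 1 (%z. (z - p) $ i)" using PF_diff[OF PF_crd PF_const[of _ _ "p $ i"]] by simp
  qed
 qed
 have gz: "g z = (\<gamma> * poly (al I (z - p)) 1) * poly (al (Rt - I) (z - p)) 1" for z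
 proof -
  let ?w = "z - p"
  have "fps_of_poly (coeff (hw ?w) 0) = fps_const (coeff (coeff (hw ?w) \<delta>) 0) * \<rho> Rt ?w"
   by (rule \<rho>_coeff[OF tdeg_hw degree_hw order_refl card_Rt]) (rule S(3))
  also have "\<rho> Rt ?w = \<rho> I ?w * \<rho> (Rt - I) ?w"
   unfolding \<rho>_def using prod.subset_diff[OF sub(1) finite_Rt] by (simp only: mult.commute)
  also have "\<dots> = fps_of_poly (al I ?w) * fps_of_poly (al (Rt - I) ?w)" using fal[of I ?w] fal[of "Rt - I" ?w] van by simp
  finally have "fps_of_poly (coeff (hw ?w) 0) = fps_of_poly ([:\<gamma>:] * al I ?w * al (Rt - I) ?w)"
   by (simp only: lead_hw fps_of_poly_mult fps_of_poly_const coeff_pCons_0 mult.assoc)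
  then have e: "coeff (hw ?w) 0 = [:\<gamma>:] * al I ?w * al (Rt - I) ?w" by (simp only: fps_of_poly_eq_iff)
  have "g z = ev (hw ?w) (1, 0)" by (simp add: ev_hw)
  also have "\<dots> = poly (coeff (hw ?w) 0) 1" by (simp add: ev_def poly_0_coeff_0)
  finally show ?thesis unfolding e by simp
 qed
 show False by (rule no_factor[OF PF_scale[OF PFal[OF sub(1)]] PFal[OF sub(2)] gz cards])
qed

text \<open>The minor has at most \<delta>^2 columns and entries of degree at most \<delta>
  (\<delta> - 1) in \<open>w\<close>.\<close>

lemma section_certificate:
 "\<exists>\<Delta>. PF crd (\<delta> ^ 4) \<Delta> & (EX w. \<Delta> w ~= 0) & (ALL w. \<Delta> w ~= 0 --> section_irr w)"
proof -
 obtain r where r: "r \<in> Rt" using card_Rt d1 by (metis card.empty ex_in_conv not_one_le_zero)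
 from ex_section_irr obtain w0 where w0: "section_irr w0" by blast
 have "\<exists>\<Delta>. PF crd (card KI * (\<delta> * (\<delta> - 1))) \<Delta> & \<Delta> w0 ~= 0 &
  (ALL z. \<Delta> z ~= 0 --> (ALL x. (\<forall>J\<in>{..\<delta>*(\<delta>-1)}. (\<Sum>i\<in>KI. x i * Mk r J i z) = 0) --> (\<forall>i\<in>KI. x i = 0)))"
 proof (rule PF_minor[OF finite_KI])
  show "finite {..\<delta>*(\<delta>-1)}" by simp
  fix i J assume J: "J \<in> {..\<delta>*(\<delta>-1)}"
  have "Gr crd (%w. fps_X ^ snd i * S r w ^ fst i)" by (intro Gr_mult Gr_const Gr_power S(1)[OF r])
  then have "PF crd J (Mk r J i)" unfolding Mk_def Gr_def by blast
  then show "PF crd (\<delta> * (\<delta> - 1)) (Mk r J i)" by (rule PF_mono) (use J in simp)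
 qed (rule irr_imp_triv[OF w0 r])
 then obtain \<Delta> where D: "PF crd (card KI * (\<delta> * (\<delta> - 1))) \<Delta>" "\<Delta> w0 ~= 0"
  "!!z x. \<Delta> z ~= 0 ==> (\<forall>J\<in>{..\<delta>*(\<delta>-1)}. (\<Sum>i\<in>KI. x i * Mk r J i z) = 0) ==> (\<forall>i\<in>KI. x i = 0)" by blast
 have "card KI * (\<delta> * (\<delta> - 1)) \<le> \<delta> * \<delta> * (\<delta> * \<delta>)" using card_KI by (intro mult_le_mono) auto
 then have "card KI * (\<delta> * (\<delta> - 1)) \<le> \<delta> ^ 4" by (simp add: eval_nat_numeral mult_ac)
 then have "PF crd (\<delta> ^ 4) \<Delta>" by (rule PF_mono[OF D(1)])
 moreover have "section_irr w" if "\<Delta> w ~= 0" for w by (rule triv_imp_irr[OF r D(3)[OF that]])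
 ultimately show ?thesis using D(2) by blast
qed

end

section \<open>Averaging over planes\<close>

locale fq_hyper = fqa q ty + hyper g \<delta>
 for q and ty :: "'k::{alg_closed_field,field_gcd} itself" and g :: "'k ^ 'n::finite => 'k" and \<delta> +
 assumes stable: "!!z. g z = 0 ==> g (\<chi> i. (z $ i) ^ q) = 0" and q_large: "q > 15 * \<delta> ^ 4"
begin

abbreviation V :: "('k ^ 'n) set" where "V \<equiv> Vq"
definition Q :: real where "Q = real (card V)"
definition N :: real where "N = real (card {z\<in>V. g z = 0})"
definition ind :: "'k ^ 'n => real" where "ind z = (if g z = 0 then 1 else 0)"
text \<open>Degenerate planes are included; this makes the points of a random plane exactly uniform
  and pairwise independent.\<close>

definition T :: "(('k ^ 'n) \<times> ('k ^ 'n) \<times> ('k ^ 'n)) set" where "T = V \<times> V \<times> V"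
definition pt :: "('k ^ 'n) \<times> ('k ^ 'n) \<times> ('k ^ 'n) => 'k \<times> 'k => 'k ^ 'n" where
 "pt L P = snd (snd L) + fst P *s fst (snd L) + snd P *s fst L"
definition cnt :: "('k ^ 'n) \<times> ('k ^ 'n) \<times> ('k ^ 'n) => real" where "cnt L = real (NP (%P. g (pt L P)))"

lemma finite_V: "finite V" by (rule finite_Vq)

lemma q_pos: "real q > 0" using q2 by simp
lemma Q_pos: "Q > 0" using q2 by (simp add: Q_def card_Vq)
lemma N_nonneg: "N \<ge> 0" by (simp add: N_def)
lemma card_T: "real (card T) = Q ^ 3" by (simp add: T_def Q_def card_cartesian_product power3_eq_cube)
lemma finite_T: "finite T" using finite_V by (simp add: T_def)
lemma card_Rq: "real (card Rq) = (real q)\<^sup>2" by (simp add: Rq_def card_cartesian_product card_Fq power2_eq_square)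

lemma sum_ind: "(\<Sum>z\<in>V. ind z) = N"
 unfolding ind_def N_def using finite_V by (simp add: sum.If_cases Int_def)

lemma cnt_eq: "cnt L = (\<Sum>P\<in>Rq. ind (pt L P))"
 unfolding cnt_def NP_def ind_def using finite_Rq by (simp add: sum.If_cases Int_def)

lemma sum_shift: "c \<in> V ==> (\<Sum>p\<in>V. f (p + c)) = (\<Sum>p\<in>V. (f p :: real))"
 by (rule sum.reindex_bij_witness[of _ "%p. p - c" "%p. p + c"]) (auto intro: Vq_add Vq_diff)

text \<open>For t \<noteq> t' the map from (p, w) to the two points on the line is a bijection of V
  \<times> V.\<close>

lemma sum_pair:
 assumes t: "t \<in> Fq" "t' \<in> Fq" "t ~= t'" and ab: "a \<in> V" "b \<in> V"
 shows "(\<Sum>p\<in>V. \<Sum>w\<in>V. f (p + t *s w + a) * h (p + t' *s w + b)) = (\<Sum>x\<in>V. f x) * (\<Sum>y\<in>V. (h y :: real))"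
proof -
 define c where "c = inverse (t - t')"
 have c: "c \<in> Fq" "c * (t - t') = 1" using t by (auto simp: c_def intro!: Fq_inverse Fq_diff)
 define W where "W x y = c *s ((x - a) - (y - b))" for x y
 have tW: "(t - t') *s W x y = (x - a) - (y - b)" for x y using c(2) by (simp add: W_def vector_smult_assoc mult.commute)
 have WV: "W x y \<in> V" if "x \<in> V" "y \<in> V" for x y unfolding W_def using that ab c by (intro Vq_scale Vq_diff) auto
 have "(\<Sum>p\<in>V. \<Sum>w\<in>V. f (p + t *s w + a) * h (p + t' *s w + b)) = (\<Sum>u\<in>V \<times> V. f (fst u + t *s snd u + a) * h (fst u + t' *s snd u + b))"
  by (simp add: sum.cartesian_product case_prod_beta)
 also have "\<dots> = (\<Sum>u\<in>V \<times> V. f (fst u) * h (snd u))"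
 proof (rule sum.reindex_bij_witness[of _ "%u. (fst u - a - t *s W (fst u) (snd u), W (fst u) (snd u))" "%u. (fst u + t *s snd u + a, fst u + t' *s snd u + b)"])
  fix u assume u: "u \<in> V \<times> V"
  obtain p w where pw: "u = (p, w)" by (cases u)
  have "W (p + t *s w + a) (p + t' *s w + b) = c *s ((t - t') *s w)" unfolding W_def by (simp add: vector_sub_rdistrib algebra_simps)
  then have Ww: "W (p + t *s w + a) (p + t' *s w + b) = w" by (simp only: vector_smult_assoc c(2) vector_smult_lid)
  show "(fst (fst u + t *s snd u + a, fst u + t' *s snd u + b) - a - t *s W (fst (fst u + t *s snd u + a, fst u + t' *s snd u + b)) (snd (fst u + t *s snd u + a, fst u + t' *s snd u + b)),
    W (fst (fst u + t *s snd u + a, fst u + t' *s snd u + b)) (snd (fst u + t *s snd u + a, fst u + t' *s snd u + b))) = u"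
   using Ww by (simp add: pw)
  show "(fst u + t *s snd u + a, fst u + t' *s snd u + b) \<in> V \<times> V" using u t ab by (auto intro!: Vq_add Vq_scale)
 next
  fix u assume u: "u \<in> V \<times> V"
  obtain x y where xy: "u = (x, y)" by (cases u)
  have "x - a - t *s W x y + t' *s W x y + b = (x - a) - (t - t') *s W x y + b" by (simp add: vector_sub_rdistrib)
  then have e: "x - a - t *s W x y + t' *s W x y + b = y" unfolding tW by simp
  show "(fst (fst u - a - t *s W (fst u) (snd u), W (fst u) (snd u)) + t *s snd (fst u - a - t *s W (fst u) (snd u), W (fst u) (snd u)) + a,
   fst (fst u - a - t *s W (fst u) (snd u), W (fst u) (snd u)) + t' *s snd (fst u - a - t *s W (fst u) (snd u), W (fst u) (snd u)) + b) = u"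
   using e by (simp add: xy)
  show "(fst u - a - t *s W (fst u) (snd u), W (fst u) (snd u)) \<in> V \<times> V"
  proof -
   have "fst u \<in> V" "snd u \<in> V" using u by auto
   then have "fst u - a - t *s W (fst u) (snd u) \<in> V" "W (fst u) (snd u) \<in> V"
    using Vq_diff[OF Vq_diff[OF _ ab(1)] Vq_scale[OF t(1) WV]] WV by blast+
   then show ?thesis by simp
  qed
 qed simp
 also have "\<dots> = (\<Sum>x\<in>V. f x) * (\<Sum>y\<in>V. h y)" unfolding sum_product by (simp only: sum.cartesian_product case_prod_unfold)
 finally show ?thesis .
qed

lemma sum_T: "(\<Sum>L\<in>T. F (fst L) (fst (snd L)) (snd (snd L))) = (\<Sum>v\<in>V. \<Sum>w\<in>V. \<Sum>p\<in>V. (F v w p :: real))"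
 unfolding T_def by (simp add: sum.cartesian_product case_prod_beta)

lemma sum_T_pt: assumes P: "P \<in> Rq" shows "(\<Sum>L\<in>T. ind (pt L P)) = Q\<^sup>2 * N"
proof -
 have F: "fst P \<in> Fq" "snd P \<in> Fq" using P by (auto simp: Rq_def)
 have "(\<Sum>L\<in>T. ind (pt L P)) = (\<Sum>v\<in>V. \<Sum>w\<in>V. \<Sum>p\<in>V. ind (p + (fst P *s w + snd P *s v)))"
  unfolding pt_def using sum_T[of "%v w p. ind (p + fst P *s w + snd P *s v)"] by (simp add: add.assoc)
 also have "\<dots> = (\<Sum>v\<in>V. \<Sum>w\<in>V. N)"
  by (intro sum.cong refl) (subst sum_shift, auto simp: sum_ind intro!: Vq_add Vq_scale F)
 finally show ?thesis by (simp add: Q_def power2_eq_square)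
qed

lemma sum_T_pair: assumes P: "P \<in> Rq" "P' \<in> Rq" "P ~= P'" shows "(\<Sum>L\<in>T. ind (pt L P) * ind (pt L P')) = Q * N\<^sup>2"
proof -
 have F: "fst P \<in> Fq" "snd P \<in> Fq" "fst P' \<in> Fq" "snd P' \<in> Fq" using P by (auto simp: Rq_def)
 have e: "(\<Sum>L\<in>T. ind (pt L P) * ind (pt L P')) = (\<Sum>v\<in>V. \<Sum>w\<in>V. \<Sum>p\<in>V. ind (p + fst P *s w + snd P *s v) * ind (p + fst P' *s w + snd P' *s v))"
  unfolding pt_def by (rule sum_T)
 show ?thesis
 proof (cases "fst P = fst P'")
  case False
  have "(\<Sum>w\<in>V. \<Sum>p\<in>V. ind (p + fst P *s w + snd P *s v) * ind (p + fst P' *s w + snd P' *s v)) = N * N" if "v \<in> V" for v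
   by (subst sum.swap, subst sum_pair) (use that F False in \<open>auto simp: sum_ind intro!: Vq_scale\<close>)
  then show ?thesis unfolding e by (simp add: Q_def power2_eq_square)
 next
  case True
  then have s: "snd P ~= snd P'" using P(3) by (auto simp: prod_eq_iff)
  have "(\<Sum>v\<in>V. \<Sum>p\<in>V. ind (p + fst P *s w + snd P *s v) * ind (p + fst P' *s w + snd P' *s v)) = N * N" if "w \<in> V" for w
  proof -
   have "(\<Sum>v\<in>V. \<Sum>p\<in>V. ind (p + fst P *s w + snd P *s v) * ind (p + fst P' *s w + snd P' *s v)) =
    (\<Sum>p\<in>V. \<Sum>v\<in>V. ind (p + snd P *s v + fst P *s w) * ind (p + snd P' *s v + fst P' *s w))"
    by (subst sum.swap) (simp only: add.assoc add.commute[of "fst _ *s w"])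
   also have "\<dots> = N * N" by (subst sum_pair) (use that F s in \<open>auto simp: sum_ind intro!: Vq_scale\<close>)
   finally show ?thesis .
  qed
  then have "(\<Sum>w\<in>V. \<Sum>v\<in>V. \<Sum>p\<in>V. ind (p + fst P *s w + snd P *s v) * ind (p + fst P' *s w + snd P' *s v)) = Q * N\<^sup>2"
   by (simp add: Q_def power2_eq_square)
  then show ?thesis unfolding e by (subst sum.swap)
 qed
qed

definition \<mu> :: real where "\<mu> = N * (real q)\<^sup>2 / Q"

lemma \<mu>_nonneg: "\<mu> \<ge> 0" using N_nonneg Q_pos by (simp add: \<mu>_def)

lemma sum_cnt: "(\<Sum>L\<in>T. cnt L) = Q ^ 3 * \<mu>"
proof -
 have "(\<Sum>L\<in>T. cnt L) = (\<Sum>P\<in>Rq. \<Sum>L\<in>T. ind (pt L P))" unfolding cnt_eq by (rule sum.swap)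
 also have "\<dots> = (real q)\<^sup>2 * (Q\<^sup>2 * N)" using sum_T_pt card_Rq by simp
 finally show ?thesis using Q_pos by (simp add: \<mu>_def power3_eq_cube power2_eq_square)
qed

lemma variance: "(\<Sum>L\<in>T. (cnt L - \<mu>)\<^sup>2) \<le> Q ^ 3 * \<mu>"
proof -
 have "(\<Sum>L\<in>T. (cnt L)\<^sup>2) = (\<Sum>L\<in>T. \<Sum>P\<in>Rq. \<Sum>P'\<in>Rq. ind (pt L P) * ind (pt L P'))"
  unfolding cnt_eq power2_eq_square sum_product ..
 also have "\<dots> = (\<Sum>P\<in>Rq. \<Sum>L\<in>T. \<Sum>P'\<in>Rq. ind (pt L P) * ind (pt L P'))" by (rule sum.swap)
 also have "\<dots> = (\<Sum>P\<in>Rq. \<Sum>P'\<in>Rq. \<Sum>L\<in>T. ind (pt L P) * ind (pt L P'))" by (intro sum.cong refl) (rule sum.swap)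
 also have "\<dots> \<le> (\<Sum>P\<in>Rq. \<Sum>P'\<in>Rq. (if P' = P then Q\<^sup>2 * N else 0) + Q * N\<^sup>2)"
 proof (intro sum_mono)
  fix P P' assume P: "P \<in> Rq" "P' \<in> Rq"
  have QN: "Q * N\<^sup>2 \<ge> 0" using Q_pos by simp
  have ii: "ind z * ind z = ind z" for z by (simp add: ind_def)
  show "(\<Sum>L\<in>T. ind (pt L P) * ind (pt L P')) \<le> (if P' = P then Q\<^sup>2 * N else 0) + Q * N\<^sup>2"
  proof (cases "P' = P")
   case True
   then show ?thesis using sum_T_pt[OF P(1)] QN by (simp add: ii)
  next
   case False
   then show ?thesis using sum_T_pair[OF P] by auto
  qed
 qed
 also have "\<dots> = (real q)\<^sup>2 * (Q\<^sup>2 * N) + (real q)\<^sup>2 * ((real q)\<^sup>2 * (Q * N\<^sup>2))"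
  using finite_Rq card_Rq by (simp add: sum.distrib algebra_simps power2_eq_square power4_eq_xxxx)
 finally have 2: "(\<Sum>L\<in>T. (cnt L)\<^sup>2) \<le> (real q)\<^sup>2 * (Q\<^sup>2 * N) + (real q)\<^sup>2 * ((real q)\<^sup>2 * (Q * N\<^sup>2))" .
 have "(\<Sum>L\<in>T. (cnt L - \<mu>)\<^sup>2) = (\<Sum>L\<in>T. (cnt L)\<^sup>2) - 2 * \<mu> * (\<Sum>L\<in>T. cnt L) + real (card T) * \<mu>\<^sup>2"
  by (simp add: power2_diff sum.distrib sum_subtractf sum_distrib_left algebra_simps)
 also have "\<dots> = (\<Sum>L\<in>T. (cnt L)\<^sup>2) - Q ^ 3 * \<mu>\<^sup>2" unfolding sum_cnt card_T by (simp add: power2_eq_square algebra_simps)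
 also have "Q ^ 3 * \<mu>\<^sup>2 = (real q)\<^sup>2 * ((real q)\<^sup>2 * (Q * N\<^sup>2))"
  using Q_pos by (simp add: \<mu>_def power3_eq_cube power2_eq_square)
 also have "(\<Sum>L\<in>T. (cnt L)\<^sup>2) - \<dots> \<le> (real q)\<^sup>2 * (Q\<^sup>2 * N)" using 2 by linarith
 also have "\<dots> = Q ^ 3 * \<mu>" using Q_pos by (simp add: \<mu>_def power3_eq_cube power2_eq_square)
 finally show ?thesis .
qed

text \<open>The last inequality is where the factor 15 is used: the three certificates have total
  degree at most 5\<delta>^4.\<close>

lemma degrees: "\<delta> + 1 < q" "2 * \<delta> * \<delta> < q" "\<delta> ^ 4 < q" "3 * ((\<delta> + 1) + 2 * \<delta> * \<delta> + \<delta> ^ 4) \<le> q - 1"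
proof -
 have a: "\<delta> \<le> \<delta> ^ 4" "\<delta> * \<delta> \<le> \<delta> ^ 4" "1 \<le> \<delta> ^ 4"
  using power_increasing[of 1 4 \<delta>] power_increasing[of 2 4 \<delta>] d1 by (simp_all add: power2_eq_square)
 have b: "2 * \<delta> * \<delta> = 2 * (\<delta> * \<delta>)" by simp
 show "\<delta> + 1 < q" "2 * \<delta> * \<delta> < q" "\<delta> ^ 4 < q" "3 * ((\<delta> + 1) + 2 * \<delta> * \<delta> + \<delta> ^ 4) \<le> q - 1"
  unfolding b using a q_large by auto
qed

lemma zeros_real:
 assumes "PF crd s (f :: 'k ^ 'n => 'k)" "f w ~= 0" "s < q"
 shows "real (card {z\<in>V. f z = 0}) \<le> real s / (real q - 1) * Q"
proof -
 have "real (card {z\<in>V. f z = 0} * (q - 1)) \<le> real (s * q ^ CARD('n))" using schwartz_zippel[OF assms] by (simp only: of_nat_le_iff)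
 then have "real (card {z\<in>V. f z = 0}) * (real q - 1) \<le> real s * Q" using q2 by (simp add: Q_def card_Vq of_nat_diff)
 then show ?thesis using q2 by (simp add: field_simps)
qed

definition irrL :: "('k ^ 'n) \<times> ('k ^ 'n) \<times> ('k ^ 'n) => bool" where "irrL L \<longleftrightarrow> irr \<delta> (%P. g (pt L P))"

text \<open>A union bound: \<open>v\<close> has to avoid the zeros of \<Theta>, \<open>p\<close>
  those of the certificate for simple roots, and \<open>w\<close> those of the section certificate.
  Each fails with probability at most the degree divided by q - 1.\<close>

lemma irr_planes: "real (card {L\<in>T. irrL L}) \<ge> 2 / 3 * Q ^ 3"
proof -
 define bad where "bad v w p = (if irrL (v, w, p) then 0 else 1 :: real)" for v w p
 have bad01: "0 \<le> bad v w p" "bad v w p \<le> 1" for v w p by (auto simp: bad_def)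
 define d where "d s = real s / (real q - 1)" for s
 have d0: "d s \<ge> 0" for s using q2 by (simp add: d_def)
 have Q0: "Q \<ge> 0" using Q_pos by simp
 from ex_direction[OF g exact d1 char_pos not_power] obtain \<Theta> TT where \<Theta>: "PF crd (\<delta> + 1) \<Theta>" "EX v. \<Theta> v ~= 0"
  "!!v. \<Theta> v ~= 0 ==> TT v ~= 0 & (EX z P. (ALL t. g (z + t *s v) = poly P t) & pderiv P ~= 0)"
  "!!z v. EX P. (ALL t. g (z + t *s v) = poly P t) & degree P \<le> \<delta> & coeff P \<delta> = TT v" by blast
 have sumle: "(\<Sum>x\<in>V. f x) \<le> real (card {x\<in>V. h x = 0}) * A + Q * B"
  if f: "!!x. x \<in> V ==> f x \<le> A" "!!x. x \<in> V ==> h x ~= 0 ==> f x \<le> B" and AB: "A \<ge> 0" "B \<ge> 0" for f A B and h :: "'k ^ 'n => 'k"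
 proof -
  have "(\<Sum>x\<in>V. f x) \<le> (\<Sum>x\<in>V. (if h x = 0 then A else 0) + B)"
  proof (rule sum_mono)
   fix x assume x: "x \<in> V"
   show "f x \<le> (if h x = 0 then A else 0) + B" using f(1)[OF x] f(2)[OF x] AB by (cases "h x = 0") auto
  qed
  also have "\<dots> = real (card {x\<in>V. h x = 0}) * A + Q * B" using finite_V by (simp add: sum.distrib sum.If_cases Int_def Q_def)
  finally show ?thesis .
 qed
 have w_sum: "(\<Sum>w\<in>V. bad v w p) \<le> d (\<delta> ^ 4) * Q" if dir: "hyper_dir g \<delta> v \<gamma>" and sp: "hyper_dir.simple g v p" for v \<gamma> p
 proof -
  interpret hyper_pt g \<delta> v \<gamma> p by (rule hyper_pt.intro[OF dir hyper_pt_axioms.intro[OF sp]])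
  from section_certificate obtain \<Delta> w0 where D: "PF crd (\<delta> ^ 4) \<Delta>" "\<Delta> w0 ~= 0" "!!w. \<Delta> w ~= 0 ==> section_irr w" by blast
  have "(\<Sum>w\<in>V. bad v w p) \<le> real (card {w\<in>V. \<Delta> w = 0}) * 1 + Q * 0"
  proof (rule sumle)
   fix w assume "\<Delta> w ~= 0"
   then show "bad v w p \<le> 0" using D(3) by (simp add: bad_def irrL_def pt_def)
  qed (simp_all add: bad01)
  also have "\<dots> \<le> d (\<delta> ^ 4) * Q" using zeros_real[OF D(1,2) degrees(3)] by (simp add: d_def)
  finally show ?thesis .
 qed
 have p_sum: "(\<Sum>p\<in>V. \<Sum>w\<in>V. bad v w p) \<le> (d (2 * \<delta> * \<delta>) + d (\<delta> ^ 4)) * Q\<^sup>2" if v: "\<Theta> v ~= 0" for v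
 proof -
  have dir: "hyper_dir g \<delta> v (TT v)" using \<Theta>(3)[OF v] \<Theta>(4) by unfold_locales blast+
  interpret hyper_dir g \<delta> v "TT v" by (rule dir)
  from simple_certificate obtain \<Delta> z0 where D: "PF crd (2 * \<delta> * \<delta>) \<Delta>" "\<Delta> z0 ~= 0" "!!z. \<Delta> z ~= 0 ==> simple z" by blast
  have "(\<Sum>p\<in>V. \<Sum>w\<in>V. bad v w p) \<le> real (card {p\<in>V. \<Delta> p = 0}) * Q + Q * (d (\<delta> ^ 4) * Q)"
  proof (rule sumle)
   show "(\<Sum>w\<in>V. bad v w p) \<le> Q" for p using sum_bounded_above[of V "%w. bad v w p" 1] bad01 by (simp add: Q_def)
   show "(\<Sum>w\<in>V. bad v w p) \<le> d (\<delta> ^ 4) * Q" if "\<Delta> p ~= 0" for p by (rule w_sum[OF dir D(3)[OF that]])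
  qed (use Q0 d0 in auto)
  also have "real (card {p\<in>V. \<Delta> p = 0}) * Q \<le> d (2 * \<delta> * \<delta>) * Q * Q"
   using zeros_real[OF D(1,2) degrees(2)] Q0 by (intro mult_right_mono) (simp_all add: d_def)
  finally show ?thesis by (simp add: power2_eq_square algebra_simps)
 qed
 have "(\<Sum>v\<in>V. \<Sum>p\<in>V. \<Sum>w\<in>V. bad v w p) \<le> real (card {v\<in>V. \<Theta> v = 0}) * Q\<^sup>2 + Q * ((d (2 * \<delta> * \<delta>) + d (\<delta> ^ 4)) * Q\<^sup>2)"
 proof (rule sumle)
  have "(\<Sum>w\<in>V. bad v w p) \<le> Q" for v p using sum_bounded_above[of V "%w. bad v w p" 1] bad01 by (simp add: Q_def)
  then show "(\<Sum>p\<in>V. \<Sum>w\<in>V. bad v w p) \<le> Q\<^sup>2" for v using sum_bounded_above[of V "%p. \<Sum>w\<in>V. bad v w p" Q] by (simp add: Q_def power2_eq_square)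
 qed (use p_sum d0 in auto)
 also have "real (card {v\<in>V. \<Theta> v = 0}) * Q\<^sup>2 \<le> d (\<delta> + 1) * Q * Q\<^sup>2"
 proof -
  obtain v0 where "\<Theta> v0 ~= 0" using \<Theta>(2) by blast
  then show ?thesis using zeros_real[OF \<Theta>(1) _ degrees(1)] by (intro mult_right_mono) (simp_all add: d_def)
 qed
 finally have "(\<Sum>v\<in>V. \<Sum>p\<in>V. \<Sum>w\<in>V. bad v w p) \<le> (d (\<delta> + 1) + d (2 * \<delta> * \<delta>) + d (\<delta> ^ 4)) * Q ^ 3"
  by (simp add: power2_eq_square power3_eq_cube algebra_simps)
 also have "d (\<delta> + 1) + d (2 * \<delta> * \<delta>) + d (\<delta> ^ 4) \<le> 1 / 3"
 proof -
  have "real (3 * ((\<delta> + 1) + 2 * \<delta> * \<delta> + \<delta> ^ 4)) \<le> real (q - 1)" using degrees(4) by (simp only: of_nat_le_iff)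
  also have "real (q - 1) = real q - 1" using q2 by (simp add: of_nat_diff)
  finally have "real ((\<delta> + 1) + 2 * \<delta> * \<delta> + \<delta> ^ 4) / (real q - 1) \<le> 1 / 3" using q2 by (simp add: field_simps)
  then show ?thesis by (simp add: d_def add_divide_distrib)
 qed
 finally have b: "(\<Sum>v\<in>V. \<Sum>p\<in>V. \<Sum>w\<in>V. bad v w p) \<le> 1 / 3 * Q ^ 3" using Q0 by (simp add: mult_right_mono)
 have "(\<Sum>L\<in>T. bad (fst L) (fst (snd L)) (snd (snd L))) = (\<Sum>v\<in>V. \<Sum>w\<in>V. \<Sum>p\<in>V. bad v w p)" by (rule sum_T)
 also have "\<dots> = (\<Sum>v\<in>V. \<Sum>p\<in>V. \<Sum>w\<in>V. bad v w p)" by (rule sum.cong[OF refl]) (rule sum.swap)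
 finally have "(\<Sum>L\<in>T. bad (fst L) (fst (snd L)) (snd (snd L))) \<le> 1 / 3 * Q ^ 3" using b by simp
 moreover have "(\<Sum>L\<in>T. bad (fst L) (fst (snd L)) (snd (snd L))) = real (card T) - real (card {L\<in>T. irrL L})"
 proof -
  have "(\<Sum>L\<in>T. bad (fst L) (fst (snd L)) (snd (snd L))) = (\<Sum>L\<in>T. 1 - (if irrL L then 1 else 0))" by (rule sum.cong) (auto simp: bad_def)
  also have "\<dots> = real (card T) - real (card {L\<in>T. irrL L})" using finite_T by (simp add: sum_subtractf sum.If_cases Int_def)
  finally show ?thesis .
 qed
 ultimately show ?thesis unfolding card_T by linarith
qed

lemma pt_frob: assumes "L \<in> T" shows "(\<chi> i. (pt L P $ i) ^ q) = pt L (pw P)"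
proof -
 have f: "(fst L $ i) ^ q = fst L $ i" "(fst (snd L) $ i) ^ q = fst (snd L) $ i" "(snd (snd L) $ i) ^ q = snd (snd L) $ i" for i
  using assms by (auto simp: T_def Vq_def Fq_def)
 show ?thesis by (simp add: Finite_Cartesian_Product.vec_eq_iff pt_def pw_def frob power_mult_distrib f)
qed

lemma Pl_pt: "Pl \<delta> (%P. g (pt L P))"
proof (rule PF_comp_crd[OF g])
 fix i
 have "Pl 1 (%P. snd (snd L) $ i + fst (snd L) $ i * fst P + fst L $ i * snd P)"
  by (rule PF_add[OF PF_add[OF PF_const PF_scale[OF Pl_fst]] PF_scale[OF Pl_snd]])
 then show "Pl 1 (%P. pt L P $ i)" by (simp add: pt_def mult.commute)
qed

lemma cnt_irr: assumes "L \<in> T" "irrL L" shows "\<bar>cnt L - real q\<bar> \<le> E \<delta>"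
 unfolding cnt_def
proof (rule irr_count(1)[OF _ degrees(1)])
 show "irr \<delta> (%P. g (pt L P))" using assms(2) by (simp add: irrL_def)
 fix P assume "g (pt L P) = 0"
 from stable[OF this] show "g (pt L (pw P)) = 0" unfolding pt_frob[OF assms(1)] .
qed

lemma E_nonneg: "E \<delta> \<ge> 0" using E_mono[of 0 \<delta>] by (simp add: E_def)

lemma cnt_multiple: "\<exists>j :: nat. \<bar>cnt L - real j * real q\<bar> \<le> E \<delta>"
proof (cases "EX P. g (pt L P) ~= 0")
 case True
 then obtain P where "g (pt L P) ~= 0" by blast
 from plane_count[OF Pl_pt this degrees(1)] show ?thesis by (simp add: cnt_def)
next
 case False
 then have "cnt L = real (card Rq)" by (simp add: cnt_def NP_def)
 then show ?thesis using E_nonneg card_Rq by (intro exI[of _ q]) (simp add: power2_eq_square)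
qed

text \<open>If j \<noteq> 1, the deviation y of the count from q is at least t = q - E. As y / (y -
  D0)^2 decreases, y is at most t / (t - D0)^2 times the squared deviation from the mean, and the
  average of these squares is at most \<mu>.\<close>

lemma mean_bound:
 assumes D0: "\<bar>\<mu> - real q\<bar> \<le> D0" "D0 < real q - E \<delta>"
 shows "\<bar>\<mu> - real q\<bar> \<le> E \<delta> + (real q - E \<delta>) / (real q - E \<delta> - D0)\<^sup>2 * \<mu>"
proof -
 define t where "t = real q - E \<delta>"
 define c where "c = t / (t - D0)\<^sup>2"
 have t: "t > D0" "D0 \<ge> 0" using D0 by (auto simp: t_def)
 have c0: "c \<ge> 0" using t by (simp add: c_def)
 have pw: "\<bar>cnt L - real q\<bar> \<le> E \<delta> + c * (cnt L - \<mu>)\<^sup>2" for L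
 proof -
  obtain j :: nat where j: "\<bar>cnt L - real j * real q\<bar> \<le> E \<delta>" using cnt_multiple by blast
  have c1: "c * (cnt L - \<mu>)\<^sup>2 \<ge> 0" using c0 by simp
  show ?thesis
  proof (cases "j = 1")
   case True
   then show ?thesis using j c1 by simp
  next
   case False
   define y where "y = \<bar>cnt L - real q\<bar>"
   have "\<bar>real j * real q - real q\<bar> \<ge> real q"
   proof (cases "j = 0")
    case F: False
    then have "real j \<ge> 2" using False by simp
    then have "real j * real q \<ge> 2 * real q" using q_pos by (intro mult_right_mono) auto
    then show ?thesis by simp
   qed simp
   then have y: "y \<ge> t" using j by (simp add: y_def t_def)
   have "y - D0 \<le> \<bar>cnt L - \<mu>\<bar>" using D0(1) by (simp add: y_def)
   then have "(y - D0)\<^sup>2 \<le> (cnt L - \<mu>)\<^sup>2" using y t abs_le_square_iff[of "y - D0" "cnt L - \<mu>"] by simp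
   moreover have "y * (t - D0)\<^sup>2 \<le> t * (y - D0)\<^sup>2"
   proof -
    have "t * y \<ge> t * t" using y t by (intro mult_left_mono) auto
    moreover have "D0 * D0 \<le> t * t" using t by (intro mult_mono) auto
    ultimately have "0 \<le> (y - t) * (t * y - D0 * D0)" using y by (intro mult_nonneg_nonneg) auto
    then show ?thesis by (simp add: power2_eq_square algebra_simps)
   qed
   then have "y \<le> c * (y - D0)\<^sup>2" using t by (simp add: c_def field_simps)
   moreover have "c * (y - D0)\<^sup>2 \<le> c * (cnt L - \<mu>)\<^sup>2" using calculation(1) c0 by (rule mult_left_mono)
   ultimately show ?thesis using E_nonneg by (simp add: y_def)
  qed
 qed
 have Q3: "Q ^ 3 > 0" using Q_pos by simp
 have "Q ^ 3 * \<bar>\<mu> - real q\<bar> = \<bar>\<Sum>L\<in>T. (cnt L - real q)\<bar>"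
  using Q3 by (simp add: sum_subtractf sum_cnt card_T right_diff_distrib[symmetric] abs_mult)
 also have "\<dots> \<le> (\<Sum>L\<in>T. \<bar>cnt L - real q\<bar>)" by (rule sum_abs)
 also have "\<dots> \<le> (\<Sum>L\<in>T. E \<delta> + c * (cnt L - \<mu>)\<^sup>2)" by (rule sum_mono) (rule pw)
 also have "\<dots> = Q ^ 3 * E \<delta> + c * (\<Sum>L\<in>T. (cnt L - \<mu>)\<^sup>2)" by (simp add: sum.distrib sum_distrib_left card_T)
 also have "\<dots> \<le> Q ^ 3 * E \<delta> + c * (Q ^ 3 * \<mu>)" using variance c0 by (simp add: mult_left_mono)
 also have "\<dots> = Q ^ 3 * (E \<delta> + c * \<mu>)" by (simp add: algebra_simps)
 finally show ?thesis using Q3 by (simp add: c_def t_def)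
qed

text \<open>Irreducible planes make up at least two thirds, so one of them has squared deviation at
  most 3/2 times the variance bound \<mu>; its count is within \<open>E\<close> of q.\<close>

lemma mean_rough: "\<bar>\<mu> - real q\<bar> \<le> E \<delta> + sqrt (3 / 2 * \<mu>)"
proof -
 let ?W = "{L\<in>T. irrL L}"
 have finW: "finite ?W" using finite_T by simp
 have "\<exists>L\<in>?W. (cnt L - \<mu>)\<^sup>2 \<le> 3 / 2 * \<mu>"
 proof (rule ccontr)
  assume "~ ?thesis"
  then have lt: "3 / 2 * \<mu> < (cnt L - \<mu>)\<^sup>2" if "L \<in> ?W" for L using that by force
  have "card ?W > 0" using irr_planes Q_pos by (smt (verit) divide_pos_pos mult_pos_pos of_nat_0_less_iff zero_less_power)
  then have "?W ~= {}" using card_gt_0_iff by blast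
  then have "(\<Sum>L\<in>?W. 3 / 2 * \<mu>) < (\<Sum>L\<in>?W. (cnt L - \<mu>)\<^sup>2)" using lt by (intro sum_strict_mono finW)
  also have "\<dots> \<le> (\<Sum>L\<in>T. (cnt L - \<mu>)\<^sup>2)" by (rule sum_mono2[OF finite_T]) auto
  also have "\<dots> \<le> Q ^ 3 * \<mu>" by (rule variance)
  finally have "real (card ?W) * (3 / 2 * \<mu>) < Q ^ 3 * \<mu>" by simp
  moreover have "(2 / 3 * Q ^ 3) * (3 / 2 * \<mu>) \<le> real (card ?W) * (3 / 2 * \<mu>)" using irr_planes \<mu>_nonneg by (intro mult_right_mono) auto
  ultimately show False by simp
 qed
 then obtain L where L: "L \<in> T" "irrL L" "(cnt L - \<mu>)\<^sup>2 \<le> 3 / 2 * \<mu>" by blast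
 have "\<bar>cnt L - \<mu>\<bar> \<le> sqrt (3 / 2 * \<mu>)" using real_sqrt_le_mono[OF L(3)] by simp
 then show ?thesis using cnt_irr[OF L(1,2)] by linarith
qed

end

section \<open>Numerical evaluation of the mean\<close>

context fq_hyper
begin

text \<open>The error aimed at exceeds \<open>E \<delta>\<close> by 3\<delta>^2 + 2\<delta> + 1,
  that is by 6 if \<delta> = 1 and by at least 17 otherwise. These are the constants K for which the
  rough estimate is fed into \<open>mean_bound\<close>.\<close>

lemma mean_final: "\<bar>\<mu> - real q\<bar> \<le> (real \<delta> - 1) * (real \<delta> - 2) * sqrt (real q) + real \<delta> + 1 + 5 * (real \<delta>)\<^sup>2"
proof -
 define x where "x = real q"
 define s where "s = sqrt (3 / 2 * \<mu>)"
 have m0: "\<mu> \<ge> 0" by (rule \<mu>_nonneg)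
 have rough: "\<bar>\<mu> - x\<bar> \<le> E \<delta> + s" using mean_rough by (simp add: x_def s_def)
 have Ed: "E \<delta> = (real \<delta> - 1) * (real \<delta> - 2) * sqrt x + 2 * (real \<delta>)\<^sup>2 - real \<delta>" using d1 by (simp add: E_def x_def)
 have fin: "\<bar>\<mu> - x\<bar> \<le> E \<delta> + K" if D0: "E \<delta> + s \<le> D0" "D0 < x - E \<delta>" and K: "(x - E \<delta>) * \<mu> \<le> K * (x - E \<delta> - D0)\<^sup>2" for D0 K
 proof -
  have "\<bar>\<mu> - x\<bar> \<le> E \<delta> + (x - E \<delta>) / (x - E \<delta> - D0)\<^sup>2 * \<mu>"
   unfolding x_def by (rule mean_bound) (use rough D0 in \<open>auto simp: x_def\<close>)
  moreover have "(x - E \<delta>) / (x - E \<delta> - D0)\<^sup>2 * \<mu> \<le> K" using K D0(2) by (simp add: field_simps)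
  ultimately show ?thesis by linarith
 qed
 have goal: "\<bar>\<mu> - x\<bar> \<le> E \<delta> + (3 * (real \<delta>)\<^sup>2 + 2 * real \<delta> + 1)"
 proof (cases "\<delta> = 1")
  case True
  have E1: "E \<delta> = 1" using True by (simp add: E_def)
  have x16: "x \<ge> 16" using q_large True by (simp add: x_def)
  \<comment> \<open>The square root is linearised by the inequality of arithmetic and geometric
    means, with a coefficient of \<mu> small enough to be moved to the other side.\<close>
  have "s \<le> \<mu> / 8 + 3" unfolding s_def
  proof (rule real_le_lsqrt)
   have "0 \<le> (\<mu> / 8 - 3)\<^sup>2" by simp
   then show "3 / 2 * \<mu> \<le> (\<mu> / 8 + 3)\<^sup>2" by (simp add: power2_eq_square algebra_simps)
  qed (use m0 in auto)
  then have mu: "7 * \<mu> \<le> 8 * x + 32" and sD: "E \<delta> + s \<le> 4 + (x + 4) / 7" using rough E1 by (auto simp: field_simps)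
  have "\<bar>\<mu> - x\<bar> \<le> E \<delta> + 6"
  proof (rule fin[OF sD])
   show "4 + (x + 4) / 7 < x - E \<delta>" using x16 by (simp add: E1 field_simps)
   have "(x - 1) * (7 * \<mu>) \<le> (x - 1) * (8 * x + 32)" using mu x16 by (intro mult_left_mono) auto
   moreover have "0 \<le> 160 * (x - 16)\<^sup>2" by simp
   ultimately show "(x - E \<delta>) * \<mu> \<le> 6 * (x - E \<delta> - (4 + (x + 4) / 7))\<^sup>2"
    using x16 unfolding E1 by (simp add: power2_eq_square field_simps)
  qed
  then show ?thesis using True by simp
 next
  case False
  then have d2: "real \<delta> \<ge> 2" using d1 by simp
  define y where "y = (real \<delta>)\<^sup>2"
  have y4: "y \<ge> 4" using mult_mono[OF d2 d2] by (simp add: y_def power2_eq_square)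
  have "real (15 * \<delta> ^ 4) < real q" using q_large by (simp only: of_nat_less_iff)
  then have xy: "15 * (y * y) < x" by (simp add: x_def y_def power2_eq_square power4_eq_xxxx mult.assoc)
  have yy: "y * y \<ge> 4 * y" using y4 by (intro mult_right_mono) auto
  then have x240: "x \<ge> 240" and yx: "60 * y \<le> x" using xy y4 by linarith+
  \<comment> \<open>26/100 lies just above 1 / sqrt 15.\<close>
  have sq: "y * sqrt x \<le> 26 / 100 * x"
  proof (rule power2_le_imp_le)
   have "(y * sqrt x)\<^sup>2 = (y * y) * x" using x240 by (simp add: power2_eq_square algebra_simps)
   also have "\<dots> \<le> (x / 15) * x" using xy x240 by (intro mult_right_mono) auto
   also have "\<dots> \<le> (26 / 100 * x)\<^sup>2" using x240 by (simp add: power2_eq_square)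
   finally show "(y * sqrt x)\<^sup>2 \<le> (26 / 100 * x)\<^sup>2" .
  qed (use x240 in simp)
  have "(real \<delta> - 1) * (real \<delta> - 2) \<le> y" using d2 by (simp add: y_def power2_eq_square algebra_simps)
  then have "(real \<delta> - 1) * (real \<delta> - 2) * sqrt x \<le> y * sqrt x" using x240 by (intro mult_right_mono) auto
  moreover define A where "A = (real \<delta> - 1) * (real \<delta> - 2) * sqrt x"
  moreover have "E \<delta> = A + 2 * y - real \<delta>" by (simp add: Ed A_def y_def)
  moreover have "y * sqrt x \<le> 26 / 100 * x" by (rule sq)
  ultimately have E3: "E \<delta> \<le> 3 / 10 * x" using yx d2 x240 by argo
  have "s \<le> \<mu> / 20 + 15 / 2" unfolding s_def
  proof (rule real_le_lsqrt)
   have "0 \<le> (\<mu> / 20 - 15 / 2)\<^sup>2" by simp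
   then show "3 / 2 * \<mu> \<le> (\<mu> / 20 + 15 / 2)\<^sup>2" by (simp add: power2_eq_square algebra_simps)
  qed (use m0 in auto)
  then have mu: "\<mu> \<le> 14014 / 10000 * x" and s1: "s \<le> 1014 / 10000 * x" using rough E3 x240 by linarith+
  have "\<bar>\<mu> - x\<bar> \<le> E \<delta> + 17"
  proof (rule fin[of "E \<delta> + 1014 / 10000 * x"])
   show "E \<delta> + s \<le> E \<delta> + 1014 / 10000 * x" using s1 by simp
   show "E \<delta> + 1014 / 10000 * x < x - E \<delta>" using E3 x240 by linarith
   define u where "u = x - E \<delta> - (E \<delta> + 1014 / 10000 * x)"
   have u: "u \<ge> 2986 / 10000 * x" using E3 by (simp add: u_def)
   have t: "x - E \<delta> = (u + 11014 / 10000 * x) / 2" by (simp add: u_def)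
   have "(x - E \<delta>) * \<mu> \<le> (x - E \<delta>) * (14014 / 10000 * x)" using mu E3 x240 by (intro mult_left_mono) auto
   also have "\<dots> = 7007 / 10000 * (u * x) + 77175098 / 100000000 * (x * x)" unfolding t by (simp add: algebra_simps)
   also have "\<dots> \<le> 17 * u\<^sup>2"
   proof -
    have a: "2986 / 10000 * x * u \<le> u * u" using u x240 by (intro mult_right_mono) auto
    have b: "x * (2986 / 10000 * x) \<le> x * u" using u x240 by (intro mult_left_mono) auto
    have "u * x \<ge> 0" "x * x \<ge> 0" using u x240 by auto
    then show ?thesis using a b by (simp add: power2_eq_square mult.commute)
   qed
   finally show "(x - E \<delta>) * \<mu> \<le> 17 * (x - E \<delta> - (E \<delta> + 1014 / 10000 * x))\<^sup>2" by (simp add: u_def)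
  qed
  moreover have "17 \<le> 3 * (real \<delta>)\<^sup>2 + 2 * real \<delta> + 1" using y4 d2 by (simp add: y_def)
  ultimately show ?thesis by linarith
 qed
 show ?thesis using goal unfolding Ed by (simp add: x_def)
qed

end

section \<open>Polynomials and polynomial functions\<close>

lemma expo_split: "expo m (z + (t - z $ a) *s axis a 1) = t ^ m a * expo (m(a := 0)) z"
 for z :: "'k::field ^ 'n::finite"
proof -
 let ?z = "z + (t - z $ a) *s axis a 1"
 have za: "?z $ a = t" by (simp add: axis_def)
 have zi: "?z $ i = z $ i" if "i ~= a" for i using that by (simp add: axis_def)
 have 1: "(\<Prod>i\<in>UNIV-{a}. (?z $ i) ^ m i) = (\<Prod>i\<in>UNIV-{a}. (z $ i) ^ m i)"
  by (intro prod.cong refl arg_cong2[where f = power] zi) simp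
 have 2: "(\<Prod>i\<in>UNIV-{a}. (z $ i) ^ (m(a := 0)) i) = (\<Prod>i\<in>UNIV-{a}. (z $ i) ^ m i)" by (rule prod.cong) auto
 have "expo m ?z = t ^ m a * (\<Prod>i\<in>UNIV-{a}. (?z $ i) ^ m i)"
  unfolding expo_def by (subst prod.remove[of _ a]) (simp_all only: za finite UNIV_I)
 moreover have "expo (m(a := 0)) z = (\<Prod>i\<in>UNIV-{a}. (z $ i) ^ (m(a := 0)) i)"
  unfolding expo_def by (subst prod.remove[of _ a]) (simp_all del: fun_upd_apply, simp)
 ultimately show ?thesis unfolding 1 2 by simp
qed

text \<open>Along the axis \<open>a\<close> the sum is a polynomial in one variable; each of its
  coefficients collects the exponents with a given value at \<open>a\<close> and involves one
  variable less.\<close>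

lemma expo_indep:
 fixes c :: "('n::finite => nat) => 'k::field"
 assumes inf: "infinite (UNIV :: 'k set)" and fin: "finite M" and z: "!!z. (\<Sum>m\<in>M. c m * expo m z) = 0" and m: "m \<in> M"
 shows "c m = 0"
proof -
 have "\<forall>m\<in>M. c m = 0" if "\<forall>m\<in>M. ALL i. i \<notin> A --> m i = 0" "finite M" "ALL z. (\<Sum>m\<in>M. c m * expo m z) = 0" for A :: "'n set" and M and c :: "('n => nat) => 'k"
  using finite[of A] that
 proof (induction A arbitrary: M c rule: finite_induct)
  case empty
  then have M0: "m = (%_. 0)" if "m \<in> M" for m using that by auto
  show ?case
  proof
   fix m assume "m \<in> M"
   then have "M = {%_. 0}" using M0 by auto
   then show "c m = 0" using empty(3)[rule_format, of 0] M0[OF \<open>m \<in> M\<close>] by (simp add: expo_def)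
  qed
 next
  case (insert a A)
  show ?case
  proof
   fix m0 assume m0: "m0 \<in> M"
   define k where "k = m0 a"
   define Mk where "Mk = {m\<in>M. m a = k}"
   define r where "r m = m(a := 0 :: nat)" for m :: "'n => nat"
   have finMk: "finite Mk" using insert.prems(2) by (simp add: Mk_def)
   have inj: "inj_on r Mk"
   proof (rule inj_onI)
    fix m m' assume mm: "m \<in> Mk" "m' \<in> Mk" "r m = r m'"
    have rk: "(r m)(a := k) = m" if "m \<in> Mk" for m using that by (auto simp: r_def Mk_def)
    show "m = m'" using rk[OF mm(1)] rk[OF mm(2)] mm(3) by metis
   qed
   have "\<forall>m\<in>r ` Mk. c (m(a := k)) = 0"
   proof (rule insert.IH[of "r ` Mk" "%m. c (m(a := k))"])
    show "\<forall>m\<in>r ` Mk. ALL i. i \<notin> A --> m i = 0" using insert.prems(1) by (auto simp: r_def Mk_def)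
    show "finite (r ` Mk)" using finMk by simp
    show "ALL z. (\<Sum>m\<in>r ` Mk. c (m(a := k)) * expo m z) = 0"
    proof
     fix z :: "'k ^ 'n"
     define P where "P = (\<Sum>m\<in>M. monom (c m * expo (r m) z) (m a))"
     have "poly P t = 0" for t
     proof -
      have "poly P t = (\<Sum>m\<in>M. c m * expo m (z + (t - z $ a) *s axis a 1))"
       unfolding P_def poly_sum poly_monom expo_split r_def by (rule sum.cong) (simp_all add: mult_ac)
      then show ?thesis using insert.prems(3) by simp
     qed
     then have "P = 0" by (intro poly_eqI_infinite[OF inf]) simp
     then have "0 = coeff P k" by simp
     also have "\<dots> = (\<Sum>m\<in>M. if m a = k then c m * expo (r m) z else 0)" by (simp add: P_def coeff_sum)
     also have "\<dots> = (\<Sum>m\<in>Mk. c m * expo (r m) z)" unfolding Mk_def using insert.prems(2) by (simp add: sum.inter_filter)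
     also have "\<dots> = (\<Sum>m\<in>Mk. c ((r m)(a := k)) * expo (r m) z)"
      by (rule sum.cong) (auto simp: r_def Mk_def)
     also have "\<dots> = (\<Sum>m\<in>r ` Mk. c (m(a := k)) * expo m z)" by (simp add: sum.reindex[OF inj])
     finally show "(\<Sum>m\<in>r ` Mk. c (m(a := k)) * expo m z) = 0" by simp
    qed
   qed
   moreover have "m0 \<in> Mk" using m0 by (simp add: Mk_def k_def)
   moreover have "(r m0)(a := k) = m0" by (simp add: r_def k_def)
   ultimately show "c m0 = 0" by (metis imageI)
  qed
 qed
 from this[of M UNIV c] show ?thesis using fin z m by blast
qed

lemma mpoly_eval_expo: "mpoly_eval f z = (\<Sum>m\<in>Poly_Mapping.keys f. Poly_Mapping.lookup f m * expo (Poly_Mapping.lookup m) z)"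
 for f :: "('n::finite, 'k::comm_ring_1) mpoly"
 by (simp add: mpoly_eval_def expo_def)

lemma sum_le_mpoly_degree: "m \<in> Poly_Mapping.keys f ==> (\<Sum>i\<in>UNIV. Poly_Mapping.lookup m i) \<le> mpoly_degree f"
 unfolding mpoly_degree_def by (rule Max_ge) auto

lemma PF_mpoly_eval: "PF crd (mpoly_degree f) (mpoly_eval f)"
 for f :: "('n::finite, 'k::comm_ring_1) mpoly"
proof -
 have "PF crd (mpoly_degree f) (%z. \<Sum>m\<in>Poly_Mapping.keys f. Poly_Mapping.lookup f m * expo (Poly_Mapping.lookup m) z)"
  by (intro PF_sum PF_scale PF_mono[OF PF_expo] sum_le_mpoly_degree)
 then show ?thesis by (simp add: mpoly_eval_expo[abs_def])
qed

lemma lookup_of_fun: "Poly_Mapping.lookup (Abs_poly_mapping m) = m" for m :: "'n::finite => nat"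
 by (rule Abs_poly_mapping_inverse) simp

lemma mpoly_of_PF:
 fixes f :: "'k::comm_ring_1 ^ 'n::finite => 'k"
 assumes "PF crd s f" shows "EX u. mpoly_degree u \<le> s & (ALL z. mpoly_eval u z = f z)"
proof -
 from PF_rep[OF assms] obtain c where c: "!!z. f z = (\<Sum>m\<in>Mon s. c m * expo m z)" by blast
 define KS where "KS = {k :: 'n \<Rightarrow>\<^sub>0 nat. Poly_Mapping.lookup k \<in> Mon s}"
 have bij: "bij_betw Poly_Mapping.lookup KS (Mon s)"
  by (rule bij_betwI[where g = Abs_poly_mapping]) (auto simp: KS_def lookup_of_fun lookup_inverse)
 have finKS: "finite KS" using bij_betw_finite[OF bij] finite_Mon by blast
 define h where "h k = (if k \<in> KS then c (Poly_Mapping.lookup k) else 0)" for k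
 have finh: "finite {k. h k ~= 0}" by (rule finite_subset[OF _ finKS]) (auto simp: h_def)
 define u where "u = Abs_poly_mapping h"
 have lu: "Poly_Mapping.lookup u = h" unfolding u_def by (rule Abs_poly_mapping_inverse) (use finh in simp)
 have keys: "Poly_Mapping.keys u \<subseteq> KS"
 proof
  fix k assume "k \<in> Poly_Mapping.keys u"
  then have "h k ~= 0" using lu by (simp add: in_keys_iff)
  then show "k \<in> KS" by (simp add: h_def split: if_splits)
 qed
 have "mpoly_eval u z = f z" for z
 proof -
  have "mpoly_eval u z = (\<Sum>k\<in>KS. h k * expo (Poly_Mapping.lookup k) z)"
   unfolding mpoly_eval_expo lu by (rule sum.mono_neutral_left[OF finKS keys]) (auto simp: in_keys_iff lu)
  also have "\<dots> = (\<Sum>k\<in>KS. c (Poly_Mapping.lookup k) * expo (Poly_Mapping.lookup k) z)" by (rule sum.cong) (auto simp: h_def)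
  also have "\<dots> = (\<Sum>m\<in>Mon s. c m * expo m z)" by (rule sum.reindex_bij_betw[OF bij])
  finally show ?thesis using c by simp
 qed
 moreover have "mpoly_degree u \<le> s"
  unfolding mpoly_degree_def by (rule Max.boundedI) (use keys in \<open>auto simp: KS_def Mon_def\<close>)
 ultimately show ?thesis by blast
qed

lemma mpoly_degree_pos_nonzero:
 fixes f :: "('n::finite, 'k::field) mpoly"
 assumes "mpoly_degree f > 0" "infinite (UNIV :: 'k set)" shows "EX z. mpoly_eval f z ~= 0"
proof (rule ccontr)
 assume "~ ?thesis"
 then have z: "(\<Sum>m\<in>Poly_Mapping.keys f. Poly_Mapping.lookup f m * expo (Poly_Mapping.lookup m) z) = 0" for z by (simp add: mpoly_eval_expo)
 have inj: "inj_on Poly_Mapping.lookup (Poly_Mapping.keys f)" by (rule inj_onI) (simp add: poly_mapping_eqI)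
 define c where "c m = Poly_Mapping.lookup f (Abs_poly_mapping m)" for m
 have "Poly_Mapping.keys f ~= {}" using assms(1) by (auto simp: mpoly_degree_def)
 then obtain k where k: "k \<in> Poly_Mapping.keys f" by blast
 have "c (Poly_Mapping.lookup k) = 0"
 proof (rule expo_indep[OF assms(2)])
  show "finite (Poly_Mapping.lookup ` Poly_Mapping.keys f)" by simp
  show "(\<Sum>m\<in>Poly_Mapping.lookup ` Poly_Mapping.keys f. c m * expo m z) = 0" for z
   using z[of z] by (simp add: sum.reindex[OF inj] c_def lookup_inverse)
 qed (use k in auto)
 then show False using k by (simp add: c_def lookup_inverse in_keys_iff)
qed

lemma mpoly_degree_0_const: "mpoly_degree f = 0 ==> mpoly_eval f z = mpoly_eval f w"
 for f :: "('n::finite, 'k::alg_closed_field) mpoly"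
 using vecs.PF_0[of "mpoly_eval f" z w] PF_mpoly_eval[of f] by simp

section \<open>The Frobenius map of the algebraic closure\<close>

text \<open>Gives access to gcds and unique factorisation for polynomials over the closure.\<close>

instance alg_closure :: (field) field_gcd ..

lemma finite_field_power: "x ^ CARD('a) = x" for x :: "'a::{field,finite}"
proof (cases "x = 0")
 case False
 let ?A = "UNIV - {0 :: 'a}"
 have cA: "card ?A = CARD('a) - 1" by simp
 have "(\<Prod>y\<in>?A. y) = (\<Prod>y\<in>?A. x * y)"
  by (rule sum.reindex_bij_witness[of ?A "%y. x * y" "%y. y / x"] prod.reindex_bij_witness[of ?A "%y. x * y" "%y. y / x"]) (use False in auto)
 also have "\<dots> = x ^ (CARD('a) - 1) * (\<Prod>y\<in>?A. y)" by (simp add: prod.distrib cA)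
 finally have "x ^ (CARD('a) - 1) = 1" by (simp add: prod_zero_iff)
 then have "x ^ Suc (CARD('a) - 1) = x" by (simp only: power_Suc mult_1_right)
 moreover have "Suc (CARD('a) - 1) = CARD('a)" by simp
 ultimately show ?thesis by (simp only:)
qed simp

lemma card_fixed_alg_closure:
 "{x :: 'a::{field,finite} alg_closure. x ^ CARD('a) = x} = range to_ac" "card (range (to_ac :: 'a => 'a alg_closure)) = CARD('a)"
proof -
 show c: "card (range (to_ac :: 'a => 'a alg_closure)) = CARD('a)" by (rule card_image[OF inj_to_ac])
 let ?q = "CARD('a)"
 have q2: "?q \<ge> 2" using card_mono[of "UNIV :: 'a set" "{0, 1}"] by simp
 define p :: "'a alg_closure poly" where "p = monom 1 ?q - monom 1 1"
 have "coeff p ?q = 1" using q2 by (simp add: p_def)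
 then have p0: "p ~= 0" by auto
 have dp: "degree p \<le> ?q" unfolding p_def using q2 by (intro degree_diff_le) (auto intro: order_trans[OF degree_monom_le])
 have roots: "{x. poly p x = 0} = {x. x ^ ?q = x}" by (simp add: p_def poly_monom)
 have sub: "range to_ac \<subseteq> {x :: 'a alg_closure. x ^ ?q = x}"
 proof
  fix y :: "'a alg_closure" assume "y \<in> range to_ac"
  then obtain u :: 'a where "y = to_ac u" by blast
  then show "y \<in> {x. x ^ ?q = x}" using finite_field_power[of u] by (simp flip: to_ac_power)
 qed
 have "card {x :: 'a alg_closure. x ^ ?q = x} \<le> ?q" using card_poly_roots_bound[OF p0] dp roots by simp
 then have "range to_ac = {x :: 'a alg_closure. x ^ ?q = x}"
  using poly_roots_finite[OF p0] roots c by (intro card_seteq[OF _ sub]) auto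
 then show "{x :: 'a alg_closure. x ^ ?q = x} = range to_ac" by simp
qed

text \<open>The polynomial \<open>X\<^sup>q - X\<close> is the product of all \<open>X - a\<close>, so it is invariant under translation
 by the \<open>q\<close> elements of the base field; comparing degrees it is additive.\<close>

lemma frobenius_add: "(x + y) ^ CARD('a) = x ^ CARD('a) + y ^ CARD('a)" for x y :: "'a::{field,finite} alg_closure"
proof -
 let ?q = "CARD('a)"
 let ?F = "range (to_ac :: 'a => 'a alg_closure)"
 have q2: "?q \<ge> 2" using card_mono[of "UNIV :: 'a set" "{0, 1}"] by simp
 define p :: "'a alg_closure poly" where "p = monom 1 ?q - monom 1 1"
 have pp: "poly p u = u ^ ?q - u" for u by (simp add: p_def poly_monom)
 have dp: "degree p = ?q"
 proof (rule antisym)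
  show "degree p \<le> ?q" unfolding p_def using q2 by (intro degree_diff_le) (auto intro: order_trans[OF degree_monom_le])
  show "?q \<le> degree p" by (rule le_degree) (use q2 in \<open>simp add: p_def\<close>)
 qed
 have rootF: "poly p u = 0" if "u \<in> ?F" for u using that card_fixed_alg_closure(1)[where 'a = 'a] by (auto simp: pp)
 have lp: "lead_coeff p = 1" unfolding dp using q2 by (simp add: p_def)
 have "p = smult (lead_coeff p) (\<Prod>r\<in>?F. [:- r, 1:])"
  using prod_roots_eq[of ?F "%r. r" p] rootF dp card_fixed_alg_closure(2)[where 'a = 'a] by simp
 then have pf: "poly p u = (\<Prod>r\<in>?F. u - r)" for u unfolding lp by (simp add: poly_prod)
 have inv: "poly p (u + c) = poly p u" if c: "c \<in> ?F" for u c
 proof -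
  have "(\<Prod>r\<in>?F. u + c - r) = (\<Prod>r\<in>?F. u - r)"
   by (rule prod.reindex_bij_witness[of _ "%r. r + c" "%r. r - c"]) (use c in \<open>auto simp flip: to_ac_add to_ac_diff\<close>)
  then show ?thesis by (simp add: pf)
 qed
 define D where "D = pcompose p [:y, 1:] - p - [:poly p y:]"
 have pD: "poly D u = poly p (u + y) - poly p u - poly p y" for u by (simp add: D_def poly_pcompose add.commute)
 have "D = 0"
 proof (rule ccontr)
  assume D0: "D ~= 0"
  have dc: "degree (pcompose p [:y, 1:]) = ?q" by (simp add: degree_pcompose dp)
  have lc: "lead_coeff (pcompose p [:y, 1:]) = 1" by (simp add: lead_coeff_comp lp)
  have "degree D \<le> ?q" unfolding D_def by (intro degree_diff_le) (auto simp: dc dp)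
  moreover have "coeff D ?q = 0"
  proof -
   have "coeff (pcompose p [:y, 1:]) ?q = 1" using lc unfolding dc .
   moreover have "coeff p ?q = 1" using lp unfolding dp .
   moreover have "coeff [:poly p y:] ?q = 0" using q2 by (simp add: coeff_pCons split: nat.splits)
   ultimately show ?thesis by (simp add: D_def)
  qed
  ultimately have "degree D < ?q" using D0 by (metis le_neq_implies_less leading_coeff_0_iff)
  moreover have "?F \<subseteq> {u. poly D u = 0}"
  proof
   fix u assume u: "u \<in> ?F"
   have "poly p (u + y) = poly p y" using inv[OF u, of y] by (simp only: add.commute)
   then show "u \<in> {u. poly D u = 0}" using rootF[OF u] by (simp add: pD)
  qed
  then have "?q \<le> card {u. poly D u = 0}" using card_mono[OF poly_roots_finite[OF D0]] card_fixed_alg_closure(2)[where 'a = 'a] by metis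
  ultimately show False using card_poly_roots_bound[OF D0] by simp
 qed
 then have "poly p (x + y) - poly p x - poly p y = 0" using pD[of x] by simp
 then show ?thesis by (simp add: pp algebra_simps)
qed

theorem theorem5p3:
  fixes H :: "('a::{field,finite} alg_closure ^ 'n::finite) set"
    and q n \<delta> :: nat
  assumes "q = CARD('a)"
    and "n = CARD('n)"
    and "base_hypersurface H"
    and "absolutely_irreducible H"
    and "hypersurface_degree H = \<delta>"
    and "real q > 15 * real \<delta> powr (13 / 3)"
  shows "\<bar>real (card (H \<inter> rational_points)) - real q powi (int n - 1)\<bar>
           \<le> (\<omega> (real q) (real \<delta>) + 5 * (real \<delta>)\<^sup>2) * real q powi (int n - 2)"
proof -
 have inf: "infinite (UNIV :: 'a alg_closure set)" by (rule infinite_alg_closed)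
 have q2: "q \<ge> 2" using card_mono[of "UNIV :: 'a set" "{0, 1}"] by (simp add: assms(1))
 from assms(3) obtain f0 :: "('n, 'a) mpoly" where f0: "mpoly_degree f0 > 0" "H = zero_set {Poly_Mapping.map to_ac f0}"
  unfolding base_hypersurface_def by blast
 let ?f = "Poly_Mapping.map to_ac f0 :: ('n, 'a alg_closure) mpoly"
 have lf: "Poly_Mapping.lookup ?f m = to_ac (Poly_Mapping.lookup f0 m)" for m by (simp add: map.rep_eq when_def)
 have "Poly_Mapping.keys ?f = Poly_Mapping.keys f0" by (auto simp: in_keys_iff lf)
 then have df: "mpoly_degree ?f > 0" using f0(1) by (simp add: mpoly_degree_def)
 let ?D = "%d. \<exists>f :: ('n, 'a alg_closure) mpoly. mpoly_degree f > 0 & H = zero_set {f} & mpoly_degree f = d"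
 have "?D (mpoly_degree ?f)" using df f0(2) by blast
 then have "?D \<delta>" using LeastI[of ?D] assms(5) unfolding hypersurface_degree_def by blast
 then obtain m0 :: "('n, 'a alg_closure) mpoly" where m0: "mpoly_degree m0 = \<delta>" "\<delta> > 0" "H = zero_set {m0}" by blast
 have least: "\<delta> \<le> mpoly_degree f" if "mpoly_degree f > 0" "H = zero_set {f}" for f :: "('n, 'a alg_closure) mpoly"
  using that Least_le[of ?D "mpoly_degree f"] assms(5) unfolding hypersurface_degree_def by blast
 define g where "g = mpoly_eval m0"
 have Hg: "z \<in> H \<longleftrightarrow> g z = 0" for z using m0(3) by (simp add: zero_set_def g_def)
 have irrH: "irreducible_variety H" using assms(4) by (simp add: absolutely_irreducible_def)
 have ne: "H ~= {}" using irrH by (simp add: irreducible_variety_def)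
 have nu: "H ~= UNIV" using mpoly_degree_pos_nonzero[of m0] m0 inf Hg by (auto simp: g_def)
 \<comment> \<open>\<open>g\<close> is an equation of least degree over the closure and may have any
   coefficients there; stability under Frobenius is read off from \<open>f0\<close>, which has the
   same zeros and coefficients in the base field.\<close>
 have "fq_hyper q g \<delta>"
 proof unfold_locales
  show "2 \<le> q" by (rule q2)
  show "(x + y) ^ q = x ^ q + y ^ q" for x y :: "'a alg_closure" unfolding assms(1) by (rule frobenius_add)
  show "card {x :: 'a alg_closure. x ^ q = x} = q" unfolding assms(1) card_fixed_alg_closure by (rule refl)
  show "infinite (UNIV :: 'a alg_closure set)" by (rule inf)
  show "CHAR('a alg_closure) > 0" using finite_imp_CHAR_pos[OF finite[of "UNIV :: 'a set"]] by simp
  show "PF crd \<delta> g" unfolding g_def m0(1)[symmetric] by (rule PF_mpoly_eval)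
  show "1 \<le> \<delta>" using m0(2) by simp
  show "\<delta> \<le> s" if f: "PF crd s f" "!!z. f z = 0 \<longleftrightarrow> g z = 0" for f s
  proof -
   from mpoly_of_PF[OF f(1)] obtain u where u: "mpoly_degree u \<le> s" "!!z. mpoly_eval u z = f z" by blast
   have Hu: "H = zero_set {u}" using u(2) f(2) Hg by (auto simp: zero_set_def)
   have "mpoly_degree u > 0"
   proof (rule ccontr)
    assume "~ ?thesis"
    then have c: "f z = f w" for z w using mpoly_degree_0_const[of u z w] u(2) by simp
    show False
    proof (cases "f 0 = 0")
     case True
     then have "f z = 0" for z using c[of z 0] by (simp only:)
     then show False using nu f(2) Hg by blast
    next
     case False
     then have "f z ~= 0" for z using c[of z 0] by (simp only: not_False_eq_True)
     then show False using ne f(2) Hg by blast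
    qed
   qed
   from least[OF this Hu] u(1) show ?thesis by simp
  qed
  show "(ALL z. g z = 0 --> f z = 0) | (ALL z. g z = 0 --> h z = 0)"
   if fh: "PF crd s f" "PF crd t h" "!!z. g z = 0 ==> f z * h z = 0" for f h s t
  proof -
   from mpoly_of_PF[OF fh(1)] obtain u where u: "!!z. mpoly_eval u z = f z" by blast
   from mpoly_of_PF[OF fh(2)] obtain w where w: "!!z. mpoly_eval w z = h z" by blast
   \<comment> \<open>With \<open>m0\<close> in both systems the two sets are contained in H, so
     their union is exactly H.\<close>
   define A where "A = zero_set {m0, u}"
   define B where "B = zero_set {m0, w}"
   have A: "z \<in> A \<longleftrightarrow> g z = 0 & f z = 0" for z by (simp add: A_def zero_set_def g_def u)
   have B: "z \<in> B \<longleftrightarrow> g z = 0 & h z = 0" for z by (simp add: B_def zero_set_def g_def w)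
   have "H = A \<union> B" using A B Hg fh(3) by fastforce
   moreover have "algebraic_set A" "algebraic_set B" unfolding algebraic_set_def A_def B_def by blast+
   ultimately have "H = A | H = B" using irrH unfolding irreducible_variety_def by blast
   then show ?thesis using A B Hg by blast
  qed
  have fs: "(\<Sum>i\<in>I. F i) ^ q = (\<Sum>i\<in>I. F i ^ q)" for F :: "('n \<Rightarrow>\<^sub>0 nat) => 'a alg_closure" and I
   using q2 by (induction I rule: infinite_finite_induct) (simp_all add: frobenius_add assms(1) zero_power)
  show "g (\<chi> i. (z $ i) ^ q) = 0" if "g z = 0" for z
  proof -
   have "mpoly_eval ?f (\<chi> i. (z $ i) ^ q) = mpoly_eval ?f z ^ q"
    unfolding mpoly_eval_def fs
   proof (rule sum.cong[OF refl])
    fix m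
    have "Poly_Mapping.lookup ?f m ^ q = Poly_Mapping.lookup ?f m"
     using finite_field_power[of "Poly_Mapping.lookup f0 m"] unfolding lf assms(1) by (simp flip: to_ac_power)
    moreover have "(\<Prod>i\<in>UNIV. ((\<chi> i. (z $ i) ^ q) $ i) ^ Poly_Mapping.lookup m i) = (\<Prod>i\<in>UNIV. (z $ i) ^ Poly_Mapping.lookup m i) ^ q"
     unfolding prod_power_distrib by (rule prod.cong) (simp_all add: power_mult[symmetric] mult.commute)
    ultimately show "Poly_Mapping.lookup ?f m * (\<Prod>i\<in>UNIV. ((\<chi> i. (z $ i) ^ q) $ i) ^ Poly_Mapping.lookup m i) =
     (Poly_Mapping.lookup ?f m * (\<Prod>i\<in>UNIV. (z $ i) ^ Poly_Mapping.lookup m i)) ^ q" by (simp add: power_mult_distrib)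
   qed
   moreover have "mpoly_eval ?f z = 0" using that Hg[of z] f0(2) by (simp add: zero_set_def)
   ultimately have "(\<chi> i. (z $ i) ^ q) \<in> H" using f0(2) q2 by (simp add: zero_set_def zero_power)
   then show ?thesis using Hg by blast
  qed
  show "15 * \<delta> ^ 4 < q"
  proof -
   \<comment> \<open>As \<delta> \<ge> 1, the exponent 13/3 may be lowered to 4.\<close>
   have "real \<delta> ^ 4 = real \<delta> powr 4" using m0(2) by (simp add: powr_numeral)
   also have "\<dots> \<le> real \<delta> powr (13 / 3)" using m0(2) by (intro powr_mono) auto
   finally have "15 * real \<delta> ^ 4 < real q" using assms(6) by linarith
   then have "real (15 * \<delta> ^ 4) < real q" by simp
   then show ?thesis by (simp only: of_nat_less_iff)
  qed
 qed
 then interpret fq_hyper q "TYPE('a alg_closure)" g \<delta> .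
 have "rational_points = (V :: ('a alg_closure ^ 'n) set)"
 proof -
  have "{x :: 'a alg_closure. x ^ q = x} = range to_ac" unfolding assms(1) by (rule card_fixed_alg_closure(1))
  then show ?thesis by (simp only: rational_points_def Vq_def Fq_def)
 qed
 then have "H \<inter> rational_points = {z\<in>V. g z = 0}" using Hg by auto
 then have N: "real (card (H \<inter> rational_points)) = N" by (simp add: N_def)
 have q0: "real q ~= 0" using q2 by simp
 \<comment> \<open>The factor between mean and total, N = \<mu> r; it is 1/q when n = 1, whence the
   integer exponent.\<close>
 define r where "r = real q powi (int n - 2)"
 have Qn: "Q = real q powi int n" by (simp add: Q_def card_Vq assms(2))
 have r: "r = Q / (real q)\<^sup>2" unfolding r_def Qn using q0 by (simp add: power_int_diff)
 have r1: "real q powi (int n - 1) = real q * r" unfolding r Qn using q0 by (simp add: power_int_diff power2_eq_square)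
 have Nr: "N = \<mu> * r" unfolding r \<mu>_def using Q_pos q0 by simp
 have r0: "r \<ge> 0" unfolding r using Q_pos by simp
 have "\<bar>N - real q * r\<bar> = \<bar>\<mu> - real q\<bar> * r" unfolding Nr left_diff_distrib[symmetric] abs_mult using r0 by simp
 also have "\<dots> \<le> (\<omega> (real q) (real \<delta>) + 5 * (real \<delta>)\<^sup>2) * r"
  using mean_final r0 by (intro mult_right_mono) (simp_all add: \<omega>_def)
 finally show ?thesis unfolding N r1 r_def[symmetric] .
qed

end
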